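(* Fix a constant $p_{\infty,*}>0$. (1) (Equilibrium bubbles of (AS) are spherical.) Let $(\mathbf v_{l,*},p_{l,*},\partial\Omega_*,p_{g,*},\mathbf v_{g,*},\rho_{g,*},\dots)$ be a $C^2$ steady-state solution of (AS) with $\lim_{|x|\to\infty}p_{l,*}(x)=p_{\infty,*}$. Assume $\mu_l\ne0$ and $\sigma\ne0$. Suppose that $\mathbf v_{l,*}(x)=O(|x|^{-2})$ as $|x|\to\infty$ and $\lim_{|x|\to\infty}\nabla\mathbf v_{l,*}(x)=0$ (the zero matrix). Then $\mathbf v_{l,*}=\mathbf 0$, $p_{l,*}=p_{\infty,*}$ and $\Omega_*$ is a sphere (ball). Moreover, $\rho_{g,*}$ is constant and $\mathrm{div}\,\mathbf v_{g,*}=0$. (2) (Spherically symmetric equilibria of (AS).) For each $M>0$, $$\mathbf v_{l,*}=\mathbf 0,\quad p_{l,*}=p_{\infty,*},\quad \Omega_*=B_{R_*[M]},\quad \rho_{g,*}[M]=\frac1{\mathcal R_gT_\infty}\Big(p_{\infty,*}+\frac{2\sigma}{R_*[M]}\Big),\quad \mathbf v_{g,*}=\mathbf 0,$$ $$p_{g,*}[M]=p_{\infty,*}+\frac{2\sigma}{R_*[M]},\quad T_{g,*}=T_{l,*}=T_\infty,\quad s_*=c_v\log\Big((\mathcal R_gT_\infty)^\gamma\Big(p_{\infty,*}+\frac{2\sigma}{R_*[M]}\Big)^{1-\gamma}\Big)$$ is a spherically symmetric equilibrium of (AS). Furthermore, any regular spherically symmetric equilibrium solution of (AS) is uniquely determined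 by its total mass $M$, and is given by these formulas. No radiation condition $T_l(|x|)=T_\infty+o(|x|^{-1})$ on the liquid temperature is required. (3) The mappings $M\in(0,\infty)\mapsto R_*[M]$ and $M\mapsto\rho_*[M]$, where $\rho_*:=\rho_{g,*}$, are continuous (even smooth).
   Context: Parameters: $\rho_l,\kappa_g,\mathcal R_g,c_v,\sigma,T_\infty>0$, $\mu_l\ge0$, $\nu_l=\mu_l/\rho_l$, $\gamma=1+\mathcal R_g/c_v>1$. $\mathbb D(\mathbf u)=\frac12(\nabla\mathbf u+(\nabla\mathbf u)^\top)$, $B_R=\{x\in\mathbb R^3:|x|<R\}$. (AS): the gas bubble/liquid system with bubble region $\Omega(t)\subset\mathbb R^3$, bounded and simply connected. In $\mathbb R^3\setminus\Omega(t)$: $\partial_t\mathbf v_l=\nu_l\Delta\mathbf v_l-\mathbf v_l\cdot\nabla\mathbf v_l-\frac1{\rho_l}\nabla p_l$, $\mathrm{div}\,\mathbf v_l=0$, $T_l=T_\infty$. In $\Omega(t)$: $\partial_t\rho_g+\mathrm{div}(\rho_g\mathbf v_g)=0$, $p_g=p_g(t)$ (spatially uniform), $\rho_gT_g(\partial_ts+\mathbf v_g\cdot\nabla s)=\mathrm{div}(\kappa_g\nabla T_g)$, $p_g=\mathcal R_gT_g\rho_g$, $s=c_v\log(p_g/\rho_g^\gamma)$. On $\partial\Omega(t)$, with outer unit normal $\hat{\mathbf n}$ and parametrization $\boldsymbol\omega$: $\mathbf v_l\cdot\hat{\mathbf n}=\mathbf v_g\cdot\hat{\mathbf n}=\partial_t\boldsymbol\omega\cdot\hat{\mathbf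 n}$, $p_g\hat{\mathbf n}-p_l\hat{\mathbf n}+2\mu_l\hat{\mathbf n}\cdot\mathbb D(\mathbf v_l)=\sigma\hat{\mathbf n}(\nabla_S\cdot\hat{\mathbf n})$, $T_g=T_\infty$, where $\nabla_S\cdot$ is the surface divergence. Far field: $\mathbf v_l\to\mathbf 0$, $p_l\to p_{\infty,*}$, $T_l\to T_\infty$ as $|x|\to\infty$. Steady-state (equilibrium) solutions are time-independent solutions; in particular $\mathbf v_{l,*}\cdot\hat{\mathbf n}=\mathbf v_{g,*}\cdot\hat{\mathbf n}=0$ on $\partial\Omega_*$. Spherically symmetric means: $\Omega$ is a ball centered at the origin, velocities have the form $v(r)x/|x|$, $r=|x|$, and scalar fields are radial. Mass is $\int_\Omega\rho_g\,dx$. For $M>0$, $R_*[M]$ denotes the unique positive root $R$ of $p_{\infty,*}R^3+2\sigma R^2-\frac{3\mathcal R_gT_\infty M}{4\pi}=0$.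
   Formalization: The bubble surface ∂Ω is assumed to be one closed surface parametrized by ω over the unit sphere (no enclosed liquid cavity); otherwise the shell 1<|x|<2 with v=0, p_g=p_∞+σ, p_l=p_∞ outside and p_l=p_g+2σ in the cavity is a non-ball steady state. *)

theory Defs
  imports "HOL-Analysis.Analysis" "HOL-Library.Landau_Symbols"
begin

section \<open>Differential operators on subsets of three-space\<close>

text \<open>
  All derivatives are taken within a set S. At interior points of S they are the ordinary ones;
  at points of the C2 boundary of a closed region they are the one-sided derivatives, which are
  still unique there.
\<close>

type_synonym R3 = "real ^ 3"

definition jac :: "R3 set \<Rightarrow> (R3 \<Rightarrow> R3) \<Rightarrow> R3 \<Rightarrow> real ^ 3 ^ 3" where
  "jac S u x = matrix (frechet_derivative u (at x within S))"

definition grad :: "R3 set \<Rightarrow> (R3 \<Rightarrow> real) \<Rightarrow> R3 \<Rightarrow> R3" where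
  "grad S f x = (\<chi> i. frechet_derivative f (at x within S) (axis i 1))"

definition divergence :: "R3 set \<Rightarrow> (R3 \<Rightarrow> R3) \<Rightarrow> R3 \<Rightarrow> real" where
  "divergence S u x = trace (jac S u x)"

definition laplacian :: "R3 set \<Rightarrow> (R3 \<Rightarrow> real) \<Rightarrow> R3 \<Rightarrow> real" where
  "laplacian S f x = divergence S (grad S f) x"

definition vec_laplacian :: "R3 set \<Rightarrow> (R3 \<Rightarrow> R3) \<Rightarrow> R3 \<Rightarrow> R3" where
  "vec_laplacian S u x = (\<chi> i. laplacian S (\<lambda>y. u y $ i) x)"

definition sym_grad :: "R3 set \<Rightarrow> (R3 \<Rightarrow> R3) \<Rightarrow> R3 \<Rightarrow> real ^ 3 ^ 3" where
  "sym_grad S u x = (1 / 2) *\<^sub>R (jac S u x + transpose (jac S u x))"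

text \<open>For closed S this is regularity up to and including the boundary.\<close>

definition C2_on :: "R3 set \<Rightarrow> (R3 \<Rightarrow> 'b::real_normed_vector) \<Rightarrow> bool" where
  "C2_on S f \<longleftrightarrow>
    (\<exists>(f' :: R3 \<Rightarrow> R3 \<Rightarrow>\<^sub>L 'b) (f'' :: R3 \<Rightarrow> R3 \<Rightarrow>\<^sub>L R3 \<Rightarrow>\<^sub>L 'b).
      (\<forall>x\<in>S. (f has_derivative blinfun_apply (f' x)) (at x within S)) \<and>
      (\<forall>x\<in>S. (f' has_derivative blinfun_apply (f'' x)) (at x within S)) \<and>
      continuous_on S f'')"


section \<open>Domains with C2 boundary, outer normal, surface divergence\<close>

definition C2_defining :: "R3 set \<Rightarrow> R3 \<Rightarrow> R3 set \<Rightarrow> (R3 \<Rightarrow> real) \<Rightarrow> bool" where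
  "C2_defining \<Omega> x U \<phi> \<longleftrightarrow>
    open U \<and> x \<in> U \<and> C2_on U \<phi> \<and> (\<forall>y\<in>U. grad U \<phi> y \<noteq> 0) \<and>
    \<Omega> \<inter> U = {y \<in> U. \<phi> y < 0} \<and> frontier \<Omega> \<inter> U = {y \<in> U. \<phi> y = 0}"

definition C2_domain :: "R3 set \<Rightarrow> bool" where
  "C2_domain \<Omega> \<longleftrightarrow> open \<Omega> \<and> (\<forall>x\<in>frontier \<Omega>. \<exists>U \<phi>. C2_defining \<Omega> x U \<phi>)"

text \<open>
  The normalised gradient does not depend on the defining function; since the defining function
  is negative inside the domain, the vector points outwards.
\<close>

definition outer_normal :: "R3 set \<Rightarrow> R3 \<Rightarrow> R3" where
  "outer_normal \<Omega> x =
    (THE n. \<exists>U \<phi>. C2_defining \<Omega> x U \<phi> \<and> n = grad U \<phi> x /\<^sub>R norm (grad U \<phi> x))"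

text \<open>
  Surface divergence at x of a field F along a surface S with unit normal n at x, i.e. the sum of
  the products of e with the derivative of F along e, over an orthonormal basis e of the tangent
  plane. It is written as the trace of the derivative composed with the tangential projection.
  The derivative within S is determined on tangent vectors only, and only those are fed to it.
  For the outer normal of a ball of radius R the value is 2 / R.
\<close>

definition surface_div :: "R3 set \<Rightarrow> R3 \<Rightarrow> (R3 \<Rightarrow> R3) \<Rightarrow> R3 \<Rightarrow> real" where
  "surface_div S n F x =
    (\<Sum>b\<in>Basis. frechet_derivative F (at x within S) (b - (b \<bullet> n) *\<^sub>R n) \<bullet> b)"


section \<open>The gas bubble / liquid system\<close>

record bubble_params =
  rho_liq :: real
  mu_liq :: real
  kappa_gas :: real
  R_gas :: real
  cv_gas :: real
  sigma_st :: real
  T_inf :: real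

definition admissible :: "bubble_params \<Rightarrow> bool" where
  "admissible P \<longleftrightarrow> rho_liq P > 0 \<and> mu_liq P \<ge> 0 \<and> kappa_gas P > 0 \<and> R_gas P > 0 \<and>
    cv_gas P > 0 \<and> sigma_st P > 0 \<and> T_inf P > 0"

definition nu_liq :: "bubble_params \<Rightarrow> real" where
  "nu_liq P = mu_liq P / rho_liq P"

definition gamma_gas :: "bubble_params \<Rightarrow> real" where
  "gamma_gas P = 1 + R_gas P / cv_gas P"

text \<open>
  The state of the system at one instant. The liquid fields are meaningful on the complement of
  the region, the gas fields on its closure; values elsewhere are irrelevant. The gas pressure is
  spatially uniform, hence a number. The map surf parametrizes the bubble surface over the unit
  sphere.
\<close>

record bubble_state =
  region :: "R3 set"
  surf :: "R3 \<Rightarrow> R3"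
  vel_l :: "R3 \<Rightarrow> R3"
  pres_l :: "R3 \<Rightarrow> real"
  temp_l :: "R3 \<Rightarrow> real"
  dens_g :: "R3 \<Rightarrow> real"
  vel_g :: "R3 \<Rightarrow> R3"
  pres_g :: real
  temp_g :: "R3 \<Rightarrow> real"
  entr_g :: "R3 \<Rightarrow> real"

definition bubble_geometry :: "bubble_state \<Rightarrow> bool" where
  "bubble_geometry st \<longleftrightarrow>
    region st \<noteq> {} \<and> bounded (region st) \<and> simply_connected (region st) \<and>
    (\<exists>g. homeomorphism (sphere 0 1) (frontier (region st)) (surf st) g)"

definition C2_state :: "bubble_state \<Rightarrow> bool" where
  "C2_state st \<longleftrightarrow>
    C2_domain (region st) \<and>
    C2_on (- region st) (vel_l st) \<and> C2_on (- region st) (pres_l st) \<and>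
    C2_on (- region st) (temp_l st) \<and>
    C2_on (closure (region st)) (dens_g st) \<and> C2_on (closure (region st)) (vel_g st) \<and>
    C2_on (closure (region st)) (temp_g st) \<and> C2_on (closure (region st)) (entr_g st)"

definition time_regular :: "(real \<Rightarrow> bubble_state) \<Rightarrow> real \<Rightarrow> bool" where
  "time_regular U t \<longleftrightarrow>
    (\<forall>x \<in> - closure (region (U t)). (\<lambda>\<tau>. vel_l (U \<tau>) x) differentiable (at t)) \<and>
    (\<forall>x \<in> region (U t). (\<lambda>\<tau>. dens_g (U \<tau>) x) differentiable (at t) \<and>
                        (\<lambda>\<tau>. entr_g (U \<tau>) x) differentiable (at t)) \<and>
    (\<forall>y \<in> sphere 0 1. (\<lambda>\<tau>. surf (U \<tau>) y) differentiable (at t))"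

text \<open>
  The momentum and incompressibility equations are imposed in the open exterior, where the time
  derivative at a fixed point makes sense although the region moves; by continuity the spatial
  terms extend to the boundary.
\<close>

definition liquid_eqs :: "bubble_params \<Rightarrow> (real \<Rightarrow> bubble_state) \<Rightarrow> real \<Rightarrow> bool" where
  "liquid_eqs P U t \<longleftrightarrow>
    (let S = - region (U t); v = vel_l (U t); p = pres_l (U t) in
      (\<forall>x \<in> - closure (region (U t)).
         vector_derivative (\<lambda>\<tau>. vel_l (U \<tau>) x) (at t) =
           nu_liq P *\<^sub>R vec_laplacian S v x - jac S v x *v v x - (1 / rho_liq P) *\<^sub>R grad S p x \<and>
         divergence S v x = 0) \<and>
      (\<forall>x\<in>S. temp_l (U t) x = T_inf P))"

text \<open>Positivity of pressure and density is what makes the logarithm in the entropy meaningful.\<close>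

definition gas_eqs :: "bubble_params \<Rightarrow> (real \<Rightarrow> bubble_state) \<Rightarrow> real \<Rightarrow> bool" where
  "gas_eqs P U t \<longleftrightarrow>
    (let \<Omega> = region (U t); \<rho> = dens_g (U t); v = vel_g (U t); p = pres_g (U t);
         T = temp_g (U t); s = entr_g (U t) in
      p > 0 \<and>
      (\<forall>x\<in>\<Omega>.
         \<rho> x > 0 \<and>
         vector_derivative (\<lambda>\<tau>. dens_g (U \<tau>) x) (at t) + divergence \<Omega> (\<lambda>y. \<rho> y *\<^sub>R v y) x = 0 \<and>
         \<rho> x * T x * (vector_derivative (\<lambda>\<tau>. entr_g (U \<tau>) x) (at t) + v x \<bullet> grad \<Omega> s x) =
           divergence \<Omega> (\<lambda>y. kappa_gas P *\<^sub>R grad \<Omega> T y) x \<and>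
         p = R_gas P * T x * \<rho> x \<and>
         s x = cv_gas P * ln (p / \<rho> x powr gamma_gas P)))"

definition boundary_eqs :: "bubble_params \<Rightarrow> (real \<Rightarrow> bubble_state) \<Rightarrow> real \<Rightarrow> bool" where
  "boundary_eqs P U t \<longleftrightarrow>
    (let \<Omega> = region (U t); n = outer_normal \<Omega>; v\<^sub>l = vel_l (U t); v\<^sub>g = vel_g (U t) in
      (\<forall>y \<in> sphere 0 1. let x = surf (U t) y in
         v\<^sub>l x \<bullet> n x = v\<^sub>g x \<bullet> n x \<and>
         v\<^sub>g x \<bullet> n x = vector_derivative (\<lambda>\<tau>. surf (U \<tau>) y) (at t) \<bullet> n x) \<and>
      (\<forall>x \<in> frontier \<Omega>.
         pres_g (U t) *\<^sub>R n x - pres_l (U t) x *\<^sub>R n x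
           + (2 * mu_liq P) *\<^sub>R (n x v* sym_grad (- \<Omega>) v\<^sub>l x)
           = (sigma_st P * surface_div (frontier \<Omega>) (n x) n x) *\<^sub>R n x \<and>
         temp_g (U t) x = T_inf P))"

definition far_field :: "bubble_params \<Rightarrow> real \<Rightarrow> bubble_state \<Rightarrow> bool" where
  "far_field P p_inf st \<longleftrightarrow>
    (vel_l st \<longlongrightarrow> 0) at_infinity \<and> (pres_l st \<longlongrightarrow> p_inf) at_infinity \<and>
    (temp_l st \<longlongrightarrow> T_inf P) at_infinity"

definition AS_solution :: "bubble_params \<Rightarrow> real \<Rightarrow> (real \<Rightarrow> bubble_state) \<Rightarrow> bool" where
  "AS_solution P p_inf U \<longleftrightarrow>
    (\<forall>t>0. bubble_geometry (U t) \<and> C2_state (U t) \<and> time_regular U t \<and>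
           liquid_eqs P U t \<and> gas_eqs P U t \<and> boundary_eqs P U t \<and> far_field P p_inf (U t))"

definition steady_state :: "bubble_params \<Rightarrow> real \<Rightarrow> bubble_state \<Rightarrow> bool" where
  "steady_state P p_inf st \<longleftrightarrow> AS_solution P p_inf (\<lambda>_. st)"


section \<open>Spherically symmetric equilibria\<close>

definition radial_scalar_on :: "R3 set \<Rightarrow> (R3 \<Rightarrow> real) \<Rightarrow> bool" where
  "radial_scalar_on S f \<longleftrightarrow> (\<exists>h. \<forall>x\<in>S. f x = h (norm x))"

definition radial_vector_on :: "R3 set \<Rightarrow> (R3 \<Rightarrow> R3) \<Rightarrow> bool" where
  "radial_vector_on S u \<longleftrightarrow> (\<exists>h. \<forall>x\<in>S. u x = h (norm x) *\<^sub>R (x /\<^sub>R norm x))"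

definition spherically_symmetric :: "bubble_state \<Rightarrow> bool" where
  "spherically_symmetric st \<longleftrightarrow>
    (\<exists>R>0. region st = ball 0 R) \<and>
    radial_vector_on (- region st) (vel_l st) \<and>
    radial_scalar_on (- region st) (pres_l st) \<and>
    radial_scalar_on (- region st) (temp_l st) \<and>
    radial_vector_on (closure (region st)) (vel_g st) \<and>
    radial_scalar_on (closure (region st)) (dens_g st) \<and>
    radial_scalar_on (closure (region st)) (temp_g st) \<and>
    radial_scalar_on (closure (region st)) (entr_g st)"

definition gas_mass :: "bubble_state \<Rightarrow> real" where
  "gas_mass st = integral (region st) (dens_g st)"

definition R_star :: "bubble_params \<Rightarrow> real \<Rightarrow> real \<Rightarrow> real" where
  "R_star P p_inf M = (THE R. R > 0 \<and>
     p_inf * R ^ 3 + 2 * sigma_st P * R ^ 2 - 3 * R_gas P * T_inf P * M / (4 * pi) = 0)"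

definition p_star :: "bubble_params \<Rightarrow> real \<Rightarrow> real \<Rightarrow> real" where
  "p_star P p_inf M = p_inf + 2 * sigma_st P / R_star P p_inf M"

definition rho_star :: "bubble_params \<Rightarrow> real \<Rightarrow> real \<Rightarrow> real" where
  "rho_star P p_inf M =
    1 / (R_gas P * T_inf P) * (p_inf + 2 * sigma_st P / R_star P p_inf M)"

definition spherical_equilibrium :: "bubble_params \<Rightarrow> real \<Rightarrow> real \<Rightarrow> bubble_state" where
  "spherical_equilibrium P p_inf M =
    \<lparr> region = ball 0 (R_star P p_inf M),
      surf = (\<lambda>y. R_star P p_inf M *\<^sub>R y),
      vel_l = (\<lambda>x. 0),
      pres_l = (\<lambda>x. p_inf),
      temp_l = (\<lambda>x. T_inf P),
      dens_g = (\<lambda>x. rho_star P p_inf M),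
      vel_g = (\<lambda>x. 0),
      pres_g = p_star P p_inf M,
      temp_g = (\<lambda>x. T_inf P),
      entr_g = (\<lambda>x. cv_gas P * ln ((R_gas P * T_inf P) powr gamma_gas P *
                                  p_star P p_inf M powr (1 - gamma_gas P))) \<rparr>"

text \<open>
  Equality of states, disregarding the values of fields outside their domains and the choice of
  the surface parametrization.
\<close>

definition same_state :: "bubble_state \<Rightarrow> bubble_state \<Rightarrow> bool" where
  "same_state st st' \<longleftrightarrow>
    region st = region st' \<and> pres_g st = pres_g st' \<and>
    (\<forall>x \<in> - region st. vel_l st x = vel_l st' x \<and> pres_l st x = pres_l st' x \<and>
                       temp_l st x = temp_l st' x) \<and>
    (\<forall>x \<in> closure (region st). dens_g st x = dens_g st' x \<and> vel_g st x = vel_g st' x \<and>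
                               temp_g st x = temp_g st' x \<and> entr_g st x = entr_g st' x)"

definition smooth_on_reals :: "real set \<Rightarrow> (real \<Rightarrow> real) \<Rightarrow> bool" where
  "smooth_on_reals A f \<longleftrightarrow> (\<forall>k. \<forall>x\<in>A. (deriv ^^ k) f field_differentiable (at x))"

end

theory Submission
  imports Defs "HOL-Computational_Algebra.Polynomial"
begin

text \<open>
  On a steady boundary the velocities are tangential, so the traction condition tested with the
  liquid velocity has no normal part, and the energy flux through the bubble surface vanishes. The
  decay at infinity removes the flux through large spheres. Hence the dissipation vanishes, the
  liquid velocity is a Killing field whose gradient tends to zero at infinity, and therefore it is
  zero and the pressure is constant. The traction condition then says that the bubble surface has
  constant mean curvature H.

  For Alexandrov's theorem, minimising the sum of |y - x|^2 and n (Phi y)^2 over y, where Phi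
  defines the domain E, covers E by images of the boundary layer under y + n Phi(y) grad Phi(y).
  Bounding the Jacobian by the inequality of arithmetic and geometric means and letting n tend to
  infinity gives the Heintze--Karcher inequality |E| <= 2 |bd E| / (3 H), strictly where the boundary
  is not umbilic. The Minkowski formula is the equality case, so the boundary is totally umbilic,
  hence a sphere.

  In the gas, the entropy equation is an elliptic equation without zeroth order term for the
  temperature, so the maximum principle makes the temperature and with it the density constant. In the
  radial case, incompressibility makes r^2 v(r) constant, and the remaining unknowns are determined
  by the normal stress balance and the mass, which yields the cubic equation for the radius.
\<close>

section \<open>Gradients, Jacobians and integrals of divergences\<close>

definition has_grad :: "(R3 \<Rightarrow> real) \<Rightarrow> R3 \<Rightarrow> R3 \<Rightarrow> bool" where
  "has_grad f g x \<longleftrightarrow> (f has_derivative (\<lambda>h. g \<bullet> h)) (at x)"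

definition has_jac :: "(R3 \<Rightarrow> R3) \<Rightarrow> real^3^3 \<Rightarrow> R3 \<Rightarrow> bool" where
  "has_jac F J x \<longleftrightarrow> (F has_derivative (\<lambda>h. J *v h)) (at x)"

definition outer :: "R3 \<Rightarrow> R3 \<Rightarrow> real^3^3" where
  "outer u w = (\<chi> i j. u $ i * w $ j)"

lemma outer_mult_vec: "outer u w *v h = (w \<bullet> h) *\<^sub>R u"
  by (vector outer_def matrix_vector_mult_def inner_vec_def sum_distrib_right sum_distrib_left mult_ac)

lemma trace_outer: "trace (outer u w) = u \<bullet> w"
  by (simp add: trace_def outer_def inner_vec_def)

lemma trace_scaleR: "trace (c *\<^sub>R (J::real^3^3)) = c * trace J"
  by (simp add: trace_def sum_distrib_left)

lemma trace_minus: "trace (- (J::real^3^3)) = - trace J"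
  by (simp add: trace_def sum_negf)

lemma continuous_on_outer [continuous_intros]:
  assumes "continuous_on S u" "continuous_on S w"
  shows "continuous_on S (\<lambda>x. outer (u x) (w x))"
  unfolding outer_def by (intro continuous_on_vec_lambda continuous_intros assms)

lemma continuous_on_matrix_vector [continuous_intros]:
  fixes A :: "'a::topological_space \<Rightarrow> real^3^3"
  assumes "continuous_on S A" "continuous_on S w"
  shows "continuous_on S (\<lambda>x. A x *v w x)"
  unfolding matrix_vector_mult_def by (intro continuous_on_vec_lambda continuous_intros assms)

lemma continuous_on_transpose [continuous_intros]:
  fixes A :: "'a::topological_space \<Rightarrow> real^3^3"
  assumes "continuous_on S A"
  shows "continuous_on S (\<lambda>x. transpose (A x))"
  unfolding transpose_def by (intro continuous_on_vec_lambda continuous_intros assms)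

lemma continuous_on_trace [continuous_intros]:
  fixes A :: "'a::topological_space \<Rightarrow> real^3^3"
  assumes "continuous_on S A"
  shows "continuous_on S (\<lambda>x. trace (A x))"
  unfolding trace_def by (intro continuous_intros assms)

lemma continuous_on_matrix_matrix [continuous_intros]:
  fixes A :: "'a::topological_space \<Rightarrow> real^3^3"
  assumes "continuous_on S A" "continuous_on S B"
  shows "continuous_on S (\<lambda>x. A x ** B x)"
  unfolding matrix_matrix_mult_def by (intro continuous_on_vec_lambda continuous_intros assms)

lemma scaleR_matrix_vector: "(c *\<^sub>R (A::real^3^3)) *v x = c *\<^sub>R (A *v x)"
  by (simp add: scaleR_matrix_vector_assoc)

lemma uminus_matrix_vector: "(- (A::real^3^3)) *v x = - (A *v x)"
  by (vector matrix_vector_mult_def sum_negf)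

lemma inner_transpose: "(transpose (A::real^3^3) *v u) \<bullet> w = u \<bullet> (A *v w)"
  by (metis dot_lmul_matrix inner_commute transpose_matrix_vector transpose_transpose)

lemma has_grad_const: "has_grad (\<lambda>x. c) 0 x"
  by (simp add: has_grad_def)

lemma has_grad_add: "has_grad f g x \<Longrightarrow> has_grad f2 g2 x \<Longrightarrow> has_grad (\<lambda>x. f x + f2 x) (g + g2) x"
  unfolding has_grad_def by (auto intro!: derivative_eq_intros simp: inner_add_left)

lemma has_grad_diff: "has_grad f g x \<Longrightarrow> has_grad f2 g2 x \<Longrightarrow> has_grad (\<lambda>x. f x - f2 x) (g - g2) x"
  unfolding has_grad_def by (auto intro!: derivative_eq_intros simp: inner_diff_left)

lemma has_grad_minus: "has_grad f g x \<Longrightarrow> has_grad (\<lambda>x. - f x) (- g) x"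
  unfolding has_grad_def by (auto intro!: derivative_eq_intros)

lemma has_grad_mult:
  "has_grad f g x \<Longrightarrow> has_grad f2 g2 x \<Longrightarrow> has_grad (\<lambda>x. f x * f2 x) (f2 x *\<^sub>R g + f x *\<^sub>R g2) x"
  unfolding has_grad_def
  by (rule derivative_eq_intros | assumption)+ (auto simp: inner_add_left)

lemma has_grad_chain:
  assumes "(G has_real_derivative d) (at (f x))" "has_grad f g x"
  shows "has_grad (\<lambda>x. G (f x)) (d *\<^sub>R g) x"
  using has_derivative_compose[OF assms(2)[unfolded has_grad_def] assms(1)[unfolded has_field_derivative_def]]
  by (simp add: has_grad_def)

lemma has_grad_inner:
  assumes "has_jac F J x" "has_jac G K x"
  shows "has_grad (\<lambda>x. F x \<bullet> G x) (transpose J *v G x + transpose K *v F x) x"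
  using has_derivative_inner[OF assms[unfolded has_jac_def]]
  unfolding has_grad_def inner_add_left inner_transpose by (simp add: inner_commute add.commute)

lemma has_grad_inner_const: "has_grad (\<lambda>x. a \<bullet> x) a x"
  unfolding has_grad_def by (auto intro!: derivative_eq_intros)

lemma has_grad_component:
  assumes "has_jac F J x" shows "has_grad (\<lambda>x. F x $ i) (J $ i) x"
  using bounded_linear.has_derivative[OF bounded_linear_vec_nth assms[unfolded has_jac_def], of i]
  by (simp add: has_grad_def matrix_vector_mult_def inner_vec_def)

lemma has_jac_id: "has_jac (\<lambda>x. x) (mat 1) x"
  by (simp add: has_jac_def)

lemma has_jac_const: "has_jac (\<lambda>x. c) 0 x"
  by (simp add: has_jac_def)

lemma has_jac_add: "has_jac F J x \<Longrightarrow> has_jac G K x \<Longrightarrow> has_jac (\<lambda>x. F x + G x) (J + K) x"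
  unfolding has_jac_def by (auto intro!: derivative_eq_intros simp: matrix_vector_mult_add_rdistrib)

lemma has_jac_diff: "has_jac F J x \<Longrightarrow> has_jac G K x \<Longrightarrow> has_jac (\<lambda>x. F x - G x) (J - K) x"
  unfolding has_jac_def by (auto intro!: derivative_eq_intros simp: matrix_vector_mult_diff_rdistrib)

lemma has_jac_minus: "has_jac F J x \<Longrightarrow> has_jac (\<lambda>x. - F x) (- J) x"
  unfolding has_jac_def by (auto intro!: derivative_eq_intros simp: uminus_matrix_vector)

lemma has_jac_scaleR:
  assumes "has_grad f g x" "has_jac F J x"
  shows "has_jac (\<lambda>x. f x *\<^sub>R F x) (f x *\<^sub>R J + outer (F x) g) x"
  using has_derivative_scaleR[OF assms(1)[unfolded has_grad_def] assms(2)[unfolded has_jac_def]]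
  by (simp add: has_jac_def matrix_vector_mult_add_rdistrib outer_mult_vec scaleR_matrix_vector)

lemma has_jac_cmul:
  assumes "has_jac F J x"
  shows "has_jac (\<lambda>x. c *\<^sub>R F x) (c *\<^sub>R J) x"
  using has_derivative_scaleR_right[OF assms[unfolded has_jac_def], of c]
  by (simp add: has_jac_def scaleR_matrix_vector)

lemma has_grad_continuous: "has_grad f g x \<Longrightarrow> isCont f x"
  unfolding has_grad_def using has_derivative_continuous by blast

lemma has_jac_continuous: "has_jac f g x \<Longrightarrow> isCont f x"
  unfolding has_jac_def using has_derivative_continuous by blast

lemma has_grad_unique: "has_grad f g x \<Longrightarrow> has_grad f k x \<Longrightarrow> g = k"
  unfolding has_grad_def
  using has_derivative_unique[of f "(\<bullet>) g" x "(\<bullet>) k"] by (metis vector_eq_rdot inner_commute)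

lemma has_grad_cong_open:
  assumes "has_grad f g x" "open S" "x \<in> S" "\<And>y. y \<in> S \<Longrightarrow> f y = k y"
  shows "has_grad k g x"
  using assms unfolding has_grad_def by (metis has_derivative_transform_within_open)

lemma has_jac_cong_open:
  assumes "has_jac f g x" "open S" "x \<in> S" "\<And>y. y \<in> S \<Longrightarrow> f y = k y"
  shows "has_jac k g x"
  using assms unfolding has_jac_def by (metis has_derivative_transform_within_open)

lemma has_jac_unique: "has_jac f g x \<Longrightarrow> has_jac f k x \<Longrightarrow> g = k"
  unfolding has_jac_def
  by (metis has_derivative_unique matrix_eq)

lemma set_integrable_bounded_continuous:
  fixes f :: "R3 \<Rightarrow> real"
  assumes "E \<in> sets borel" "bounded K" "continuous_on E f"
    and "\<And>x. x \<in> E \<Longrightarrow> \<bar>f x\<bar> \<le> B" "\<And>x. x \<in> E \<Longrightarrow> x \<notin> K \<Longrightarrow> f x = 0" and B0: "0 \<le> B"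
  shows "set_integrable lborel E f"
proof -
  obtain a where a: "K \<subseteq> cball 0 a" using bounded_subset_ballD[OF assms(2), of 0] ball_subset_cball by (meson order_trans)
  show ?thesis unfolding set_integrable_def
  proof (rule integrableI_bounded_set[where A="cball 0 a" and B=B])
    show "(\<lambda>x. indicat_real E x *\<^sub>R f x) \<in> borel_measurable lborel"
      using borel_measurable_continuous_on_indicator[OF assms(1,3)] by simp
    show "emeasure lborel (cball 0 a :: R3 set) < \<infinity>"
      by (rule emeasure_bounded_finite) simp
    show "AE x in lborel. x \<in> cball 0 a \<longrightarrow> norm (indicat_real E x *\<^sub>R f x) \<le> B"
    proof (rule AE_I2, rule impI)
      fix x :: R3 assume "x \<in> cball 0 a"
      show "norm (indicat_real E x *\<^sub>R f x) \<le> B"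
      proof (cases "x \<in> E")
        case True then show ?thesis using assms(4) by simp
      next
        case False
        then show ?thesis using B0 by simp
      qed
    qed
    show "AE x in lborel. x \<notin> cball 0 a \<longrightarrow> indicat_real E x *\<^sub>R f x = 0"
      by (rule AE_I2) (use subsetD[OF a] assms(5) in \<open>force simp: indicator_def\<close>)
  qed auto
qed

lemma lborel_integral_translate:
  fixes f :: "R3 \<Rightarrow> real"
  assumes "f \<in> borel_measurable borel"
  shows "(LINT x|lborel. f (x + c)) = (LINT x|lborel. f x)"
proof -
  have "(LINT x|lborel. f x) = (LINT x|distr lborel borel ((+) c). f x)" by (simp add: lborel_distr_plus)
  also have "\<dots> = (LINT x|lborel. f (c + x))" by (rule integral_distr) (use assms in auto)
  finally show ?thesis by (simp add: add.commute)
qed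

lemma integral_directional_derivative_zero:
  fixes f :: "R3 \<Rightarrow> real"
  assumes f: "\<And>x. has_grad f (g x) x" and g: "continuous_on UNIV g"
    and supp: "\<And>x. norm x > R \<Longrightarrow> f x = 0"
  shows "(LINT x|lborel. g x \<bullet> e) = 0" "integrable lborel (\<lambda>x. g x \<bullet> e)"
proof -
  have g0: "g x = 0" if "norm x > R" for x
  proof -
    have op: "open {x::R3. norm x > R}" by (intro open_Collect_less continuous_intros)
    have "has_grad f 0 x"
      by (rule has_grad_cong_open[OF has_grad_const op]) (use that supp in auto)
    then show ?thesis using f has_grad_unique by blast
  qed
  have contf: "continuous_on UNIV f" using f has_grad_continuous continuous_at_imp_continuous_on by blast
  obtain B where B: "\<And>x. norm (g x) \<le> B"
  proof -
    have "bounded (g ` cball 0 R)"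
      by (intro compact_imp_bounded compact_continuous_image) (auto intro: continuous_on_subset[OF g])
    then obtain B where B: "\<forall>x\<in>cball 0 R. norm (g x) \<le> B" by (auto simp: bounded_iff)
    have "norm (g x) \<le> max B 0" for x
      by (cases "norm x \<le> R") (use B in \<open>force simp: g0\<close>)+
    then show ?thesis using that by blast
  qed
  define s where "s n x = (f (x + (1 / Suc n) *\<^sub>R e) - f x) * Suc n" for n x
  have mf: "f \<in> borel_measurable borel" using contf by (simp add: borel_measurable_continuous_onI)
  have intf: "integrable lborel f"
  proof -
    have "bounded (f ` cball 0 R)"
      by (intro compact_imp_bounded compact_continuous_image) (auto intro: continuous_on_subset[OF contf])
    then obtain C where C: "\<forall>x\<in>cball 0 R. norm (f x) \<le> C" by (auto simp: bounded_iff)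
    have "set_integrable lborel UNIV f"
      by (rule set_integrable_bounded_continuous[OF _ bounded_cball[of 0 R] contf, where B="max C 0"])
        (use C supp in \<open>force simp: max_def not_le\<close>)+
    then show ?thesis by (simp add: set_integrable_def)
  qed
  have intf': "integrable lborel (\<lambda>x. f (x + c))" for c
  proof -
    have "integrable (distr lborel borel ((+) c)) f" using intf by (simp add: lborel_distr_plus)
    then show ?thesis by (subst (asm) integrable_distr_eq) (use mf in \<open>auto simp: add.commute\<close>)
  qed
  have s0: "(LINT x|lborel. s n x) = 0" for n
    unfolding s_def by (simp add: intf intf' lborel_integral_translate[OF mf])
  have lip: "\<bar>f y - f x\<bar> \<le> B * norm (y - x)" for x y
  proof -
    have "norm (f y - f x) \<le> B * norm (y - x)"
    proof (rule differentiable_bound[of UNIV f "\<lambda>x h. g x \<bullet> h"])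
      show "(f has_derivative (\<bullet>) (g x)) (at x within UNIV)" for x using f by (simp add: has_grad_def)
      show "onorm ((\<bullet>) (g x)) \<le> B" for x
        by (rule onorm_le) (metis B Cauchy_Schwarz_ineq2 mult_right_mono norm_ge_zero order_trans real_norm_def)
    qed auto
    then show ?thesis by simp
  qed
  have B0: "B \<ge> 0" using B[of 0] norm_ge_zero order_trans by blast
  define w where "w x = indicat_real (cball (0::R3) (R + norm e)) x * (B * norm e)" for x
  have w: "integrable lborel w" unfolding w_def
    by (intro integrable_mult_left integrable_real_indicator emeasure_bounded_finite) auto
  have m1: "(\<lambda>x. g x \<bullet> e) \<in> borel_measurable lborel"
    by (simp, intro borel_measurable_continuous_onI continuous_intros g)
  have m2: "s n \<in> borel_measurable lborel" for n
    unfolding s_def by (simp, intro borel_measurable_continuous_onI continuous_intros continuous_on_compose2[OF contf] contf) auto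
  have bd: "norm (s n x) \<le> w x" for n x
  proof (cases "norm x \<le> R + norm e")
    case True
    have "\<bar>s n x\<bar> = \<bar>f (x + (1 / Suc n) *\<^sub>R e) - f x\<bar> * Suc n" by (simp add: s_def abs_mult)
    also have "\<dots> \<le> (B * norm (x + (1 / Suc n) *\<^sub>R e - x)) * Suc n" by (intro mult_right_mono lip) auto
    also have "\<dots> = B * norm e" by (simp add: field_simps)
    finally show ?thesis using True by (simp add: w_def)
  next
    case False
    have "norm ((1 / Suc n) *\<^sub>R e) \<le> norm e" by (simp add: field_simps)
    then have "norm (x + (1 / Suc n) *\<^sub>R e) > R" using False norm_diff_ineq[of x "(1 / Suc n) *\<^sub>R e"] by linarith
    moreover have "norm x > R" using False norm_ge_zero[of e] by linarith
    ultimately show ?thesis using False by (simp add: s_def w_def supp)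
  qed
  have lim: "(\<lambda>n. s n x) \<longlonglongrightarrow> g x \<bullet> e" for x
  proof -
    have "((\<lambda>t. f (x + t *\<^sub>R e)) has_derivative (\<lambda>t. g (x + 0 *\<^sub>R e) \<bullet> (t *\<^sub>R e))) (at 0)"
      by (rule has_derivative_compose[of "\<lambda>t. x + t *\<^sub>R e" "\<lambda>t. t *\<^sub>R e" 0 UNIV f, simplified])
        (use f[of x] in \<open>auto simp: has_grad_def intro!: derivative_eq_intros\<close>)
    then have "((\<lambda>t. f (x + t *\<^sub>R e)) has_real_derivative (g x \<bullet> e)) (at 0)"
      by (simp add: has_field_derivative_def mult.commute[of _ "g x \<bullet> e"])
    then have "((\<lambda>h. (f (x + h *\<^sub>R e) - f x) / h) \<longlongrightarrow> g x \<bullet> e) (at 0)"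
      by (simp add: DERIV_def)
    moreover have "filterlim (\<lambda>n. 1 / real (Suc n)) (at 0) sequentially"
      unfolding filterlim_at using LIMSEQ_Suc[OF lim_1_over_n[where 'a=real]] by auto
    ultimately have "(\<lambda>n. (f (x + (1 / real (Suc n)) *\<^sub>R e) - f x) / (1 / real (Suc n))) \<longlonglongrightarrow> g x \<bullet> e"
      by (rule filterlim_compose)
    then show ?thesis by (simp add: s_def)
  qed
  show "integrable lborel (\<lambda>x. g x \<bullet> e)"
    by (rule integrable_dominated_convergence[OF m1 m2 w]; rule AE_I2; use lim bd in simp)
  have "(\<lambda>n. LINT x|lborel. s n x) \<longlonglongrightarrow> (LINT x|lborel. g x \<bullet> e)"
    by (rule integral_dominated_convergence[OF m1 m2 w]; rule AE_I2; use lim bd in simp)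
  then show "(LINT x|lborel. g x \<bullet> e) = 0" using s0 LIMSEQ_unique by (simp add: LIMSEQ_const_iff)
qed

lemma integral_trace_jac_zero:
  assumes F: "\<And>x. has_jac F (J x) x" and J: "continuous_on UNIV J"
    and supp: "\<And>x. norm x > R \<Longrightarrow> F x = 0"
  shows "(LINT x|lborel. trace (J x)) = 0" "integrable lborel (\<lambda>x. trace (J x))"
proof -
  have *: "(LINT x|lborel. J x $ i \<bullet> axis i 1) = 0" "integrable lborel (\<lambda>x. J x $ i \<bullet> axis i 1)" for i
    by (rule integral_directional_derivative_zero[of "\<lambda>x. F x $ i" _ R];
        use F has_grad_component supp in \<open>force intro!: continuous_intros J\<close>)+
  have eq: "trace (J x) = (\<Sum>i\<in>UNIV. J x $ i \<bullet> axis i 1)" for x by (simp add: trace_def inner_axis)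
  show "(LINT x|lborel. trace (J x)) = 0" unfolding eq by (subst Bochner_Integration.integral_sum) (use * in auto)
  show "integrable lborel (\<lambda>x. trace (J x))" unfolding eq using * by auto
qed

section \<open>The divergence theorem through boundary layers\<close>

text \<open>
  Boundary integrals are replaced by limits of integrals over the layers where 0 < k Phi < 1 for
  large k, which avoids surface measures altogether.
\<close>

definition step :: "real \<Rightarrow> real" where
  "step t = (max 0 (t - 1/2))\<^sup>2 / ((max 0 (t - 1/2))\<^sup>2 + (max 0 (1 - t))\<^sup>2)"

definition step' :: "real \<Rightarrow> real" where
  "step' t = (let a = max 0 (t - 1/2); b = max 0 (1 - t) in 2 * a * b * (a + b) / (a\<^sup>2 + b\<^sup>2)\<^sup>2)"

lemma has_real_derivative_max_power2:
  "((\<lambda>t. (max 0 t)\<^sup>2) has_real_derivative 2 * max 0 x) (at (x::real))"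
proof -
  consider "x > 0" | "x < 0" | "x = 0" by linarith
  then show ?thesis
  proof cases
    case 1
    show ?thesis
      by (rule has_field_derivative_transform_within_open[where S="{0<..}" and f="\<lambda>t. t\<^sup>2"])
        (use 1 in \<open>auto intro!: derivative_eq_intros\<close>)
  next
    case 2
    show ?thesis
      by (rule has_field_derivative_transform_within_open[where S="{..<0}" and f="\<lambda>t. 0"])
        (use 2 in \<open>auto intro!: derivative_eq_intros\<close>)
  next
    case 3
    have "((\<lambda>h::real. ((max 0 h)\<^sup>2) / h) \<longlongrightarrow> 0) (at 0)"
    proof (rule Lim_null_comparison)
      show "\<forall>\<^sub>F x::real in at 0. norm ((max 0 x)\<^sup>2 / x) \<le> \<bar>x\<bar>"
        by (intro always_eventually) (auto simp: max_def power2_eq_square)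
      show "((\<lambda>x::real. \<bar>x\<bar>) \<longlongrightarrow> 0) (at 0)" by (rule tendsto_rabs_zero) (rule tendsto_ident_at)
    qed
    then show ?thesis using 3 by (simp add: DERIV_def)
  qed
qed

lemma step_denominator_pos: "(max 0 (t - 1/2))\<^sup>2 + (max 0 (1 - t))\<^sup>2 > (0::real)"
  by (cases "t > 1/2") (auto simp: max_def add_pos_nonneg add_nonneg_pos)

lemma has_real_derivative_step: "(step has_real_derivative step' t) (at t)"
proof -
  let ?a = "max 0 (t - 1/2)" and ?b = "max 0 (1 - t)"
  have a: "((\<lambda>t. (max 0 (t - 1/2))\<^sup>2) has_real_derivative 2 * ?a * 1) (at t)"
    by (rule DERIV_chain'[OF _ has_real_derivative_max_power2, of "\<lambda>t. t - 1/2"])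
      (auto intro!: derivative_eq_intros)
  have b: "((\<lambda>t. (max 0 (1 - t))\<^sup>2) has_real_derivative 2 * ?b * (-1)) (at t)"
    by (rule DERIV_chain'[OF _ has_real_derivative_max_power2, of "\<lambda>t. 1 - t"])
      (auto intro!: derivative_eq_intros)
  have "(step has_real_derivative ((2 * ?a * 1) * (?a\<^sup>2 + ?b\<^sup>2) - ?a\<^sup>2 * (2 * ?a * 1 + 2 * ?b * (-1))) / ((?a\<^sup>2 + ?b\<^sup>2) * (?a\<^sup>2 + ?b\<^sup>2))) (at t)"
    unfolding step_def
    by (rule DERIV_divide[OF a DERIV_add[OF a b]]) (use step_denominator_pos[of t] in linarith)
  also have "((2 * ?a * 1) * (?a\<^sup>2 + ?b\<^sup>2) - ?a\<^sup>2 * (2 * ?a * 1 + 2 * ?b * (-1))) / ((?a\<^sup>2 + ?b\<^sup>2) * (?a\<^sup>2 + ?b\<^sup>2)) = step' t"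
    unfolding step'_def Let_def by (simp add: power2_eq_square algebra_simps)
  finally show ?thesis .
qed

lemma step_simps:
  "t \<le> 1/2 \<Longrightarrow> step t = 0" "t \<ge> 1 \<Longrightarrow> step t = 1" "step' t \<ge> 0" "t \<le> 1/2 \<Longrightarrow> step' t = 0"
  "t \<ge> 1 \<Longrightarrow> step' t = 0" "0 \<le> step t" "step t \<le> 1"
  using step_denominator_pos[of t] by (auto simp: step_def step'_def Let_def)

lemma continuous_on_step [continuous_intros]:
  "continuous_on S f \<Longrightarrow> continuous_on S (\<lambda>x. step (f x))"
  by (rule continuous_on_compose2[of UNIV step])
    (auto intro!: continuous_at_imp_continuous_on DERIV_isCont[OF has_real_derivative_step])

lemma continuous_on_step' [continuous_intros]:
  assumes "continuous_on S f" shows "continuous_on S (\<lambda>x. step' (f x))"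
proof -
  have "((max 0 (f x - 1/2))\<^sup>2 + (max 0 (1 - f x))\<^sup>2)\<^sup>2 \<noteq> 0" for x
    using step_denominator_pos[of "f x"] by (metis less_irrefl power_not_zero)
  then show ?thesis unfolding step'_def Let_def by (intro continuous_intros assms) auto
qed

lemma compact_sublevel:
  fixes f :: "R3 \<Rightarrow> real"
  assumes "compact K" "continuous_on K f"
  shows "compact {x\<in>K. f x \<le> a}"
proof -
  have "{x\<in>K. f x \<le> a} = K \<inter> (K \<inter> f -` {..a})" by auto
  moreover have "compact (K \<inter> (K \<inter> f -` {..a}))"
    by (intro compact_Int_closed[OF assms(1)] continuous_closed_preimage assms compact_imp_closed closed_atMost)
  ultimately show ?thesis by simp
qed

lemma positive_near_zero_set:
  fixes f \<Phi> :: "R3 \<Rightarrow> real"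
  assumes K: "compact K" and \<Phi>: "continuous_on K \<Phi>" and f: "continuous_on K f"
    and pos: "\<And>x. x \<in> K \<Longrightarrow> \<Phi> x = 0 \<Longrightarrow> f x > 0"
  obtains \<delta> c where "\<delta> > 0" "c > 0" "\<And>x. x \<in> K \<Longrightarrow> \<bar>\<Phi> x\<bar> \<le> \<delta> \<Longrightarrow> f x \<ge> c"
proof -
  have "\<exists>\<delta>>0. \<forall>x\<in>K. \<bar>\<Phi> x\<bar> \<le> \<delta> \<longrightarrow> f x > 0"
  proof -
    let ?K = "{x\<in>K. f x \<le> 0}"
    have c: "compact ?K" by (rule compact_sublevel[OF K f])
    show ?thesis
    proof (cases "?K = {}")
      case True then show ?thesis by (intro exI[of _ 1]) force
    next
      case False
      obtain y where y: "y \<in> ?K" "\<And>x. x \<in> ?K \<Longrightarrow> \<bar>\<Phi> y\<bar> \<le> \<bar>\<Phi> x\<bar>"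
        using continuous_attains_inf[OF c False, of "\<lambda>x. \<bar>\<Phi> x\<bar>"] continuous_on_subset[OF \<Phi>, of ?K]
        by (metis (mono_tags, lifting) continuous_on_rabs mem_Collect_eq subsetI)
      have "\<Phi> y \<noteq> 0" using y pos[of y] by force
      then show ?thesis using y(2) by (intro exI[of _ "\<bar>\<Phi> y\<bar> / 2"]) force
    qed
  qed
  then obtain \<delta> where \<delta>: "\<delta> > 0" "\<And>x. x \<in> K \<Longrightarrow> \<bar>\<Phi> x\<bar> \<le> \<delta> \<Longrightarrow> f x > 0" by blast
  let ?L = "{x\<in>K. \<bar>\<Phi> x\<bar> \<le> \<delta>}"
  have c: "compact ?L" by (rule compact_sublevel[OF K]) (intro continuous_intros \<Phi>)
  show ?thesis
  proof (cases "?L = {}")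
    case True then show ?thesis using that[of \<delta> 1] \<delta> by force
  next
    case False
    obtain y where y: "y \<in> ?L" "\<And>x. x \<in> ?L \<Longrightarrow> f y \<le> f x"
      using continuous_attains_inf[OF c False, of f] continuous_on_subset[OF f, of ?L] by blast
    then show ?thesis using that[of \<delta> "f y"] \<delta> by force
  qed
qed

lemma C1_cutoff_identity:
  fixes \<Phi> :: "R3 \<Rightarrow> real"
  assumes \<Phi>: "\<And>x. has_grad \<Phi> (g x) x" and g: "continuous_on UNIV g"
    and F: "\<And>x. \<Phi> x > 0 \<Longrightarrow> has_jac F (J x) x" and J: "continuous_on {x. \<Phi> x > 0} J"
    and supp: "\<And>x. \<Phi> x > 0 \<Longrightarrow> norm x > R \<Longrightarrow> F x = 0"
    and bd: "\<And>x. \<Phi> x > 0 \<Longrightarrow> \<bar>trace (J x)\<bar> \<le> B" and B: "0 \<le> B" and k: "k > 0"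
  shows "set_integrable lborel {x. \<Phi> x > 0} (\<lambda>x. step (k * \<Phi> x) * trace (J x))" (is ?th1)
    and "set_integrable lborel {x. \<Phi> x > 0} (\<lambda>x. k * step' (k * \<Phi> x) * (F x \<bullet> g x))" (is ?th2)
    and "(LINT x:{x. \<Phi> x > 0}|lborel. step (k * \<Phi> x) * trace (J x)) =
      - (LINT x:{x. \<Phi> x > 0}|lborel. k * step' (k * \<Phi> x) * (F x \<bullet> g x))" (is ?th3)
    and "set_integrable lborel {x. \<Phi> x > 0} (\<lambda>x. trace (J x))" (is ?th4)
proof -
  let ?E = "{x. \<Phi> x > 0}"
  have c\<Phi>: "continuous_on UNIV \<Phi>" using \<Phi> has_grad_continuous continuous_at_imp_continuous_on by blast
  have cF: "continuous_on ?E F" using F has_jac_continuous continuous_at_imp_continuous_on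
    by (metis (mono_tags, lifting) mem_Collect_eq)
  have oE: "open ?E" by (intro open_Collect_less continuous_intros c\<Phi>)
  let ?Z = "{x. k * \<Phi> x < 1/2}"
  have oZ: "open ?Z" by (intro open_Collect_less continuous_intros c\<Phi>)
  have EZ: "?E \<union> ?Z = UNIV"
  proof -
    have "k * \<Phi> x < 1/2" if "\<not> \<Phi> x > 0" for x
      using mult_nonneg_nonpos[of k "\<Phi> x"] that k by linarith
    then show ?thesis by auto
  qed
  define G where "G x = (if \<Phi> x > 0 then step (k * \<Phi> x) *\<^sub>R F x else 0)" for x
  define K where "K x = (if \<Phi> x > 0 then step (k * \<Phi> x) *\<^sub>R J x + outer (F x) ((step' (k * \<Phi> x) * k) *\<^sub>R g x) else 0)" for x
  have st: "has_grad (\<lambda>x. step (k * \<Phi> x)) ((step' (k * \<Phi> x) * k) *\<^sub>R g x) x" for x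
    using has_grad_chain[OF has_real_derivative_step has_grad_mult[OF has_grad_const[of k] \<Phi>[of x]]] by simp
  have G: "has_jac G (K x) x" for x
  proof (cases "\<Phi> x > 0")
    case True
    show ?thesis
      by (rule has_jac_cong_open[OF _ oE, of "\<lambda>x. step (k * \<Phi> x) *\<^sub>R F x"])
        (use True has_jac_scaleR[OF st F[OF True]] in \<open>auto simp: K_def G_def\<close>)
  next
    case False
    show ?thesis
      by (rule has_jac_cong_open[OF _ oZ, of "\<lambda>x. 0"])
        (use False EZ has_jac_const[of 0 x] in \<open>auto simp: K_def G_def step_simps\<close>)
  qed
  have "continuous_on ?E K"
    by (rule continuous_on_eq[of _ "\<lambda>x. step (k * \<Phi> x) *\<^sub>R J x + outer (F x) ((step' (k * \<Phi> x) * k) *\<^sub>R g x)"])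
      (auto simp: K_def intro!: continuous_intros J cF continuous_on_subset[OF c\<Phi>] continuous_on_subset[OF g])
  moreover have "continuous_on ?Z K"
    by (rule continuous_on_eq[of _ "\<lambda>x. 0"]) (auto simp: K_def step_simps outer_def vec_eq_iff)
  ultimately have K: "continuous_on UNIV K" using continuous_on_open_Un[OF oE oZ] EZ by simp
  have int0: "(LINT x|lborel. trace (K x)) = 0" "integrable lborel (\<lambda>x. trace (K x))"
    by (rule integral_trace_jac_zero[OF G K, of R]; auto simp: G_def supp)+
  have eq: "trace (K x) = indicat_real ?E x *\<^sub>R (step (k * \<Phi> x) * trace (J x) + k * step' (k * \<Phi> x) * (F x \<bullet> g x))" for x
    by (simp add: K_def indicator_def trace_add trace_scaleR trace_outer) (simp add: trace_def)
  have J0: "J x = 0" if "\<Phi> x > 0" "norm x > R" for x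
  proof -
    have o: "open (?E \<inter> {x. norm x > R})" by (intro open_Int oE open_Collect_less continuous_intros)
    have "has_jac F 0 x"
      by (rule has_jac_cong_open[OF has_jac_const o]) (use that supp in auto)
    then show ?thesis using F[OF that(1)] has_jac_unique by blast
  qed
  have J0': "trace (J x) = 0" if "x \<in> ?E" "x \<notin> cball 0 R" for x
  proof -
    have "J x = 0" by (rule J0) (use that in \<open>simp_all add: not_le\<close>)
    then show ?thesis by (simp add: trace_def)
  qed
  have b: "?E \<in> sets borel" using oE by simp
  show th1: ?th1
  proof (rule set_integrable_bounded_continuous[OF b bounded_cball[of 0 R] _ _ _ B])
    show "continuous_on ?E (\<lambda>x. step (k * \<Phi> x) * trace (J x))"
      by (intro continuous_intros J continuous_on_subset[OF c\<Phi>]) auto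
    show "\<bar>step (k * \<Phi> x) * trace (J x)\<bar> \<le> B" if "x \<in> ?E" for x
    proof -
      have "\<bar>step (k * \<Phi> x)\<bar> \<le> 1" using step_simps(6,7)[of "k * \<Phi> x"] by linarith
      moreover have "\<bar>trace (J x)\<bar> \<le> B" using bd[of x] that by blast
      ultimately have "\<bar>step (k * \<Phi> x)\<bar> * \<bar>trace (J x)\<bar> \<le> 1 * B"
        by (rule mult_mono) simp_all
      then show ?thesis by (simp add: abs_mult)
    qed
    show "step (k * \<Phi> x) * trace (J x) = 0" if "x \<in> ?E" "x \<notin> cball 0 R" for x
      using J0'[OF that] by simp
  qed
  show ?th4
  proof (rule set_integrable_bounded_continuous[OF b bounded_cball[of 0 R] _ _ _ B])
    show "continuous_on ?E (\<lambda>x. trace (J x))"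
      by (intro continuous_intros J)
    show "trace (J x) = 0" if "x \<in> ?E" "x \<notin> cball 0 R" for x
      by (rule J0'[OF that])
    show "\<bar>trace (J x)\<bar> \<le> B" if "x \<in> ?E" for x using bd that by blast
  qed
  have a: "set_integrable lborel ?E (\<lambda>x. step (k * \<Phi> x) * trace (J x) + k * step' (k * \<Phi> x) * (F x \<bullet> g x))"
    unfolding set_integrable_def using int0(2) by (simp only: eq)
  show th2: ?th2 using set_integral_diff(1)[OF a th1] by (simp only: add_diff_cancel_left')
  have "(LINT x:?E|lborel. step (k * \<Phi> x) * trace (J x) + k * step' (k * \<Phi> x) * (F x \<bullet> g x)) = 0"
    unfolding set_lebesgue_integral_def using int0(1) by (simp only: eq)
  then show ?th3 using set_integral_add(2)[OF th1 th2] by linarith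
qed

lemma cutoff_ball_exists:
  fixes R :: real assumes "0 \<le> R"
  obtains \<eta> :: "R3 \<Rightarrow> real" and g where "\<And>x. has_grad \<eta> (g x) x" "continuous_on UNIV g"
    "\<And>x. 0 \<le> \<eta> x" "\<And>x. \<eta> x \<le> 1" "\<And>x. norm x \<le> R \<Longrightarrow> \<eta> x = 1" "\<And>x. norm x > R + 1 \<Longrightarrow> \<eta> x = 0"
proof
  let ?\<eta> = "\<lambda>x::R3. 1 - step (x \<bullet> x - R\<^sup>2)"
  let ?g = "\<lambda>x::R3. - (step' (x \<bullet> x - R\<^sup>2) *\<^sub>R (2 *\<^sub>R x))"
  have n: "has_grad (\<lambda>x. x \<bullet> x - R\<^sup>2) (2 *\<^sub>R x) x" for x
    using has_grad_diff[OF has_grad_inner[OF has_jac_id has_jac_id] has_grad_const, of "R\<^sup>2" x]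
    by (simp add: scaleR_2)
  show "has_grad ?\<eta> (?g x) x" for x
    using has_grad_diff[OF has_grad_const has_grad_chain[OF has_real_derivative_step n]] by simp
  show "continuous_on UNIV ?g" by (intro continuous_intros)
  show "0 \<le> ?\<eta> x" "?\<eta> x \<le> 1" for x using step_simps(6,7) by simp_all
  show "?\<eta> x = 1" if "norm x \<le> R" for x
  proof -
    have "x \<bullet> x \<le> R\<^sup>2" using that assms by (metis norm_ge_zero power2_norm_eq_inner power_mono)
    then show ?thesis by (simp add: step_simps)
  qed
  show "?\<eta> x = 0" if "norm x > R + 1" for x
  proof -
    have "(R + 1)\<^sup>2 \<le> (norm x)\<^sup>2" using that assms by (intro power_mono) auto
    then have "x \<bullet> x \<ge> R\<^sup>2 + 1" unfolding power2_norm_eq_inner using assms by (simp add: power2_sum)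
    then show ?thesis by (simp add: step_simps)
  qed
qed

locale C2_function =
  fixes \<Phi> :: "R3 \<Rightarrow> real" and g :: "R3 \<Rightarrow> R3" and A :: "R3 \<Rightarrow> real^3^3"
  assumes grad_\<Phi>: "has_grad \<Phi> (g x) x" and jac_g: "has_jac g (A x) x" and cont_A: "continuous_on UNIV A"
    and regular: "\<Phi> x = 0 \<Longrightarrow> g x \<noteq> 0"
begin

lemma cont_\<Phi>: "continuous_on S \<Phi>"
  using grad_\<Phi> has_grad_continuous continuous_at_imp_continuous_on by blast

lemma cont_g: "continuous_on S g"
  using jac_g has_jac_continuous continuous_at_imp_continuous_on by blast

lemma cont_A': "continuous_on S A"
  using cont_A continuous_on_subset by blast

abbreviation "E \<equiv> {x. \<Phi> x > 0}"

lemma open_E: "open E" by (intro open_Collect_less continuous_intros cont_\<Phi>)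

lemma closed_E: "closed {x. \<Phi> x \<ge> 0}" by (intro closed_Collect_le continuous_intros cont_\<Phi>)

lemma layer_bounded:
  assumes "0 \<le> R"
  obtains C \<delta> where "\<delta> > 0" "C \<ge> 0" "\<And>k. k > 1/\<delta> \<Longrightarrow>
    set_integrable lborel E (\<lambda>x. k * step' (k * \<Phi> x) * indicat_real (cball 0 R) x)"
    "\<And>k. k > 1/\<delta> \<Longrightarrow> (LINT x:E|lborel. k * step' (k * \<Phi> x) * indicat_real (cball 0 R) x) \<le> C"
proof -
  obtain \<eta> g\<eta> where \<eta>: "\<And>x. has_grad \<eta> (g\<eta> x) x" "continuous_on UNIV g\<eta>"
    "\<And>x. 0 \<le> \<eta> x" "\<And>x. \<eta> x \<le> 1" "\<And>x. norm x \<le> R \<Longrightarrow> \<eta> x = 1" "\<And>x. norm x > R + 1 \<Longrightarrow> \<eta> x = 0"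
    by (rule cutoff_ball_exists[OF assms], rule that)
  define J where "J x = \<eta> x *\<^sub>R A x + outer (g x) (g\<eta> x)" for x
  have c\<eta>: "continuous_on S \<eta>" for S using \<eta>(1) has_grad_continuous continuous_at_imp_continuous_on by blast
  have J: "has_jac (\<lambda>x. \<eta> x *\<^sub>R g x) (J x) x" for x
    unfolding J_def by (rule has_jac_scaleR[OF \<eta>(1) jac_g])
  have cJ: "continuous_on UNIV J" unfolding J_def by (intro continuous_intros c\<eta> cont_A cont_g \<eta>)
  have J0: "J x = 0" if "norm x > R + 1" for x
  proof (rule has_jac_unique[OF J])
    have "open {x::R3. norm x > R + 1}" by (intro open_Collect_less continuous_intros)
    from has_jac_cong_open[OF has_jac_const this, of x 0] that \<eta>(6)
    show "has_jac (\<lambda>x. \<eta> x *\<^sub>R g x) 0 x" by simp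
  qed
  have "bounded ((\<lambda>x. trace (J x)) ` cball 0 (R + 1))"
    by (intro compact_imp_bounded compact_continuous_image continuous_intros continuous_on_subset[OF cJ]) auto
  then obtain B0 where B0: "\<forall>x\<in>cball 0 (R + 1). \<bar>trace (J x)\<bar> \<le> B0" by (auto simp: bounded_iff)
  define B where "B = max B0 0"
  have B: "\<bar>trace (J x)\<bar> \<le> B * indicat_real (cball 0 (R + 1)) x" for x
  proof (cases "norm x \<le> R + 1")
    case True then show ?thesis using B0 by (force simp: B_def)
  next
    case False then have "J x = 0" using J0 by simp
    then have "trace (J x) = 0" by (simp add: trace_def)
    then show ?thesis by (simp add: B_def indicator_def)
  qed
  have Bp: "B \<ge> 0" by (simp add: B_def)
  have B': "\<bar>trace (J x)\<bar> \<le> B" for x using B[of x] Bp by (cases "norm x \<le> R + 1") auto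
  obtain \<delta> c where \<delta>: "\<delta> > 0" "c > 0" "\<And>x. x \<in> cball 0 R \<Longrightarrow> \<bar>\<Phi> x\<bar> \<le> \<delta> \<Longrightarrow> g x \<bullet> g x \<ge> c"
    by (rule positive_near_zero_set[of "cball 0 R" \<Phi> "\<lambda>x. g x \<bullet> g x"])
      (auto intro!: continuous_intros cont_g cont_\<Phi> simp: regular)
  define C where "C = B * measure lborel (cball 0 (R + 1) :: R3 set) / c"
  have C0: "C \<ge> 0" unfolding C_def using Bp \<delta>(2) by simp
  have *: "set_integrable lborel E (\<lambda>x. k * step' (k * \<Phi> x) * indicat_real (cball 0 R) x) \<and>
     (LINT x:E|lborel. k * step' (k * \<Phi> x) * indicat_real (cball 0 R) x) \<le> C" if k: "k > 1 / \<delta>" for k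
  proof -
    have k0: "k > 0" using k \<delta>(1) by (meson divide_pos_pos less_trans zero_less_one)
    note id = C1_cutoff_identity[OF grad_\<Phi> cont_g, of "\<lambda>x. \<eta> x *\<^sub>R g x" J "R + 1" B k]
    have id1: "set_integrable lborel E (\<lambda>x. step (k * \<Phi> x) * trace (J x))"
      and id2: "set_integrable lborel E (\<lambda>x. k * step' (k * \<Phi> x) * (\<eta> x *\<^sub>R g x \<bullet> g x))"
      and id3: "(LINT x:E|lborel. step (k * \<Phi> x) * trace (J x)) =
        - (LINT x:E|lborel. k * step' (k * \<Phi> x) * (\<eta> x *\<^sub>R g x \<bullet> g x))"
      using id J B' Bp k0 \<eta>(6) continuous_on_subset[OF cJ] by auto
    have pt: "k * step' (k * \<Phi> x) * indicat_real (cball 0 R) x \<le> (k * step' (k * \<Phi> x) * (\<eta> x *\<^sub>R g x \<bullet> g x)) / c"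
      if "x \<in> E" for x
    proof (cases "norm x \<le> R \<and> k * \<Phi> x < 1")
      case True
      then have "\<Phi> x < \<delta>" using k k0 \<delta>(1) by (smt (verit, ccfv_SIG) divide_less_eq mult.commute mult_le_cancel_left_pos)
      then have "g x \<bullet> g x \<ge> c" using \<delta>(3)[of x] True that by auto
      then have "1 \<le> (\<eta> x *\<^sub>R g x \<bullet> g x) / c" using True \<eta>(5) \<delta>(2) by simp
      from mult_left_mono[OF this, of "k * step' (k * \<Phi> x)"] True show ?thesis
        using k0 step_simps(3)[of "k * \<Phi> x"] by simp
    next
      case False
      then have "k * step' (k * \<Phi> x) * indicat_real (cball 0 R) x = 0"
        using step_simps(5)[of "k * \<Phi> x"] by auto
      moreover have "0 \<le> (k * step' (k * \<Phi> x) * (\<eta> x *\<^sub>R g x \<bullet> g x)) / c"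
        using \<delta>(2) k0 step_simps(3)[of "k * \<Phi> x"] \<eta>(3)[of x] by simp
      ultimately show ?thesis by linarith
    qed
    have pt0: "0 \<le> k * step' (k * \<Phi> x) * indicat_real (cball 0 R) x" for x
      using k0 step_simps(3)[of "k * \<Phi> x"] by simp
    have nrm: "norm (indicat_real E x) * norm (k * step' (k * \<Phi> x) * indicat_real (cball 0 R) x)
        \<le> norm (indicat_real E x) * norm ((k * step' (k * \<Phi> x) * (\<eta> x *\<^sub>R g x \<bullet> g x)) / c)" for x
    proof (cases "x \<in> E")
      case True
      then show ?thesis using pt[OF True] pt0[of x] by (simp only: indicator_simps real_norm_def)
    qed simp
    have iR: "set_integrable lborel E (\<lambda>x. (k * step' (k * \<Phi> x) * (\<eta> x *\<^sub>R g x \<bullet> g x)) / c)"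
      using id2 by (rule set_integrable_divide)
    have m: "(\<lambda>x. indicat_real E x *\<^sub>R (k * step' (k * \<Phi> x) * indicat_real (cball 0 R) x)) \<in> borel_measurable lborel"
    proof -
      have "(\<lambda>x. k * step' (k * \<Phi> x)) \<in> borel_measurable borel"
        by (intro borel_measurable_continuous_onI continuous_intros cont_\<Phi>)
      moreover have "E \<in> sets borel" "cball 0 R \<in> sets borel" using open_E by simp_all
      ultimately show ?thesis
        by (intro borel_measurable_scaleR borel_measurable_times[of "\<lambda>x. k * step' (k * \<Phi> x)"] borel_measurable_indicator) simp_all
    qed
    have 1: "set_integrable lborel E (\<lambda>x. k * step' (k * \<Phi> x) * indicat_real (cball 0 R) x)"
      unfolding set_integrable_def
    proof (rule Bochner_Integration.integrable_bound[OF iR[unfolded set_integrable_def] m], rule AE_I2)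
      fix x :: R3
      show "norm (indicat_real E x *\<^sub>R (k * step' (k * \<Phi> x) * indicat_real (cball 0 R) x))
        \<le> norm (indicat_real E x *\<^sub>R ((k * step' (k * \<Phi> x) * (\<eta> x *\<^sub>R g x \<bullet> g x)) / c))"
        using nrm[of x] unfolding real_scaleR_def real_norm_def abs_mult[of "indicat_real E x"] .
    qed
    have "(LINT x:E|lborel. k * step' (k * \<Phi> x) * indicat_real (cball 0 R) x)
        \<le> (LINT x:E|lborel. (k * step' (k * \<Phi> x) * (\<eta> x *\<^sub>R g x \<bullet> g x)) / c)"
      by (rule set_integral_mono[OF 1 iR pt])
    also have "\<dots> = - (LINT x:E|lborel. step (k * \<Phi> x) * trace (J x)) / c"
      using id3 by (simp add: set_integral_divide_zero)
    also have "\<dots> \<le> C"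
    proof -
      have w: "set_integrable lborel E (\<lambda>x. - (B * indicat_real (cball 0 (R+1)) x))"
        unfolding set_integrable_def
        by (rule integrable_mult_indicator) (use open_E in \<open>auto intro!: integrable_mult_right integrable_real_indicator emeasure_bounded_finite\<close>)
      have "- (LINT x:E|lborel. B * indicat_real (cball 0 (R+1)) x) \<le> (LINT x:E|lborel. step (k * \<Phi> x) * trace (J x))"
      proof -
        have "(LINT x:E|lborel. - (B * indicat_real (cball 0 (R+1)) x)) \<le> (LINT x:E|lborel. step (k * \<Phi> x) * trace (J x))"
        proof (rule set_integral_mono[OF w id1])
          fix x assume "x \<in> E"
          have "\<bar>step (k * \<Phi> x) * trace (J x)\<bar> \<le> 1 * (B * indicat_real (cball 0 (R+1)) x)"
            unfolding abs_mult by (rule mult_mono[OF _ B]) (use step_simps(6,7) in auto)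
          then show "- (B * indicat_real (cball 0 (R+1)) x) \<le> step (k * \<Phi> x) * trace (J x)" by linarith
        qed
        then show ?thesis unfolding set_lebesgue_integral_def by (simp only: scaleR_minus_right integral_minus)
      qed
      moreover have "(LINT x:E|lborel. B * indicat_real (cball 0 (R+1)) x) \<le> B * measure lborel (cball 0 (R + 1) :: R3 set)"
      proof -
        have "(LINT x:E|lborel. B * indicat_real (cball 0 (R+1)) x) \<le> (LINT x|lborel. B * indicat_real (cball (0::R3) (R+1)) x)"
          unfolding set_lebesgue_integral_def
        proof (rule integral_mono)
          show "integrable lborel (\<lambda>x. indicat_real E x *\<^sub>R (B * indicat_real (cball 0 (R+1)) x))"
            using w unfolding set_integrable_def by simp
          show "integrable lborel (\<lambda>x. B * indicat_real (cball (0::R3) (R+1)) x)"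
            by (intro integrable_mult_right integrable_real_indicator emeasure_bounded_finite) auto
        qed (use Bp in \<open>auto simp: indicator_def\<close>)
        also have "\<dots> = B * measure lborel (cball 0 (R + 1) :: R3 set)" by simp
        finally show ?thesis .
      qed
      ultimately have "- (LINT x:E|lborel. step (k * \<Phi> x) * trace (J x)) \<le> B * measure lborel (cball 0 (R + 1) :: R3 set)" by linarith
      then have "- (LINT x:E|lborel. step (k * \<Phi> x) * trace (J x)) / c \<le> B * measure lborel (cball 0 (R + 1) :: R3 set) / c"
        by (rule divide_right_mono) (use \<delta>(2) in simp)
      then show ?thesis unfolding C_def .
    qed
    finally show ?thesis using 1 by blast
  qed
  show ?thesis by (rule that[OF \<delta>(1) C0]) (use * in blast)+
qed

lemma integral_div_nonpos:
  assumes F: "\<And>x. \<Phi> x > 0 \<Longrightarrow> has_jac F (J x) x" and J: "continuous_on E J"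
    and cF: "continuous_on {x. \<Phi> x \<ge> 0} F"
    and R: "0 \<le> R" and supp: "\<And>x. \<Phi> x > 0 \<Longrightarrow> norm x > R \<Longrightarrow> F x = 0"
    and bd: "\<And>x. \<Phi> x > 0 \<Longrightarrow> \<bar>trace (J x)\<bar> \<le> B"
    and sgn: "\<And>x. \<Phi> x = 0 \<Longrightarrow> norm x \<le> R \<Longrightarrow> F x \<bullet> g x \<ge> 0"
  shows "(LINT x:E|lborel. trace (J x)) \<le> 0"
proof (rule field_le_epsilon)
  fix e :: real assume e: "e > 0"
  define B' where "B' = max B 0"
  obtain C \<delta> where C: "\<delta> > 0" "C \<ge> 0" "\<And>k. k > 1/\<delta> \<Longrightarrow>
    set_integrable lborel E (\<lambda>x. k * step' (k * \<Phi> x) * indicat_real (cball 0 R) x)"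
    "\<And>k. k > 1/\<delta> \<Longrightarrow> (LINT x:E|lborel. k * step' (k * \<Phi> x) * indicat_real (cball 0 R) x) \<le> C"
    by (rule layer_bounded[OF R], rule that)
  define eps where "eps = e / (C + 1)"
  have eps: "eps > 0" using e C(2) by (simp add: eps_def)
  obtain \<delta>' c where \<delta>': "\<delta>' > 0" "c > 0" "\<And>x. x \<in> {x. \<Phi> x \<ge> 0} \<inter> cball 0 R \<Longrightarrow> \<bar>\<Phi> x\<bar> \<le> \<delta>' \<Longrightarrow> F x \<bullet> g x + eps \<ge> c"
  proof (rule positive_near_zero_set[of "{x. \<Phi> x \<ge> 0} \<inter> cball 0 R" \<Phi> "\<lambda>x. F x \<bullet> g x + eps"])
    show "compact ({x. \<Phi> x \<ge> 0} \<inter> cball 0 R)" using closed_E by (simp add: closed_Int_compact)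
    show "continuous_on ({x. \<Phi> x \<ge> 0} \<inter> cball 0 R) (\<lambda>x. F x \<bullet> g x + eps)"
      by (intro continuous_intros cont_g continuous_on_subset[OF cF]) auto
    show "F x \<bullet> g x + eps > 0" if "x \<in> {x. \<Phi> x \<ge> 0} \<inter> cball 0 R" "\<Phi> x = 0" for x
      using sgn[of x] that eps by (auto simp: add_nonneg_pos)
  qed (auto intro: cont_\<Phi>)
  define k where "k n = real (Suc n) + 1/\<delta> + 1/\<delta>'" for n
  have k: "k n > 1/\<delta>" "k n > 1/\<delta>'" "k n > 0" "k n \<ge> n" for n
    using C(1) \<delta>'(1) unfolding k_def by (auto simp: add_pos_pos add_pos_nonneg)
  have B': "B' \<ge> 0" by (simp add: B'_def)
  have bd': "\<bar>trace (J x)\<bar> \<le> B'" if "\<Phi> x > 0" for x using bd[OF that] by (simp add: B'_def)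
  have id: "set_integrable lborel E (\<lambda>x. step (k n * \<Phi> x) * trace (J x))"
    "set_integrable lborel E (\<lambda>x. k n * step' (k n * \<Phi> x) * (F x \<bullet> g x))"
    "(LINT x:E|lborel. step (k n * \<Phi> x) * trace (J x)) =
      - (LINT x:E|lborel. k n * step' (k n * \<Phi> x) * (F x \<bullet> g x))"
    "set_integrable lborel E (\<lambda>x. trace (J x))" for n
    by (rule C1_cutoff_identity[OF grad_\<Phi> cont_g F J supp bd' B' k(3)]; assumption)+
  have up: "(LINT x:E|lborel. step (k n * \<Phi> x) * trace (J x)) \<le> e" for n
  proof -
    have "- (LINT x:E|lborel. k n * step' (k n * \<Phi> x) * (F x \<bullet> g x)) = (LINT x:E|lborel. - (k n * step' (k n * \<Phi> x) * (F x \<bullet> g x)))"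
      unfolding set_lebesgue_integral_def by (simp only: scaleR_minus_right integral_minus)
    also have "\<dots> \<le> (LINT x:E|lborel. eps * (k n * step' (k n * \<Phi> x) * indicat_real (cball 0 R) x))"
    proof (rule set_integral_mono)
      show "set_integrable lborel E (\<lambda>x. - (k n * step' (k n * \<Phi> x) * (F x \<bullet> g x)))"
        using id(2)[of n] unfolding set_integrable_def by (simp only: scaleR_minus_right integrable_minus)
      show "set_integrable lborel E (\<lambda>x. eps * (k n * step' (k n * \<Phi> x) * indicat_real (cball 0 R) x))"
        by (rule set_integrable_mult_right) (use C(3)[OF k(1)] in blast)
      fix x assume x: "x \<in> E"
      have s: "0 \<le> k n * step' (k n * \<Phi> x)" using k(3)[of n] step_simps(3) by simp
      show "- (k n * step' (k n * \<Phi> x) * (F x \<bullet> g x)) \<le> eps * (k n * step' (k n * \<Phi> x) * indicat_real (cball 0 R) x)"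
      proof (cases "norm x \<le> R \<and> k n * \<Phi> x < 1")
        case True
        have "\<Phi> x \<le> \<delta>'"
        proof (rule ccontr)
          assume "\<not> \<Phi> x \<le> \<delta>'"
          then have "(1 / \<delta>') * \<delta>' \<le> k n * \<Phi> x" using k(2)[of n] k(3)[of n] \<delta>'(1) by (intro mult_mono) auto
          then show False using True \<delta>'(1) by simp
        qed
        then have "- (F x \<bullet> g x) \<le> eps" using \<delta>'(3)[of x] \<delta>'(2) True x by auto
        from mult_left_mono[OF this s] show ?thesis using True by (simp add: mult.commute)
      next
        case False
        then consider "norm x > R" | "k n * \<Phi> x \<ge> 1" by linarith
        then show ?thesis
        proof cases
          case 1 then show ?thesis using supp[of x] x by simp
        next
          case 2 then show ?thesis using step_simps(5)[of "k n * \<Phi> x"] by simp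
        qed
      qed
    qed
    also have "\<dots> = eps * (LINT x:E|lborel. k n * step' (k n * \<Phi> x) * indicat_real (cball 0 R) x)"
      by (rule set_integral_mult_right)
    also have "\<dots> \<le> eps * C" using C(4)[OF k(1)[of n]] eps by (intro mult_left_mono) auto
    also have "\<dots> \<le> e" using e C(2) unfolding eps_def by (simp add: field_simps)
    finally show ?thesis using id(3)[of n] by simp
  qed
  have "(\<lambda>n. LINT x:E|lborel. step (k n * \<Phi> x) * trace (J x)) \<longlonglongrightarrow> (LINT x:E|lborel. trace (J x))"
    unfolding set_lebesgue_integral_def
  proof (rule integral_dominated_convergence[where w="\<lambda>x. indicat_real E x * \<bar>trace (J x)\<bar>"])
    have i4: "integrable lborel (\<lambda>x. indicat_real E x *\<^sub>R trace (J x))"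
      using id(4) unfolding set_integrable_def by simp
    then show "(\<lambda>x. indicat_real E x *\<^sub>R trace (J x)) \<in> borel_measurable lborel" by simp
    show "integrable lborel (\<lambda>x. indicat_real E x * \<bar>trace (J x)\<bar>)" using integrable_abs[OF i4] by (simp add: abs_mult)
    show "(\<lambda>x. indicat_real E x *\<^sub>R (step (k n * \<Phi> x) * trace (J x))) \<in> borel_measurable lborel" for n
      using id(1)[of n] unfolding set_integrable_def by simp
    show "AE x in lborel. norm (indicat_real E x *\<^sub>R (step (k n * \<Phi> x) * trace (J x))) \<le> indicat_real E x * \<bar>trace (J x)\<bar>" for n
      by (rule AE_I2) (simp add: abs_mult mult_left_le_one_le[OF abs_ge_zero step_simps(6,7)] abs_of_nonneg[OF step_simps(6)] indicator_def)
    show "AE x in lborel. (\<lambda>n. indicat_real E x *\<^sub>R (step (k n * \<Phi> x) * trace (J x))) \<longlonglongrightarrow> indicat_real E x *\<^sub>R trace (J x)"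
    proof (rule AE_I2)
      fix x :: R3
      show "(\<lambda>n. indicat_real E x *\<^sub>R (step (k n * \<Phi> x) * trace (J x))) \<longlonglongrightarrow> indicat_real E x *\<^sub>R trace (J x)"
      proof (cases "x \<in> E")
        case True
        obtain N where N: "real N > 1 / \<Phi> x" using reals_Archimedean2 by blast
        have "step (k n * \<Phi> x) = 1" if "n \<ge> N" for n
        proof (rule step_simps(2))
          have "1 / \<Phi> x \<le> k n" using k(4)[of n] N that by linarith
          then show "1 \<le> k n * \<Phi> x" using True by (simp add: field_simps)
        qed
        then have "\<forall>\<^sub>F n in sequentially. indicat_real E x *\<^sub>R (step (k n * \<Phi> x) * trace (J x)) = indicat_real E x *\<^sub>R trace (J x)"
          unfolding eventually_sequentially by (intro exI[of _ N]) simp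
        then show ?thesis by (rule tendsto_eventually)
      qed simp
    qed
  qed
  then have "(LINT x:E|lborel. trace (J x)) \<le> e" by (rule LIMSEQ_le_const2) (use up in blast)
  then show "(LINT x:E|lborel. trace (J x)) \<le> 0 + e" by simp
qed

lemma integral_div_zero:
  assumes F: "\<And>x. \<Phi> x > 0 \<Longrightarrow> has_jac F (J x) x" and J: "continuous_on E J"
    and cF: "continuous_on {x. \<Phi> x \<ge> 0} F"
    and R: "0 \<le> R" and supp: "\<And>x. \<Phi> x > 0 \<Longrightarrow> norm x > R \<Longrightarrow> F x = 0"
    and bd: "\<And>x. \<Phi> x > 0 \<Longrightarrow> \<bar>trace (J x)\<bar> \<le> B"
    and sgn: "\<And>x. \<Phi> x = 0 \<Longrightarrow> norm x \<le> R \<Longrightarrow> F x \<bullet> g x = 0"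
  shows "(LINT x:E|lborel. trace (J x)) = 0"
proof (rule antisym)
  show "(LINT x:E|lborel. trace (J x)) \<le> 0"
    by (rule integral_div_nonpos[OF F J cF R supp bd]) (use sgn in auto)
  have "(LINT x:E|lborel. trace (- J x)) \<le> 0"
  proof (rule integral_div_nonpos[of "\<lambda>x. - F x" _ R B])
    show "\<Phi> x > 0 \<Longrightarrow> has_jac (\<lambda>x. - F x) (- J x) x" for x using F by (rule has_jac_minus)
    show "continuous_on E (\<lambda>x. - J x)" by (intro continuous_intros J)
    show "continuous_on {x. \<Phi> x \<ge> 0} (\<lambda>x. - F x)" by (intro continuous_intros cF)
    show "\<Phi> x > 0 \<Longrightarrow> norm x > R \<Longrightarrow> - F x = 0" for x using supp by simp
    show "\<Phi> x > 0 \<Longrightarrow> \<bar>trace (- J x)\<bar> \<le> B" for x using bd by (simp add: trace_minus)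
    show "\<Phi> x = 0 \<Longrightarrow> norm x \<le> R \<Longrightarrow> - F x \<bullet> g x \<ge> 0" for x using sgn[of x] by simp
  qed (rule R)
  then show "0 \<le> (LINT x:E|lborel. trace (J x))"
    unfolding set_lebesgue_integral_def trace_minus by (simp only: scaleR_minus_right integral_minus)
qed

end

lemma decreasing_primitive:
  fixes \<gamma> :: "real \<Rightarrow> real"
  assumes c: "continuous_on UNIV \<gamma>" and z: "\<And>t. t \<ge> D \<Longrightarrow> \<gamma> t = 0"
  obtains G where "\<And>t. (G has_real_derivative - \<gamma> t) (at t)" "\<And>t. t \<ge> D \<Longrightarrow> G t = 0"
proof
  let ?G = "\<lambda>t. integral {t..D+1} \<gamma>"
  show "(?G has_real_derivative - \<gamma> t) (at t)" for t
  proof (cases "t < D + 1")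
    case True
    have "((\<lambda>u. integral {u..D+1} \<gamma>) has_real_derivative - \<gamma> t) (at t within {t-1..D+1})"
      by (rule integral_has_real_derivative'[OF continuous_on_subset[OF c]]) (use True in auto)
    then show ?thesis using at_within_Icc_at[of "t - 1" t "D + 1"] True by simp
  next
    case False
    have "((\<lambda>t. 0) has_real_derivative - \<gamma> t) (at t)" using z[of t] False by simp
    then show ?thesis
    proof (rule has_field_derivative_transform_within_open[where S="{D<..}"])
      fix u assume "u \<in> {D<..}"
      then have "integral {u..D+1} \<gamma> = integral {u..D+1} (\<lambda>x. 0)"
        by (intro integral_cong) (use z in auto)
      then show "0 = integral {u..D+1} \<gamma>" by simp
    qed (use False in auto)
  qed
  show "integral {t..D+1} \<gamma> = 0" if "t \<ge> D" for t
  proof -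
    have "integral {t..D+1} \<gamma> = integral {t..D+1} (\<lambda>x. 0)"
      by (intro integral_cong) (use z that in auto)
    then show ?thesis by simp
  qed
qed

lemma primitive_pos:
  fixes G :: "real \<Rightarrow> real"
  assumes G: "\<And>t. (G has_real_derivative - \<gamma> t) (at t)" and z: "\<And>t. t \<ge> D \<Longrightarrow> G t = 0"
    and nn: "\<And>t. \<gamma> t \<ge> 0" and s: "s > 0" "\<gamma> s > 0"
  shows "G 0 > 0"
proof -
  have mono: "G b \<le> G a" if "a \<le> b" for a b
  proof (rule DERIV_nonpos_imp_nonincreasing[OF that])
    fix x show "\<exists>y. (G has_real_derivative y) (at x) \<and> y \<le> 0"
      using G[of x] nn[of x] by (intro exI[of _ "- \<gamma> x"]) simp
  qed
  obtain d where d: "d > 0" "\<And>h. h > 0 \<Longrightarrow> h < d \<Longrightarrow> G (s + h) < G s"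
    using DERIV_neg_dec_right[OF G[of s]] s by auto
  have "G (s + d/2) < G s" using d by simp
  moreover have "G s \<le> G 0" using mono s by simp
  moreover have "G (s + d/2) \<ge> 0"
    using mono[of "s + d/2" "max D (s + d/2)"] z[of "max D (s + d/2)"] by simp
  ultimately show ?thesis by linarith
qed

lemma has_real_derivative_max_power3:
  "((\<lambda>t. (max 0 t)^3) has_real_derivative 3 * (max 0 x)\<^sup>2) (at (x::real))"
proof -
  consider "x > 0" | "x < 0" | "x = 0" by linarith
  then show ?thesis
  proof cases
    case 1
    show ?thesis
      by (rule has_field_derivative_transform_within_open[where S="{0<..}" and f="\<lambda>t. t^3"])
        (use 1 in \<open>auto intro!: derivative_eq_intros\<close>)
  next
    case 2
    show ?thesis
      by (rule has_field_derivative_transform_within_open[where S="{..<0}" and f="\<lambda>t. 0"])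
        (use 2 in \<open>auto intro!: derivative_eq_intros\<close>)
  next
    case 3
    have "((\<lambda>h::real. ((max 0 h)^3) / h) \<longlongrightarrow> 0) (at 0)"
    proof (rule Lim_null_comparison)
      show "\<forall>\<^sub>F x::real in at 0. norm ((max 0 x)^3 / x) \<le> \<bar>x\<bar>\<^sup>2"
        by (intro always_eventually) (auto simp: max_def power2_eq_square power3_eq_cube)
      show "((\<lambda>x::real. \<bar>x\<bar>\<^sup>2) \<longlongrightarrow> 0) (at 0)" by (rule tendsto_eq_intros | simp)+
    qed
    then show ?thesis using 3 by (simp add: DERIV_def)
  qed
qed

context C2_function
begin

lemma E_borel: "E \<in> sets borel" using open_E by simp

lemma set_integrable_E:
  assumes "bounded E" "continuous_on UNIV f"
  shows "set_integrable lborel E (f :: R3 \<Rightarrow> real)" "bounded (f ` closure E)"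
proof -
  show "bounded (f ` closure E)"
    by (intro compact_imp_bounded compact_continuous_image continuous_on_subset[OF assms(2)])
      (use assms(1) in \<open>simp_all add: compact_closure\<close>)
  then obtain B where B: "\<forall>x\<in>closure E. \<bar>f x\<bar> \<le> B" by (auto simp: bounded_iff)
  show "set_integrable lborel E f"
  proof (rule set_integrable_bounded_continuous[OF E_borel assms(1) continuous_on_subset[OF assms(2)], where B="max B 0"])
    show "\<bar>f x\<bar> \<le> max B 0" if "x \<in> E" for x
      using B closure_subset[of E] that by (meson max.coboundedI1 subsetD)
  qed auto
qed

lemma set_integral_E_limit_zero:
  fixes f :: "nat \<Rightarrow> R3 \<Rightarrow> real"
  assumes b: "bounded E" and m: "\<And>n. set_borel_measurable borel E (f n)"
    and bd: "\<And>n x. x \<in> E \<Longrightarrow> \<bar>f n x\<bar> \<le> B"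
    and lim: "\<And>x. x \<in> E \<Longrightarrow> \<forall>\<^sub>F n in sequentially. f n x = 0"
  shows "(\<lambda>n. LINT x:E|lborel. f n x) \<longlonglongrightarrow> 0"
proof -
  have "(\<lambda>n. LINT x:E|lborel. f n x) \<longlonglongrightarrow> (LINT x|(lborel::R3 measure). (0::real))"
    unfolding set_lebesgue_integral_def
  proof (rule integral_dominated_convergence[where w="\<lambda>x. B * indicat_real E x"])
    show "(\<lambda>x. indicat_real E x *\<^sub>R f n x) \<in> borel_measurable lborel" for n
      using m[of n] unfolding set_borel_measurable_def by simp
    show "integrable lborel (\<lambda>x. B * indicat_real E x)"
      using b E_borel by (intro integrable_mult_right integrable_real_indicator emeasure_bounded_finite) auto
    show "AE x in lborel. norm (indicat_real E x *\<^sub>R f n x) \<le> B * indicat_real E x" for n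
      by (rule AE_I2) (use bd in \<open>auto simp: indicator_def\<close>)
    show "AE x in lborel. (\<lambda>n. indicat_real E x *\<^sub>R f n x) \<longlonglongrightarrow> 0"
    proof (rule AE_I2)
      fix x
      show "(\<lambda>n. indicat_real E x *\<^sub>R f n x) \<longlonglongrightarrow> 0"
      proof (cases "x \<in> E")
        case True
        from lim[OF this] have "\<forall>\<^sub>F n in sequentially. indicat_real E x *\<^sub>R f n x = 0"
          by eventually_elim simp
        then show ?thesis by (rule tendsto_eventually)
      qed simp
    qed
  qed simp
  then show ?thesis by simp
qed

lemma layer_limit:
  assumes b: "bounded E"
    and F: "\<And>x. has_jac F (J x) x" and J: "continuous_on UNIV J"
    and \<rho>: "\<And>x. has_grad \<rho> (g\<rho> x) x" and g\<rho>: "continuous_on UNIV g\<rho>" and \<rho>pos: "\<And>x. x \<in> E \<Longrightarrow> \<rho> x > 0"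
    and G: "\<And>t. (G has_real_derivative - \<gamma> t) (at t)" and \<gamma>: "continuous_on UNIV \<gamma>"
    and z: "\<And>t. t \<ge> D \<Longrightarrow> G t = 0"
  shows "(\<lambda>n. LINT x:E|lborel. \<gamma> (real n * (\<Phi> x * \<rho> x)) * (real n * ((\<rho> x *\<^sub>R g x + \<Phi> x *\<^sub>R g\<rho> x) \<bullet> F x)))
    \<longlonglongrightarrow> - G 0 * (LINT x:E|lborel. trace (J x))"
proof -
  define s where "s n x = real n * (\<Phi> x * \<rho> x)" for n x
  define gs where "gs n x = real n *\<^sub>R (\<rho> x *\<^sub>R g x + \<Phi> x *\<^sub>R g\<rho> x)" for n x
  have gs: "has_grad (s n) (gs n x) x" for n x
    unfolding s_def gs_def
    using has_grad_mult[OF has_grad_const[of "real n"] has_grad_mult[OF grad_\<Phi> \<rho>]] by simp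
  have c\<rho>: "continuous_on UNIV \<rho>" using \<rho> has_grad_continuous continuous_at_imp_continuous_on by blast
  have cF: "continuous_on UNIV F" using F has_jac_continuous continuous_at_imp_continuous_on by blast
  have cG: "continuous_on UNIV G" using G DERIV_isCont continuous_at_imp_continuous_on by blast
  have cs: "continuous_on UNIV (s n)" for n unfolding s_def by (intro continuous_intros cont_\<Phi> c\<rho>)
  have cgs: "continuous_on UNIV (gs n)" for n
    unfolding gs_def by (intro continuous_intros cont_\<Phi> c\<rho> cont_g g\<rho>)
  have cGs: "continuous_on UNIV (\<lambda>x. G (s n x))" "continuous_on UNIV (\<lambda>x. \<gamma> (s n x))" for n
    by (rule continuous_on_compose2[OF cG cs] continuous_on_compose2[OF \<gamma> cs]; simp)+
  define K where "K n x = (G (s n x) - G 0) *\<^sub>R J x + outer (F x) ((- \<gamma> (s n x)) *\<^sub>R gs n x)" for n x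
  have K: "has_jac (\<lambda>x. (G (s n x) - G 0) *\<^sub>R F x) (K n x) x" for n x
    unfolding K_def
    by (rule has_jac_scaleR[OF _ F])
      (use has_grad_diff[OF has_grad_chain[OF G gs] has_grad_const[of "G 0"]] in simp)
  have cK: "continuous_on UNIV (K n)" for n
    unfolding K_def by (intro continuous_intros cGs cF cgs J)
  obtain R where R: "E \<subseteq> cball 0 R" "R \<ge> 0"
  proof -
    obtain a where "E \<subseteq> ball 0 a" using bounded_subset_ballD[OF b, of 0] by blast
    then show ?thesis using that[of "max a 0"] by (force simp: subset_iff)
  qed
  have zero: "(LINT x:E|lborel. trace (K n x)) = 0" for n
  proof -
    have ct: "continuous_on UNIV (\<lambda>x. trace (K n x))" by (intro continuous_intros cK)
    obtain B where B: "\<forall>x\<in>closure E. \<bar>trace (K n x)\<bar> \<le> B"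
      using set_integrable_E(2)[OF b ct] by (auto simp: bounded_iff)
    show ?thesis
    proof (rule integral_div_zero[OF K])
      show "continuous_on E (K n)" using cK continuous_on_subset by blast
      show "continuous_on {x. 0 \<le> \<Phi> x} (\<lambda>x. (G (s n x) - G 0) *\<^sub>R F x)"
        by (rule continuous_on_subset[of UNIV]) (intro continuous_intros cGs cF, simp)
      show "(G (s n x) - G 0) *\<^sub>R F x = 0" if "0 < \<Phi> x" "R < norm x" for x using R that by force
      show "\<bar>trace (K n x)\<bar> \<le> B" if "0 < \<Phi> x" for x using B closure_subset[of E] that by blast
      show "(G (s n x) - G 0) *\<^sub>R F x \<bullet> g x = 0" if "\<Phi> x = 0" for x using that by (simp add: s_def)
    qed (rule R)
  qed
  have tr: "trace (K n x) = (G (s n x) * trace (J x) - G 0 * trace (J x)) - \<gamma> (s n x) * (gs n x \<bullet> F x)" for n x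
    unfolding K_def trace_add trace_scaleR trace_outer by (simp add: inner_commute algebra_simps)
  have ctJ: "continuous_on UNIV (\<lambda>x. trace (J x))" by (intro continuous_intros J)
  have i1: "set_integrable lborel E (\<lambda>x. G (s n x) * trace (J x))" for n
    by (intro set_integrable_E[OF b] continuous_intros cGs J)
  have i2: "set_integrable lborel E (\<lambda>x. G 0 * trace (J x))"
    by (intro set_integrable_E[OF b] continuous_intros J)
  have i3: "set_integrable lborel E (\<lambda>x. \<gamma> (s n x) * (gs n x \<bullet> F x))" for n
    by (intro set_integrable_E[OF b] continuous_intros cGs cgs cF)
  have eq: "(LINT x:E|lborel. \<gamma> (s n x) * (gs n x \<bullet> F x)) =
     (LINT x:E|lborel. G (s n x) * trace (J x)) - G 0 * (LINT x:E|lborel. trace (J x))" for n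
    using zero[of n] unfolding tr
    by (simp add: set_integral_diff(2)[OF set_integral_diff(1)[OF i1 i2] i3] set_integral_diff(2)[OF i1 i2])
  obtain B where B: "\<forall>x\<in>closure E. \<bar>trace (J x)\<bar> \<le> B"
    using set_integrable_E(2)[OF b ctJ] by (auto simp: bounded_iff)
  have "bounded (G ` {0..max D 0})"
    by (intro compact_imp_bounded compact_continuous_image continuous_on_subset[OF cG]) auto
  then obtain C where C: "\<forall>t\<in>{0..max D 0}. \<bar>G t\<bar> \<le> C" by (auto simp: bounded_iff)
  have C': "\<bar>G t\<bar> \<le> \<bar>C\<bar>" if "t \<ge> 0" for t

  proof (cases "t \<le> max D 0")
    case True
    then have "\<bar>G t\<bar> \<le> C" using C that by simp
    then show ?thesis by linarith
  next
    case False
    then show ?thesis using z[of t] by simp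
  qed
  have "(\<lambda>n. LINT x:E|lborel. G (s n x) * trace (J x)) \<longlonglongrightarrow> 0"
  proof (rule set_integral_E_limit_zero[OF b])
    show "set_borel_measurable borel E (\<lambda>x. G (s n x) * trace (J x))" for n
      using borel_measurable_integrable[OF i1[of n, unfolded set_integrable_def]]
      unfolding set_borel_measurable_def by simp
    show "\<bar>G (s n x) * trace (J x)\<bar> \<le> \<bar>C\<bar> * \<bar>B\<bar>" if "x \<in> E" for n x
      unfolding abs_mult
    proof (rule mult_mono)
      show "\<bar>G (s n x)\<bar> \<le> \<bar>C\<bar>" by (rule C') (use \<rho>pos[OF that] that in \<open>simp add: s_def\<close>)
      show "\<bar>trace (J x)\<bar> \<le> \<bar>B\<bar>" using B subsetD[OF closure_subset that] abs_ge_self[of B] by fastforce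
    qed auto
    show "\<forall>\<^sub>F n in sequentially. G (s n x) * trace (J x) = 0" if "x \<in> E" for x
    proof -
      have p: "\<Phi> x * \<rho> x > 0" using that \<rho>pos by simp
      obtain N where N: "real N > D / (\<Phi> x * \<rho> x)" using reals_Archimedean2 by blast
      have "G (s n x) = 0" if "n \<ge> N" for n
      proof (rule z)
        have "D / (\<Phi> x * \<rho> x) \<le> real n" using N that by linarith
        then show "D \<le> s n x" using p by (simp add: s_def pos_divide_le_eq)
      qed
      then show ?thesis unfolding eventually_sequentially by auto
    qed
  qed
  then have "(\<lambda>n. LINT x:E|lborel. \<gamma> (s n x) * (gs n x \<bullet> F x)) \<longlonglongrightarrow> 0 - G 0 * (LINT x:E|lborel. trace (J x))"
    unfolding eq by (intro tendsto_intros)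
  then show ?thesis by (simp add: s_def gs_def)
qed

end

section \<open>Surface area, umbilicity defect and the Minkowski formula\<close>

locale layered_domain = C2_function +
  fixes \<delta> :: real
  assumes \<delta>_pos: "\<delta> > 0" and layer_regular: "\<bar>\<Phi> x\<bar> \<le> \<delta> \<Longrightarrow> g x \<noteq> 0"
    and bounded_E: "bounded {x. \<Phi> x > 0}" and sym_A: "transpose (A x) = A x"
begin

text \<open>
  The function r agrees with |g| near the boundary and is positive everywhere, so nn is a globally
  continuously differentiable extension of the inner unit normal. By the divergence theorem, area is
  the integral of the weight over the boundary.
\<close>

definition r2 :: "R3 \<Rightarrow> real" where "r2 x = g x \<bullet> g x + (max 0 ((\<Phi> x)\<^sup>2 - \<delta>\<^sup>2))\<^sup>2"
definition r :: "R3 \<Rightarrow> real" where "r x = sqrt (r2 x)"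
definition gr :: "R3 \<Rightarrow> R3" where
  "gr x = (1 / r x) *\<^sub>R (A x *v g x + (2 * max 0 ((\<Phi> x)\<^sup>2 - \<delta>\<^sup>2) * \<Phi> x) *\<^sub>R g x)"
definition nn :: "R3 \<Rightarrow> R3" where "nn x = (1 / r x) *\<^sub>R g x"
definition Jn :: "R3 \<Rightarrow> real^3^3" where
  "Jn x = (1 / r x) *\<^sub>R A x + outer (g x) ((- 1 / (r x)\<^sup>2) *\<^sub>R gr x)"
definition area :: "(R3 \<Rightarrow> real) \<Rightarrow> (R3 \<Rightarrow> R3) \<Rightarrow> real" where
  "area \<zeta> g\<zeta> = - (LINT x:E|lborel. trace (\<zeta> x *\<^sub>R Jn x + outer (nn x) (g\<zeta> x)))"

lemma r2_pos: "r2 x > 0"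
proof (cases "\<bar>\<Phi> x\<bar> \<le> \<delta>")
  case True
  then have "g x \<bullet> g x > 0" using layer_regular by simp
  then show ?thesis by (simp add: r2_def add_pos_nonneg)
next
  case False
  then have "\<delta>\<^sup>2 < \<bar>\<Phi> x\<bar>\<^sup>2" using \<delta>_pos by (intro power_strict_mono) auto
  then have "(max 0 ((\<Phi> x)\<^sup>2 - \<delta>\<^sup>2))\<^sup>2 > 0" by simp
  then show ?thesis by (simp add: r2_def add_nonneg_pos)
qed

lemma r_pos: "r x > 0" using r2_pos by (simp add: r_def)

lemma r_nz: "r x \<noteq> 0" using r_pos[of x] by simp

lemma r_layer: assumes "\<bar>\<Phi> x\<bar> \<le> \<delta>" shows "r x = norm (g x)" "(r x)\<^sup>2 = g x \<bullet> g x"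
proof -
  have "(\<Phi> x)\<^sup>2 \<le> \<delta>\<^sup>2" using assms \<delta>_pos by (metis abs_ge_zero power2_abs power_mono)
  then have "r2 x = g x \<bullet> g x" by (simp add: r2_def)
  then show "r x = norm (g x)" "(r x)\<^sup>2 = g x \<bullet> g x" using r2_pos[of x] by (simp_all add: r_def norm_eq_sqrt_inner)
qed

lemma g_nn: "g x = r x *\<^sub>R nn x" using r_nz by (simp add: nn_def)

lemma grad_r: "has_grad r (gr x) x"
proof -
  have 1: "has_grad (\<lambda>x. g x \<bullet> g x) (transpose (A x) *v g x + transpose (A x) *v g x) x"
    by (rule has_grad_inner[OF jac_g jac_g])
  have "has_grad (\<lambda>x. (\<Phi> x)\<^sup>2) ((2 * \<Phi> x) *\<^sub>R g x) x"
    by (rule has_grad_chain[OF _ grad_\<Phi>]) (auto intro!: derivative_eq_intros)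
  from has_grad_diff[OF this has_grad_const[of "\<delta>\<^sup>2"]]
  have "has_grad (\<lambda>x. (\<Phi> x)\<^sup>2 - \<delta>\<^sup>2) ((2 * \<Phi> x) *\<^sub>R g x) x" by simp
  from has_grad_chain[OF has_real_derivative_max_power2 this]
  have 2: "has_grad (\<lambda>x. (max 0 ((\<Phi> x)\<^sup>2 - \<delta>\<^sup>2))\<^sup>2) ((2 * max 0 ((\<Phi> x)\<^sup>2 - \<delta>\<^sup>2)) *\<^sub>R (2 * \<Phi> x) *\<^sub>R g x) x" .
  have "has_grad r2 (2 *\<^sub>R (A x *v g x + (2 * max 0 ((\<Phi> x)\<^sup>2 - \<delta>\<^sup>2) * \<Phi> x) *\<^sub>R g x)) x"
    using has_grad_add[OF 1 2] unfolding r2_def[abs_def]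
    by (simp add: sym_A scaleR_add_right scaleR_2 algebra_simps flip: scaleR_add_left)
  from has_grad_chain[OF DERIV_real_sqrt this] r2_pos[of x]
  show ?thesis unfolding r_def[abs_def] gr_def by (simp add: r_def field_simps)
qed

lemma cont_r: "continuous_on S r"
  using grad_r has_grad_continuous continuous_at_imp_continuous_on by blast

lemma cont_gr: "continuous_on S gr"
  unfolding gr_def[abs_def] by (intro continuous_intros cont_r cont_A' cont_g cont_\<Phi>) (simp add: r_nz)

lemma jac_nn: "has_jac nn (Jn x) x"
proof -
  have "has_grad (\<lambda>x. 1 / r x) ((- 1 / (r x)\<^sup>2) *\<^sub>R gr x) x"
    by (rule has_grad_chain[OF _ grad_r]) (use r_nz[of x] in \<open>auto intro!: derivative_eq_intros simp: power2_eq_square\<close>)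
  from has_jac_scaleR[OF this jac_g] show ?thesis by (simp add: nn_def[abs_def] Jn_def)
qed

lemma cont_nn: "continuous_on S nn"
  using jac_nn has_jac_continuous continuous_at_imp_continuous_on by blast

lemma cont_Jn: "continuous_on S Jn"
  unfolding Jn_def[abs_def] by (intro continuous_intros cont_r cont_A' cont_g cont_gr) (simp_all add: r_nz)

lemma r_lower: obtains r0 where "r0 > 0" "\<And>x. x \<in> E \<Longrightarrow> r0 \<le> r x"
proof (cases "E = {}")
  case True then show ?thesis using that[of 1] by auto
next
  case False
  obtain y where "y \<in> closure E" "\<And>x. x \<in> closure E \<Longrightarrow> r y \<le> r x"
    using continuous_attains_inf[of "closure E" r] False bounded_E cont_r by (auto simp: compact_closure)
  then show ?thesis using that[of "r y"] r_pos closure_subset[of E] by blast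
qed

lemma layer_area:
  assumes \<zeta>: "\<And>x. has_grad \<zeta> (g\<zeta> x) x" and g\<zeta>: "continuous_on UNIV g\<zeta>"
    and G: "\<And>t. (G has_real_derivative - \<gamma> t) (at t)" and \<gamma>: "continuous_on UNIV \<gamma>"
    and z: "\<And>t. t \<ge> D \<Longrightarrow> G t = 0" "\<And>t. t \<ge> D \<Longrightarrow> \<gamma> t = 0"
  shows "(\<lambda>n. LINT x:E|lborel. \<zeta> x * \<gamma> (real n * (\<Phi> x * r x)) * (real n * (g x \<bullet> g x)))
    \<longlonglongrightarrow> G 0 * area \<zeta> g\<zeta>"
proof -
  let ?s = "\<lambda>n x. real n * (\<Phi> x * r x)"
  have c\<zeta>: "continuous_on UNIV \<zeta>" using \<zeta> has_grad_continuous continuous_at_imp_continuous_on by blast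
  have c\<gamma>: "continuous_on UNIV (\<lambda>x. \<gamma> (?s n x))" for n
    by (rule continuous_on_compose2[OF \<gamma>]) (auto intro!: continuous_intros cont_\<Phi> cont_r)
  have F: "has_jac (\<lambda>x. \<zeta> x *\<^sub>R nn x) (\<zeta> x *\<^sub>R Jn x + outer (nn x) (g\<zeta> x)) x" for x
    by (rule has_jac_scaleR[OF \<zeta> jac_nn])
  have l1: "(\<lambda>n. LINT x:E|lborel. \<gamma> (?s n x) * (real n * ((r x *\<^sub>R g x + \<Phi> x *\<^sub>R gr x) \<bullet> (\<zeta> x *\<^sub>R nn x))))
    \<longlonglongrightarrow> - G 0 * (LINT x:E|lborel. trace (\<zeta> x *\<^sub>R Jn x + outer (nn x) (g\<zeta> x)))"
    by (rule layer_limit[OF bounded_E F _ grad_r cont_gr r_pos G \<gamma> z(1)])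
      (intro continuous_intros c\<zeta> cont_Jn cont_nn g\<zeta>)
  let ?h = "\<lambda>n x. \<gamma> (?s n x) * (real n * \<Phi> x) * (\<zeta> x * (gr x \<bullet> nn x))"
  have eq: "\<zeta> x * \<gamma> (?s n x) * (real n * (g x \<bullet> g x)) =
      \<gamma> (?s n x) * (real n * ((r x *\<^sub>R g x + \<Phi> x *\<^sub>R gr x) \<bullet> (\<zeta> x *\<^sub>R nn x))) - ?h n x" for n x
  proof -
    have "r x * (g x \<bullet> nn x) = g x \<bullet> g x" using r_nz[of x] by (simp add: nn_def)
    then show ?thesis by (simp add: inner_add_left algebra_simps)
  qed
  obtain r0 where r0: "r0 > 0" "\<And>x. x \<in> E \<Longrightarrow> r0 \<le> r x" using r_lower by metis
  have "bounded (\<gamma> ` {0..max D 0})"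
    by (intro compact_imp_bounded compact_continuous_image continuous_on_subset[OF \<gamma>]) auto
  then obtain C where C: "\<forall>t\<in>{0..max D 0}. \<bar>\<gamma> t\<bar> \<le> C" by (auto simp: bounded_iff)
  obtain B where B: "\<forall>x\<in>closure E. \<bar>\<zeta> x * (gr x \<bullet> nn x)\<bar> \<le> B"
  proof -
    have "continuous_on UNIV (\<lambda>x. \<zeta> x * (gr x \<bullet> nn x))"
      by (intro continuous_intros c\<zeta> cont_gr cont_nn)
    from set_integrable_E(2)[OF bounded_E this] that show ?thesis by (auto simp: bounded_iff)
  qed
  have ih: "set_integrable lborel E (?h n)" for n
    by (intro set_integrable_E[OF bounded_E] continuous_intros c\<gamma> cont_\<Phi> c\<zeta> cont_gr cont_nn)
  have l2: "(\<lambda>n. LINT x:E|lborel. ?h n x) \<longlonglongrightarrow> 0"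
  proof (rule set_integral_E_limit_zero[OF bounded_E])
    show "set_borel_measurable borel E (?h n)" for n
      using borel_measurable_integrable[OF ih[of n, unfolded set_integrable_def]]
      unfolding set_borel_measurable_def by simp
    show "\<bar>?h n x\<bar> \<le> \<bar>C\<bar> * (\<bar>D\<bar> / r0) * \<bar>B\<bar>" if x: "x \<in> E" for n x
    proof (cases "?s n x \<ge> D")
      case True then show ?thesis using z(2)[OF True] r0(1) by simp
    next
      case False
      have s0: "?s n x \<ge> 0" using x r_pos[of x] by simp
      have 1: "\<bar>\<gamma> (?s n x)\<bar> \<le> \<bar>C\<bar>" using C False s0 by force
      have "real n * \<Phi> x * r0 \<le> real n * \<Phi> x * r x" using r0(2)[OF x] x by (intro mult_left_mono) auto
      also have "\<dots> \<le> \<bar>D\<bar>" using False by (simp add: mult.assoc)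
      finally have 2: "\<bar>real n * \<Phi> x\<bar> \<le> \<bar>D\<bar> / r0" using r0(1) x by (simp add: field_simps)
      have 3: "\<bar>\<zeta> x * (gr x \<bullet> nn x)\<bar> \<le> \<bar>B\<bar>"
        using B subsetD[OF closure_subset x] abs_ge_self[of B] by fastforce
      show ?thesis unfolding abs_mult[of "_ * _" "\<zeta> x * _"] abs_mult[of "\<gamma> _"]
        by (intro mult_mono 1 2 3) (use r0(1) in auto)
    qed
    show "\<forall>\<^sub>F n in sequentially. ?h n x = 0" if "x \<in> E" for x
    proof -
      have p: "\<Phi> x * r x > 0" using that r_pos by simp
      obtain N where N: "real N > D / (\<Phi> x * r x)" using reals_Archimedean2 by blast
      have "?h n x = 0" if "n \<ge> N" for n
      proof -
        have "D / (\<Phi> x * r x) \<le> real n" using N that by linarith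
        then have "D \<le> ?s n x" using p by (simp add: pos_divide_le_eq)
        then show ?thesis using z(2) by simp
      qed
      then show ?thesis unfolding eventually_sequentially by auto
    qed
  qed
  have i1: "set_integrable lborel E (\<lambda>x. \<gamma> (?s n x) * (real n * ((r x *\<^sub>R g x + \<Phi> x *\<^sub>R gr x) \<bullet> (\<zeta> x *\<^sub>R nn x))))" for n
    by (intro set_integrable_E[OF bounded_E] continuous_intros c\<gamma> cont_\<Phi> c\<zeta> cont_gr cont_nn cont_r cont_g)
  have "(\<lambda>n. LINT x:E|lborel. \<zeta> x * \<gamma> (?s n x) * (real n * (g x \<bullet> g x)))
    \<longlonglongrightarrow> - G 0 * (LINT x:E|lborel. trace (\<zeta> x *\<^sub>R Jn x + outer (nn x) (g\<zeta> x))) - 0"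
    unfolding eq set_integral_diff(2)[OF i1 ih] by (rule tendsto_diff[OF l1 l2])
  then show ?thesis by (simp add: area_def)
qed

lemma div_nonpos:
  assumes F: "\<And>x. has_jac F (J x) x" and J: "continuous_on UNIV J"
    and sgn: "\<And>x. \<Phi> x = 0 \<Longrightarrow> F x \<bullet> g x \<ge> 0"
  shows "(LINT x:E|lborel. trace (J x)) \<le> 0"
proof -
  obtain R where R: "E \<subseteq> cball 0 R" "R \<ge> 0"
  proof -
    obtain a where "E \<subseteq> ball 0 a" using bounded_subset_ballD[OF bounded_E, of 0] by blast
    then show ?thesis using that[of "max a 0"] by (force simp: subset_iff)
  qed
  have ct: "continuous_on UNIV (\<lambda>x. trace (J x))" by (intro continuous_intros J)
  have cF: "continuous_on UNIV F" using F has_jac_continuous continuous_at_imp_continuous_on by blast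
  obtain B where B: "\<forall>x\<in>closure E. \<bar>trace (J x)\<bar> \<le> B"
    using set_integrable_E(2)[OF bounded_E ct] by (auto simp: bounded_iff)
  show ?thesis
  proof (rule integral_div_nonpos[OF F])
    show "continuous_on E J" using J continuous_on_subset by blast
    show "continuous_on {x. 0 \<le> \<Phi> x} F" using cF continuous_on_subset by blast
    show "F x = 0" if "0 < \<Phi> x" "R < norm x" for x using R that by force
    show "\<bar>trace (J x)\<bar> \<le> B" if "0 < \<Phi> x" for x using B closure_subset[of E] that by blast
  qed (use R sgn in auto)
qed

lemma div_zero:
  assumes F: "\<And>x. has_jac F (J x) x" and J: "continuous_on UNIV J"
    and sgn: "\<And>x. \<Phi> x = 0 \<Longrightarrow> F x \<bullet> g x = 0"
  shows "(LINT x:E|lborel. trace (J x)) = 0"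
proof (rule antisym)
  show "(LINT x:E|lborel. trace (J x)) \<le> 0" using div_nonpos[OF F J] sgn by simp
  have "(LINT x:E|lborel. trace (- J x)) \<le> 0"
    by (rule div_nonpos[OF has_jac_minus[OF F]]) (use sgn in \<open>auto intro!: continuous_intros J\<close>)
  then show "0 \<le> (LINT x:E|lborel. trace (J x))"
    unfolding set_lebesgue_integral_def trace_minus by (simp only: scaleR_minus_right integral_minus)
qed

end

definition tr_perp :: "real^3^3 \<Rightarrow> R3 \<Rightarrow> real" where
  "tr_perp A n = trace A - n \<bullet> (A *v n)"

text \<open>For symmetric A and unit n this is a quarter of the squared difference of the eigenvalues on the plane orthogonal to n.\<close>

definition umb :: "real^3^3 \<Rightarrow> R3 \<Rightarrow> real" where
  "umb A n = (trace (A ** A) - 2 * ((A *v n) \<bullet> (A *v n)) + (n \<bullet> (A *v n))\<^sup>2) / 2 - (tr_perp A n)\<^sup>2 / 4"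

lemma inner_conj:
  fixes Q A :: "real^3^3"
  shows "w \<bullet> ((transpose Q ** A ** Q) *v u) = (Q *v w) \<bullet> (A *v (Q *v u))"
  unfolding matrix_vector_mul_assoc[symmetric]
  using inner_transpose[of Q "A *v (Q *v u)" w] inner_commute[of w] inner_commute[of "A *v (Q *v u)"] by metis

lemma conj_invariants:
  fixes Q A :: "real^3^3"
  assumes Q: "orthogonal_matrix Q"
  shows "trace (transpose Q ** A ** Q) = trace A"
    and "tr_perp (transpose Q ** A ** Q) e = tr_perp A (Q *v e)"
    and "umb (transpose Q ** A ** Q) e = umb A (Q *v e)"
    and "det (transpose Q ** A ** Q) = det A"
proof -
  have QQ: "Q ** transpose Q = mat 1" "transpose Q ** Q = mat 1" using Q by (auto simp: orthogonal_matrix_def)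
  have tr: "trace (transpose Q ** B ** Q) = trace B" for B
  proof -
    have "trace (transpose Q ** B ** Q) = trace (Q ** (transpose Q ** B))" by (rule trace_mul_sym)
    also have "Q ** (transpose Q ** B) = B" by (simp add: matrix_mul_assoc QQ)
    finally show ?thesis .
  qed
  show "trace (transpose Q ** A ** Q) = trace A" by (rule tr)
  show tp: "tr_perp (transpose Q ** A ** Q) e = tr_perp A (Q *v e)"
    by (simp add: tr_perp_def tr inner_conj)
  have "(transpose Q ** A ** Q) ** (transpose Q ** A ** Q) = transpose Q ** A ** (Q ** transpose Q) ** A ** Q"
    by (simp add: matrix_mul_assoc)
  also have "\<dots> = transpose Q ** (A ** A) ** Q" by (simp add: QQ matrix_mul_assoc)
  finally have sq: "trace ((transpose Q ** A ** Q) ** (transpose Q ** A ** Q)) = trace (A ** A)" by (simp add: tr)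
  have iso: "(transpose Q *v u) \<bullet> (transpose Q *v u) = u \<bullet> u" for u
    by (metis QQ(1) inner_transpose matrix_vector_mul_assoc matrix_vector_mul_lid)
  have nv: "((transpose Q ** A ** Q) *v e) \<bullet> ((transpose Q ** A ** Q) *v e) = (A *v (Q *v e)) \<bullet> (A *v (Q *v e))"
    by (metis iso matrix_vector_mul_assoc)
  show "umb (transpose Q ** A ** Q) e = umb A (Q *v e)"
    unfolding umb_def tp sq nv by (simp only: inner_conj)
  have "det Q * det Q = 1" by (metis QQ(2) det_I det_mul det_transpose)
  then show "det (transpose Q ** A ** Q) = det A" by (simp add: det_mul)
qed

lemma symmetric_entries:
  assumes "transpose A = A" shows "(A::real^3^3) $ i $ j = A $ j $ i"
  using arg_cong[OF assms, of "\<lambda>M. M $ j $ i"] by (simp add: transpose_def)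

lemma tr_perp_axis: "tr_perp A (axis 3 1) = A$1$1 + A$2$2"
  by (simp add: tr_perp_def trace_def sum_3 inner_vec_def matrix_vector_mult_def axis_def)

lemma umb_axis:
  assumes "transpose A = A"
  shows "umb A (axis 3 1) = ((A$1$1 - A$2$2) / 2)\<^sup>2 + (A$1$2)\<^sup>2"
  using symmetric_entries[OF assms, of 2 1] symmetric_entries[OF assms, of 3 1] symmetric_entries[OF assms, of 3 2]
  unfolding umb_def tr_perp_axis
  by (simp add: trace_def sum_3 inner_vec_def matrix_vector_mult_def matrix_matrix_mult_def axis_def)
    (simp add: power2_eq_square field_simps)

lemma transpose_conj: "transpose A = A \<Longrightarrow> transpose (transpose Q ** A ** Q) = transpose Q ** (A::real^3^3) ** Q"
  by (simp add: matrix_transpose_mul matrix_mul_assoc)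

lemma tangential_minor_axis:
  fixes A :: "real^3^3"
  assumes A: "transpose A = A"
  shows "(1 + t * tr_perp A (axis 3 1) / 2)\<^sup>2 - t\<^sup>2 * umb A (axis 3 1) =
    (1 + t * A$1$1) * (1 + t * A$2$2) - (t * A$1$2) * (t * A$1$2)"
  unfolding umb_axis[OF A] tr_perp_axis by (simp add: power2_eq_square field_simps)

lemma det_rank_one_update_axis:
  fixes A :: "real^3^3"
  assumes A: "transpose A = A"
  shows "det (mat 1 + t *\<^sub>R A + c *\<^sub>R outer (axis 3 1) (axis 3 1)) =
    det (mat 1 + t *\<^sub>R A) + c * ((1 + t * tr_perp A (axis 3 1) / 2)\<^sup>2 - t\<^sup>2 * umb A (axis 3 1))"
proof -
  have s: "A$2$1 = A$1$2" "A$3$1 = A$1$3" "A$3$2 = A$2$3" using symmetric_entries[OF A] by auto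
  show ?thesis
    unfolding tangential_minor_axis[OF A] by (simp add: det_3 mat_def outer_def axis_def s algebra_simps)
qed

lemma rank_one_hessian_nonneg_axis:
  fixes A :: "real^3^3"
  assumes A: "transpose A = A" and psd: "\<And>w. w \<bullet> ((mat 1 + t *\<^sub>R A + c *\<^sub>R outer (axis 3 1) (axis 3 1)) *v w) \<ge> 0"
  shows "1 + t * tr_perp A (axis 3 1) / 2 \<ge> 0"
    and "(1 + t * tr_perp A (axis 3 1) / 2)\<^sup>2 - t\<^sup>2 * umb A (axis 3 1) \<ge> 0"
proof -
  have s: "A$2$1 = A$1$2" "A$3$1 = A$1$3" "A$3$2 = A$2$3" using symmetric_entries[OF A] by auto
  define a b d where "a = 1 + t * A$1$1" and "b = t * A$1$2" and "d = 1 + t * A$2$2"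
  have q: "a * x * x + 2 * b * x * y + d * y * y \<ge> 0" for x y
    using psd[of "vector [x, y, 0]"]
    by (simp add: a_def b_def d_def s inner_vec_def sum_3 matrix_vector_mult_def mat_def outer_def axis_def algebra_simps)
  have a: "a \<ge> 0" using q[of 1 0] by simp
  have d: "d \<ge> 0" using q[of 0 1] by simp
  show "1 + t * tr_perp A (axis 3 1) / 2 \<ge> 0"
  proof -
    have "1 + t * tr_perp A (axis 3 1) / 2 = (a + d) / 2"
      unfolding tr_perp_axis a_def d_def by (simp add: field_simps)
    then show ?thesis using a d by simp
  qed
  have "a * d - b * b \<ge> 0"
  proof (cases "a = 0")
    case True
    have "b = 0"
    proof (rule ccontr)
      assume b: "b \<noteq> 0"
      from q[of "- (d + 1) / (2 * b)" 1] True b show False by (simp add: field_simps)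
    qed
    then show ?thesis using True by simp
  next
    case False
    then have "a * (a * d - b * b) \<ge> 0" using q[of "-b" a] by (simp add: algebra_simps)
    then show ?thesis using a False by (simp add: zero_le_mult_iff)
  qed
  then show "(1 + t * tr_perp A (axis 3 1) / 2)\<^sup>2 - t\<^sup>2 * umb A (axis 3 1) \<ge> 0"
    unfolding tangential_minor_axis[OF A] a_def b_def d_def .
qed

lemma matrix_add_rdistrib: "((B::real^3^3) + C) ** A = B ** A + C ** (A::real^3^3)"
  by (simp add: matrix_matrix_mult_def vec_eq_iff sum.distrib algebra_simps)

lemma matrix_mult_scaleR:
  fixes A B :: "real^3^3"
  shows "A ** (c *\<^sub>R B) = c *\<^sub>R (A ** B)" "(c *\<^sub>R A) ** B = c *\<^sub>R (A ** B)"
  by (simp_all add: matrix_matrix_mult_def vec_eq_iff sum_distrib_left mult_ac)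

lemma conj_shift:
  assumes "orthogonal_matrix Q"
  shows "transpose Q ** (mat 1 + t *\<^sub>R A) ** Q = mat 1 + t *\<^sub>R (transpose Q ** A ** (Q::real^3^3))"
  using assms unfolding orthogonal_matrix_def
  by (simp add: matrix_add_ldistrib matrix_add_rdistrib matrix_mult_scaleR)

lemma conj_rank_one:
  fixes Q :: "real^3^3"
  assumes Q: "orthogonal_matrix Q" "Q *v axis 3 1 = n"
  shows "transpose Q ** (mat 1 + t *\<^sub>R A + c *\<^sub>R outer n n) ** Q =
    mat 1 + t *\<^sub>R (transpose Q ** A ** Q) + c *\<^sub>R outer (axis 3 1) (axis 3 1)"
proof -
  have QQ: "transpose Q ** Q = mat 1" using Q by (auto simp: orthogonal_matrix_def)
  have tn: "transpose Q *v n = axis 3 1" by (metis Q(2) QQ matrix_vector_mul_assoc matrix_vector_mul_lid)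
  have O: "transpose Q ** outer n n ** Q = outer (axis 3 1) (axis 3 1)"
  proof (rule matrix_eq[THEN iffD2], rule allI)
    fix w :: R3
    have "n \<bullet> (Q *v w) = axis 3 1 \<bullet> w" by (metis inner_transpose tn transpose_transpose)
    then show "(transpose Q ** outer n n ** Q) *v w = outer (axis 3 1) (axis 3 1) *v w"
      by (simp add: matrix_vector_mul_assoc[symmetric] outer_mult_vec tn matrix_vector_mult_scaleR del: transpose_matrix_vector)
  qed
  show ?thesis using conj_shift[OF Q(1), of t A] O
    by (simp add: matrix_add_ldistrib matrix_add_rdistrib matrix_mult_scaleR)
qed

lemma rank_one_hessian_nonneg:
  fixes A :: "real^3^3"
  assumes A: "transpose A = A" and n: "norm n = 1"
    and psd: "\<And>w. w \<bullet> ((mat 1 + t *\<^sub>R A + c *\<^sub>R outer n n) *v w) \<ge> 0"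
  shows "1 + t * tr_perp A n / 2 \<ge> 0" "(1 + t * tr_perp A n / 2)\<^sup>2 - t\<^sup>2 * umb A n \<ge> 0"
proof -
  obtain Q :: "real^3^3" where Q: "orthogonal_matrix Q" "Q *v axis 3 1 = n"
    using orthogonal_matrix_exists_basis[OF n] by metis
  have psd': "w \<bullet> ((mat 1 + t *\<^sub>R (transpose Q ** A ** Q) + c *\<^sub>R outer (axis 3 1) (axis 3 1)) *v w) \<ge> 0" for w
    unfolding conj_rank_one[OF Q, symmetric] inner_conj by (rule psd)
  show "1 + t * tr_perp A n / 2 \<ge> 0" "(1 + t * tr_perp A n / 2)\<^sup>2 - t\<^sup>2 * umb A n \<ge> 0"
    using rank_one_hessian_nonneg_axis[OF transpose_conj[OF A] psd']
    unfolding conj_invariants(2,3)[OF Q(1)] Q(2) by blast+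
qed

lemma det_rank_one_update:
  fixes A :: "real^3^3"
  assumes A: "transpose A = A" and n: "norm n = 1"
  shows "det (mat 1 + t *\<^sub>R A + c *\<^sub>R outer n n) =
    det (mat 1 + t *\<^sub>R A) + c * ((1 + t * tr_perp A n / 2)\<^sup>2 - t\<^sup>2 * umb A n)"
proof -
  obtain Q :: "real^3^3" where Q: "orthogonal_matrix Q" "Q *v axis 3 1 = n"
    using orthogonal_matrix_exists_basis[OF n] by metis
  have "det (mat 1 + t *\<^sub>R A + c *\<^sub>R outer n n) =
      det (mat 1 + t *\<^sub>R (transpose Q ** A ** Q) + c *\<^sub>R outer (axis 3 1) (axis 3 1))"
    by (simp only: conj_rank_one[OF Q, symmetric] conj_invariants(4)[OF Q(1)])
  also have "\<dots> = det (mat 1 + t *\<^sub>R (transpose Q ** A ** Q)) + c * ((1 + t * tr_perp A n / 2)\<^sup>2 - t\<^sup>2 * umb A n)"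
    unfolding det_rank_one_update_axis[OF transpose_conj[OF A, of Q]] conj_invariants(2,3)[OF Q(1)] Q(2) ..
  also have "det (mat 1 + t *\<^sub>R (transpose Q ** A ** Q)) = det (mat 1 + t *\<^sub>R A)"
    by (simp only: conj_shift[OF Q(1), symmetric] conj_invariants(4)[OF Q(1)])
  finally show ?thesis .
qed

lemma umbilic:
  fixes A :: "real^3^3"
  assumes A: "transpose A = A" and n: "norm n = 1" and u: "umb A n \<le> 0" and e: "n \<bullet> e = 0"
  shows "A *v e = (tr_perp A n / 2) *\<^sub>R e + (n \<bullet> (A *v e)) *\<^sub>R n"
proof -
  obtain Q :: "real^3^3" where Q: "orthogonal_matrix Q" "Q *v axis 3 1 = n"
    using orthogonal_matrix_exists_basis[OF n] by metis
  have QQ: "transpose Q ** Q = mat 1" "Q ** transpose Q = mat 1" using Q by (auto simp: orthogonal_matrix_def)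
  let ?A = "transpose Q ** A ** Q"
  define f where "f = transpose Q *v e"
  have ef: "e = Q *v f" by (simp add: f_def matrix_vector_mul_assoc QQ del: transpose_matrix_vector)
  have tn: "transpose Q *v n = axis 3 1" by (metis Q(2) QQ(1) matrix_vector_mul_assoc matrix_vector_mul_lid)
  have s: "?A$2$1 = ?A$1$2" "?A$3$1 = ?A$1$3" "?A$3$2 = ?A$2$3"
    using symmetric_entries[OF transpose_conj[OF A]] by auto
  have "((?A$1$1 - ?A$2$2) / 2)\<^sup>2 + (?A$1$2)\<^sup>2 \<le> 0"
    using u unfolding Q(2)[symmetric] conj_invariants(3)[OF Q(1), symmetric] umb_axis[OF transpose_conj[OF A]] .
  then have z: "?A$1$1 = ?A$2$2" "?A$1$2 = 0" by (simp_all add: sum_power2_le_zero_iff)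
  have f3: "f$3 = 0" using e unfolding f_def by (metis Q(2) f_def ef inner_axis' inner_transpose tn transpose_transpose inner_real_def mult_1 cart_eq_inner_axis inner_commute)
  have tp: "tr_perp A n = ?A$1$1 + ?A$2$2"
    using conj_invariants(2)[OF Q(1), of A "axis 3 1"] by (simp add: Q(2) tr_perp_axis)
  have "n \<bullet> (A *v e) = axis 3 1 \<bullet> (?A *v f)" by (simp add: inner_conj Q(2) ef)
  then have ne: "n \<bullet> (A *v e) = (?A *v f) $ 3" by (simp add: inner_axis')
  have "?A *v f = (tr_perp A n / 2) *\<^sub>R f + (n \<bullet> (A *v e)) *\<^sub>R axis 3 1"
    unfolding ne tp using z s f3
    by (simp add: vec_eq_iff forall_3 matrix_vector_mult_def sum_3 axis_def)
  then have "Q *v (?A *v f) = Q *v ((tr_perp A n / 2) *\<^sub>R f + (n \<bullet> (A *v e)) *\<^sub>R axis 3 1)" by simp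
  moreover have "Q *v (?A *v f) = A *v e"
    by (simp add: matrix_vector_mul_assoc matrix_mul_assoc QQ ef)
  ultimately show ?thesis by (simp add: matrix_vector_right_distrib matrix_vector_mult_scaleR Q(2) ef[symmetric])
qed

lemma det_bounded:
  fixes M :: "real^3^3"
  assumes "\<And>i j. \<bar>M$i$j\<bar> \<le> B"
  shows "\<bar>det M\<bar> \<le> 6 * B^3"
proof -
  have p: "\<bar>M$i$j * M$k$l * M$p$q\<bar> \<le> B^3" for i j k l p q
    unfolding abs_mult power3_eq_cube by (intro mult_mono assms) (auto intro: order_trans[OF abs_ge_zero assms])
  show ?thesis unfolding det_3
    using p[of 1 1 2 2 3 3] p[of 1 2 2 3 3 1] p[of 1 3 2 1 3 2] p[of 1 1 2 3 3 2] p[of 1 2 2 1 3 3] p[of 1 3 2 2 3 1]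
    by linarith
qed

context layered_domain
begin

abbreviation hh :: "R3 \<Rightarrow> real" where "hh x \<equiv> tr_perp (A x) (nn x)"

lemma A_inner: "(A x *v u) \<bullet> w = u \<bullet> (A x *v w)"
  using inner_transpose[of "A x" u w] by (simp only: sym_A)

lemma gr_layer: "\<bar>\<Phi> x\<bar> \<le> \<delta> \<Longrightarrow> gr x = (1 / r x) *\<^sub>R (A x *v g x)"
proof -
  assume "\<bar>\<Phi> x\<bar> \<le> \<delta>"
  then have "(\<Phi> x)\<^sup>2 \<le> \<delta>\<^sup>2" using \<delta>_pos by (metis abs_ge_zero power2_abs power_mono)
  then show ?thesis by (simp add: gr_def)
qed

lemma cont_hh: "continuous_on S hh"
  unfolding tr_perp_def by (intro continuous_intros cont_A' cont_nn)

lemma tangential_field_jac: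
  "has_jac (\<lambda>x. r x *\<^sub>R x - (x \<bullet> nn x) *\<^sub>R g x)
    (r x *\<^sub>R mat 1 + outer x (gr x) - ((x \<bullet> nn x) *\<^sub>R A x + outer (g x) (nn x + transpose (Jn x) *v x))) x"
proof -
  have "has_grad (\<lambda>x. x \<bullet> nn x) (nn x + transpose (Jn x) *v x) x"
    using has_grad_inner[OF has_jac_id jac_nn] by (simp add: transpose_mat)
  from has_jac_diff[OF has_jac_scaleR[OF grad_r has_jac_id] has_jac_scaleR[OF this jac_g]]
  show ?thesis .
qed

lemma tangential_field_div:
  assumes "\<bar>\<Phi> x\<bar> \<le> \<delta>"
  shows "trace (r x *\<^sub>R mat 1 + outer x (gr x) - ((x \<bullet> nn x) *\<^sub>R A x + outer (g x) (nn x + transpose (Jn x) *v x)))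
    = 2 * r x - (x \<bullet> nn x) * hh x"
proof -
  have rr: "g x \<bullet> g x = r x * r x" using r_layer(2)[OF assms] by (simp add: power2_eq_square)
  have t1: "trace (mat 1 :: real^3^3) = 3" by (simp add: trace_I)
  have "g x \<bullet> (transpose (Jn x) *v x) = (Jn x *v g x) \<bullet> x"
    by (metis inner_commute inner_transpose)
  also have "Jn x *v g x = (1 / r x) *\<^sub>R (A x *v g x) - ((gr x \<bullet> g x) / (r x)\<^sup>2) *\<^sub>R g x"
    by (simp add: Jn_def matrix_vector_mult_add_rdistrib scaleR_matrix_vector outer_mult_vec)
  finally have "g x \<bullet> (transpose (Jn x) *v x) = (A x *v g x) \<bullet> x / r x - ((A x *v g x) \<bullet> g x) * (g x \<bullet> x) / (r x * r x * r x)"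
    by (simp add: inner_diff_left gr_layer[OF assms] power2_eq_square)
  moreover have "x \<bullet> gr x = (A x *v g x) \<bullet> x / r x" by (simp add: gr_layer[OF assms] inner_commute)
  moreover have "g x \<bullet> nn x = r x" using rr r_nz by (simp add: nn_def)
  moreover have "nn x \<bullet> (A x *v nn x) = ((A x *v g x) \<bullet> g x) / (r x * r x)"
    by (simp add: nn_def matrix_vector_mult_scaleR inner_commute)
  moreover have "x \<bullet> nn x = (g x \<bullet> x) / r x" by (simp add: nn_def inner_commute)
  ultimately show ?thesis
    using r_nz[of x]
    by (simp add: trace_sub trace_add trace_scaleR trace_outer t1 tr_perp_def inner_add_right)
      (simp add: field_simps)
qed

lemma eventually_layer: "\<forall>\<^sub>F n in sequentially. \<forall>x. \<Phi> x > 0 \<longrightarrow> real n * \<Phi> x < 1 \<longrightarrow> \<Phi> x \<le> d" if "d > 0"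
proof -
  obtain N where N: "real N > 1 / d" using reals_Archimedean2 by blast
  have "\<Phi> x \<le> d" if "n \<ge> N" "\<Phi> x > 0" "real n * \<Phi> x < 1" for n x
  proof (rule ccontr)
    assume "\<not> \<Phi> x \<le> d"
    moreover have "1 / d \<le> real n" using N that(1) by linarith
    ultimately have "(1 / d) * d \<le> real n * \<Phi> x" using \<open>d > 0\<close> by (intro mult_mono) auto
    then show False using that \<open>d > 0\<close> by simp
  qed
  then show ?thesis unfolding eventually_sequentially by blast
qed

lemma minkowski_layer:
  "\<forall>\<^sub>F n in sequentially. (LINT x:E|lborel. (1 - step (real n * \<Phi> x)) * (2 * r x - (x \<bullet> nn x) * hh x)) = 0"
  using eventually_layer[OF \<delta>_pos]
proof eventually_elim
  case (elim n)
  let ?Y = "\<lambda>x. r x *\<^sub>R x - (x \<bullet> nn x) *\<^sub>R g x"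
  let ?JY = "\<lambda>x. r x *\<^sub>R mat 1 + outer x (gr x) - ((x \<bullet> nn x) *\<^sub>R A x + outer (g x) (nn x + transpose (Jn x) *v x))"
  have cY: "continuous_on UNIV ?Y" by (intro continuous_intros cont_r cont_nn cont_g)
  have cJY: "continuous_on UNIV ?JY"
    by (intro continuous_intros cont_r cont_nn cont_g cont_gr cont_A cont_Jn)
  have tang: "?Y x \<bullet> g x = 0" if "\<bar>\<Phi> x\<bar> \<le> \<delta>" for x
  proof -
    have rr: "g x \<bullet> g x = r x * r x" using r_layer(2)[OF that] by (simp add: power2_eq_square)
    have "?Y x \<bullet> g x = r x * (x \<bullet> g x) - (x \<bullet> g x) / r x * (g x \<bullet> g x)"
      by (simp only: inner_diff_left inner_scaleR_left nn_def inner_scaleR_right) simp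
    then show ?thesis unfolding rr using r_nz[of x] by simp
  qed
  have gs: "has_grad (\<lambda>x. 1 - step (real n * \<Phi> x)) (- ((step' (real n * \<Phi> x) * n) *\<^sub>R g x)) x" for x
    using has_grad_diff[OF has_grad_const has_grad_chain[OF has_real_derivative_step has_grad_mult[OF has_grad_const[of "real n"] grad_\<Phi>]]]
    by simp
  have "(LINT x:E|lborel. trace ((1 - step (real n * \<Phi> x)) *\<^sub>R ?JY x + outer (?Y x) (- ((step' (real n * \<Phi> x) * n) *\<^sub>R g x)))) = 0"
  proof (rule div_zero[OF has_jac_scaleR[OF gs tangential_field_jac]])
    show "continuous_on UNIV (\<lambda>x. (1 - step (real n * \<Phi> x)) *\<^sub>R ?JY x + outer (?Y x) (- ((step' (real n * \<Phi> x) * n) *\<^sub>R g x)))"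
      by (intro continuous_intros cJY cY cont_\<Phi> cont_g)
    show "(1 - step (real n * \<Phi> x)) *\<^sub>R ?Y x \<bullet> g x = 0" if "\<Phi> x = 0" for x
      using tang[of x] that \<delta>_pos by simp
  qed
  moreover have "trace ((1 - step (real n * \<Phi> x)) *\<^sub>R ?JY x + outer (?Y x) (- ((step' (real n * \<Phi> x) * n) *\<^sub>R g x)))
      = (1 - step (real n * \<Phi> x)) * (2 * r x - (x \<bullet> nn x) * hh x)" if "x \<in> E" for x
  proof (cases "real n * \<Phi> x < 1")
    case True
    then have l: "\<bar>\<Phi> x\<bar> \<le> \<delta>" using elim that by auto
    show ?thesis unfolding trace_add trace_scaleR trace_outer tangential_field_div[OF l]
      by (simp only: inner_minus_right inner_scaleR_right tang[OF l])
  next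
    case False
    then have "step (real n * \<Phi> x) = 1" "step' (real n * \<Phi> x) = 0" using step_simps by simp_all
    then show ?thesis by (simp add: trace_add trace_outer)
  qed
  ultimately show ?case
    by (subst set_lebesgue_integral_cong[OF _ , of E lborel _ "\<lambda>x. trace ((1 - step (real n * \<Phi> x)) *\<^sub>R ?JY x + outer (?Y x) (- ((step' (real n * \<Phi> x) * n) *\<^sub>R g x)))"])
      (use E_borel in simp_all)
qed

lemma minkowski:
  assumes H: "\<And>x. \<Phi> x = 0 \<Longrightarrow> hh x = - H * norm (g x)"
  shows "2 * area (\<lambda>x. 1) (\<lambda>x. 0) = 3 * H * measure lborel E"
proof -
  let ?\<gamma> = "\<lambda>t. 1 - step t"
  have c\<gamma>: "continuous_on UNIV ?\<gamma>" by (intro continuous_intros)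
  obtain G where G: "\<And>t. (G has_real_derivative - ?\<gamma> t) (at t)" "\<And>t. t \<ge> 1 \<Longrightarrow> G t = 0"
    using decreasing_primitive[OF c\<gamma>, of 1] step_simps(2) by (metis cancel_comm_monoid_add_class.diff_cancel)
  have G0: "G 0 > 0"
    by (rule primitive_pos[OF G, where s="1/2"]) (simp_all add: step_simps)
  have J1: "has_jac (\<lambda>x. 2 *\<^sub>R nn x + H *\<^sub>R x) (2 *\<^sub>R Jn x + H *\<^sub>R mat 1) x" for x
    by (intro has_jac_add has_jac_cmul jac_nn has_jac_id)
  note lim = layer_limit[OF bounded_E _ _ has_grad_const[of 1] _ _ G(1) c\<gamma> G(2), simplified]
  have L1: "(\<lambda>n. LINT x:E|lborel. ?\<gamma> (real n * \<Phi> x) * (real n * (g x \<bullet> (2 *\<^sub>R nn x + H *\<^sub>R x))))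
     \<longlonglongrightarrow> - (G 0 * (LINT x:E|lborel. trace (2 *\<^sub>R Jn x + H *\<^sub>R mat 1)))"
    by (rule lim[OF J1]) (intro continuous_intros cont_Jn)
  have L2: "(\<lambda>n. LINT x:E|lborel. ?\<gamma> (real n * \<Phi> x) * (real n * (g x \<bullet> nn x)))
     \<longlonglongrightarrow> - (G 0 * (LINT x:E|lborel. trace (Jn x)))"
    by (rule lim[OF jac_nn]) (intro continuous_intros cont_Jn)
  let ?a = "\<lambda>n. LINT x:E|lborel. ?\<gamma> (real n * \<Phi> x) * (real n * (g x \<bullet> (2 *\<^sub>R nn x + H *\<^sub>R x)))"
  let ?b = "\<lambda>n. LINT x:E|lborel. ?\<gamma> (real n * \<Phi> x) * (real n * (g x \<bullet> nn x))"
  define La where "La = - (G 0 * (LINT x:E|lborel. trace (2 *\<^sub>R Jn x + H *\<^sub>R mat 1)))"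
  define Lb where "Lb = - (G 0 * (LINT x:E|lborel. trace (Jn x)))"
  have cg: "continuous_on UNIV (\<lambda>x. ?\<gamma> (real n * \<Phi> x))" for n
    by (intro continuous_intros cont_\<Phi>)
  have bound: "\<bar>La\<bar> \<le> \<eta> * Lb" if \<eta>: "\<eta> > 0" for \<eta>
  proof -
    have "compact (closure E)" using bounded_E by (simp add: compact_closure)
    then obtain d c where d: "d > 0" "c > 0"
      "\<And>x. x \<in> closure E \<Longrightarrow> \<bar>\<Phi> x\<bar> \<le> d \<Longrightarrow> \<eta> * r x - \<bar>(x \<bullet> nn x) * (hh x + H * r x)\<bar> \<ge> c"
    proof (rule positive_near_zero_set[of "closure E" \<Phi> "\<lambda>x. \<eta> * r x - \<bar>(x \<bullet> nn x) * (hh x + H * r x)\<bar>"])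
      show "continuous_on (closure E) (\<lambda>x. \<eta> * r x - \<bar>(x \<bullet> nn x) * (hh x + H * r x)\<bar>)"
        by (intro continuous_intros cont_r cont_hh cont_nn)
      show "0 < \<eta> * r x - \<bar>(x \<bullet> nn x) * (hh x + H * r x)\<bar>" if "x \<in> closure E" "\<Phi> x = 0" for x
        using H[OF that(2)] r_layer(1)[of x] that \<delta>_pos \<eta> r_pos[of x] by simp
    qed (auto intro: cont_\<Phi>)
    have "\<forall>\<^sub>F n in sequentially. \<bar>?a n\<bar> \<le> \<eta> * ?b n"
      using eventually_layer[OF \<delta>_pos] eventually_layer[OF d(1)] minkowski_layer
    proof eventually_elim
      case (elim n)
      have i0: "set_integrable lborel E (\<lambda>x. real n * (?\<gamma> (real n * \<Phi> x) * (2 * r x - (x \<bullet> nn x) * hh x)))"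
        by (intro set_integrable_E[OF bounded_E] continuous_intros cont_\<Phi> cont_r cont_nn cont_hh)
      have ia: "set_integrable lborel E (\<lambda>x. ?\<gamma> (real n * \<Phi> x) * (real n * (g x \<bullet> (2 *\<^sub>R nn x + H *\<^sub>R x))))"
        by (intro set_integrable_E[OF bounded_E] continuous_intros cont_\<Phi> cont_g cont_nn)
      have ib: "set_integrable lborel E (\<lambda>x. ?\<gamma> (real n * \<Phi> x) * (real n * (g x \<bullet> nn x)))"
        by (intro set_integrable_E[OF bounded_E] continuous_intros cont_\<Phi> cont_g cont_nn)
      have z: "(LINT x:E|lborel. real n * (?\<gamma> (real n * \<Phi> x) * (2 * r x - (x \<bullet> nn x) * hh x))) = 0"
        using elim(3) by simp
      have "?a n = ?a n - (LINT x:E|lborel. real n * (?\<gamma> (real n * \<Phi> x) * (2 * r x - (x \<bullet> nn x) * hh x)))" by (simp only: z diff_zero)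
      also have "\<dots> = (LINT x:E|lborel. ?\<gamma> (real n * \<Phi> x) * (real n * (g x \<bullet> (2 *\<^sub>R nn x + H *\<^sub>R x)))
          - real n * (?\<gamma> (real n * \<Phi> x) * (2 * r x - (x \<bullet> nn x) * hh x)))"
        by (rule set_integral_diff(2)[OF ia i0, symmetric])
      finally have eq: "?a n = \<dots>" .
      have id: "set_integrable lborel E (\<lambda>x. ?\<gamma> (real n * \<Phi> x) * (real n * (g x \<bullet> (2 *\<^sub>R nn x + H *\<^sub>R x)))
          - real n * (?\<gamma> (real n * \<Phi> x) * (2 * r x - (x \<bullet> nn x) * hh x)))"
        by (rule set_integral_diff(1)[OF ia i0])
      have pt: "\<bar>?\<gamma> (real n * \<Phi> x) * (real n * (g x \<bullet> (2 *\<^sub>R nn x + H *\<^sub>R x)))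
          - real n * (?\<gamma> (real n * \<Phi> x) * (2 * r x - (x \<bullet> nn x) * hh x))\<bar> \<le> \<eta> * (?\<gamma> (real n * \<Phi> x) * (real n * (g x \<bullet> nn x)))"
        if x: "x \<in> E" for x
      proof (cases "real n * \<Phi> x < 1")
        case True
        then have l: "\<bar>\<Phi> x\<bar> \<le> \<delta>" "\<bar>\<Phi> x\<bar> \<le> d" using elim x by auto
        have gn: "g x \<bullet> nn x = r x" using r_layer(2)[OF l(1)] r_nz[of x] by (simp add: nn_def power2_eq_square field_simps)
        have gx: "g x \<bullet> x = r x * (x \<bullet> nn x)" using r_nz[of x] by (simp add: nn_def inner_commute)
        have "?\<gamma> (real n * \<Phi> x) * (real n * (g x \<bullet> (2 *\<^sub>R nn x + H *\<^sub>R x)))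
          - real n * (?\<gamma> (real n * \<Phi> x) * (2 * r x - (x \<bullet> nn x) * hh x)) =
          (?\<gamma> (real n * \<Phi> x) * real n) * ((x \<bullet> nn x) * (hh x + H * r x))"
          by (simp add: inner_add_right gn gx algebra_simps)
        moreover have "\<bar>(?\<gamma> (real n * \<Phi> x) * real n) * ((x \<bullet> nn x) * (hh x + H * r x))\<bar>
            \<le> (?\<gamma> (real n * \<Phi> x) * real n) * (\<eta> * r x)"
        proof -
          have 1: "0 \<le> ?\<gamma> (real n * \<Phi> x) * real n" using step_simps(7)[of "real n * \<Phi> x"] by simp
          have "\<bar>(x \<bullet> nn x) * (hh x + H * r x)\<bar> \<le> \<eta> * r x"
            using d(3)[OF subsetD[OF closure_subset x] l(2)] d(2) by linarith
          from mult_left_mono[OF this 1] show ?thesis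
            unfolding abs_mult[of "?\<gamma> (real n * \<Phi> x) * real n"] abs_of_nonneg[OF 1] .
        qed
        ultimately show ?thesis by (simp only: gn mult_ac)
      next
        case False
        then have "step (real n * \<Phi> x) = 1" using step_simps by simp
        then show ?thesis by simp
      qed
      have u: "?a n \<le> (LINT x:E|lborel. \<eta> * (?\<gamma> (real n * \<Phi> x) * (real n * (g x \<bullet> nn x))))"
        unfolding eq by (rule set_integral_mono[OF id set_integrable_mult_right[OF ib]]) (use pt in \<open>auto simp: abs_le_iff\<close>)
      have l: "(LINT x:E|lborel. - \<eta> * (?\<gamma> (real n * \<Phi> x) * (real n * (g x \<bullet> nn x)))) \<le> ?a n"
        unfolding eq by (rule set_integral_mono[OF set_integrable_mult_right[OF ib] id]) (use pt in \<open>force simp: abs_le_iff\<close>)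
      show ?case using u l unfolding set_integral_mult_right by linarith
    qed
    then show ?thesis unfolding La_def Lb_def
      by (rule tendsto_le[OF sequentially_bot tendsto_mult[OF tendsto_const L2] tendsto_rabs[OF L1]])
  qed
  have "La = 0"
  proof (rule ccontr)
    assume n: "La \<noteq> 0"
    then have "\<bar>La\<bar> > 0" by simp
    have "Lb > 0" using bound[of 1] n by simp
    from bound[of "\<bar>La\<bar> / (2 * Lb)"] this n show False by simp
  qed
  then have z: "(LINT x:E|lborel. trace (2 *\<^sub>R Jn x + H *\<^sub>R mat 1)) = 0" using G0 by (simp add: La_def)
  have i1: "set_integrable lborel E (\<lambda>x. 2 * trace (Jn x))"
    by (intro set_integrable_E[OF bounded_E] continuous_intros cont_Jn)
  have i2: "set_integrable lborel E (\<lambda>x. H * 3)"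
    by (intro set_integrable_E[OF bounded_E] continuous_intros)
  have m: "(LINT x:E|lborel. H * 3) = 3 * H * measure lborel E" by (simp add: set_lebesgue_integral_def)
  have "(LINT x:E|lborel. trace (2 *\<^sub>R Jn x + H *\<^sub>R mat 1)) = 2 * (LINT x:E|lborel. trace (Jn x)) + 3 * H * measure lborel E"
    using set_integral_add(2)[OF i1 i2] m by (simp add: trace_add trace_scaleR trace_I)
  moreover have "area (\<lambda>x. 1) (\<lambda>x. 0) = - (LINT x:E|lborel. trace (Jn x))"
    by (simp add: area_def trace_add trace_outer)
  ultimately show ?thesis using z by simp
qed

end

section \<open>The Heintze--Karcher inequality\<close>

lemma umb_nonneg:
  fixes A :: "real^3^3"
  assumes A: "transpose A = A" and n: "norm n = 1"
  shows "umb A n \<ge> 0"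
proof -
  obtain Q :: "real^3^3" where Q: "orthogonal_matrix Q" "Q *v axis 3 1 = n"
    using orthogonal_matrix_exists_basis[OF n] by metis
  have "umb A n = umb (transpose Q ** A ** Q) (axis 3 1)" by (simp only: conj_invariants(3)[OF Q(1)] Q(2))
  then show ?thesis by (simp only: umb_axis[OF transpose_conj[OF A]]) simp
qed

lemma second_order_min:
  assumes S: "open S" "y \<in> S" and q: "\<And>z. z \<in> S \<Longrightarrow> has_grad f (q z) z" and J: "has_jac q J y"
    and min: "\<And>z. z \<in> S \<Longrightarrow> f y \<le> f z"
  shows "q y = 0" "w \<bullet> (J *v w) \<ge> 0"
proof -
  have line: "((\<lambda>t. f (y + t *\<^sub>R w)) has_real_derivative q (y + t *\<^sub>R w) \<bullet> w) (at t)"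
    if "y + t *\<^sub>R w \<in> S" for t w
  proof -
    have "((\<lambda>t. y + t *\<^sub>R w) has_derivative (\<lambda>h. h *\<^sub>R w)) (at t)" by (auto intro!: derivative_eq_intros)
    from has_derivative_compose[OF this q[OF that, unfolded has_grad_def]]
    show ?thesis by (simp add: has_field_derivative_def mult.commute[of _ "_ \<bullet> w"])
  qed
  obtain e where e: "e > 0" "ball y e \<subseteq> S" using S openE by blast
  have inS: "y + t *\<^sub>R w \<in> S" if "\<bar>t\<bar> * norm w < e" for t w
    by (rule subsetD[OF e(2)]) (use that in \<open>simp add: dist_norm\<close>)
  show q0: "q y = 0"
  proof -
    let ?w = "q y"
    have "q (y + 0 *\<^sub>R ?w) \<bullet> ?w = 0"
    proof (rule DERIV_local_min[OF line])
      show "y + 0 *\<^sub>R ?w \<in> S" using S by simp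
      show "e / (norm ?w + 1) > 0" using e by (simp add: add_nonneg_pos)
      show "\<forall>t. \<bar>0 - t\<bar> < e / (norm ?w + 1) \<longrightarrow> f (y + 0 *\<^sub>R ?w) \<le> f (y + t *\<^sub>R ?w)"
      proof (intro allI impI)
        fix t :: real assume t: "\<bar>0 - t\<bar> < e / (norm ?w + 1)"
        have p: "norm ?w + 1 > 0" by (simp add: add_nonneg_pos)
        have "\<bar>t\<bar> * norm ?w \<le> \<bar>t\<bar> * (norm ?w + 1)" by (simp add: mult_left_mono)
        also have "\<dots> < e" using t p by (simp add: pos_less_divide_eq)
        finally show "f (y + 0 *\<^sub>R ?w) \<le> f (y + t *\<^sub>R ?w)" using min[OF inS] by simp
      qed
    qed
    then show ?thesis by simp
  qed
  show "w \<bullet> (J *v w) \<ge> 0"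
  proof (rule ccontr)
    assume neg: "\<not> w \<bullet> (J *v w) \<ge> 0"
    have "((\<lambda>t. y + t *\<^sub>R w) has_derivative (\<lambda>h. h *\<^sub>R w)) (at 0)" by (auto intro!: derivative_eq_intros)
    moreover have "(q has_derivative (*v) J) (at (y + 0 *\<^sub>R w))" using J by (simp add: has_jac_def)
    ultimately have "((\<lambda>t. q (y + t *\<^sub>R w)) has_derivative (\<lambda>h. J *v (h *\<^sub>R w))) (at 0)"
      by (rule has_derivative_compose)
    then have "((\<lambda>t. q (y + t *\<^sub>R w) \<bullet> w) has_derivative (\<lambda>h. (J *v (h *\<^sub>R w)) \<bullet> w)) (at 0)"
      by (rule has_derivative_inner_left)
    then have "((\<lambda>t. q (y + t *\<^sub>R w) \<bullet> w) has_real_derivative (w \<bullet> (J *v w))) (at 0)"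
      by (simp add: has_field_derivative_def matrix_vector_mult_scaleR inner_commute mult.commute[of _ "w \<bullet> _"])
    from DERIV_neg_dec_right[OF this] neg q0
    have "\<exists>d>0. \<forall>h>0. h < d \<longrightarrow> q (y + h *\<^sub>R w) \<bullet> w < 0" by simp
    then obtain d where d: "d > 0" "\<And>h. h > 0 \<Longrightarrow> h < d \<Longrightarrow> q (y + h *\<^sub>R w) \<bullet> w < 0"
      by blast
    define h where "h = min (d / 2) (e / (2 * (norm w + 1)))"
    have np: "norm w + 1 > 0" by (simp add: add_nonneg_pos)
    have h: "h > 0" "h < d" using d e np by (auto simp: h_def)
    have hw: "h * norm w < e"
    proof -
      have "h * norm w \<le> h * (norm w + 1)" using h by (simp add: mult_left_mono)
      also have "\<dots> \<le> e / (2 * (norm w + 1)) * (norm w + 1)" using np by (intro mult_right_mono) (auto simp: h_def)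
      also have "\<dots> < e" using np e by (simp add: field_simps add_pos_nonneg)
      finally show ?thesis .
    qed
    have "\<exists>z>0. z < h \<and> f (y + h *\<^sub>R w) - f (y + 0 *\<^sub>R w) = (h - 0) * (q (y + z *\<^sub>R w) \<bullet> w)"
    proof (rule MVT2[OF h(1) line])
      fix t assume "0 \<le> t" "t \<le> h"
      then have "\<bar>t\<bar> * norm w \<le> h * norm w" by (simp add: mult_right_mono)
      then show "y + t *\<^sub>R w \<in> S" using hw by (intro inS) linarith
    qed
    then obtain z where z: "z > 0" "z < h" "f (y + h *\<^sub>R w) - f y = h * (q (y + z *\<^sub>R w) \<bullet> w)" by auto
    have "q (y + z *\<^sub>R w) \<bullet> w < 0" using d(2) z h by simp
    then have "f (y + h *\<^sub>R w) < f y" using z(3) mult_pos_neg[OF h(1)] by (smt (verit))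
    moreover have "f y \<le> f (y + h *\<^sub>R w)" by (rule min[OF inS]) (use h hw in simp)
    ultimately show False by simp
  qed
qed

context layered_domain
begin

lemma covering:
  assumes x: "x \<in> E" and k: "k > 0" and z0: "\<Phi> z0 = 0" and D: "norm (x - z0) \<le> D"
  obtains y where "y \<in> E" "y + (k * \<Phi> y) *\<^sub>R g y = x" "k * \<Phi> y * norm (g y) \<le> D" "k * (\<Phi> y)\<^sup>2 \<le> D\<^sup>2"
    "\<And>w. w \<bullet> ((mat 1 + (k * \<Phi> y) *\<^sub>R A y + k *\<^sub>R outer (g y) (g y)) *v w) \<ge> 0"
proof -
  define Q where "Q y = (y - x) \<bullet> (y - x) / 2 + k * (\<Phi> y)\<^sup>2 / 2" for y
  define q where "q y = (y - x) + (k * \<Phi> y) *\<^sub>R g y" for y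
  have gQ: "has_grad Q (q y) y" for y
  proof -
    have j: "has_jac (\<lambda>y. y - x) (mat 1) y" using has_jac_diff[OF has_jac_id has_jac_const, of x] by simp
    have "has_grad (\<lambda>y. (\<Phi> y)\<^sup>2) ((2 * \<Phi> y) *\<^sub>R g y) y"
      by (rule has_grad_chain[OF _ grad_\<Phi>]) (auto intro!: derivative_eq_intros)
    from has_grad_add[OF has_grad_mult[OF has_grad_const[of "1/2"] has_grad_inner[OF j j]] has_grad_mult[OF has_grad_const[of "k/2"] this]]
    show ?thesis by (simp add: Q_def[abs_def] q_def flip: scaleR_add_left scaleR_2)
  qed
  have Jq: "has_jac q (mat 1 + ((k * \<Phi> y) *\<^sub>R A y + outer (g y) (k *\<^sub>R g y))) y" for y
  proof -
    have j: "has_jac (\<lambda>y. y - x) (mat 1) y" using has_jac_diff[OF has_jac_id has_jac_const, of x] by simp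
    have "has_grad (\<lambda>y. k * \<Phi> y) (k *\<^sub>R g y) y" using has_grad_mult[OF has_grad_const grad_\<Phi>] by simp
    from has_jac_add[OF j has_jac_scaleR[OF this jac_g]] show ?thesis by (simp add: q_def[abs_def])
  qed
  have cQ: "continuous_on S Q" for S using gQ has_grad_continuous continuous_at_imp_continuous_on by blast
  have D0: "D \<ge> 0" using D norm_ge_zero order_trans by blast
  obtain y where y: "y \<in> cball x (D + 1)" "\<And>z. z \<in> cball x (D + 1) \<Longrightarrow> Q y \<le> Q z"
    using continuous_attains_inf[of "cball x (D + 1)" Q] cQ D0 by auto
  have z0c: "z0 \<in> cball x (D + 1)" using D by (simp add: dist_norm)
  have Qz0: "Q z0 \<le> D\<^sup>2 / 2"
  proof -
    have "(norm (z0 - x))\<^sup>2 \<le> D\<^sup>2" using D by (intro power_mono) (auto simp: norm_minus_commute)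
    then show ?thesis by (simp add: Q_def z0 power2_norm_eq_inner)
  qed
  have Qy: "Q y \<le> D\<^sup>2 / 2" using y(2)[OF z0c] Qz0 by simp
  have min: "Q y \<le> Q z" for z
  proof (cases "z \<in> cball x (D + 1)")
    case True then show ?thesis by (rule y(2))
  next
    case False
    then have "D \<le> norm (z - x)" by (simp add: dist_norm norm_minus_commute)
    then have "D\<^sup>2 \<le> (norm (z - x))\<^sup>2" using D0 by (intro power_mono) auto
    then have "D\<^sup>2 / 2 \<le> Q z" using k by (simp add: Q_def power2_norm_eq_inner add_increasing2)
    then show ?thesis using Qy by simp
  qed
  have q0: "q y = 0" and psd: "w \<bullet> ((mat 1 + ((k * \<Phi> y) *\<^sub>R A y + outer (g y) (k *\<^sub>R g y))) *v w) \<ge> 0" for w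
    by (rule second_order_min[OF open_UNIV UNIV_I gQ Jq min])+
  have yx: "y + (k * \<Phi> y) *\<^sub>R g y = x" using q0 by (simp add: q_def algebra_simps)
  have yE: "y \<in> E"
  proof (rule ccontr)
    assume "y \<notin> E"
    then have neg: "\<Phi> y \<le> 0" by simp
    obtain t where t: "0 \<le> t" "t \<le> 1" "\<Phi> (x + t *\<^sub>R (y - x)) = 0"
    proof -
      have "\<exists>t\<ge>0. t \<le> 1 \<and> \<Phi> (x + t *\<^sub>R (y - x)) = 0"
        by (rule IVT2') (use neg x in \<open>auto intro!: continuous_intros continuous_on_compose2[OF cont_\<Phi>[of UNIV]]\<close>)
      then show ?thesis using that by blast
    qed
    let ?z = "x + t *\<^sub>R (y - x)"
    have "Q ?z = t\<^sup>2 * ((y - x) \<bullet> (y - x)) / 2" using t(3) by (simp add: Q_def power2_eq_square)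
    also have "\<dots> \<le> (y - x) \<bullet> (y - x) / 2" using t by (simp add: mult_left_le_one_le power_le_one)
    finally have "(y - x) \<bullet> (y - x) / 2 + k * (\<Phi> y)\<^sup>2 / 2 \<le> (y - x) \<bullet> (y - x) / 2"
      using min[of ?z] by (simp add: Q_def)
    then have "k * (\<Phi> y)\<^sup>2 \<le> 0" by simp
    then have "\<Phi> y = 0" using k by (simp add: mult_le_0_iff)
    then have "y = x" using yx by simp
    then show False using x \<open>y \<notin> E\<close> by simp
  qed
  have n2: "(norm (y - x))\<^sup>2 + k * (\<Phi> y)\<^sup>2 \<le> D\<^sup>2" using Qy by (simp add: Q_def power2_norm_eq_inner)
  have "(norm (y - x))\<^sup>2 \<le> D\<^sup>2" using n2 k by (smt (verit) mult_nonneg_nonneg zero_le_power2)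
  then have nD: "norm (y - x) \<le> D" by (rule power2_le_imp_le) (rule D0)
  show ?thesis
  proof (rule that[OF yE yx])
    have "x - y = (k * \<Phi> y) *\<^sub>R g y" using yx by (simp add: algebra_simps)
    then have "norm (x - y) = k * \<Phi> y * norm (g y)" using k yE by (simp add: abs_mult)
    then show "k * \<Phi> y * norm (g y) \<le> D" using nD by (simp add: norm_minus_commute)
    show "k * (\<Phi> y)\<^sup>2 \<le> D\<^sup>2" using n2 by (smt (verit) zero_le_power2)
    have eq: "outer (g y) (k *\<^sub>R g y) = k *\<^sub>R outer (g y) (g y)" by (simp add: outer_def vec_eq_iff)
    show "w \<bullet> ((mat 1 + (k * \<Phi> y) *\<^sub>R A y + k *\<^sub>R outer (g y) (g y)) *v w) \<ge> 0" for w
      using psd[of w] unfolding eq by (simp only: add.assoc)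
  qed
qed

definition contact :: "real \<Rightarrow> nat \<Rightarrow> R3 set" where
  "contact D n = {y\<in>E. n * \<Phi> y * norm (g y) \<le> D \<and> n * (\<Phi> y)\<^sup>2 \<le> D\<^sup>2 \<and>
     0 \<le> 1 + (n * \<Phi> y) * hh y / 2 \<and> 0 \<le> (1 + (n * \<Phi> y) * hh y / 2)\<^sup>2 - (n * \<Phi> y)\<^sup>2 * umb (A y) (nn y)}"

lemma cont_umb: "continuous_on S (\<lambda>y. umb (A y) (nn y))"
  unfolding umb_def by (intro continuous_intros cont_A' cont_nn cont_hh) auto

lemma contact_borel: "contact D n \<in> sets borel"
proof -
  have "contact D n = E \<inter> ({y. n * \<Phi> y * norm (g y) \<le> D} \<inter> {y. n * (\<Phi> y)\<^sup>2 \<le> D\<^sup>2} \<inter> {y. 0 \<le> 1 + (n * \<Phi> y) * hh y / 2} \<inter>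
     {y. 0 \<le> (1 + (n * \<Phi> y) * hh y / 2)\<^sup>2 - (n * \<Phi> y)\<^sup>2 * umb (A y) (nn y)})"
    by (auto simp: contact_def)
  moreover have "closed ({y. n * \<Phi> y * norm (g y) \<le> D} \<inter> {y. n * (\<Phi> y)\<^sup>2 \<le> D\<^sup>2} \<inter> {y. 0 \<le> 1 + (n * \<Phi> y) * hh y / 2} \<inter>
     {y. 0 \<le> (1 + (n * \<Phi> y) * hh y / 2)\<^sup>2 - (n * \<Phi> y)\<^sup>2 * umb (A y) (nn y)})"
    by (intro closed_Int closed_Collect_le continuous_intros cont_\<Phi> cont_g cont_hh cont_umb) auto
  ultimately show ?thesis using E_borel by (simp add: borel_closed sets.Int)
qed

lemma eventually_contact_layer:
  assumes "d > 0"
  shows "\<forall>\<^sub>F n in sequentially. \<forall>y\<in>E. real n * (\<Phi> y)\<^sup>2 \<le> D\<^sup>2 \<longrightarrow> \<Phi> y \<le> d"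
proof -
  obtain N where N: "real N > D\<^sup>2 / d\<^sup>2" using reals_Archimedean2 by blast
  have "\<Phi> y \<le> d" if "n \<ge> N" "y \<in> E" "real n * (\<Phi> y)\<^sup>2 \<le> D\<^sup>2" for n y
  proof (rule ccontr)
    assume "\<not> \<Phi> y \<le> d"
    then have dy: "d\<^sup>2 < (\<Phi> y)\<^sup>2" using assms by (intro power_strict_mono) auto
    have "D\<^sup>2 < real n * d\<^sup>2"
    proof -
      have "D\<^sup>2 / d\<^sup>2 < real n" using N that(1) by linarith
      then show ?thesis using assms by (simp add: pos_divide_less_eq)
    qed
    also have "\<dots> \<le> real n * (\<Phi> y)\<^sup>2" using dy by (intro mult_left_mono) auto
    finally show False using that(3) by simp
  qed
  then show ?thesis unfolding eventually_sequentially by blast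
qed

lemma contact_covers:
  assumes z0: "\<Phi> z0 = 0" and D: "\<And>x. x \<in> E \<Longrightarrow> norm (x - z0) \<le> D"
  shows "\<forall>\<^sub>F n in sequentially. E \<subseteq> (\<lambda>y. y + (real n * \<Phi> y) *\<^sub>R g y) ` contact D n \<and>
    (\<forall>y\<in>contact D n. \<Phi> y \<le> \<delta>)"
  using eventually_contact_layer[OF \<delta>_pos, of D] eventually_gt_at_top[of 0]
proof eventually_elim
  case (elim n)
  have "x \<in> (\<lambda>y. y + (real n * \<Phi> y) *\<^sub>R g y) ` contact D n" if x: "x \<in> E" for x
  proof -
    have kp: "real n > 0" using elim(2) by simp
    obtain y where y: "y \<in> E" "y + (real n * \<Phi> y) *\<^sub>R g y = x" "real n * \<Phi> y * norm (g y) \<le> D"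
      "real n * (\<Phi> y)\<^sup>2 \<le> D\<^sup>2"
      "\<And>w. w \<bullet> ((mat 1 + (real n * \<Phi> y) *\<^sub>R A y + real n *\<^sub>R outer (g y) (g y)) *v w) \<ge> 0"
      by (rule covering[OF x kp z0 D[OF x]], rule that)
    have l: "\<bar>\<Phi> y\<bar> \<le> \<delta>" using elim(1) y by auto
    have nn1: "norm (nn y) = 1" using r_layer(1)[OF l] r_pos[of y] by (simp add: nn_def)
    have o: "real n *\<^sub>R outer (g y) (g y) = (real n * (r y)\<^sup>2) *\<^sub>R outer (nn y) (nn y)"
      by (subst (1 2) g_nn) (simp add: outer_def vec_eq_iff power2_eq_square)
    note R = rank_one_hessian_nonneg[OF sym_A nn1 y(5)[unfolded o]]
    have "y \<in> contact D n" unfolding contact_def mem_Collect_eq using y(1,3,4) R(1,2) by blast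
    then show ?thesis using y(2) by blast
  qed
  then show ?case using elim(1) by (auto simp: contact_def)
qed

end

context layered_domain
begin

lemma det_contact:
  obtains C where "C \<ge> 0"
    "\<And>n y. y \<in> contact D n \<Longrightarrow> \<Phi> y \<le> \<delta> \<Longrightarrow>
      \<bar>det (mat 1 + ((real n * \<Phi> y) *\<^sub>R A y + outer (g y) (real n *\<^sub>R g y)))\<bar> \<le> C +
        real n * (g y \<bullet> g y) * ((1 + (n * \<Phi> y) * hh y / 2)\<^sup>2 - (n * \<Phi> y)\<^sup>2 * umb (A y) (nn y))"
proof -
  obtain r0 where r0: "r0 > 0" "\<And>x. x \<in> E \<Longrightarrow> r0 \<le> r x" using r_lower by metis
  have "bounded (A ` closure E)"
    by (intro compact_imp_bounded compact_continuous_image cont_A') (use bounded_E in \<open>simp add: compact_closure\<close>)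
  then obtain a where a: "\<forall>x\<in>closure E. norm (A x) \<le> a" by (auto simp: bounded_iff)
  have ent: "\<bar>A x $ i $ j\<bar> \<le> \<bar>a\<bar>" if "x \<in> E" for x i j
  proof -
    have "\<bar>A x $ i $ j\<bar> \<le> norm (A x $ i)" by (rule component_le_norm_cart)
    also have "\<dots> \<le> norm (A x)" by (rule Finite_Cartesian_Product.norm_nth_le)
    also have "\<dots> \<le> a" using a[rule_format, OF subsetD[OF closure_subset that]] by simp
    finally show ?thesis by linarith
  qed
  define B where "B = 1 + \<bar>D\<bar> / r0 * \<bar>a\<bar>"
  show ?thesis
  proof
    show "6 * B^3 \<ge> 0" using r0 by (simp add: B_def)
    fix n y assume y: "y \<in> contact D n" and l: "\<Phi> y \<le> \<delta>"
    have yE: "y \<in> E" using y by (simp add: contact_def)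
    have l': "\<bar>\<Phi> y\<bar> \<le> \<delta>" using l yE by simp
    have rg: "r y = norm (g y)" by (rule r_layer(1)[OF l'])
    have nn1: "norm (nn y) = 1" using rg r_pos[of y] by (simp add: nn_def)
    have o: "outer (g y) (real n *\<^sub>R g y) = (real n * (r y)\<^sup>2) *\<^sub>R outer (nn y) (nn y)"
      by (subst (1 2) g_nn) (simp add: outer_def vec_eq_iff power2_eq_square)
    let ?m = "(1 + (n * \<Phi> y) * hh y / 2)\<^sup>2 - (n * \<Phi> y)\<^sup>2 * umb (A y) (nn y)"
    have m0: "?m \<ge> 0" using y by (simp add: contact_def)
    have "real n * \<Phi> y * r0 \<le> real n * \<Phi> y * norm (g y)"
      using r0(2)[OF yE] yE rg by (intro mult_left_mono) auto
    also have "\<dots> \<le> \<bar>D\<bar>"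
      using y unfolding contact_def mem_Collect_eq by (meson abs_ge_self order_trans)
    finally have t: "\<bar>real n * \<Phi> y\<bar> \<le> \<bar>D\<bar> / r0" using r0(1) yE by (simp add: field_simps)
    have "\<bar>det (mat 1 + (real n * \<Phi> y) *\<^sub>R A y)\<bar> \<le> 6 * B^3"
    proof (rule det_bounded)
      fix i j
      have "\<bar>(real n * \<Phi> y) * A y $ i $ j\<bar> \<le> \<bar>D\<bar> / r0 * \<bar>a\<bar>"
        unfolding abs_mult[of "real n * \<Phi> y"] by (intro mult_mono t ent yE) (use r0 in auto)
      moreover have "\<bar>(mat 1 :: real^3^3) $ i $ j\<bar> \<le> 1" by (simp add: mat_def)
      ultimately show "\<bar>(mat 1 + (real n * \<Phi> y) *\<^sub>R A y) $ i $ j\<bar> \<le> B"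
        unfolding B_def by simp
    qed
    moreover have "det (mat 1 + ((real n * \<Phi> y) *\<^sub>R A y + outer (g y) (real n *\<^sub>R g y))) =
       det (mat 1 + (real n * \<Phi> y) *\<^sub>R A y) + real n * (r y)\<^sup>2 * ?m"
      using det_rank_one_update[OF sym_A nn1, where t="real n * \<Phi> y" and c="real n * (r y)\<^sup>2"]
      unfolding o by (simp add: add.assoc)
    moreover have "real n * (r y)\<^sup>2 * ?m \<ge> 0" using m0 by simp
    ultimately show "\<bar>det (mat 1 + ((real n * \<Phi> y) *\<^sub>R A y + outer (g y) (real n *\<^sub>R g y)))\<bar> \<le> 6 * B^3 +
        real n * (g y \<bullet> g y) * ?m"
      unfolding r_layer(2)[OF l', symmetric] by linarith
  qed
qed

lemma measure_le_contact:
  assumes cov: "E \<subseteq> (\<lambda>y. y + (real n * \<Phi> y) *\<^sub>R g y) ` contact D n"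
  shows "measure lborel E \<le> (LINT y:E|lborel. indicat_real (contact D n) y *
      \<bar>det (mat 1 + ((real n * \<Phi> y) *\<^sub>R A y + outer (g y) (real n *\<^sub>R g y)))\<bar>)"
    and "set_integrable lborel E (\<lambda>y. indicat_real (contact D n) y *
      \<bar>det (mat 1 + ((real n * \<Phi> y) *\<^sub>R A y + outer (g y) (real n *\<^sub>R g y)))\<bar>)"
proof -
  let ?S = "contact D n" and ?T = "\<lambda>y. y + (real n * \<Phi> y) *\<^sub>R g y"
  let ?J = "\<lambda>y. mat 1 + ((real n * \<Phi> y) *\<^sub>R A y + outer (g y) (real n *\<^sub>R g y))"
  have SE: "?S \<subseteq> E" by (auto simp: contact_def)
  have bS: "bounded ?S" using bounded_E SE bounded_subset by blast
  have cJ: "continuous_on UNIV ?J" by (intro continuous_intros cont_\<Phi> cont_g cont_A')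
  have cdet: "continuous_on UNIV (\<lambda>y. \<bar>det (?J y)\<bar>)"
  proof -
    have cc: "continuous_on UNIV (\<lambda>y. ?J y $ i $ j)" for i j
      using continuous_on_component[OF continuous_on_component[OF cJ]] .
    have "continuous_on UNIV (\<lambda>y. det (?J y))"
      unfolding det_3 by (intro continuous_on_add continuous_on_diff continuous_on_mult cc)
    then show ?thesis by (rule continuous_on_rabs)
  qed
  have iE: "set_integrable lborel E (\<lambda>y. \<bar>det (?J y)\<bar>)" by (rule set_integrable_E[OF bounded_E cdet])
  have iS: "set_integrable lborel ?S (\<lambda>y. \<bar>det (?J y)\<bar>)"
    by (rule set_integrable_subset[OF iE _ SE]) (use contact_borel in simp)
  have jT: "has_jac ?T (?J y) y" for y
  proof -
    have "has_grad (\<lambda>y. real n * \<Phi> y) (real n *\<^sub>R g y) y" using has_grad_mult[OF has_grad_const grad_\<Phi>] by simp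
    from has_jac_add[OF has_jac_id has_jac_scaleR[OF this jac_g]] show ?thesis by simp
  qed
  have lS: "?S \<in> lmeasurable"
    by (rule bounded_set_imp_lmeasurable[OF bS]) (use contact_borel in \<open>simp add: sets_completionI_sets\<close>)
  have dT: "(?T has_derivative (*v) (?J y)) (at y within ?S)" for y
    using jT[of y] unfolding has_jac_def by (rule has_derivative_at_withinI)
  have intS: "(\<lambda>y. \<bar>det (matrix ((*v) (?J y)))\<bar>) integrable_on ?S"
    using set_borel_integral_eq_integral(1)[OF iS] by (simp only: matrix_of_matrix_vector_mul)
  have im: "?T ` ?S \<in> lmeasurable \<and> measure lebesgue (?T ` ?S) \<le> integral ?S (\<lambda>y. \<bar>det (?J y)\<bar>)"
    using m_diff_image_weak[OF lS dT intS] by (simp only: matrix_of_matrix_vector_mul)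
  have "measure lborel E = measure lebesgue E" using E_borel by (simp add: measure_completion)
  also have "\<dots> \<le> measure lebesgue (?T ` ?S)"
    by (rule measure_mono_fmeasurable[OF cov]) (use im E_borel in \<open>simp_all add: sets_completionI_sets\<close>)
  also have "\<dots> \<le> integral ?S (\<lambda>y. \<bar>det (?J y)\<bar>)" using im by blast
  also have "\<dots> = (LINT y:?S|lborel. \<bar>det (?J y)\<bar>)" using set_borel_integral_eq_integral(2)[OF iS] by simp
  also have "\<dots> = (LINT y:E|lborel. indicat_real ?S y * \<bar>det (?J y)\<bar>)"
    unfolding set_lebesgue_integral_def
    by (rule Bochner_Integration.integral_cong) (use SE in \<open>auto simp: indicator_def\<close>)
  finally show "measure lborel E \<le> (LINT y:E|lborel. indicat_real ?S y * \<bar>det (?J y)\<bar>)" .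
  have "(\<lambda>y. indicat_real ?S y *\<^sub>R \<bar>det (?J y)\<bar>) = (\<lambda>y. indicat_real E y *\<^sub>R (indicat_real ?S y * \<bar>det (?J y)\<bar>))"
    using SE by (auto simp: indicator_def fun_eq_iff)
  then show "set_integrable lborel E (\<lambda>y. indicat_real ?S y * \<bar>det (?J y)\<bar>)"
    using iS unfolding set_integrable_def by simp
qed

end

context layered_domain
begin

lemma set_integrable_contact: "set_integrable lborel E (\<lambda>y. indicat_real (contact D n) y * C)"
proof -
  have "contact D n \<subseteq> E" by (auto simp: contact_def)
  then have "bounded (contact D n)" using bounded_E bounded_subset by blast
  then have "integrable lborel (\<lambda>y. indicat_real (contact D n) y * C)"
    using contact_borel by (intro integrable_mult_left integrable_real_indicator emeasure_bounded_finite) auto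
  then show ?thesis unfolding set_integrable_def
    by (rule integrable_mult_indicator[rotated]) (use E_borel in simp)
qed

lemma contact_vanishes: "(\<lambda>n. LINT y:E|lborel. indicat_real (contact D n) y * C) \<longlonglongrightarrow> 0"
proof (rule set_integral_E_limit_zero[OF bounded_E])
  show "set_borel_measurable borel E (\<lambda>y. indicat_real (contact D n) y * C)" for n
    using borel_measurable_integrable[OF set_integrable_contact[of D n C, unfolded set_integrable_def]]
    unfolding set_borel_measurable_def by simp
  show "\<bar>indicat_real (contact D n) y * C\<bar> \<le> \<bar>C\<bar>" for n y by (simp add: indicator_def)
  show "\<forall>\<^sub>F n in sequentially. indicat_real (contact D n) y * C = 0" if "y \<in> E" for y
  proof -
    have p: "\<Phi> y / 2 > 0" using that by simp
    show ?thesis using eventually_contact_layer[OF p, of D]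
    proof eventually_elim
      case (elim n)
      have "y \<notin> contact D n"
      proof
        assume "y \<in> contact D n"
        then have "\<Phi> y \<le> \<Phi> y / 2" using elim by (simp add: contact_def)
        then show False using p by simp
      qed
      then show ?case by simp
    qed
  qed
qed

lemma contact_pointwise:
  assumes y: "y \<in> contact D n" and l: "\<Phi> y \<le> \<delta>" and H: "H > 0" and D: "D \<ge> 0"
    and eta: "0 < \<eta>" "\<eta> \<le> 1" and near: "\<bar>hh y + H * r y\<bar> \<le> \<eta> * r y"
    and \<zeta>: "0 \<le> \<zeta> y" "\<zeta> y \<le> 1" and c0: "0 < c0" "\<zeta> y > 0 \<Longrightarrow> umb (A y) (nn y) \<ge> c0 * (r y)\<^sup>2"
  defines "s \<equiv> real n * (\<Phi> y * r y)"
  shows "(1 + (n * \<Phi> y) * hh y / 2)\<^sup>2 - (n * \<Phi> y)\<^sup>2 * umb (A y) (nn y)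
    \<le> (max 0 (1 - s * H / 2))\<^sup>2 + \<eta> * (D + D\<^sup>2) - \<zeta> y * (c0 * s\<^sup>2 * (max 0 (1 - s * H / 2))\<^sup>2)" and "s \<le> D" and "s \<ge> 0"
proof -
  have yE: "y \<in> E" using y by (simp add: contact_def)
  have l': "\<bar>\<Phi> y\<bar> \<le> \<delta>" using l yE by simp
  have rg: "r y = norm (g y)" by (rule r_layer(1)[OF l'])
  have rp: "r y > 0" by (rule r_pos)
  have nn1: "norm (nn y) = 1" using rg rp by (simp add: nn_def)
  show sD: "s \<le> D" using y rg by (simp add: contact_def s_def mult.assoc)
  show s0: "s \<ge> 0" using yE rp by (simp add: s_def)
  define t where "t = real n * \<Phi> y"
  have t0: "t \<ge> 0" using yE by (simp add: t_def)
  have st: "s = t * r y" by (simp add: s_def t_def)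
  define u where "u = 1 + t * hh y / 2"
  define a where "a = max 0 (1 - s * H / 2)"
  have u0: "u \<ge> 0" using y by (simp add: contact_def u_def t_def)
  have a01: "0 \<le> a" "a \<le> 1" using s0 H by (auto simp: a_def)
  have "hh y \<le> - H * r y + \<eta> * r y" using near by linarith
  from mult_left_mono[OF this t0] have "u \<le> 1 - s * H / 2 + \<eta> * s / 2"
    by (simp add: u_def st algebra_simps)
  also have "\<dots> \<le> a + \<eta> * D / 2"
  proof -
    have "\<eta> * s \<le> \<eta> * D" using sD eta by simp
    then show ?thesis unfolding a_def by linarith
  qed
  finally have ua: "u \<le> a + \<eta> * D / 2" .
  have "u\<^sup>2 \<le> (a + \<eta> * D / 2)\<^sup>2" by (rule power_mono[OF ua u0])
  also have "\<dots> = a\<^sup>2 + \<eta> * (a * D) + \<eta> * (\<eta> * D\<^sup>2 / 4)" by (simp add: power2_eq_square algebra_simps)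
  also have "\<dots> \<le> a\<^sup>2 + \<eta> * D + \<eta> * D\<^sup>2"
  proof -
    have "a * D \<le> D" using a01 D by (simp add: mult_left_le_one_le)
    moreover have "\<eta> * D\<^sup>2 / 4 \<le> D\<^sup>2"
    proof -
      have "\<eta> * D\<^sup>2 \<le> 1 * D\<^sup>2" using eta by (intro mult_right_mono) auto
      then show ?thesis using zero_le_power2[of D] by linarith
    qed
    ultimately show ?thesis using eta by (intro add_mono mult_left_mono) auto
  qed
  finally have u2: "u\<^sup>2 \<le> a\<^sup>2 + \<eta> * (D + D\<^sup>2)" by (simp add: algebra_simps)
  have "\<zeta> y * (c0 * s\<^sup>2 * a\<^sup>2) \<le> t\<^sup>2 * umb (A y) (nn y)"
  proof (cases "\<zeta> y > 0")
    case True
    have "\<zeta> y * (c0 * s\<^sup>2 * a\<^sup>2) \<le> 1 * (c0 * s\<^sup>2 * 1)"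
      using \<zeta> c0 a01 by (intro mult_mono) (auto intro!: mult_nonneg_nonneg power_le_one)
    also have "\<dots> = t\<^sup>2 * (c0 * (r y)\<^sup>2)" by (simp add: st power_mult_distrib)
    also have "\<dots> \<le> t\<^sup>2 * umb (A y) (nn y)" using c0(2)[OF True] by (intro mult_left_mono) auto
    finally show ?thesis .
  next
    case False
    then have "\<zeta> y = 0" using \<zeta> by simp
    then show ?thesis using umb_nonneg[OF sym_A nn1] by simp
  qed
  then show "(1 + (n * \<Phi> y) * hh y / 2)\<^sup>2 - (n * \<Phi> y)\<^sup>2 * umb (A y) (nn y)
    \<le> (max 0 (1 - s * H / 2))\<^sup>2 + \<eta> * (D + D\<^sup>2) - \<zeta> y * (c0 * s\<^sup>2 * (max 0 (1 - s * H / 2))\<^sup>2)"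
    using u2 unfolding u_def t_def a_def by linarith
qed

lemma heintze_karcher:
  assumes H: "H > 0" and mean: "\<And>x. \<Phi> x = 0 \<Longrightarrow> hh x = - H * norm (g x)"
    and z0: "\<Phi> z0 = 0"
    and \<zeta>: "\<And>x. has_grad \<zeta> (g\<zeta> x) x" "continuous_on UNIV g\<zeta>" "\<And>x. 0 \<le> \<zeta> x" "\<And>x. \<zeta> x \<le> 1"
    and c0: "0 < c0" "\<And>x. \<zeta> x > 0 \<Longrightarrow> umb (A x) (nn x) \<ge> c0 * (r x)\<^sup>2"
  obtains K where "K > 0" "measure lborel E \<le> 2 / (3 * H) * area (\<lambda>x. 1) (\<lambda>x. 0) - K * area \<zeta> g\<zeta>"
proof -
  let ?a1 = "area (\<lambda>x. 1) (\<lambda>x. 0)"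
  let ?s = "\<lambda>n x. real n * (\<Phi> x * r x)"
  obtain D where D: "D \<ge> 0" "\<And>x. x \<in> E \<Longrightarrow> norm (x - z0) \<le> D"
  proof -
    obtain a where a: "E \<subseteq> ball z0 a" using bounded_subset_ballD[OF bounded_E] by blast
    have "norm (x - z0) \<le> \<bar>a\<bar>" if "x \<in> E" for x using subsetD[OF a that] by (simp add: dist_norm norm_minus_commute)
    then show ?thesis using that[of "\<bar>a\<bar>"] by simp
  qed
  define c1 where "c1 = min c0 (H\<^sup>2 / 4)"
  have c1: "c1 > 0" "c1 \<le> c0" "c1 \<le> H\<^sup>2 / 4" using c0 H by (auto simp: c1_def)
  have c1': "\<zeta> x > 0 \<Longrightarrow> umb (A x) (nn x) \<ge> c1 * (r x)\<^sup>2" for x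
    using c0(2)[of x] mult_right_mono[OF c1(2) zero_le_power2[of "r x"]] by linarith
  let ?aa = "\<lambda>t. (max 0 (1 - t * H / 2))\<^sup>2"
  let ?G = "\<lambda>t. (2 / (3 * H)) * (max 0 (1 - t * H / 2))^3"
  let ?\<tau> = "\<lambda>t. max 0 (min 1 (D + 1 - t))"
  let ?d = "\<lambda>t. c1 * (max 0 t)\<^sup>2 * ?aa t"
  have G: "(?G has_real_derivative - ?aa t) (at t)" for t
  proof -
    have "((\<lambda>t. 1 - t * H / 2) has_real_derivative - H / 2) (at t)" by (auto intro!: derivative_eq_intros)
    from DERIV_cmult[OF DERIV_chain'[OF this has_real_derivative_max_power3], of "2 / (3 * H)"] H
    show ?thesis by (simp add: field_simps)
  qed
  have ca: "continuous_on UNIV ?aa" by (intro continuous_intros) auto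
  have zG: "t \<ge> 2 / H \<Longrightarrow> ?G t = 0" "t \<ge> 2 / H \<Longrightarrow> ?aa t = 0" for t
    using H by (auto simp: field_simps max_def)
  have zd: "t \<ge> 2 / H \<Longrightarrow> ?d t = 0" for t using zG(2)[of t] by simp
  have c\<tau>: "continuous_on UNIV ?\<tau>" by (intro continuous_intros)
  have cd: "continuous_on UNIV ?d" by (intro continuous_intros) auto
  have z\<tau>: "t \<ge> D + 1 \<Longrightarrow> ?\<tau> t = 0" for t by simp
  obtain T where T: "\<And>t. (T has_real_derivative - ?\<tau> t) (at t)" "\<And>t. t \<ge> D + 1 \<Longrightarrow> T t = 0"
    using decreasing_primitive[OF c\<tau> z\<tau>] by blast
  obtain V where V: "\<And>t. (V has_real_derivative - ?d t) (at t)" "\<And>t. t \<ge> 2 / H \<Longrightarrow> V t = 0"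
    using decreasing_primitive[OF cd zd] by blast
  have V0: "V 0 > 0"
    by (rule primitive_pos[OF V(1) V(2), where s="1/H"], assumption) (use c1 H in \<open>auto simp: field_simps\<close>)
  have lG: "(\<lambda>n. LINT x:E|lborel. 1 * ?aa (?s n x) * (real n * (g x \<bullet> g x))) \<longlonglongrightarrow> ?G 0 * ?a1"
    by (rule layer_area[OF has_grad_const _ G ca zG]) (auto intro: continuous_intros)
  have lT: "(\<lambda>n. LINT x:E|lborel. 1 * ?\<tau> (?s n x) * (real n * (g x \<bullet> g x))) \<longlonglongrightarrow> T 0 * ?a1"
    by (rule layer_area[OF has_grad_const _ T(1) c\<tau> T(2) z\<tau>]) (auto intro: continuous_intros)
  have lV: "(\<lambda>n. LINT x:E|lborel. \<zeta> x * ?d (?s n x) * (real n * (g x \<bullet> g x))) \<longlonglongrightarrow> V 0 * area \<zeta> g\<zeta>"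
    by (rule layer_area[OF \<zeta>(1,2) V(1) cd V(2) zd])
  obtain C where C: "C \<ge> 0" "\<And>n y. y \<in> contact D n \<Longrightarrow> \<Phi> y \<le> \<delta> \<Longrightarrow>
      \<bar>det (mat 1 + ((real n * \<Phi> y) *\<^sub>R A y + outer (g y) (real n *\<^sub>R g y)))\<bar> \<le> C +
        real n * (g y \<bullet> g y) * ((1 + (n * \<Phi> y) * hh y / 2)\<^sup>2 - (n * \<Phi> y)\<^sup>2 * umb (A y) (nn y))"
    by (rule det_contact[of D], rule that)
  have c\<zeta>: "continuous_on UNIV \<zeta>" using \<zeta>(1) has_grad_continuous continuous_at_imp_continuous_on by blast
  have dle: "?d t \<le> ?aa t" if "t \<ge> 0" for t
  proof (cases "t * H / 2 \<ge> 1")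
    case True then show ?thesis by simp
  next
    case False
    then have "(t * H / 2)\<^sup>2 \<le> 1" using H that by (intro power_le_one) auto
    moreover have "c1 * t\<^sup>2 \<le> (H\<^sup>2 / 4) * t\<^sup>2" using c1(3) by (intro mult_right_mono) auto
    ultimately have "c1 * (max 0 t)\<^sup>2 \<le> 1" using that by (simp add: power_mult_distrib power_divide max_def mult.commute)
    then show ?thesis using mult_right_mono[of "c1 * (max 0 t)\<^sup>2" 1 "?aa t"] by simp
  qed
  have main: "measure lborel E \<le> ?G 0 * ?a1 + \<eta> * (D + D\<^sup>2) * (T 0 * ?a1) - V 0 * area \<zeta> g\<zeta>"
    if eta: "0 < \<eta>" "\<eta> \<le> 1" for \<eta>
  proof -
    have "compact (closure E)" using bounded_E by (simp add: compact_closure)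
    then obtain d c where d: "d > 0" "c > 0"
      "\<And>x. x \<in> closure E \<Longrightarrow> \<bar>\<Phi> x\<bar> \<le> d \<Longrightarrow> \<eta> * r x - \<bar>hh x + H * r x\<bar> \<ge> c"
    proof (rule positive_near_zero_set[of "closure E" \<Phi> "\<lambda>x. \<eta> * r x - \<bar>hh x + H * r x\<bar>"])
      show "continuous_on (closure E) (\<lambda>x. \<eta> * r x - \<bar>hh x + H * r x\<bar>)"
        by (intro continuous_intros cont_r cont_hh)
      show "0 < \<eta> * r x - \<bar>hh x + H * r x\<bar>" if "x \<in> closure E" "\<Phi> x = 0" for x
        using mean[OF that(2)] r_layer(1)[of x] that \<delta>_pos eta r_pos[of x] by simp
    qed (auto intro: cont_\<Phi>)
    let ?f = "\<lambda>n. (LINT y:E|lborel. indicat_real (contact D n) y * C)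
       + (LINT x:E|lborel. 1 * ?aa (?s n x) * (real n * (g x \<bullet> g x)))
       + \<eta> * (D + D\<^sup>2) * (LINT x:E|lborel. 1 * ?\<tau> (?s n x) * (real n * (g x \<bullet> g x)))
       - (LINT x:E|lborel. \<zeta> x * ?d (?s n x) * (real n * (g x \<bullet> g x)))"
    have lim: "?f \<longlonglongrightarrow> 0 + ?G 0 * ?a1 + \<eta> * (D + D\<^sup>2) * (T 0 * ?a1) - V 0 * area \<zeta> g\<zeta>"
      by (intro tendsto_diff tendsto_add tendsto_mult[OF tendsto_const] contact_vanishes lG lT lV)
    have cc: "\<forall>\<^sub>F n in sequentially. E \<subseteq> (\<lambda>y. y + (real n * \<Phi> y) *\<^sub>R g y) ` contact D n \<and>
      (\<forall>y\<in>contact D n. \<Phi> y \<le> \<delta>)"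
      by (rule contact_covers[OF z0]) (rule D(2))
    have "\<forall>\<^sub>F n in sequentially. measure lborel E \<le> ?f n"
      using cc eventually_contact_layer[OF d(1), of D]
    proof eventually_elim
      case (elim n)
      have cov: "E \<subseteq> (\<lambda>y. y + (real n * \<Phi> y) *\<^sub>R g y) ` contact D n" using elim by blast
      have cs: "continuous_on UNIV (?s n)" by (intro continuous_intros cont_\<Phi> cont_r)
      have i1: "set_integrable lborel E (\<lambda>x. 1 * ?aa (?s n x) * (real n * (g x \<bullet> g x)))"
        by (intro set_integrable_E[OF bounded_E] continuous_intros cont_\<Phi> cont_g cont_r) auto
      have i2: "set_integrable lborel E (\<lambda>x. \<eta> * (D + D\<^sup>2) * (1 * ?\<tau> (?s n x) * (real n * (g x \<bullet> g x))))"
        by (intro set_integrable_E[OF bounded_E] continuous_intros cont_\<Phi> cont_g cont_r)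
      have i3: "set_integrable lborel E (\<lambda>x. \<zeta> x * ?d (?s n x) * (real n * (g x \<bullet> g x)))"
        by (intro set_integrable_E[OF bounded_E] continuous_intros cont_\<Phi> cont_g cont_r c\<zeta>) auto
      note i0 = set_integrable_contact[of D n C]
      note m = measure_le_contact[OF cov]
      have "measure lborel E \<le> (LINT y:E|lborel. indicat_real (contact D n) y *
          \<bar>det (mat 1 + ((real n * \<Phi> y) *\<^sub>R A y + outer (g y) (real n *\<^sub>R g y)))\<bar>)" by (rule m(1))
      also have "\<dots> \<le> (LINT x:E|lborel. ((indicat_real (contact D n) x * C + 1 * ?aa (?s n x) * (real n * (g x \<bullet> g x)))
          + \<eta> * (D + D\<^sup>2) * (1 * ?\<tau> (?s n x) * (real n * (g x \<bullet> g x)))) - \<zeta> x * ?d (?s n x) * (real n * (g x \<bullet> g x)))"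
      proof (rule set_integral_mono[OF m(2) set_integral_diff(1)[OF set_integral_add(1)[OF set_integral_add(1)[OF i0 i1] i2] i3]])
        fix y assume yE: "y \<in> E"
        have s0: "?s n y \<ge> 0" using yE r_pos[of y] by simp
        have ng: "real n * (g y \<bullet> g y) \<ge> 0" by simp
        have dn: "\<zeta> y * ?d (?s n y) \<le> ?aa (?s n y)"
        proof -
          have "\<zeta> y * ?d (?s n y) \<le> 1 * ?d (?s n y)" using \<zeta>(4) c1 by (intro mult_right_mono) auto
          then show ?thesis using dle[OF s0] by simp
        qed
        show "indicat_real (contact D n) y *
          \<bar>det (mat 1 + ((real n * \<Phi> y) *\<^sub>R A y + outer (g y) (real n *\<^sub>R g y)))\<bar> \<le>
          ((indicat_real (contact D n) y * C + 1 * ?aa (?s n y) * (real n * (g y \<bullet> g y)))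
          + \<eta> * (D + D\<^sup>2) * (1 * ?\<tau> (?s n y) * (real n * (g y \<bullet> g y)))) - \<zeta> y * ?d (?s n y) * (real n * (g y \<bullet> g y))"
        proof (cases "y \<in> contact D n")
          case True
          have l: "\<Phi> y \<le> \<delta>" using elim True by blast
          have "\<Phi> y \<le> d" using elim True yE by (simp add: contact_def)
          then have near: "\<bar>hh y + H * r y\<bar> \<le> \<eta> * r y"
            using d(3)[OF subsetD[OF closure_subset yE]] d(2) yE by force
          note P = contact_pointwise[OF True l H D(1) eta near \<zeta>(3,4) c1(1) c1']
          have "?\<tau> (?s n y) = 1" using P(2) by simp
          have b: "(1 + (n * \<Phi> y) * hh y / 2)\<^sup>2 - (n * \<Phi> y)\<^sup>2 * umb (A y) (nn y)
            \<le> ?aa (?s n y) + \<eta> * (D + D\<^sup>2) * ?\<tau> (?s n y) - \<zeta> y * ?d (?s n y)"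
            using P(1) \<open>?\<tau> (?s n y) = 1\<close> s0 by (simp add: max_absorb2)
          from mult_left_mono[OF b ng] C(2)[OF True l]
          have "\<bar>det (mat 1 + ((real n * \<Phi> y) *\<^sub>R A y + outer (g y) (real n *\<^sub>R g y)))\<bar> \<le> C +
            real n * (g y \<bullet> g y) * (?aa (?s n y) + \<eta> * (D + D\<^sup>2) * ?\<tau> (?s n y) - \<zeta> y * ?d (?s n y))"
            by linarith
          then show ?thesis using True by (simp only: indicator_simps algebra_simps)
        next
          case False
          have "0 \<le> (?aa (?s n y) - \<zeta> y * ?d (?s n y)) * (real n * (g y \<bullet> g y))" using dn ng by simp
          moreover have "0 \<le> \<eta> * (D + D\<^sup>2) * (1 * ?\<tau> (?s n y) * (real n * (g y \<bullet> g y)))"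
            using eta D ng by (intro mult_nonneg_nonneg) auto
          ultimately show ?thesis using False by (simp add: left_diff_distrib)
        qed
      qed
      also have "\<dots> = ?f n"
        unfolding set_integral_diff(2)[OF set_integral_add(1)[OF set_integral_add(1)[OF i0 i1] i2] i3]
          set_integral_add(2)[OF set_integral_add(1)[OF i0 i1] i2] set_integral_add(2)[OF i0 i1]
          set_integral_mult_right ..
      finally show ?case .
    qed
    from tendsto_le[OF sequentially_bot lim tendsto_const this] show ?thesis by simp
  qed
  have "measure lborel E \<le> ?G 0 * ?a1 - V 0 * area \<zeta> g\<zeta>"
  proof (rule field_le_epsilon)
    fix e :: real assume e: "e > 0"
    define X where "X = \<bar>(D + D\<^sup>2) * (T 0 * ?a1)\<bar> + 1"
    have X: "X > 0" by (simp add: X_def)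
    define \<eta> where "\<eta> = min 1 (e / X)"
    have eta: "0 < \<eta>" "\<eta> \<le> 1" using e X by (auto simp: \<eta>_def)
    have "\<eta> * ((D + D\<^sup>2) * (T 0 * ?a1)) \<le> \<eta> * X" using eta by (intro mult_left_mono) (auto simp: X_def)
    also have "\<dots> \<le> (e / X) * X" using X by (intro mult_right_mono) (auto simp: \<eta>_def)
    also have "\<dots> = e" using X by simp
    finally show "measure lborel E \<le> ?G 0 * ?a1 - V 0 * area \<zeta> g\<zeta> + e" using main[OF eta] by (simp add: mult.assoc)
  qed
  then show ?thesis using that[OF V0] by simp
qed

lemma equality_umbilic_area:
  assumes H: "H > 0" and mean: "\<And>x. \<Phi> x = 0 \<Longrightarrow> hh x = - H * norm (g x)"
    and z0: "\<Phi> z0 = 0"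
    and \<zeta>: "\<And>x. has_grad \<zeta> (g\<zeta> x) x" "continuous_on UNIV g\<zeta>" "\<And>x. 0 \<le> \<zeta> x" "\<And>x. \<zeta> x \<le> 1"
    and c0: "0 < c0" "\<And>x. \<zeta> x > 0 \<Longrightarrow> umb (A x) (nn x) \<ge> c0 * (r x)\<^sup>2"
  shows "area \<zeta> g\<zeta> \<le> 0"
proof -
  obtain K where K: "K > 0" "measure lborel E \<le> 2 / (3 * H) * area (\<lambda>x. 1) (\<lambda>x. 0) - K * area \<zeta> g\<zeta>"
    by (rule heintze_karcher[OF H _ z0 \<zeta> c0(1)], erule mean, erule c0(2), rule that)
  have "2 / (3 * H) * area (\<lambda>x. 1) (\<lambda>x. 0) = measure lborel E"
    using minkowski[OF mean] H by (simp add: field_simps)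
  then have "K * area \<zeta> g\<zeta> \<le> 0" using K(2) by linarith
  then show ?thesis using K(1) by (simp add: mult_le_0_iff)
qed

end

definition bump :: "real \<Rightarrow> R3 \<Rightarrow> real" where
  "bump \<epsilon> x = (max 0 (\<epsilon>\<^sup>2 - x \<bullet> x))\<^sup>2"

definition grad_bump :: "real \<Rightarrow> R3 \<Rightarrow> R3" where
  "grad_bump \<epsilon> x = (- 4 * max 0 (\<epsilon>\<^sup>2 - x \<bullet> x)) *\<^sub>R x"

lemma has_grad_bump: "has_grad (bump \<epsilon>) (grad_bump \<epsilon> x) x"
proof -
  have "has_grad (\<lambda>x. \<epsilon>\<^sup>2 - x \<bullet> x) (- (2 *\<^sub>R x)) x"
    using has_grad_diff[OF has_grad_const has_grad_inner[OF has_jac_id has_jac_id], of "\<epsilon>\<^sup>2" x]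
    by (simp add: scaleR_2)
  from has_grad_chain[OF has_real_derivative_max_power2 this]
  show ?thesis by (simp add: bump_def[abs_def] grad_bump_def)
qed

lemma has_grad_translate:
  assumes "has_grad f g (x - z)" shows "has_grad (\<lambda>x. f (x - z)) g x"
proof -
  have "((\<lambda>x. x - z) has_derivative (\<lambda>h. h)) (at x)" by (auto intro!: derivative_eq_intros)
  from has_derivative_compose[OF this assms[unfolded has_grad_def]] show ?thesis by (simp add: has_grad_def)
qed

lemma bump_pos_iff: "\<epsilon> > 0 \<Longrightarrow> bump \<epsilon> x > 0 \<longleftrightarrow> norm x < \<epsilon>"
proof -
  assume e: "\<epsilon> > 0"
  have "x \<bullet> x < \<epsilon>\<^sup>2 \<longleftrightarrow> norm x < \<epsilon>"
    unfolding power2_norm_eq_inner[symmetric] using e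
    by (auto intro: power_less_imp_less_base power_strict_mono)
  then show ?thesis by (auto simp: bump_def max_def zero_less_power2)
qed

lemma bump_nonneg: "bump \<epsilon> x \<ge> 0" by (simp add: bump_def)

lemma bump_zero: "\<epsilon> > 0 \<Longrightarrow> norm x \<ge> \<epsilon> \<Longrightarrow> bump \<epsilon> x = 0"
  using bump_pos_iff[of \<epsilon> x] bump_nonneg[of \<epsilon> x] by linarith

lemma continuous_on_bump [continuous_intros]: "continuous_on S f \<Longrightarrow> continuous_on S (\<lambda>x. bump \<epsilon> (f x))"
  unfolding bump_def by (intro continuous_intros)

lemma continuous_on_grad_bump [continuous_intros]: "continuous_on S f \<Longrightarrow> continuous_on S (\<lambda>x. grad_bump \<epsilon> (f x))"
  unfolding grad_bump_def by (intro continuous_intros)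

lemma transport_field:
  fixes z0 z1 :: R3
  assumes e: "\<epsilon> > 0"
  obtains F J where "\<And>x. has_jac F (J x) x" "continuous_on UNIV J"
    "\<And>x. trace (J x) = bump \<epsilon> (x - z1) - bump \<epsilon> (x - z0)"
    "\<And>x. F x \<noteq> 0 \<Longrightarrow> \<exists>t\<in>{0..1}. norm (x - (z0 + t *\<^sub>R (z1 - z0))) < \<epsilon>"
proof -
  let ?p = "\<lambda>t. z0 + t *\<^sub>R (z1 - z0)"
  define f where "f x = integral {0..1} (\<lambda>t::real. bump \<epsilon> (x - ?p t))" for x
  define v where "v x = integral {0..1} (\<lambda>t::real. grad_bump \<epsilon> (x - ?p t))" for x
  have int: "(\<lambda>t. grad_bump \<epsilon> (x - ?p t)) integrable_on {0..1::real}" for x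
    by (intro integrable_continuous_real continuous_intros)
  have grad: "has_grad f (v x) x" for x
  proof -
    have d: "((\<lambda>x. integral (cbox 0 1) (\<lambda>t::real. bump \<epsilon> (x - ?p t))) has_derivative
        integral (cbox 0 1) (\<lambda>t. blinfun_inner_right (grad_bump \<epsilon> (x - ?p t)))) (at x within UNIV)"
    proof (rule leibniz_rule)
      fix x and t :: real
      have "has_grad (\<lambda>x. bump \<epsilon> (x - ?p t)) (grad_bump \<epsilon> (x - ?p t)) x"
        by (rule has_grad_translate[OF has_grad_bump])
      then show "((\<lambda>x. bump \<epsilon> (x - ?p t)) has_derivative blinfun_inner_right (grad_bump \<epsilon> (x - ?p t))) (at x within UNIV)"
        by (simp add: has_grad_def blinfun_inner_right.rep_eq)
      show "(\<lambda>t. bump \<epsilon> (x - ?p t)) integrable_on cbox 0 (1::real)"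
        unfolding cbox_interval by (intro integrable_continuous_real continuous_intros)
      have "continuous_on (UNIV \<times> cbox 0 1) (\<lambda>y. blinfun_inner_right (grad_bump \<epsilon> (fst y - ?p (snd y :: real))))"
        by (rule bounded_linear.continuous_on[OF bounded_linear_blinfun_inner_right]) (intro continuous_intros)
      then show "continuous_on (UNIV \<times> cbox 0 1) (\<lambda>(x, t::real). blinfun_inner_right (grad_bump \<epsilon> (x - ?p t)))"
        by (simp add: case_prod_unfold)
    qed auto
    have "blinfun_apply (integral (cbox 0 1) (\<lambda>t. blinfun_inner_right (grad_bump \<epsilon> (x - ?p t)))) = (\<lambda>h. v x \<bullet> h)"
    proof
      fix h
      have "(\<lambda>t. blinfun_inner_right (grad_bump \<epsilon> (x - ?p t))) integrable_on cbox 0 (1::real)"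
        by (intro integrable_continuous bounded_linear.continuous_on[OF bounded_linear_blinfun_inner_right] continuous_intros)
      then have "blinfun_apply (integral (cbox 0 1) (\<lambda>t. blinfun_inner_right (grad_bump \<epsilon> (x - ?p t)))) h =
          integral (cbox 0 1) (\<lambda>t. grad_bump \<epsilon> (x - ?p t) \<bullet> h)"
        by (simp add: blinfun_apply_integral blinfun_inner_right.rep_eq)
      also have "\<dots> = v x \<bullet> h" using int[of x] by (simp add: v_def cbox_interval)
      finally show "blinfun_apply (integral (cbox 0 1) (\<lambda>t. blinfun_inner_right (grad_bump \<epsilon> (x - ?p t)))) h = v x \<bullet> h" .
    qed
    then show ?thesis using d by (simp add: has_grad_def f_def[abs_def] cbox_interval)
  qed
  have cv: "continuous_on UNIV v"
  proof -
    have "continuous_on UNIV (\<lambda>x. integral (cbox 0 1) (\<lambda>t::real. grad_bump \<epsilon> (x - ?p t)))"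
      by (rule integral_continuous_on_param) (auto simp: case_prod_unfold intro!: continuous_intros)
    then show ?thesis by (simp add: v_def[abs_def] cbox_interval)
  qed
  show ?thesis
  proof
    show "has_jac (\<lambda>x. f x *\<^sub>R (z0 - z1)) (outer (z0 - z1) (v x)) x" for x
      using has_jac_scaleR[OF grad has_jac_const, of "z0 - z1"] by simp
    show "continuous_on UNIV (\<lambda>x. outer (z0 - z1) (v x))" by (intro continuous_intros cv)
    show "trace (outer (z0 - z1) (v x)) = bump \<epsilon> (x - z1) - bump \<epsilon> (x - z0)" for x
    proof -
      have "((\<lambda>t. grad_bump \<epsilon> (x - ?p t) \<bullet> (z0 - z1)) has_integral (bump \<epsilon> (x - ?p 1) - bump \<epsilon> (x - ?p 0))) {0..1::real}"
      proof (rule fundamental_theorem_of_calculus)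
        fix t :: real
        have "((\<lambda>t. x - ?p t) has_derivative (\<lambda>h. h *\<^sub>R (z0 - z1))) (at t)"
          by (rule derivative_eq_intros refl | simp add: algebra_simps)+
        from has_derivative_compose[OF this has_grad_bump[unfolded has_grad_def]]
        have "((\<lambda>t. bump \<epsilon> (x - ?p t)) has_derivative (\<lambda>h. h * (grad_bump \<epsilon> (x - ?p t) \<bullet> (z0 - z1)))) (at t)"
          by simp
        then show "((\<lambda>t. bump \<epsilon> (x - ?p t)) has_vector_derivative grad_bump \<epsilon> (x - ?p t) \<bullet> (z0 - z1)) (at t within {0..1})"
          unfolding has_vector_derivative_def by (simp add: has_derivative_at_withinI)
      qed simp
      then have "integral {0..1} (\<lambda>t. grad_bump \<epsilon> (x - ?p t) \<bullet> (z0 - z1)) = bump \<epsilon> (x - z1) - bump \<epsilon> (x - z0)"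
        by (simp add: integral_unique)
      moreover have "integral {0..1} (\<lambda>t. grad_bump \<epsilon> (x - ?p t) \<bullet> (z0 - z1)) = v x \<bullet> (z0 - z1)"
        using int[of x] by (simp add: v_def)
      ultimately show ?thesis by (simp add: trace_outer inner_commute)
    qed
    show "\<exists>t\<in>{0..1}. norm (x - (z0 + t *\<^sub>R (z1 - z0))) < \<epsilon>" if "f x *\<^sub>R (z0 - z1) \<noteq> 0" for x
    proof (rule ccontr)
      assume "\<not> ?thesis"
      then have z: "bump \<epsilon> (x - ?p t) = 0" if "t \<in> {0..1}" for t
        using that by (intro bump_zero[OF e]) (meson not_less)
      have "integral {0..1} (\<lambda>t. bump \<epsilon> (x - ?p t)) = integral {0..1} (\<lambda>t::real. 0)"
        by (intro integral_cong z)
      then show False using that by (simp add: f_def)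
    qed
  qed
qed

context layered_domain
begin

lemma both_sides:
  assumes b: "\<Phi> b = 0" and e: "e > 0"
  obtains z0 z1 where "norm (z0 - b) < e" "norm (z1 - b) < e" "\<Phi> z0 < 0" "\<Phi> z1 > 0"
proof -
  let ?f = "\<lambda>t. \<Phi> (b + t *\<^sub>R g b)"
  have gb: "g b \<noteq> 0" using regular b by blast
  have "((\<lambda>t. b + t *\<^sub>R g b) has_derivative (\<lambda>h. h *\<^sub>R g b)) (at 0)" by (auto intro!: derivative_eq_intros)
  moreover have "(\<Phi> has_derivative (\<bullet>) (g b)) (at (b + 0 *\<^sub>R g b))" using grad_\<Phi>[of b] by (simp add: has_grad_def)
  ultimately have "(?f has_derivative (\<lambda>h. g b \<bullet> (h *\<^sub>R g b))) (at 0)" by (rule has_derivative_compose)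
  then have D: "(?f has_real_derivative (g b \<bullet> g b)) (at 0)"
    by (simp add: has_field_derivative_def mult.commute[of _ "g b \<bullet> g b"])
  have p: "g b \<bullet> g b > 0" using gb by simp
  obtain d1 where d1: "d1 > 0" "\<And>h. h > 0 \<Longrightarrow> h < d1 \<Longrightarrow> ?f 0 < ?f h"
    using DERIV_pos_inc_right[OF D p] by auto
  obtain d2 where d2: "d2 > 0" "\<And>h. h > 0 \<Longrightarrow> h < d2 \<Longrightarrow> ?f (0 - h) < ?f 0"
    using DERIV_pos_inc_left[OF D p] by auto
  define h where "h = min (min d1 d2 / 2) (e / (2 * norm (g b)))"
  have ng: "norm (g b) > 0" using gb by simp
  have h: "h > 0" "h < d1" "h < d2" using d1 d2 e ng by (auto simp: h_def)
  have "h * norm (g b) \<le> e / (2 * norm (g b)) * norm (g b)" using ng by (intro mult_right_mono) (auto simp: h_def)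
  also have "\<dots> < e" using ng e by simp
  finally have hn: "h * norm (g b) < e" .
  show ?thesis
    by (rule that[of "b + (0 - h) *\<^sub>R g b" "b + h *\<^sub>R g b"]) (use d1(2)[OF h(1,2)] d2(2)[OF h(1,3)] h hn b in auto)
qed

lemma area_pos:
  assumes \<zeta>: "\<And>x. has_grad \<zeta> (g\<zeta> x) x" "continuous_on UNIV g\<zeta>" "\<And>x. 0 \<le> \<zeta> x"
    and b: "\<Phi> b = 0" "\<zeta> b > 0"
  shows "area \<zeta> g\<zeta> > 0"
proof (rule ccontr)
  assume "\<not> area \<zeta> g\<zeta> > 0"
  then have neg: "area \<zeta> g\<zeta> \<le> 0" by simp
  have c\<zeta>: "continuous_on UNIV \<zeta>" using \<zeta>(1) has_grad_continuous continuous_at_imp_continuous_on by blast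
  obtain e where e: "e > 0" "\<And>x. norm (x - b) < e \<Longrightarrow> \<zeta> x > \<zeta> b / 2"
  proof -
    have "isCont \<zeta> b" using \<zeta>(1) has_grad_continuous by blast
    then obtain e where "e > 0" "\<And>x. dist x b < e \<Longrightarrow> dist (\<zeta> x) (\<zeta> b) < \<zeta> b / 2"
      using b(2) unfolding continuous_at_eps_delta by (metis half_gt_zero)
    then have "\<bar>\<zeta> x - \<zeta> b\<bar> < \<zeta> b / 2" if "norm (x - b) < e" for x
      using that by (simp add: dist_norm)
    then have "\<zeta> x > \<zeta> b / 2" if "norm (x - b) < e" for x
      using that by (smt (verit) field_sum_of_halves)
    then show ?thesis using that[of e] \<open>e > 0\<close> by blast
  qed
  have e2: "e / 2 > 0" using e by simp
  obtain z0 z1 where z: "norm (z0 - b) < e / 2" "norm (z1 - b) < e / 2" "\<Phi> z0 < 0" "\<Phi> z1 > 0"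
    using both_sides[OF b(1) e2] by blast
  obtain e0 where e0: "e0 > 0" "ball z0 e0 \<subseteq> {x. \<Phi> x < 0}"
  proof -
    have "open {x. \<Phi> x < 0}" by (intro open_Collect_less continuous_intros cont_\<Phi>)
    then show ?thesis using that z(3) openE by blast
  qed
  obtain e1 where e1: "e1 > 0" "ball z1 e1 \<subseteq> E" using open_E z(4) openE by blast
  define \<epsilon> where "\<epsilon> = min (e / 2) (min e0 e1)"
  have \<epsilon>: "\<epsilon> > 0" "\<epsilon> \<le> e / 2" "\<epsilon> \<le> e0" "\<epsilon> \<le> e1" using e e0 e1 by (auto simp: \<epsilon>_def)
  obtain F J where F: "\<And>x. has_jac F (J x) x" "continuous_on UNIV J"
    "\<And>x. trace (J x) = bump \<epsilon> (x - z1) - bump \<epsilon> (x - z0)"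
    "\<And>x. F x \<noteq> 0 \<Longrightarrow> \<exists>t\<in>{0..1}. norm (x - (z0 + t *\<^sub>R (z1 - z0))) < \<epsilon>"
    by (rule transport_field[OF \<epsilon>(1), of z1 z0], rule that)
  have supp: "norm (x - b) < e" if Fx: "F x \<noteq> 0" for x
  proof -
    obtain t where t: "t \<in> {0..1}" "norm (x - (z0 + t *\<^sub>R (z1 - z0))) < \<epsilon>" using F(4)[OF Fx] by blast
    have "(z0 + t *\<^sub>R (z1 - z0)) - b = (1 - t) *\<^sub>R (z0 - b) + t *\<^sub>R (z1 - b)" by (simp add: algebra_simps)
    then have "norm ((z0 + t *\<^sub>R (z1 - z0)) - b) \<le> (1 - t) * norm (z0 - b) + t * norm (z1 - b)"
      using t(1) norm_triangle_ineq[of "(1 - t) *\<^sub>R (z0 - b)" "t *\<^sub>R (z1 - b)"] by simp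
    also have "\<dots> \<le> (1 - t) * (e / 2) + t * (e / 2)" using t z by (intro add_mono mult_left_mono) auto
    also have "\<dots> = e / 2" by (simp add: field_simps)
    finally have "norm ((z0 + t *\<^sub>R (z1 - z0)) - b) \<le> e / 2" .
    then show ?thesis
      using norm_triangle_ineq[of "x - (z0 + t *\<^sub>R (z1 - z0))" "(z0 + t *\<^sub>R (z1 - z0)) - b"] t(2) \<epsilon>(2) by simp
  qed
  have cF: "continuous_on UNIV F" using F(1) has_jac_continuous continuous_at_imp_continuous_on by blast
  have "bounded (F ` cball b e)" by (intro compact_imp_bounded compact_continuous_image continuous_on_subset[OF cF]) auto
  then obtain M0 where M0: "\<forall>x\<in>cball b e. norm (F x) \<le> M0" by (auto simp: bounded_iff)
  define M where "M = max M0 1"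
  have M: "M > 0" "norm (F x) \<le> M" for x
  proof -
    show "M > 0" by (simp add: M_def)
    show "norm (F x) \<le> M"
    proof (cases "F x = 0")
      case False
      then have "x \<in> cball b e" using supp[OF False] by (simp add: dist_norm norm_minus_commute)
      then show ?thesis using M0 by (force simp: M_def)
    qed (simp add: M_def)
  qed
  define l where "l = M / (\<zeta> b / 2)"
  have l: "l > 0" using M b by (simp add: l_def)
  let ?K = "\<lambda>x. \<zeta> x *\<^sub>R Jn x + outer (nn x) (g\<zeta> x)"
  have jz: "has_jac (\<lambda>x. \<zeta> x *\<^sub>R nn x) (?K x) x" for x by (rule has_jac_scaleR[OF \<zeta>(1) jac_nn])
  have cK: "continuous_on UNIV ?K" by (intro continuous_intros c\<zeta> cont_Jn cont_nn \<zeta>(2))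
  have "(LINT x:E|lborel. trace (l *\<^sub>R ?K x + J x)) \<le> 0"
  proof (rule div_nonpos[OF has_jac_add[OF has_jac_cmul[OF jz] F(1)]])
    show "continuous_on UNIV (\<lambda>x. l *\<^sub>R ?K x + J x)" by (intro continuous_intros cK F(2))
    show "0 \<le> (l *\<^sub>R \<zeta> x *\<^sub>R nn x + F x) \<bullet> g x" if x: "\<Phi> x = 0" for x
    proof (cases "F x = 0")
      case True
      have "nn x \<bullet> g x \<ge> 0" using r_pos[of x] by (simp add: nn_def)
      then show ?thesis using True l \<zeta>(3)[of x] by simp
    next
      case False
      have ng: "nn x \<bullet> g x = norm (g x)"
        using r_layer[of x] x \<delta>_pos r_pos[of x] by (simp add: nn_def power2_eq_square field_simps norm_eq_sqrt_inner)
      have "M = l * (\<zeta> b / 2)" using b by (simp add: l_def)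
      also have "\<dots> \<le> l * \<zeta> x" using e(2)[OF supp[OF False]] l by (intro mult_left_mono) auto
      finally have "M * norm (g x) \<le> l * \<zeta> x * norm (g x)" by (rule mult_right_mono) simp
      moreover have "\<bar>F x \<bullet> g x\<bar> \<le> M * norm (g x)"
        using Cauchy_Schwarz_ineq2[of "F x" "g x"] mult_right_mono[OF M(2)[of x] norm_ge_zero[of "g x"]] by linarith
      ultimately show ?thesis by (simp add: inner_add_left ng)
    qed
  qed
  moreover have i1: "set_integrable lborel E (\<lambda>x. l * trace (?K x))"
    by (intro set_integrable_E[OF bounded_E] continuous_intros cK)
  moreover have i2: "set_integrable lborel E (\<lambda>x. trace (J x))"
    by (intro set_integrable_E[OF bounded_E] continuous_intros F(2))
  moreover have "(LINT x:E|lborel. l * trace (?K x)) = - (l * area \<zeta> g\<zeta>)"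
    by (simp add: area_def)
  ultimately have "(LINT x:E|lborel. trace (J x)) \<le> l * area \<zeta> g\<zeta>"
    by (simp add: trace_add[of "l *\<^sub>R _"] trace_scaleR set_integral_add(2)[OF i1 i2])
  also have "\<dots> \<le> 0" using l neg by (simp add: mult_nonneg_nonpos)
  finally have le0: "(LINT x:E|lborel. trace (J x)) \<le> 0" .
  have trE: "trace (J x) = bump \<epsilon> (x - z1)" if "x \<in> E" for x
  proof -
    have "x \<notin> ball z0 e0" using e0(2) that by force
    then have "\<epsilon> \<le> norm (x - z0)" using \<epsilon>(3) by (simp add: dist_norm norm_minus_commute)
    then show ?thesis using F(3) bump_zero[OF \<epsilon>(1)] by simp
  qed
  define c where "c = (3 * \<epsilon>\<^sup>2 / 4)\<^sup>2"
  have c: "c > 0" using \<epsilon> by (simp add: c_def)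
  let ?B = "ball z1 (\<epsilon>/2)"
  have BE: "?B \<subseteq> E" using e1(2) \<epsilon> by (auto simp: subset_iff)
  have "(LINT x|lborel. indicat_real ?B x * c) \<le> (LINT x|lborel. indicat_real E x *\<^sub>R trace (J x))"
  proof (rule integral_mono)
    show "integrable lborel (\<lambda>x. indicat_real ?B x * c)"
      by (intro integrable_mult_left integrable_real_indicator emeasure_bounded_finite) auto
    show "integrable lborel (\<lambda>x. indicat_real E x *\<^sub>R trace (J x))" using i2 by (simp add: set_integrable_def)
    fix x
    show "indicat_real ?B x * c \<le> indicat_real E x *\<^sub>R trace (J x)"
    proof (cases "x \<in> ?B")
      case True
      then have "norm (x - z1) \<le> \<epsilon> / 2" by (simp add: dist_norm norm_minus_commute)
      then have "(norm (x - z1))\<^sup>2 \<le> (\<epsilon> / 2)\<^sup>2" by (intro power_mono) auto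
      then have "3 * \<epsilon>\<^sup>2 / 4 \<le> \<epsilon>\<^sup>2 - (x - z1) \<bullet> (x - z1)"
        by (simp add: power2_norm_eq_inner power_divide)
      then have "c \<le> bump \<epsilon> (x - z1)" unfolding c_def bump_def by (intro power_mono max.coboundedI2) auto
      moreover have "x \<in> E" using True BE by blast
      ultimately show ?thesis using True trE by simp
    next
      case False
      then show ?thesis using trE[of x] bump_nonneg by (simp add: indicator_def)
    qed
  qed
  then have "measure lborel ?B * c \<le> 0" using le0 by (simp add: set_lebesgue_integral_def)
  moreover have "measure lborel ?B > 0" using \<epsilon>(1) by (simp add: content_ball_pos)
  ultimately show False using c by (simp add: mult_le_0_iff)
qed

lemma mean_curvature_pos:
  assumes mean: "\<And>x. \<Phi> x = 0 \<Longrightarrow> hh x = - H * norm (g x)" and b: "\<Phi> b = 0"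
  shows "H > 0"
proof -
  have "area (\<lambda>x. 1) (\<lambda>x. 0) > 0" by (rule area_pos[OF has_grad_const _ _ b]) auto
  then have "H * measure lborel E > 0" using minkowski[OF mean] by simp
  moreover have "H * measure lborel E \<le> 0" if "H \<le> 0" using that by (simp add: mult_nonpos_nonneg)
  ultimately show ?thesis by linarith
qed

lemma umbilic_boundary:
  assumes mean: "\<And>x. \<Phi> x = 0 \<Longrightarrow> hh x = - H * norm (g x)" and b: "\<Phi> b = 0"
  shows "umb (A b) (nn b) \<le> 0"
proof (rule ccontr)
  assume "\<not> umb (A b) (nn b) \<le> 0"
  then have pos: "umb (A b) (nn b) > 0" by simp
  define c0 where "c0 = umb (A b) (nn b) / (2 * (r b)\<^sup>2)"
  have c0: "c0 > 0" using pos r_nz[of b] by (simp add: c0_def)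
  have "open {x. 0 < umb (A x) (nn x) - c0 * (r x)\<^sup>2}"
    by (intro open_Collect_less continuous_intros cont_umb cont_r)
  moreover have "b \<in> {x. 0 < umb (A x) (nn x) - c0 * (r x)\<^sup>2}" using pos r_nz[of b] by (simp add: c0_def)
  ultimately obtain e where "e > 0" and eb: "ball b e \<subseteq> {x. 0 < umb (A x) (nn x) - c0 * (r x)\<^sup>2}"
    by (rule openE)
  then have e: "e > 0" "\<And>x. norm (x - b) < e \<Longrightarrow> umb (A x) (nn x) - c0 * (r x)\<^sup>2 > 0"
    using subsetD[OF eb] by (simp_all add: dist_norm norm_minus_commute)
  let ?\<zeta> = "\<lambda>x. (1 / e^4) * bump e (x - b)" and ?g = "\<lambda>x. (1 / e^4) *\<^sub>R grad_bump e (x - b)"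
  have \<zeta>: "has_grad ?\<zeta> (?g x) x" for x
    using has_grad_mult[OF has_grad_const[of "1/e^4"] has_grad_translate[OF has_grad_bump]] by simp
  have cg: "continuous_on UNIV ?g" by (intro continuous_intros)
  have nn: "0 \<le> ?\<zeta> x" for x using e bump_nonneg by simp
  have le1: "?\<zeta> x \<le> 1" for x
  proof -
    have "bump e (x - b) \<le> (e\<^sup>2)\<^sup>2" unfolding bump_def by (intro power_mono) auto
    then show ?thesis using e by (simp add: field_simps)
  qed
  have bb: "?\<zeta> b > 0" using e by (simp add: bump_def)
  have "area ?\<zeta> ?g \<le> 0"
  proof (rule equality_umbilic_area[OF mean_curvature_pos[OF mean b] mean b \<zeta> cg nn le1 c0])
    fix x assume "?\<zeta> x > 0"
    then have "bump e (x - b) > 0" using e by (simp add: zero_less_divide_iff)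
    then have "norm (x - b) < e" using bump_pos_iff[OF e(1)] by blast
    then show "umb (A x) (nn x) \<ge> c0 * (r x)\<^sup>2" using e(2) by force
  qed
  moreover have "area ?\<zeta> ?g > 0" by (rule area_pos[OF \<zeta> cg nn b bb])
  ultimately show False by simp
qed

end

section \<open>Global defining functions\<close>

lemma second_difference_estimate:
  assumes S: "open S" "x \<in> S" and f: "\<And>y. y \<in> S \<Longrightarrow> has_grad f (g y) y" and A: "has_jac g A x" and e: "e > 0"
  obtains d where "d > 0" "\<And>t. 0 < t \<Longrightarrow> t < d \<Longrightarrow>
    \<bar>f (x + t *\<^sub>R u + t *\<^sub>R w) - f (x + t *\<^sub>R u) - f (x + t *\<^sub>R w) + f x - t\<^sup>2 * ((A *v w) \<bullet> u)\<bar>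
      \<le> e * t\<^sup>2 * ((2 * norm u + norm w) * norm u)"
proof -
  obtain d0 where d0: "d0 > 0" "ball x d0 \<subseteq> S" using S openE by blast
  obtain d1 where d1: "d1 > 0" "\<And>y. norm (y - x) < d1 \<Longrightarrow> norm (g y - g x - A *v (y - x)) \<le> e * norm (y - x)"
    using A e unfolding has_jac_def has_derivative_at_alt by blast
  define m where "m = norm u + norm w + 1"
  have m: "m > 0" by (simp add: m_def add_nonneg_pos)
  define d where "d = min d0 d1 / m"
  have d: "d > 0" using d0 d1 m by (simp add: d_def)
  show ?thesis
  proof (rule that[OF d])
    fix t :: real assume t: "0 < t" "t < d"
    have tm: "t * m < d0" "t * m < d1" using t(2) m by (simp_all add: d_def pos_less_divide_eq)
    have small: "norm (a *\<^sub>R u + b *\<^sub>R w) < d0" "norm (a *\<^sub>R u + b *\<^sub>R w) < d1" if "0 \<le> a" "a \<le> t" "0 \<le> b" "b \<le> t" for a b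
    proof -
      have "norm (a *\<^sub>R u + b *\<^sub>R w) \<le> a * norm u + b * norm w"
        using norm_triangle_ineq[of "a *\<^sub>R u" "b *\<^sub>R w"] that by simp
      also have "\<dots> \<le> t * norm u + t * norm w" using that by (intro add_mono mult_right_mono) auto
      also have "\<dots> \<le> t * m" using t by (simp add: m_def algebra_simps)
      finally show "norm (a *\<^sub>R u + b *\<^sub>R w) < d0" "norm (a *\<^sub>R u + b *\<^sub>R w) < d1" using tm by linarith+
    qed
    have inS: "x + (a *\<^sub>R u + b *\<^sub>R w) \<in> S" if "0 \<le> a" "a \<le> t" "0 \<le> b" "b \<le> t" for a b
      by (rule subsetD[OF d0(2)]) (use small(1)[OF that] norm_minus_cancel[of "a *\<^sub>R u + b *\<^sub>R w"] in \<open>simp add: dist_norm\<close>)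
    have der: "((\<lambda>a. f (x + (a *\<^sub>R u + b *\<^sub>R w))) has_real_derivative g (x + (a *\<^sub>R u + b *\<^sub>R w)) \<bullet> u) (at a)"
      if "0 \<le> a" "a \<le> t" "0 \<le> b" "b \<le> t" for a b
    proof -
      have "((\<lambda>a. x + (a *\<^sub>R u + b *\<^sub>R w)) has_derivative (\<lambda>h. h *\<^sub>R u)) (at a)" by (auto intro!: derivative_eq_intros)
      from has_derivative_compose[OF this f[OF inS[OF that], unfolded has_grad_def]]
      show ?thesis by (simp add: has_field_derivative_def mult.commute[of _ "_ \<bullet> u"])
    qed
    have "\<exists>z>0. z < t \<and> (f (x + (t *\<^sub>R u + t *\<^sub>R w)) - f (x + (t *\<^sub>R u + 0 *\<^sub>R w))) - (f (x + (0 *\<^sub>R u + t *\<^sub>R w)) - f (x + (0 *\<^sub>R u + 0 *\<^sub>R w)))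
       = (t - 0) * (g (x + (z *\<^sub>R u + t *\<^sub>R w)) \<bullet> u - g (x + (z *\<^sub>R u + 0 *\<^sub>R w)) \<bullet> u)"
      by (rule MVT2[OF t(1) DERIV_diff[OF der der]]) (use t in auto)
    then obtain z where z: "0 < z" "z < t" "f (x + t *\<^sub>R u + t *\<^sub>R w) - f (x + t *\<^sub>R u) - f (x + t *\<^sub>R w) + f x
       = t * ((g (x + (z *\<^sub>R u + t *\<^sub>R w)) - g (x + (z *\<^sub>R u + 0 *\<^sub>R w))) \<bullet> u)"
      by (auto simp: add.assoc inner_diff_left)
    let ?p = "z *\<^sub>R u + t *\<^sub>R w" and ?q = "z *\<^sub>R u + 0 *\<^sub>R w"
    have b1: "norm (g (x + ?p) - g x - A *v ?p) \<le> e * norm ?p"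
      using d1(2)[of "x + ?p"] small(2)[of z t] z t by simp
    have b2: "norm (g (x + ?q) - g x - A *v ?q) \<le> e * norm ?q"
      using d1(2)[of "x + ?q"] small(2)[of z 0] z t by simp
    define err where "err = (g (x + ?p) - g x - A *v ?p) - (g (x + ?q) - g x - A *v ?q)"
    have eq: "g (x + ?p) - g (x + ?q) = t *\<^sub>R (A *v w) + err"
      by (simp add: err_def matrix_vector_right_distrib matrix_vector_mult_scaleR)
    have np: "norm ?p \<le> t * norm u + t * norm w"
    proof -
      have "norm ?p \<le> z * norm u + t * norm w" using norm_triangle_ineq[of "z *\<^sub>R u" "t *\<^sub>R w"] z t by simp
      also have "\<dots> \<le> t * norm u + t * norm w" using z by (intro add_mono mult_right_mono) auto
      finally show ?thesis .
    qed
    have nq: "norm ?q \<le> t * norm u" using z by (simp add: mult_right_mono)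
    have "norm err \<le> e * norm ?p + e * norm ?q"
      using norm_triangle_ineq4[of "g (x + ?p) - g x - A *v ?p" "g (x + ?q) - g x - A *v ?q"] b1 b2 unfolding err_def by linarith
    also have "\<dots> \<le> e * (t * norm u + t * norm w) + e * (t * norm u)"
      using np nq e by (intro add_mono mult_left_mono) auto
    finally have ne: "norm err \<le> e * t * (2 * norm u + norm w)" by (simp add: algebra_simps)
    have "f (x + t *\<^sub>R u + t *\<^sub>R w) - f (x + t *\<^sub>R u) - f (x + t *\<^sub>R w) + f x - t\<^sup>2 * ((A *v w) \<bullet> u) = t * (err \<bullet> u)"
      unfolding z(3) eq by (simp add: inner_add_left power2_eq_square algebra_simps)
    also have "\<bar>t * (err \<bullet> u)\<bar> \<le> t * (norm err * norm u)"
      using t Cauchy_Schwarz_ineq2[of err u] by (simp add: abs_mult)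
    also have "\<dots> \<le> t * (e * t * (2 * norm u + norm w) * norm u)"
      using t ne by (intro mult_left_mono mult_right_mono) auto
    finally show "\<bar>f (x + t *\<^sub>R u + t *\<^sub>R w) - f (x + t *\<^sub>R u) - f (x + t *\<^sub>R w) + f x - t\<^sup>2 * ((A *v w) \<bullet> u)\<bar>
      \<le> e * t\<^sup>2 * ((2 * norm u + norm w) * norm u)" by (simp add: power2_eq_square mult_ac)
  qed
qed

lemma hessian_symmetric:
  assumes S: "open S" "x \<in> S" and f: "\<And>y. y \<in> S \<Longrightarrow> has_grad f (g y) y" and A: "has_jac g A x"
  shows "transpose A = A"
proof -
  have sym: "(A *v w) \<bullet> u = (A *v u) \<bullet> w" for u w
  proof (rule ccontr)
    assume ne: "(A *v w) \<bullet> u \<noteq> (A *v u) \<bullet> w"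
    define C where "C = (2 * norm u + norm w) * norm u + (2 * norm w + norm u) * norm w + 1"
    have C: "C > 0" by (simp add: C_def add_nonneg_pos)
    define e where "e = \<bar>(A *v w) \<bullet> u - (A *v u) \<bullet> w\<bar> / (2 * C)"
    have e: "e > 0" using ne C by (simp add: e_def)
    obtain d1 where d1: "d1 > 0" "\<And>t. 0 < t \<Longrightarrow> t < d1 \<Longrightarrow>
      \<bar>f (x + t *\<^sub>R u + t *\<^sub>R w) - f (x + t *\<^sub>R u) - f (x + t *\<^sub>R w) + f x - t\<^sup>2 * ((A *v w) \<bullet> u)\<bar>
      \<le> e * t\<^sup>2 * ((2 * norm u + norm w) * norm u)"
      by (rule second_difference_estimate[OF S f A e], assumption, rule that)
    obtain d2 where d2: "d2 > 0" "\<And>t. 0 < t \<Longrightarrow> t < d2 \<Longrightarrow>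
      \<bar>f (x + t *\<^sub>R w + t *\<^sub>R u) - f (x + t *\<^sub>R w) - f (x + t *\<^sub>R u) + f x - t\<^sup>2 * ((A *v u) \<bullet> w)\<bar>
      \<le> e * t\<^sup>2 * ((2 * norm w + norm u) * norm w)"
      by (rule second_difference_estimate[OF S f A e], assumption, rule that)
    define t where "t = min d1 d2 / 2"
    have t: "0 < t" "t < d1" "t < d2" using d1 d2 by (auto simp: t_def)
    have sw: "x + t *\<^sub>R w + t *\<^sub>R u = x + t *\<^sub>R u + t *\<^sub>R w" by simp
    have "\<bar>t\<^sup>2 * ((A *v w) \<bullet> u) - t\<^sup>2 * ((A *v u) \<bullet> w)\<bar>
       \<le> e * t\<^sup>2 * ((2 * norm u + norm w) * norm u) + e * t\<^sup>2 * ((2 * norm w + norm u) * norm w)"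
      using d1(2)[OF t(1,2)] d2(2)[OF t(1,3)] unfolding sw by linarith
    also have "\<dots> \<le> t\<^sup>2 * (e * C)" using e by (simp add: C_def algebra_simps)
    finally have "t\<^sup>2 * \<bar>(A *v w) \<bullet> u - (A *v u) \<bullet> w\<bar> \<le> t\<^sup>2 * (e * C)"
      by (simp add: abs_mult flip: right_diff_distrib)
    then have "\<bar>(A *v w) \<bullet> u - (A *v u) \<bullet> w\<bar> \<le> e * C" using t by simp
    also have "\<dots> = \<bar>(A *v w) \<bullet> u - (A *v u) \<bullet> w\<bar> / 2" using C by (simp add: e_def)
    finally show False using ne by simp
  qed
  have "A $ i $ j = A $ j $ i" for i j
    using sym[of "axis j 1" "axis i 1"] by (simp add: inner_axis matrix_vector_mul_component)
  then show ?thesis by (simp add: transpose_def vec_eq_iff)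
qed

lemma increasing_direction:
  assumes f: "has_grad f g x" and e: "g \<bullet> e > 0"
  obtains d where "d > 0" "\<And>t. 0 < t \<Longrightarrow> t < d \<Longrightarrow> f (x + t *\<^sub>R e) > f x"
proof -
  have "((\<lambda>t. x + t *\<^sub>R e) has_derivative (\<lambda>h. h *\<^sub>R e)) (at 0)" by (auto intro!: derivative_eq_intros)
  moreover have "(f has_derivative (\<bullet>) g) (at (x + 0 *\<^sub>R e))" using f by (simp add: has_grad_def)
  ultimately have "((\<lambda>t. f (x + t *\<^sub>R e)) has_derivative (\<lambda>h. g \<bullet> (h *\<^sub>R e))) (at 0)" by (rule has_derivative_compose)
  then have D: "((\<lambda>t. f (x + t *\<^sub>R e)) has_real_derivative (g \<bullet> e)) (at 0)"
    by (simp add: has_field_derivative_def mult.commute[of _ "g \<bullet> e"])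
  from DERIV_pos_inc_right[OF D e] obtain d where "d > 0" "\<forall>h>0. h < d \<longrightarrow> f (x + 0 *\<^sub>R e) < f (x + (0 + h) *\<^sub>R e)" by blast
  then show ?thesis using that[of d] by simp
qed

lemma has_grad_imp_grad:
  assumes "has_grad f g x" "open U" "x \<in> U" shows "grad U f x = g"
proof -
  have "frechet_derivative f (at x within U) = (\<bullet>) g"
    unfolding at_within_open[OF assms(3,2)]
    using frechet_derivative_at[OF assms(1)[unfolded has_grad_def]] by simp
  then show ?thesis by (simp add: grad_def vec_eq_iff inner_axis)
qed

definition is_C2 :: "R3 set \<Rightarrow> (R3 \<Rightarrow> real) \<Rightarrow> (R3 \<Rightarrow> R3) \<Rightarrow> (R3 \<Rightarrow> real^3^3) \<Rightarrow> bool" where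
  "is_C2 S f g A \<longleftrightarrow> (\<forall>x\<in>S. has_grad f (g x) x \<and> has_jac g (A x) x) \<and> continuous_on S A"

lemma is_C2_continuous:
  assumes "is_C2 S f g A" shows "continuous_on S f" "continuous_on S g"
  using assms by (auto simp: is_C2_def intro!: continuous_at_imp_continuous_on intro: has_grad_continuous has_jac_continuous)

lemma has_derivative_blinfun_imp_grad:
  assumes "(f has_derivative blinfun_apply f') (at x)"
  shows "has_grad f (\<chi> i. blinfun_apply f' (axis i 1)) x"
proof -
  have "blinfun_apply f' h = (\<chi> i. blinfun_apply f' (axis i 1)) \<bullet> h" for h :: R3
  proof -
    have "h = (\<Sum>i\<in>UNIV. (h $ i) *\<^sub>R axis i 1)" using basis_expansion[of h] by (simp add: scalar_mult_eq_scaleR)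
    then have "blinfun_apply f' h = (\<Sum>i\<in>UNIV. (h $ i) *\<^sub>R blinfun_apply f' (axis i 1))"
      by (metis (no_types, lifting) blinfun.scaleR_right blinfun.sum_right sum.cong)
    then show ?thesis by (simp add: inner_vec_def mult.commute)
  qed
  then have "blinfun_apply f' = (\<bullet>) (\<chi> i. blinfun_apply f' (axis i 1))" by blast
  then show ?thesis using assms by (simp add: has_grad_def)
qed

lemma C2_on_open_imp_is_C2:
  assumes "open U" "C2_on U (\<phi> :: R3 \<Rightarrow> real)"
  obtains A where "is_C2 U \<phi> (grad U \<phi>) A"
proof -
  obtain f' :: "R3 \<Rightarrow> R3 \<Rightarrow>\<^sub>L real" and f'' :: "R3 \<Rightarrow> R3 \<Rightarrow>\<^sub>L R3 \<Rightarrow>\<^sub>L real" where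
    f': "\<And>x. x \<in> U \<Longrightarrow> (\<phi> has_derivative blinfun_apply (f' x)) (at x)" and
    f'': "\<And>x. x \<in> U \<Longrightarrow> (f' has_derivative blinfun_apply (f'' x)) (at x)" and c: "continuous_on U f''"
    using assms(2) unfolding C2_on_def by (metis (no_types, lifting) assms(1) at_within_open)
  have g: "grad U \<phi> x = (\<chi> i. blinfun_apply (f' x) (axis i 1))" if "x \<in> U" for x
    by (rule has_grad_imp_grad[OF has_derivative_blinfun_imp_grad[OF f'[OF that]] assms(1) that])
  define A :: "R3 \<Rightarrow> real^3^3" where "A x = (\<chi> i j. blinfun_apply (blinfun_apply (f'' x) (axis j 1)) (axis i 1))" for x
  have "has_jac (grad U \<phi>) (A x) x" if x: "x \<in> U" for x
  proof -
    have "((\<lambda>x. \<chi> i. blinfun_apply (f' x) (axis i 1)) has_derivative (\<lambda>h. \<chi> i. blinfun_apply (blinfun_apply (f'' x) h) (axis i 1))) (at x)"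
    proof (rule has_derivative_componentwise_within[THEN iffD2], rule ballI)
      fix b :: R3 assume "b \<in> Basis"
      then obtain i where b: "b = axis i 1" by (auto simp: Basis_vec_def)
      show "((\<lambda>x. (\<chi> i. blinfun_apply (f' x) (axis i 1)) \<bullet> b) has_derivative
          (\<lambda>h. (\<chi> i. blinfun_apply (blinfun_apply (f'' x) h) (axis i 1)) \<bullet> b)) (at x)"
        using bounded_linear.has_derivative[OF blinfun.bounded_linear_left f''[OF x]] by (simp add: b inner_axis)
    qed
    moreover have "(\<lambda>h. \<chi> i. blinfun_apply (blinfun_apply (f'' x) h) (axis i 1)) = (*v) (A x)"
    proof
      fix h :: R3
      have "h = (\<Sum>j\<in>UNIV. (h $ j) *\<^sub>R axis j 1)" using basis_expansion[of h] by (simp add: scalar_mult_eq_scaleR)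
      then have "blinfun_apply (f'' x) h = (\<Sum>j\<in>UNIV. (h $ j) *\<^sub>R blinfun_apply (f'' x) (axis j 1))"
        by (metis (no_types, lifting) blinfun.scaleR_right blinfun.sum_right sum.cong)
      then show "(\<chi> i. blinfun_apply (blinfun_apply (f'' x) h) (axis i 1)) = A x *v h"
        by (simp add: A_def matrix_vector_mult_def vec_eq_iff blinfun.sum_left blinfun.scaleR_left mult.commute)
    qed
    ultimately have "has_jac (\<lambda>x. \<chi> i. blinfun_apply (f' x) (axis i 1)) (A x) x" by (simp add: has_jac_def)
    then show ?thesis by (rule has_jac_cong_open[OF _ assms(1) x]) (simp add: g)
  qed
  moreover have "has_grad \<phi> (grad U \<phi> x) x" if "x \<in> U" for x
    using has_derivative_blinfun_imp_grad[OF f'[OF that]] g[OF that] by simp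
  moreover have "continuous_on U A"
    unfolding A_def by (intro continuous_on_vec_lambda continuous_intros c)
  ultimately show ?thesis using that unfolding is_C2_def by blast
qed

lemma is_C2_add:
  assumes "is_C2 S f g A" "is_C2 S f2 g2 A2"
  shows "is_C2 S (\<lambda>x. f x + f2 x) (\<lambda>x. g x + g2 x) (\<lambda>x. A x + A2 x)"
  using assms unfolding is_C2_def by (auto intro!: has_grad_add has_jac_add continuous_intros)

lemma is_C2_cmul:
  assumes "is_C2 S f g A"
  shows "is_C2 S (\<lambda>x. c * f x) (\<lambda>x. c *\<^sub>R g x) (\<lambda>x. c *\<^sub>R A x)"
  using assms has_grad_mult[OF has_grad_const[of c]] unfolding is_C2_def by (fastforce intro!: has_jac_cmul continuous_intros)

lemma is_C2_mult:
  assumes f: "is_C2 S f g A" and f2: "is_C2 S f2 g2 A2"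
  shows "is_C2 S (\<lambda>x. f x * f2 x) (\<lambda>x. f2 x *\<^sub>R g x + f x *\<^sub>R g2 x)
    (\<lambda>x. (f2 x *\<^sub>R A x + outer (g x) (g2 x)) + (f x *\<^sub>R A2 x + outer (g2 x) (g x)))"
proof -
  have c: "continuous_on S f" "continuous_on S g" "continuous_on S f2" "continuous_on S g2"
    by (rule is_C2_continuous[OF f] is_C2_continuous[OF f2])+
  show ?thesis using f f2 c unfolding is_C2_def
    by (auto intro!: has_grad_mult has_jac_add has_jac_scaleR continuous_intros)
qed

lemma is_C2_sum:
  assumes "finite Z" "\<And>z. z \<in> Z \<Longrightarrow> is_C2 S (P z) (G z) (B z)"
  shows "is_C2 S (\<lambda>x. \<Sum>z\<in>Z. P z x) (\<lambda>x. \<Sum>z\<in>Z. G z x) (\<lambda>x. \<Sum>z\<in>Z. B z x)"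
  using assms
proof (induction Z)
  case empty
  show ?case unfolding is_C2_def using has_grad_const[of 0] has_jac_const[of 0] by simp
next
  case (insert z Z)
  then show ?case using is_C2_add[of S "P z" "G z" "B z"] by simp
qed

lemma is_C2_glue_zero:
  assumes S: "open S" and f: "is_C2 S f g A" and K: "closed K" "K \<subseteq> S" and z: "\<And>x. x \<in> S \<Longrightarrow> x \<notin> K \<Longrightarrow> f x = 0"
  shows "is_C2 UNIV (\<lambda>x. if x \<in> S then f x else 0) (\<lambda>x. if x \<in> S then g x else 0) (\<lambda>x. if x \<in> S then A x else 0)"
proof -
  let ?f = "\<lambda>x. if x \<in> S then f x else 0" and ?g = "\<lambda>x. if x \<in> S then g x else 0" and ?A = "\<lambda>x. if x \<in> S then A x else 0"
  have oK: "open (- K)" using K by blast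
  have g0: "?g x = 0" if "x \<notin> K" for x
  proof (cases "x \<in> S")
    case True
    have "has_grad f 0 x"
      by (rule has_grad_cong_open[OF has_grad_const open_Int[OF S oK]]) (use True that z in auto)
    then show ?thesis using f True has_grad_unique unfolding is_C2_def by auto
  qed simp
  have A0: "?A x = 0" if "x \<notin> K" for x
  proof (cases "x \<in> S")
    case True
    have "has_jac g 0 x"
    proof (rule has_jac_cong_open[OF has_jac_const open_Int[OF S oK]])
      show "0 = g y" if "y \<in> S \<inter> - K" for y using g0[of y] that by simp
    qed (use True that in simp)
    then show ?thesis using f True has_jac_unique unfolding is_C2_def by auto
  qed simp
  have d: "has_grad ?f (?g x) x \<and> has_jac ?g (?A x) x" for x
  proof (cases "x \<in> S")
    case True
    have "has_grad ?f (g x) x" by (rule has_grad_cong_open[OF _ S True]) (use f True in \<open>auto simp: is_C2_def\<close>)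
    moreover have "has_jac ?g (A x) x" by (rule has_jac_cong_open[OF _ S True]) (use f True in \<open>auto simp: is_C2_def\<close>)
    ultimately show ?thesis using True by simp
  next
    case False
    then have x: "x \<in> - K" using K by blast
    have "has_grad ?f 0 x" by (rule has_grad_cong_open[OF has_grad_const oK x]) (use z in auto)
    moreover have "has_jac ?g 0 x" by (rule has_jac_cong_open[OF has_jac_const oK x]) (use g0 in auto)
    ultimately show ?thesis using False by simp
  qed
  have "continuous_on S ?A" by (rule continuous_on_eq[of _ A]) (use f in \<open>auto simp: is_C2_def\<close>)
  moreover have "continuous_on (- K) ?A" by (rule continuous_on_eq[of _ "\<lambda>x. 0"]) (use A0 in auto)
  ultimately have "continuous_on (S \<union> - K) ?A" by (intro continuous_on_open_Un S oK)
  moreover have "S \<union> - K = UNIV" using K by blast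
  ultimately show ?thesis using d unfolding is_C2_def by simp
qed

definition bump3 :: "real \<Rightarrow> R3 \<Rightarrow> R3 \<Rightarrow> real" where
  "bump3 c z x = (max 0 (c - (x - z) \<bullet> (x - z)))^3"

lemma is_C2_max_cube:
  fixes u :: "R3 \<Rightarrow> real"
  assumes "is_C2 S u g A"
  shows "is_C2 S (\<lambda>x. (max 0 (u x))^3) (\<lambda>x. (3 * (max 0 (u x))\<^sup>2) *\<^sub>R g x)
     (\<lambda>x. (3 * (max 0 (u x))\<^sup>2) *\<^sub>R A x + outer (g x) ((6 * max 0 (u x)) *\<^sub>R g x))"
proof -
  have c: "continuous_on S u" "continuous_on S g"
    by (rule is_C2_continuous[OF assms])+
  have 1: "has_grad (\<lambda>x. 3 * (max 0 (u x))\<^sup>2) ((6 * max 0 (u x)) *\<^sub>R g x) x" if "x \<in> S" for x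
    using has_grad_mult[OF has_grad_const[of 3] has_grad_chain[OF has_real_derivative_max_power2, of u "g x" x]] assms that
    unfolding is_C2_def by simp
  have 2: "has_grad (\<lambda>x. (max 0 (u x))^3) ((3 * (max 0 (u x))\<^sup>2) *\<^sub>R g x) x" if "x \<in> S" for x
    by (rule has_grad_chain[OF has_real_derivative_max_power3]) (use assms that in \<open>simp add: is_C2_def\<close>)
  show ?thesis unfolding is_C2_def
    using 1 2 assms by (auto intro!: has_jac_scaleR continuous_intros c simp: is_C2_def)
qed

lemma is_C2_quadratic: "is_C2 S (\<lambda>x. c - k * ((x - z) \<bullet> (x - z))) (\<lambda>x. - ((2 * k) *\<^sub>R (x - z))) (\<lambda>x. - ((2 * k) *\<^sub>R mat 1))"
proof -
  have j: "has_jac (\<lambda>y. y - z) (mat 1) x" for x using has_jac_diff[OF has_jac_id has_jac_const, of z] by simp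
  have "has_grad (\<lambda>x. c - k * ((x - z) \<bullet> (x - z))) (- ((2 * k) *\<^sub>R (x - z))) x" for x
    using has_grad_diff[OF has_grad_const[of c] has_grad_mult[OF has_grad_const[of k] has_grad_inner[OF j j]]]
    by (simp add: transpose_mat mult.commute flip: scaleR_2)
  moreover have "has_jac (\<lambda>x. - ((2 * k) *\<^sub>R (x - z))) (- ((2 * k) *\<^sub>R mat 1)) x" for x
    by (intro has_jac_minus has_jac_cmul j)
  ultimately show ?thesis by (simp add: is_C2_def)
qed

lemma bump3_pos_iff: "e > 0 \<Longrightarrow> bump3 (e\<^sup>2) z x > 0 \<longleftrightarrow> norm (x - z) < e"
proof -
  assume e: "e > 0"
  have "(x - z) \<bullet> (x - z) < e\<^sup>2 \<longleftrightarrow> norm (x - z) < e"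
    unfolding power2_norm_eq_inner[symmetric] using e
    by (auto intro: power_less_imp_less_base power_strict_mono)
  then show ?thesis by (auto simp: bump3_def max_def)
qed

lemma bump3_nonneg: "bump3 c z x \<ge> 0" by (simp add: bump3_def)

lemma C2_defining_grad:
  assumes "C2_defining \<Omega> x U \<phi>" shows "has_grad \<phi> (grad U \<phi> x) x"
proof -
  have U: "open U" "x \<in> U" "C2_on U \<phi>" using assms by (auto simp: C2_defining_def)
  obtain A where "is_C2 U \<phi> (grad U \<phi>) A" by (rule C2_on_open_imp_is_C2[OF U(1,3)], rule that)
  then show ?thesis using U(2) by (simp add: is_C2_def)
qed

lemma outer_normal_unique:
  assumes d1: "C2_defining \<Omega> x U \<phi>" and d2: "C2_defining \<Omega> x V \<psi>" and x: "x \<in> frontier \<Omega>"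
  shows "grad U \<phi> x /\<^sub>R norm (grad U \<phi> x) = grad V \<psi> x /\<^sub>R norm (grad V \<psi> x)"
proof (rule ccontr)
  let ?n1 = "grad U \<phi> x /\<^sub>R norm (grad U \<phi> x)" and ?n2 = "grad V \<psi> x /\<^sub>R norm (grad V \<psi> x)"
  assume ne: "?n1 \<noteq> ?n2"
  have nz: "grad U \<phi> x \<noteq> 0" "grad V \<psi> x \<noteq> 0" using d1 d2 by (auto simp: C2_defining_def)
  have u: "norm ?n1 = 1" "norm ?n2 = 1" using nz by simp_all
  have uu: "?n1 \<bullet> ?n1 = 1" "?n2 \<bullet> ?n2 = 1" using u by (simp_all only: norm_eq_1)
  have lt: "?n1 \<bullet> ?n2 < 1"
  proof -
    have "0 < (?n1 - ?n2) \<bullet> (?n1 - ?n2)" using ne by simp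
    also have "\<dots> = 2 - 2 * (?n1 \<bullet> ?n2)" using uu by (simp only: inner_diff_left inner_diff_right inner_commute[of ?n2 ?n1])
    finally show ?thesis by simp
  qed
  define e where "e = ?n2 - ?n1"
  have 1: "(- grad U \<phi> x) \<bullet> e > 0"
  proof -
    have "?n1 \<bullet> e < 0" using lt uu by (simp only: e_def inner_diff_right)
    moreover have "grad U \<phi> x = norm (grad U \<phi> x) *\<^sub>R ?n1" using nz by simp
    ultimately show ?thesis using nz(1)
      by (metis inner_minus_left inner_scaleR_left mult_pos_neg neg_0_less_iff_less zero_less_norm_iff)
  qed
  have 2: "grad V \<psi> x \<bullet> e > 0"
  proof -
    have "?n2 \<bullet> e > 0" using lt uu by (simp only: e_def inner_diff_right inner_commute[of ?n2 ?n1])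
    moreover have "grad V \<psi> x = norm (grad V \<psi> x) *\<^sub>R ?n2" using nz by simp
    ultimately show ?thesis using nz(2) by (metis inner_scaleR_left mult_pos_pos zero_less_norm_iff)
  qed
  obtain a where a: "a > 0" "\<And>t. 0 < t \<Longrightarrow> t < a \<Longrightarrow> - \<phi> (x + t *\<^sub>R e) > - \<phi> x"
    by (rule increasing_direction[OF has_grad_minus[OF C2_defining_grad[OF d1]] 1], rule that)
  obtain b where b: "b > 0" "\<And>t. 0 < t \<Longrightarrow> t < b \<Longrightarrow> \<psi> (x + t *\<^sub>R e) > \<psi> x"
    by (rule increasing_direction[OF C2_defining_grad[OF d2] 2], rule that)
  have z: "\<phi> x = 0" "\<psi> x = 0" using d1 d2 x by (auto simp: C2_defining_def)
  have "open (U \<inter> V)" "x \<in> U \<inter> V" using d1 d2 by (auto simp: C2_defining_def)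
  then obtain c where c: "c > 0" "ball x c \<subseteq> U \<inter> V" by (rule openE)
  define m where "m = min (min a b) (c / (norm e + 1))"
  define t where "t = m / 2"
  have ne1: "norm e + 1 > 0" by (simp add: add_nonneg_pos)
  have cp: "c / (norm e + 1) > 0" using c ne1 by simp
  have t: "0 < t" "t < a" "t < b" "t < c / (norm e + 1)"   proof -
    have "m > 0" "m \<le> a" "m \<le> b" "m \<le> c / (norm e + 1)" using a(1) b(1) cp by (auto simp: m_def)
    moreover have "0 < t" "t < m" using \<open>m > 0\<close> by (simp_all add: t_def)
    ultimately show "0 < t" "t < a" "t < b" "t < c / (norm e + 1)" by linarith+
  qed
  have "t * norm e < c"
  proof -
    have "t * norm e \<le> t * (norm e + 1)" using t by simp
    also have "\<dots> < c" using t(4) ne1 by (simp add: pos_less_divide_eq)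
    finally show ?thesis .
  qed
  then have y: "x + t *\<^sub>R e \<in> U \<inter> V" using t by (intro subsetD[OF c(2)]) (simp add: dist_norm)
  have "\<phi> (x + t *\<^sub>R e) < 0" "\<psi> (x + t *\<^sub>R e) > 0" using a(2)[OF t(1,2)] b(2)[OF t(1,3)] z by simp_all
  then have "x + t *\<^sub>R e \<in> \<Omega> \<inter> U" "x + t *\<^sub>R e \<notin> \<Omega> \<inter> V" using d1 d2 y by (auto simp: C2_defining_def)
  then show False using y by blast
qed

lemma outer_normal_eq:
  assumes "C2_defining \<Omega> x U \<phi>" "x \<in> frontier \<Omega>"
  shows "outer_normal \<Omega> x = grad U \<phi> x /\<^sub>R norm (grad U \<phi> x)"
  unfolding outer_normal_def
proof (rule the_equality)
  fix n assume "\<exists>V \<psi>. C2_defining \<Omega> x V \<psi> \<and> n = grad V \<psi> x /\<^sub>R norm (grad V \<psi> x)"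
  then show "n = grad U \<phi> x /\<^sub>R norm (grad U \<phi> x)" using outer_normal_unique[OF assms(1) _ assms(2)] by metis
qed (use assms in blast)

lemma complement_cases:
  obtains "(x::R3) \<in> interior \<Omega>" | "x \<in> frontier \<Omega>" | "x \<notin> closure \<Omega>"
  using frontier_def by blast

definition defining_piece :: "R3 set \<Rightarrow> R3 \<Rightarrow> real \<Rightarrow> (R3 \<Rightarrow> real) \<Rightarrow> (R3 \<Rightarrow> R3) \<Rightarrow> (R3 \<Rightarrow> real^3^3) \<Rightarrow> bool" where
  "defining_piece \<Omega> z e P G B \<longleftrightarrow> is_C2 UNIV P G B \<and>
    (\<forall>x\<in>\<Omega>. P x \<ge> 0 \<and> (norm (x - z) < e \<longrightarrow> P x > 0)) \<and>
    (\<forall>x. x \<notin> closure \<Omega> \<longrightarrow> P x \<le> 0 \<and> (norm (x - z) < e \<longrightarrow> P x < 0)) \<and>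
    (\<forall>x\<in>frontier \<Omega>. P x = 0 \<and> (\<exists>c\<ge>0. G x = - (c *\<^sub>R outer_normal \<Omega> x) \<and> (norm (x - z) < e \<longrightarrow> c > 0)))"

lemma local_defining_piece:
  assumes dom: "C2_domain \<Omega>"
  shows "\<exists>e>0. \<exists>P G B. is_C2 UNIV P G B \<and>
    (\<forall>x\<in>\<Omega>. P x \<ge> 0 \<and> (norm (x - z) < e \<longrightarrow> P x > 0)) \<and>
    (\<forall>x. x \<notin> closure \<Omega> \<longrightarrow> P x \<le> 0 \<and> (norm (x - z) < e \<longrightarrow> P x < 0)) \<and>
    (\<forall>x\<in>frontier \<Omega>. P x = 0 \<and> (\<exists>c\<ge>0. G x = - (c *\<^sub>R outer_normal \<Omega> x) \<and> (norm (x - z) < e \<longrightarrow> c > 0)))"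
proof -
  have o\<Omega>: "open \<Omega>" using dom by (simp add: C2_domain_def)
  have fd: "\<Omega> \<inter> frontier \<Omega> = {}" using o\<Omega> by (simp add: frontier_def interior_open)
  let ?g = "\<lambda>e x. (3 * (max 0 (e\<^sup>2 - 1 * ((x - z) \<bullet> (x - z))))\<^sup>2) *\<^sub>R - ((2 * 1) *\<^sub>R (x - z))"
  have b: "\<exists>B. is_C2 UNIV (bump3 (e\<^sup>2) z) (?g e) B" for e
    using is_C2_max_cube[OF is_C2_quadratic[of UNIV "e\<^sup>2" 1 z]] unfolding bump3_def[abs_def] by auto
  have g0: "?g e x = 0" "bump3 (e\<^sup>2) z x = 0" if "norm (x - z) \<ge> e" "e > 0" for e x
  proof -
    have "e\<^sup>2 \<le> (norm (x - z))\<^sup>2" using that by (intro power_mono) auto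
    then have "e\<^sup>2 \<le> (x - z) \<bullet> (x - z)" by (simp add: power2_norm_eq_inner)
    then show "?g e x = 0" "bump3 (e\<^sup>2) z x = 0" by (simp_all add: bump3_def)
  qed
  show ?thesis
  proof (cases z \<Omega> rule: complement_cases)
    case 1
    then obtain e where e: "e > 0" "ball z e \<subseteq> \<Omega>" using o\<Omega> by (metis interior_open openE)
    obtain B where B: "is_C2 UNIV (bump3 (e\<^sup>2) z) (?g e) B" using b by blast
    have out: "norm (x - z) \<ge> e" if "x \<notin> \<Omega>" for x
      using e(2) that by (force simp: dist_norm norm_minus_commute not_less[symmetric])
    have 1: "\<forall>x\<in>\<Omega>. bump3 (e\<^sup>2) z x \<ge> 0 \<and> (norm (x - z) < e \<longrightarrow> bump3 (e\<^sup>2) z x > 0)"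
      using bump3_nonneg bump3_pos_iff[OF e(1)] by blast
    have 2: "\<forall>x. x \<notin> closure \<Omega> \<longrightarrow> bump3 (e\<^sup>2) z x \<le> 0 \<and> (norm (x - z) < e \<longrightarrow> bump3 (e\<^sup>2) z x < 0)"
      using g0(2)[OF _ e(1)] out closure_subset[of \<Omega>] by (metis not_less order_refl subsetD)
    have 3: "\<forall>x\<in>frontier \<Omega>. bump3 (e\<^sup>2) z x = 0 \<and> (\<exists>c\<ge>0. ?g e x = - (c *\<^sub>R outer_normal \<Omega> x) \<and> (norm (x - z) < e \<longrightarrow> c > 0))"
    proof
      fix x assume "x \<in> frontier \<Omega>"
      then have n: "norm (x - z) \<ge> e" using fd out by blast
      show "bump3 (e\<^sup>2) z x = 0 \<and> (\<exists>c\<ge>0. ?g e x = - (c *\<^sub>R outer_normal \<Omega> x) \<and> (norm (x - z) < e \<longrightarrow> c > 0))"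
        using g0[OF n e(1)] n by (intro conjI exI[of _ 0]) auto
    qed
    show ?thesis using e(1) B 1 2 3 by blast
  next
    case 3
    then obtain e where e: "e > 0" "ball z e \<subseteq> - closure \<Omega>" by (metis closed_closure open_Compl ComplI openE)
    obtain B where B: "is_C2 UNIV (bump3 (e\<^sup>2) z) (?g e) B" using b by blast
    have out: "norm (x - z) \<ge> e" if "x \<in> closure \<Omega>" for x
      using e(2) that by (force simp: dist_norm norm_minus_commute not_less[symmetric])
    let ?P = "\<lambda>x. - 1 * bump3 (e\<^sup>2) z x"
    have C: "is_C2 UNIV ?P (\<lambda>x. - 1 *\<^sub>R ?g e x) (\<lambda>x. - 1 *\<^sub>R B x)" by (rule is_C2_cmul[OF B])
    have 1: "\<forall>x\<in>\<Omega>. ?P x \<ge> 0 \<and> (norm (x - z) < e \<longrightarrow> ?P x > 0)"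
      using g0(2)[OF _ e(1)] out closure_subset[of \<Omega>] by (metis mult_zero_right not_less order_refl subsetD)
    have 2: "\<forall>x. x \<notin> closure \<Omega> \<longrightarrow> ?P x \<le> 0 \<and> (norm (x - z) < e \<longrightarrow> ?P x < 0)"
      using bump3_nonneg[of "e\<^sup>2" z] bump3_pos_iff[OF e(1), of z] by simp
    have 3: "\<forall>x\<in>frontier \<Omega>. ?P x = 0 \<and> (\<exists>c\<ge>0. - 1 *\<^sub>R ?g e x = - (c *\<^sub>R outer_normal \<Omega> x) \<and> (norm (x - z) < e \<longrightarrow> c > 0))"
    proof
      fix x assume "x \<in> frontier \<Omega>"
      then have n: "norm (x - z) \<ge> e" using out by (simp add: frontier_def)
      show "?P x = 0 \<and> (\<exists>c\<ge>0. - 1 *\<^sub>R ?g e x = - (c *\<^sub>R outer_normal \<Omega> x) \<and> (norm (x - z) < e \<longrightarrow> c > 0))"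
        using g0[OF n e(1)] n by (intro conjI exI[of _ 0]) auto
    qed
    show ?thesis using e(1) C 1 2 3 by blast
  next
    case 2
    obtain U \<phi> where d: "C2_defining \<Omega> z U \<phi>" using dom 2 unfolding C2_domain_def by blast
    have U: "open U" "z \<in> U" "C2_on U \<phi>" and gn: "\<And>y. y \<in> U \<Longrightarrow> grad U \<phi> y \<noteq> 0"
      and in\<Omega>: "\<And>y. y \<in> U \<Longrightarrow> y \<in> \<Omega> \<longleftrightarrow> \<phi> y < 0" and fr: "\<And>y. y \<in> U \<Longrightarrow> y \<in> frontier \<Omega> \<longleftrightarrow> \<phi> y = 0"
      using d unfolding C2_defining_def by blast+
    obtain A where A: "is_C2 U \<phi> (grad U \<phi>) A" by (rule C2_on_open_imp_is_C2[OF U(1,3)], rule that)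
    obtain e where e: "e > 0" "cball z e \<subseteq> U" using U open_contains_cball by blast
    obtain B where B: "is_C2 U (bump3 (e\<^sup>2) z) (?g e) B" using b[of e] by (auto simp: is_C2_def intro: continuous_on_subset)
    note P = is_C2_glue_zero[OF U(1) is_C2_mult[OF is_C2_cmul[OF A, of "-1"] B] closed_cball[of z e] e(2)]
    let ?Q = "\<lambda>x. - 1 * \<phi> x * bump3 (e\<^sup>2) z x"
    let ?G = "\<lambda>x. bump3 (e\<^sup>2) z x *\<^sub>R (- 1 *\<^sub>R grad U \<phi> x) + (- 1 * \<phi> x) *\<^sub>R ?g e x"
    let ?P = "\<lambda>x. if x \<in> U then ?Q x else 0" and ?GP = "\<lambda>x. if x \<in> U then ?G x else 0"
    have "?Q x = 0" if "x \<in> U" "x \<notin> cball z e" for x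
      using g0(2)[OF _ e(1), of x] that by (simp add: dist_norm norm_minus_commute)
    from P[OF this] obtain BP where BP: "is_C2 UNIV ?P ?GP BP" by blast
    have nU: "x \<in> U" if "norm (x - z) < e" for x
      using e(2) that by (force simp: dist_norm norm_minus_commute)
    have 1: "\<forall>x\<in>\<Omega>. ?P x \<ge> 0 \<and> (norm (x - z) < e \<longrightarrow> ?P x > 0)"
    proof
      fix x assume x: "x \<in> \<Omega>"
      show "?P x \<ge> 0 \<and> (norm (x - z) < e \<longrightarrow> ?P x > 0)"
      proof (cases "x \<in> U")
        case True
        then have "\<phi> x < 0" using in\<Omega> x by blast
        then show ?thesis using True bump3_nonneg[of "e\<^sup>2" z x] bump3_pos_iff[OF e(1), of z x]
          by (simp add: mult_nonpos_nonneg mult_neg_pos)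
      next
        case False then show ?thesis using nU[of x] by auto
      qed
    qed
    have 2: "\<forall>x. x \<notin> closure \<Omega> \<longrightarrow> ?P x \<le> 0 \<and> (norm (x - z) < e \<longrightarrow> ?P x < 0)"
    proof (intro allI impI)
      fix x assume x: "x \<notin> closure \<Omega>"
      show "?P x \<le> 0 \<and> (norm (x - z) < e \<longrightarrow> ?P x < 0)"
      proof (cases "x \<in> U")
        case True
        have "x \<notin> \<Omega>" using x closure_subset by blast
        then have "\<not> \<phi> x < 0" using in\<Omega> True by blast
        moreover have "x \<notin> frontier \<Omega>" using x by (simp add: frontier_def)
        then have "\<phi> x \<noteq> 0" using fr True by blast
        ultimately have "\<phi> x > 0" by simp
        then show ?thesis using True bump3_nonneg[of "e\<^sup>2" z x] bump3_pos_iff[OF e(1), of z x]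
          by (simp add: mult_nonneg_nonneg)
      next
        case False then show ?thesis using nU[of x] by auto
      qed
    qed
    have 3: "\<forall>x\<in>frontier \<Omega>. ?P x = 0 \<and> (\<exists>c\<ge>0. ?GP x = - (c *\<^sub>R outer_normal \<Omega> x) \<and> (norm (x - z) < e \<longrightarrow> c > 0))"
    proof
      fix x assume x: "x \<in> frontier \<Omega>"
      show "?P x = 0 \<and> (\<exists>c\<ge>0. ?GP x = - (c *\<^sub>R outer_normal \<Omega> x) \<and> (norm (x - z) < e \<longrightarrow> c > 0))"
      proof (cases "x \<in> U")
        case True
        then have z: "\<phi> x = 0" using fr x by blast
        have dx: "C2_defining \<Omega> x U \<phi>" using d True by (simp add: C2_defining_def)
        have "grad U \<phi> x = norm (grad U \<phi> x) *\<^sub>R outer_normal \<Omega> x"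
          using gn[OF True] by (simp add: outer_normal_eq[OF dx x])
        then have "?GP x = - ((bump3 (e\<^sup>2) z x * norm (grad U \<phi> x)) *\<^sub>R outer_normal \<Omega> x)"
          using True z by (metis (no_types, lifting) add.right_neutral mult_zero_right scaleR_minus_right scaleR_minus1_left scaleR_scaleR scaleR_zero_left)
        moreover have "bump3 (e\<^sup>2) z x * norm (grad U \<phi> x) \<ge> 0" by (simp add: bump3_nonneg)
        moreover have "norm (x - z) < e \<longrightarrow> bump3 (e\<^sup>2) z x * norm (grad U \<phi> x) > 0"
          using bump3_pos_iff[OF e(1), of z x] gn[OF True] by simp
        ultimately show ?thesis using True z by auto
      next
        case False then show ?thesis using nU[of x] by (intro conjI exI[of _ 0]) auto
      qed
    qed
    show ?thesis using e(1) BP 1 2 3 by blast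
  qed
qed

lemma global_defining_function:
  assumes dom: "C2_domain \<Omega>" and bd: "bounded \<Omega>"
  obtains \<Phi> g A where "is_C2 UNIV \<Phi> g A" "\<Omega> = {x. \<Phi> x > 0}" "frontier \<Omega> = {x. \<Phi> x = 0}"
    "bounded {x. \<Phi> x \<ge> - 1}" "\<And>x. \<Phi> x = 0 \<Longrightarrow> g x \<noteq> 0"
    "\<And>x. \<Phi> x = 0 \<Longrightarrow> outer_normal \<Omega> x = - (g x /\<^sub>R norm (g x))"
proof -
  have o\<Omega>: "open \<Omega>" using dom by (simp add: C2_domain_def)
  have "\<exists>e P G B. e > 0 \<and> defining_piece \<Omega> z e P G B" for z
    using local_defining_piece[OF dom, of z] unfolding defining_piece_def by blast
  then obtain e P G B where loc0: "\<And>z. e z > (0::real) \<and> defining_piece \<Omega> z (e z) (P z) (G z) (B z)"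
    by metis
  have loc: "e z > 0" "is_C2 UNIV (P z) (G z) (B z)"
    "x \<in> \<Omega> \<Longrightarrow> P z x \<ge> 0" "x \<in> \<Omega> \<Longrightarrow> norm (x - z) < e z \<Longrightarrow> P z x > 0"
    "x \<notin> closure \<Omega> \<Longrightarrow> P z x \<le> 0" "x \<notin> closure \<Omega> \<Longrightarrow> norm (x - z) < e z \<Longrightarrow> P z x < 0"
    "x \<in> frontier \<Omega> \<Longrightarrow> P z x = 0 \<and> (\<exists>c\<ge>0. G z x = - (c *\<^sub>R outer_normal \<Omega> x) \<and> (norm (x - z) < e z \<longrightarrow> c > 0))"
    for z x
    using loc0[of z] unfolding defining_piece_def by blast+
  obtain R where R: "R > 0" "closure \<Omega> \<subseteq> ball 0 R"
  proof -
    obtain a where "closure \<Omega> \<subseteq> ball 0 a" using bounded_subset_ballD[OF bounded_closure[OF bd], of 0] by blast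
    then show ?thesis using that[of "max a 1"] by (force simp: subset_iff)
  qed
  obtain Z where Z: "finite Z" "cball 0 R \<subseteq> (\<Union>z\<in>Z. ball z (e z))"
  proof -
    have c: "cball 0 R \<subseteq> (\<Union>z\<in>cball 0 R. ball z (e z))" using loc(1) by auto
    show ?thesis
      by (rule compactE_image[OF compact_cball _ c]) (auto intro: that)
  qed
  have near: "\<exists>z\<in>Z. norm (x - z) < e z" if "norm x \<le> R" for x
    using subsetD[OF Z(2), of x] that by (auto simp: dist_norm norm_minus_commute)
  let ?q = "\<lambda>x::R3. (max 0 (- (R\<^sup>2) - (- 1) * ((x - 0) \<bullet> (x - 0))))^3"
  let ?gq = "\<lambda>x::R3. (3 * (max 0 (- (R\<^sup>2) - (- 1) * ((x - 0) \<bullet> (x - 0))))\<^sup>2) *\<^sub>R - ((2 * - 1) *\<^sub>R (x - 0))"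
  obtain Bq where q: "is_C2 UNIV ?q ?gq Bq"
    using is_C2_max_cube[OF is_C2_quadratic[of UNIV "- (R\<^sup>2)" "- 1" 0]] by blast
  define \<Phi> where "\<Phi> x = (\<Sum>z\<in>Z. P z x) + - 1 * ?q x" for x
  define g where "g x = (\<Sum>z\<in>Z. G z x) + - 1 *\<^sub>R ?gq x" for x
  define A where "A x = (\<Sum>z\<in>Z. B z x) + - 1 *\<^sub>R Bq x" for x
  have C2: "is_C2 UNIV \<Phi> g A"
    unfolding \<Phi>_def g_def A_def by (rule is_C2_add[OF is_C2_sum[OF Z(1) loc(2)] is_C2_cmul[OF q]])
  have q0: "?q x = 0" "?gq x = 0" if "norm x \<le> R" for x
  proof -
    have "(norm x)\<^sup>2 \<le> R\<^sup>2" using that by (intro power_mono) auto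
    then show "?q x = 0" "?gq x = 0" by (simp_all add: power2_norm_eq_inner)
  qed
  have nR: "norm x \<le> R" if "x \<in> closure \<Omega>" for x using subsetD[OF R(2) that] by simp
  have pos: "\<Phi> x > 0" if x: "x \<in> \<Omega>" for x
  proof -
    have n: "norm x \<le> R" using nR closure_subset x by blast
    obtain z where z: "z \<in> Z" "norm (x - z) < e z" using near[OF n] by blast
    have "0 < (\<Sum>z\<in>Z. P z x)" by (rule sum_pos2[OF Z(1) z(1)], rule loc(4)[OF x z(2)], rule loc(3)[OF x])
    then show ?thesis using q0[OF n] by (simp add: \<Phi>_def)
  qed
  have neg: "\<Phi> x < 0" if x: "x \<notin> closure \<Omega>" for x
  proof (cases "norm x \<le> R")
    case True
    obtain z where z: "z \<in> Z" "norm (x - z) < e z" using near[OF True] by blast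
    have "0 < (\<Sum>z\<in>Z. - P z x)" by (rule sum_pos2[OF Z(1) z(1)]) (use loc(5,6)[OF x] z in auto)
    then show ?thesis using q0[OF True] by (simp add: \<Phi>_def sum_negf)
  next
    case False
    then have "R\<^sup>2 < (norm x)\<^sup>2" using R by (intro power_strict_mono) auto
    then have "?q x > 0" by (simp add: power2_norm_eq_inner)
    moreover have "(\<Sum>z\<in>Z. P z x) \<le> 0" by (rule sum_nonpos) (use loc(5)[OF x] in auto)
    ultimately show ?thesis unfolding \<Phi>_def by linarith
  qed
  have fr: "\<Phi> x = 0 \<and> (\<exists>c>0. g x = - (c *\<^sub>R outer_normal \<Omega> x))" if x: "x \<in> frontier \<Omega>" for x
  proof -
    have n: "norm x \<le> R" using nR x by (simp add: frontier_def)
    obtain c where c: "\<And>z. c z \<ge> 0" "\<And>z. G z x = - (c z *\<^sub>R outer_normal \<Omega> x)" "\<And>z. norm (x - z) < e z \<Longrightarrow> c z > 0"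
      using loc(7)[OF x] by metis
    obtain z where z: "z \<in> Z" "norm (x - z) < e z" using near[OF n] by blast
    have "0 < (\<Sum>z\<in>Z. c z)" by (rule sum_pos2[OF Z(1) z(1)], rule c(3)[OF z(2)], rule c(1))
    moreover have "g x = - ((\<Sum>z\<in>Z. c z) *\<^sub>R outer_normal \<Omega> x)"
      using q0[OF n] by (simp add: g_def c(2) sum_negf scaleR_sum_left)
    moreover have "\<Phi> x = 0" using q0[OF n] loc(7)[OF x] by (simp add: \<Phi>_def)
    ultimately show ?thesis by blast
  qed
  have un: "norm (outer_normal \<Omega> x) = 1" if x: "x \<in> frontier \<Omega>" for x
  proof -
    obtain U \<phi> where d: "C2_defining \<Omega> x U \<phi>" using dom x unfolding C2_domain_def by blast
    then show ?thesis using outer_normal_eq[OF d x] by (simp add: C2_defining_def)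
  qed
  have tri: "x \<in> \<Omega> \<or> x \<in> frontier \<Omega> \<or> x \<notin> closure \<Omega>" for x
    using o\<Omega> by (auto simp: frontier_def interior_open)
  show ?thesis
  proof (rule that[OF C2])
    show "\<Omega> = {x. \<Phi> x > 0}" using pos neg fr tri by (auto, metis less_irrefl less_asym)
    show f: "frontier \<Omega> = {x. \<Phi> x = 0}" using pos neg fr tri by (auto, metis less_irrefl)
    show "g x \<noteq> 0" if "\<Phi> x = 0" for x
      using fr[of x] f that un[of x] by auto
    show "outer_normal \<Omega> x = - (g x /\<^sub>R norm (g x))" if "\<Phi> x = 0" for x
    proof -
      have x: "x \<in> frontier \<Omega>" using f that by simp
      obtain c where c: "c > 0" "g x = - (c *\<^sub>R outer_normal \<Omega> x)" using fr[OF x] by blast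
      then show ?thesis using un[OF x] by simp
    qed
    show "bounded {x. \<Phi> x \<ge> - 1}"
    proof (rule bounded_subset[OF bounded_cball[of 0 "R + 1"]], rule subsetI)
      fix x assume x: "x \<in> {x. \<Phi> x \<ge> - 1}"
      show "x \<in> cball 0 (R + 1)"
      proof (rule ccontr)
        assume "x \<notin> cball 0 (R + 1)"
        then have n: "norm x > R + 1" by simp
        then have "(R + 1)\<^sup>2 < (norm x)\<^sup>2" using R by (intro power_strict_mono) auto
        then have "x \<bullet> x > R\<^sup>2 + 1" unfolding power2_norm_eq_inner power2_sum using R by simp
        then have "1 < ?q x" by (simp add: one_less_power)
        moreover have "x \<notin> closure \<Omega>" using nR[of x] n by force
        then have "(\<Sum>z\<in>Z. P z x) \<le> 0" using loc(5) by (intro sum_nonpos) auto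
        ultimately show False using x by (simp add: \<Phi>_def)
      qed
    qed
  qed
qed

section \<open>Alexandrov's theorem\<close>

context C2_function
begin

lemma straightening:
  assumes b: "\<Phi> b = 0"
  obtains r \<Psi> D where "r > 0" "continuous_on (ball b r) \<Psi>" "open (\<Psi> ` ball b r)" "\<Psi> b = b"
    "\<And>y. y \<in> ball b r \<Longrightarrow> \<Phi> (\<Psi> y) = (y - b) \<bullet> g b"
    "\<And>y. y \<in> ball b r \<Longrightarrow> (\<Psi> has_derivative D y) (at y)"
    "\<And>y h. y \<in> ball b r \<Longrightarrow> g (\<Psi> y) \<bullet> D y h = g b \<bullet> h" "\<And>h. D b h = h"
proof -
  let ?a = "g b"
  have a: "?a \<bullet> ?a > 0" using regular[OF b] by simp
  define f where "f x = x + ((\<Phi> x - (x - b) \<bullet> ?a) / (?a \<bullet> ?a)) *\<^sub>R ?a" for x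
  define f' where "f' x = id_blinfun + (1 / (?a \<bullet> ?a)) *\<^sub>R (blinfun_scaleR_left ?a o\<^sub>L blinfun_inner_right (g x - ?a))" for x
  have f'_apply: "blinfun_apply (f' x) h = h + (((g x - ?a) \<bullet> h) / (?a \<bullet> ?a)) *\<^sub>R ?a" for x h
    by (simp add: f'_def blinfun.add_left blinfun.scaleR_left blinfun_scaleR_left.rep_eq blinfun_inner_right.rep_eq)
  have der: "(f has_derivative blinfun_apply (f' x)) (at x)" for x
  proof -
    have "((\<lambda>x. x + ((\<Phi> x - (x - b) \<bullet> ?a) / (?a \<bullet> ?a)) *\<^sub>R ?a) has_derivative
       (\<lambda>h. h + ((g x \<bullet> h - h \<bullet> ?a) / (?a \<bullet> ?a)) *\<^sub>R ?a)) (at x)"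
      using grad_\<Phi>[of x] a unfolding has_grad_def by (auto intro!: derivative_eq_intros)
    then show ?thesis unfolding f_def[abs_def]
      by (rule has_derivative_eq_rhs) (simp add: fun_eq_iff f'_apply inner_diff_left inner_diff_right inner_commute)
  qed
  have c: "continuous_on UNIV f'"
    unfolding f'_def
    by (intro continuous_intros bounded_bilinear.continuous_on[OF bounded_bilinear_blinfun_compose]
        bounded_linear.continuous_on[OF bounded_linear_blinfun_inner_right] cont_g)
  have fb: "f' b = id_blinfun" by (rule blinfun_eqI) (simp add: f'_apply)
  have inv: "id_blinfun o\<^sub>L f' b = id_blinfun" by (rule blinfun_eqI) (simp add: fb)
  obtain U V \<Psi> D where U: "open U" "b \<in> U" "open V" "f b \<in> V" and hom: "homeomorphism U V f \<Psi>"
    and d\<Psi>: "\<And>y. y \<in> V \<Longrightarrow> (\<Psi> has_derivative D y) (at y)"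
    and D: "\<And>y. y \<in> V \<Longrightarrow> D y = inv (blinfun_apply (f' (\<Psi> y)))" "\<And>y. y \<in> V \<Longrightarrow> bij (blinfun_apply (f' (\<Psi> y)))"
    by (rule inverse_function_theorem[OF open_UNIV der c UNIV_I inv], rule that)
  have fb': "f b = b" by (simp add: f_def b)
  obtain r where r: "r > 0" "ball b r \<subseteq> V" using U fb' openE by metis
  have \<Psi>U: "\<Psi> y \<in> U" "f (\<Psi> y) = y" if "y \<in> V" for y
    using hom that by (auto simp: homeomorphism_def)
  have val: "\<Phi> (\<Psi> y) = (y - b) \<bullet> ?a" if "y \<in> V" for y
  proof -
    have "(f (\<Psi> y) - b) \<bullet> ?a = \<Phi> (\<Psi> y)"
      using a by (simp add: f_def inner_add_left inner_diff_left)
    then show ?thesis using \<Psi>U(2)[OF that] by simp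
  qed
  show ?thesis
  proof (rule that[OF r(1)])
    have "continuous_on V \<Psi>" using hom by (simp add: homeomorphism_def)
    then show "continuous_on (ball b r) \<Psi>" by (rule continuous_on_subset[OF _ r(2)])
    have "\<Psi> ` ball b r = U \<inter> f -` ball b r"
      using hom r(2) by (force simp: homeomorphism_def image_iff)
    moreover have "open (U \<inter> f -` ball b r)"
      by (rule continuous_open_preimage) (use hom U in \<open>auto simp: homeomorphism_def\<close>)
    ultimately show "open (\<Psi> ` ball b r)" by simp
    show "\<Psi> b = b" using hom U(2) fb' unfolding homeomorphism_def by metis
    then have \<Psi>b: "\<Psi> b = b" .
    show "\<Phi> (\<Psi> y) = (y - b) \<bullet> g b" if "y \<in> ball b r" for y using val r(2) that by blast
    show "(\<Psi> has_derivative D y) (at y)" if "y \<in> ball b r" for y using d\<Psi> r(2) that by blast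
    show "g (\<Psi> y) \<bullet> D y h = g b \<bullet> h" if y: "y \<in> ball b r" for y h
    proof -
      have "((\<lambda>y. \<Phi> (\<Psi> y)) has_derivative (\<lambda>h. g (\<Psi> y) \<bullet> D y h)) (at y)"
        by (rule has_derivative_compose[OF d\<Psi> grad_\<Phi>[unfolded has_grad_def]]) (use r(2) y in blast)
      then have "((\<lambda>y. (y - b) \<bullet> ?a) has_derivative (\<lambda>h. g (\<Psi> y) \<bullet> D y h)) (at y)"
        by (rule has_derivative_transform_within_open[OF _ open_ball y]) (use val r(2) in blast)
      moreover have "((\<lambda>y. (y - b) \<bullet> ?a) has_derivative (\<lambda>h. h \<bullet> ?a)) (at y)"
        by (auto intro!: derivative_eq_intros)
      ultimately have "(\<lambda>h. g (\<Psi> y) \<bullet> D y h) = (\<lambda>h. h \<bullet> ?a)" by (rule has_derivative_unique)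
      then show ?thesis by (metis inner_commute)
    qed
    show "D b h = h" for h
    proof -
      have "b \<in> V" using U fb' by simp
      then have "D b = inv (blinfun_apply (f' b))" using D(1)[of b] \<Psi>b by simp
      then show ?thesis by (simp add: fb inv_id[unfolded id_def])
    qed
  qed
qed

lemma tangential_derivative_unique:
  assumes b: "\<Phi> b = 0" and L: "(F has_derivative L) (at b within {x. \<Phi> x = 0})"
    and L': "(F has_derivative L') (at b within {x. \<Phi> x = 0})" and e: "g b \<bullet> e = 0"
  shows "L e = L' e"
proof -
  obtain r \<Psi> D where S: "r > 0" "continuous_on (ball b r) \<Psi>" "open (\<Psi> ` ball b r)" "\<Psi> b = b"
    "\<And>y. y \<in> ball b r \<Longrightarrow> \<Phi> (\<Psi> y) = (y - b) \<bullet> g b"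
    "\<And>y. y \<in> ball b r \<Longrightarrow> (\<Psi> has_derivative D y) (at y)"
    "\<And>y h. y \<in> ball b r \<Longrightarrow> g (\<Psi> y) \<bullet> D y h = g b \<bullet> h" "\<And>h. D b h = h"
    by (rule straightening[OF b], rule that)
  define T where "T = {t::real. b + t *\<^sub>R e \<in> ball b r}"
  have oT: "open T"
  proof -
    have "T = (\<lambda>t. b + t *\<^sub>R e) -` ball b r" by (auto simp: T_def)
    moreover have "open ((\<lambda>t. b + t *\<^sub>R e) -` ball b r)"
      by (intro open_vimage open_ball continuous_intros)
    ultimately show ?thesis by simp
  qed
  have T0: "0 \<in> T" using S(1) by (simp add: T_def)
  let ?c = "\<lambda>t. \<Psi> (b + t *\<^sub>R e)"
  have cT: "?c ` T \<subseteq> {x. \<Phi> x = 0}" using S(5) e by (auto simp: T_def inner_commute)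
  have "((\<lambda>t. b + t *\<^sub>R e) has_derivative (\<lambda>h. h *\<^sub>R e)) (at 0)" by (auto intro!: derivative_eq_intros)
  moreover have "(\<Psi> has_derivative D b) (at (b + 0 *\<^sub>R e))" using S(6)[of b] S(1) by simp
  ultimately have "(?c has_derivative (\<lambda>h. D b (h *\<^sub>R e))) (at 0)" by (rule has_derivative_compose)
  then have dc: "(?c has_derivative (\<lambda>h. h *\<^sub>R e)) (at 0 within T)"
    by (simp add: S(8) has_derivative_at_withinI)
  have c0: "?c 0 = b" using S(4) by simp
  have comp: "((\<lambda>t. F (?c t)) has_derivative (\<lambda>h. M (h *\<^sub>R e))) (at 0)"
    if "(F has_derivative M) (at b within {x. \<Phi> x = 0})" for M
  proof -
    have "(F has_derivative M) (at (?c 0) within ?c ` T)"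
      unfolding c0 by (rule has_derivative_subset[OF that cT])
    from has_derivative_in_compose[OF dc this] show ?thesis unfolding at_within_open[OF T0 oT] .
  qed
  have "(\<lambda>h. L (h *\<^sub>R e)) = (\<lambda>h. L' (h *\<^sub>R e))"
    by (rule has_derivative_unique[OF comp[OF L] comp[OF L']])
  from fun_cong[OF this, of 1] show ?thesis by simp
qed

lemma tangentially_constant:
  assumes con: "connected {x. \<Phi> x = 0}" and w: "\<And>x. has_jac w (J x) x"
    and z: "\<And>x e. \<Phi> x = 0 \<Longrightarrow> g x \<bullet> e = 0 \<Longrightarrow> J x *v e = 0"
    and x: "\<Phi> x = 0" and y: "\<Phi> y = 0"
  shows "w x = w y"
proof (rule connected_local_const[where f=w and a=x and b=y, OF con])
  show "\<forall>b\<in>{x. \<Phi> x = 0}. \<forall>\<^sub>F y in at b within {x. \<Phi> x = 0}. w b = w y"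
  proof
    fix b assume "b \<in> {x. \<Phi> x = 0}"
    then have b: "\<Phi> b = 0" by simp
    obtain r \<Psi> D where S: "r > 0" "continuous_on (ball b r) \<Psi>" "open (\<Psi> ` ball b r)" "\<Psi> b = b"
      "\<And>y. y \<in> ball b r \<Longrightarrow> \<Phi> (\<Psi> y) = (y - b) \<bullet> g b"
      "\<And>y. y \<in> ball b r \<Longrightarrow> (\<Psi> has_derivative D y) (at y)"
      "\<And>y h. y \<in> ball b r \<Longrightarrow> g (\<Psi> y) \<bullet> D y h = g b \<bullet> h" "\<And>h. D b h = h"
      by (rule straightening[OF b], rule that)
    let ?a = "g b"
    have a: "?a \<bullet> ?a > 0" using regular[OF b] by simp
    define \<pi> where "\<pi> z = b + ((z - b) - (((z - b) \<bullet> ?a) / (?a \<bullet> ?a)) *\<^sub>R ?a)" for z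
    have proj: "norm (h - ((h \<bullet> ?a) / (?a \<bullet> ?a)) *\<^sub>R ?a) \<le> norm h" "(h - ((h \<bullet> ?a) / (?a \<bullet> ?a)) *\<^sub>R ?a) \<bullet> ?a = 0" for h
    proof -
      let ?p = "h - ((h \<bullet> ?a) / (?a \<bullet> ?a)) *\<^sub>R ?a"
      show o: "?p \<bullet> ?a = 0" using a by (simp add: inner_diff_left)
      define p where "p = ?p"
      define q where "q = ((h \<bullet> ?a) / (?a \<bullet> ?a)) *\<^sub>R ?a"
      have pq: "p \<bullet> q = 0" using o by (simp add: q_def p_def)
      have "h = p + q" by (simp add: p_def q_def)
      then have "h \<bullet> h = p \<bullet> p + q \<bullet> q" using pq by (simp add: inner_add_left inner_add_right inner_commute[of q p])
      then have "p \<bullet> p \<le> h \<bullet> h" by simp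
      then show "norm ?p \<le> norm h" unfolding p_def by (simp only: norm_eq_sqrt_inner real_sqrt_le_iff)
    qed
    have \<pi>b: "\<pi> z \<in> ball b r" if "z \<in> ball b r" for z
    proof -
      have "\<pi> z - b = (z - b) - (((z - b) \<bullet> ?a) / (?a \<bullet> ?a)) *\<^sub>R ?a" by (simp add: \<pi>_def)
      then have "norm (\<pi> z - b) \<le> norm (z - b)" by (simp only: proj(1))
      then show ?thesis using that by (simp add: dist_norm norm_minus_commute)
    qed
    have \<pi>0: "\<Phi> (\<Psi> (\<pi> z)) = 0" if "z \<in> ball b r" for z
    proof -
      have "\<pi> z - b = (z - b) - (((z - b) \<bullet> ?a) / (?a \<bullet> ?a)) *\<^sub>R ?a" by (simp add: \<pi>_def)
      then show ?thesis by (simp only: S(5)[OF \<pi>b[OF that]] proj(2))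
    qed
    have d0: "((\<lambda>z. w (\<Psi> (\<pi> z))) has_derivative (\<lambda>h. 0)) (at z within ball b r)" if z: "z \<in> ball b r" for z
    proof -
      have d\<pi>: "(\<pi> has_derivative (\<lambda>h. h - ((h \<bullet> ?a) / (?a \<bullet> ?a)) *\<^sub>R ?a)) (at z)"
        using a unfolding \<pi>_def[abs_def] by (auto intro!: derivative_eq_intros)
      have "((\<lambda>z. \<Psi> (\<pi> z)) has_derivative (\<lambda>h. D (\<pi> z) (h - ((h \<bullet> ?a) / (?a \<bullet> ?a)) *\<^sub>R ?a))) (at z)"
        by (rule has_derivative_compose[OF d\<pi> S(6)[OF \<pi>b[OF z]]])
      from has_derivative_compose[OF this w[unfolded has_jac_def]]
      have "((\<lambda>z. w (\<Psi> (\<pi> z))) has_derivative (\<lambda>h. J (\<Psi> (\<pi> z)) *v D (\<pi> z) (h - ((h \<bullet> ?a) / (?a \<bullet> ?a)) *\<^sub>R ?a))) (at z)" .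
      moreover have "J (\<Psi> (\<pi> z)) *v D (\<pi> z) (h - ((h \<bullet> ?a) / (?a \<bullet> ?a)) *\<^sub>R ?a) = 0" for h
      proof (rule assms(3)[OF \<pi>0[OF z]])
        have "?a \<bullet> (h - ((h \<bullet> ?a) / (?a \<bullet> ?a)) *\<^sub>R ?a) = 0"
          using proj(2)[of h] by (subst inner_commute)
        then show "g (\<Psi> (\<pi> z)) \<bullet> D (\<pi> z) (h - ((h \<bullet> ?a) / (?a \<bullet> ?a)) *\<^sub>R ?a) = 0"
          by (simp only: S(7)[OF \<pi>b[OF z]])
      qed
      ultimately show ?thesis by (simp add: has_derivative_at_withinI)
    qed
    have const: "w (\<Psi> (\<pi> z)) = w b" if "z \<in> ball b r" for z
    proof -
      have "w (\<Psi> (\<pi> z)) = w (\<Psi> (\<pi> b))"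
        by (rule has_derivative_zero_unique[OF convex_ball d0 that]) (use S(1) in simp_all)
      then show ?thesis using S(4) by (simp add: \<pi>_def)
    qed
    have "w b = w y" if "y \<in> \<Psi> ` ball b r" "\<Phi> y = 0" for y
    proof -
      obtain u where u: "u \<in> ball b r" "y = \<Psi> u" using \<open>y \<in> \<Psi> ` ball b r\<close> by blast
      have "(u - b) \<bullet> ?a = 0" using S(5)[OF u(1)] u(2) \<open>\<Phi> y = 0\<close> by simp
      then have "\<pi> u = u" by (simp add: \<pi>_def)
      then show ?thesis using const[OF u(1)] u(2) by simp
    qed
    moreover have "b \<in> \<Psi> ` ball b r" using S(1,4) by (metis centre_in_ball imageI)
    ultimately show "\<forall>\<^sub>F y in at b within {x. \<Phi> x = 0}. w b = w y"
      unfolding eventually_at_topological using S(3) by blast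
  qed
qed (use x y in simp_all)

lemma zero_set_approachable:
  assumes b: "\<Phi> b = 0" and V: "open V" "b \<in> V"
  shows "V \<inter> E \<noteq> {}"
proof -
  have p: "g b \<bullet> g b > 0" using regular[OF b] by simp
  obtain d where d: "d > 0" "\<And>t. 0 < t \<Longrightarrow> t < d \<Longrightarrow> \<Phi> (b + t *\<^sub>R g b) > \<Phi> b"
    by (rule increasing_direction[OF grad_\<Phi> p], rule that)
  obtain e where e: "e > 0" "ball b e \<subseteq> V" using V openE by blast
  have ng: "norm (g b) > 0" using p by simp
  define m where "m = min d (e / norm (g b))"
  have m: "m > 0" "m \<le> d" "m \<le> e / norm (g b)" using d e ng by (auto simp: m_def)
  have "m / 2 * norm (g b) < e"
  proof -
    have "m * norm (g b) \<le> e" using m(3) ng by (simp add: pos_le_divide_eq)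
    moreover have "m * norm (g b) > 0" using m ng by simp
    ultimately show ?thesis by simp
  qed
  then have "b + (m / 2) *\<^sub>R g b \<in> V" using m(1) by (intro subsetD[OF e(2)]) (simp add: dist_norm)
  moreover have "\<Phi> (b + (m / 2) *\<^sub>R g b) > 0" using d(2)[of "m / 2"] m b by simp
  ultimately show ?thesis by blast
qed

lemma local_side_connected:
  assumes b: "\<Phi> b = 0"
  obtains V where "open V" "b \<in> V" "connected (V \<inter> E)"
proof -
  obtain r \<Psi> D where S: "r > 0" "continuous_on (ball b r) \<Psi>" "open (\<Psi> ` ball b r)" "\<Psi> b = b"
    "\<And>y. y \<in> ball b r \<Longrightarrow> \<Phi> (\<Psi> y) = (y - b) \<bullet> g b"
    "\<And>y. y \<in> ball b r \<Longrightarrow> (\<Psi> has_derivative D y) (at y)"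
    "\<And>y h. y \<in> ball b r \<Longrightarrow> g (\<Psi> y) \<bullet> D y h = g b \<bullet> h" "\<And>h. D b h = h"
    by (rule straightening[OF b], rule that)
  let ?H = "ball b r \<inter> {y. g b \<bullet> y > g b \<bullet> b}"
  have "\<Psi> ` ball b r \<inter> E = \<Psi> ` ?H"
  proof -
    have "\<Phi> (\<Psi> y) > 0 \<longleftrightarrow> g b \<bullet> y > g b \<bullet> b" if "y \<in> ball b r" for y
      using S(5)[OF that] by (simp add: inner_diff_left inner_diff_right inner_commute)
    then show ?thesis by blast
  qed
  moreover have "connected (\<Psi> ` ?H)"
    by (intro connected_continuous_image convex_connected convex_Int convex_ball convex_halfspace_gt
        continuous_on_subset[OF S(2)]) auto
  moreover have "b \<in> \<Psi> ` ball b r" using S(1,4) by (metis centre_in_ball imageI)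
  ultimately show ?thesis using that[OF S(3)] by simp
qed

lemma connected_side:
  assumes con: "connected {x. \<Phi> x = 0}"
  shows "connected E"
proof (rule connectedI)
  fix A' B' assume oA: "open A'" and oB: "open B'" and nA: "A' \<inter> E \<noteq> {}" and nB: "B' \<inter> E \<noteq> {}"
    and dis: "A' \<inter> B' \<inter> E = {}" and cov: "E \<subseteq> A' \<union> B'"
  let ?X = "{x. \<Phi> x = 0}"
  define XA where "XA = \<Union>{V. open V \<and> V \<inter> E \<subseteq> A'}"
  define XB where "XB = \<Union>{V. open V \<and> V \<inter> E \<subseteq> B'}"
  have oX: "open XA" "open XB" by (auto simp: XA_def XB_def)
  have disX: "XA \<inter> XB \<inter> ?X = {}"
  proof (rule ccontr)
    assume "XA \<inter> XB \<inter> ?X \<noteq> {}"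
    then obtain b V W where b: "\<Phi> b = 0" "b \<in> V" "b \<in> W" "open V" "open W" "V \<inter> E \<subseteq> A'" "W \<inter> E \<subseteq> B'"
      unfolding XA_def XB_def by blast
    have "(V \<inter> W) \<inter> E \<noteq> {}" by (rule zero_set_approachable[OF b(1)]) (use b in auto)
    then show False using b dis by blast
  qed
  have covX: "?X \<subseteq> XA \<union> XB"
  proof
    fix b assume "b \<in> ?X"
    then have b: "\<Phi> b = 0" by simp
    obtain V where V: "open V" "b \<in> V" "connected (V \<inter> E)" by (rule local_side_connected[OF b], rule that)
    have "A' \<inter> (V \<inter> E) = {} \<or> B' \<inter> (V \<inter> E) = {}"
      by (rule connectedD[OF V(3) oA oB]) (use dis cov in blast)+
    then have "V \<inter> E \<subseteq> A' \<or> V \<inter> E \<subseteq> B'" using cov by blast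
    then show "b \<in> XA \<union> XB" using V unfolding XA_def XB_def by blast
  qed
  have cases: "XA \<inter> ?X = {} \<or> XB \<inter> ?X = {}"
    by (rule connectedD[OF con oX disX covX])
  have clE: "closure E \<subseteq> E \<union> ?X"
  proof -
    have "closure E \<subseteq> {x. \<Phi> x \<ge> 0}" by (rule closure_minimal[OF _ closed_E]) auto
    then show ?thesis by force
  qed
  have key: False if XQ: "XQ = \<Union>{V. open V \<and> V \<inter> E \<subseteq> Q'}" "?X \<subseteq> XQ" and Q: "open P'" "P' \<inter> E \<noteq> {}" "Q' \<inter> E \<noteq> {}" "P' \<inter> Q' \<inter> E = {}"
     "E \<subseteq> P' \<union> Q'" "open Q'" for P' Q' XQ
  proof -
    have "closed (P' \<inter> E)"
    proof (rule closure_subset_eq[THEN iffD1], rule subsetI)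
      fix x assume x: "x \<in> closure (P' \<inter> E)"
      then have "x \<in> E \<union> ?X" using clE closure_mono[of "P' \<inter> E" E] by blast
      then show "x \<in> P' \<inter> E"
      proof
        assume xE: "x \<in> E"
        show ?thesis
        proof (rule ccontr)
          assume "x \<notin> P' \<inter> E"
          then have "x \<in> Q' \<inter> E" using xE Q(5) by blast
          moreover have "open (Q' \<inter> E)" using Q(6) open_E by blast
          ultimately have "(Q' \<inter> E) \<inter> (P' \<inter> E) \<noteq> {}" using x open_Int_closure_eq_empty[of "Q' \<inter> E" "P' \<inter> E"] by blast
          then show False using Q(4) by blast
        qed
      next
        assume "x \<in> ?X"
        then obtain V where V: "open V" "x \<in> V" "V \<inter> E \<subseteq> Q'" using XQ by blast
        then have "V \<inter> (P' \<inter> E) \<noteq> {}" using x open_Int_closure_eq_empty[of V "P' \<inter> E"] by blast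
        then show ?thesis using V Q(4) by blast
      qed
    qed
    moreover have "open (P' \<inter> E)" using Q(1) open_E by blast
    ultimately have "P' \<inter> E = {} \<or> P' \<inter> E = UNIV" using clopen[of "P' \<inter> E"] by blast
    then show False using Q by blast
  qed
  show False
    using cases
  proof
    assume "XA \<inter> ?X = {}"
    then have "?X \<subseteq> XB" using covX by blast
    show False by (rule key[OF XB_def \<open>?X \<subseteq> XB\<close> oA nA nB dis cov oB])
  next
    assume "XB \<inter> ?X = {}"
    then have "?X \<subseteq> XA" using covX by blast
    moreover have "B' \<inter> A' \<inter> E = {}" "E \<subseteq> B' \<union> A'" using dis cov by blast+
    ultimately show False by (rule key[OF XA_def _ oB nB nA _ _ oA])
  qed
qed

end

lemma sum_tangential_basis:
  fixes J :: "real^3^3"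
  assumes "norm n = 1"
  shows "(\<Sum>b\<in>Basis. (J *v (b - (b \<bullet> n) *\<^sub>R n)) \<bullet> b) = tr_perp J n"
proof -
  have "(\<Sum>b\<in>Basis. (J *v (b - (b \<bullet> n) *\<^sub>R n)) \<bullet> b) = (\<Sum>b\<in>Basis. (J *v b) \<bullet> b) - (\<Sum>b\<in>Basis. (b \<bullet> n) * ((J *v n) \<bullet> b))"
    by (simp add: matrix_vector_mult_diff_distrib matrix_vector_mult_scaleR inner_diff_left sum_subtractf)
  also have "(\<Sum>b\<in>Basis. (J *v b) \<bullet> b) = trace J"
  proof -
    have "(\<Sum>b\<in>(Basis::R3 set). (J *v b) \<bullet> b) = (\<Sum>i\<in>(UNIV::3 set). (J *v axis i 1) \<bullet> axis i 1)"
    proof -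
      have B: "(Basis::R3 set) = range (\<lambda>i. axis i 1)" by (auto simp: Basis_vec_def)
      have I: "inj (\<lambda>i::3. axis i (1::real) :: R3)" by (simp add: inj_on_def axis_eq_axis)
      show ?thesis unfolding B sum.reindex[OF I] by (simp add: o_def)
    qed
    then show ?thesis by (simp add: trace_def inner_axis matrix_vector_mul_component inner_axis')
  qed
  also have "(\<Sum>b\<in>Basis. (b \<bullet> n) * ((J *v n) \<bullet> b)) = n \<bullet> (J *v n)"
    by (subst euclidean_inner[of n]) (simp add: inner_commute)
  finally show ?thesis by (simp add: tr_perp_def)
qed

context C2_function
begin

lemma jac_unit_normal:
  assumes b: "g b \<noteq> 0" and s: "transpose (A b) = A b"
  shows "has_jac (\<lambda>x. (1 / norm (g x)) *\<^sub>R g x)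
    ((1 / norm (g b)) *\<^sub>R A b + outer (g b) (- ((1 / norm (g b) ^ 3) *\<^sub>R (A b *v g b)))) b"
proof -
  have p: "norm (g b) > 0" using b by simp
  have "has_grad (\<lambda>x. g x \<bullet> g x) (2 *\<^sub>R (A b *v g b)) b"
    using has_grad_inner[OF jac_g jac_g, of b] by (simp only: s scaleR_2)
  from has_grad_chain[OF DERIV_real_sqrt this] b
  have n: "has_grad (\<lambda>x. norm (g x)) ((1 / norm (g b)) *\<^sub>R (A b *v g b)) b"
    by (simp add: norm_eq_sqrt_inner field_simps)
  have "has_grad (\<lambda>x. 1 / norm (g x)) ((- 1 / (norm (g b))\<^sup>2) *\<^sub>R ((1 / norm (g b)) *\<^sub>R (A b *v g b))) b"
    by (rule has_grad_chain[OF _ n]) (use p in \<open>auto intro!: derivative_eq_intros simp: power2_eq_square\<close>)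
  from has_jac_scaleR[OF this jac_g] show ?thesis
    by (simp add: power2_eq_square power3_eq_cube mult.assoc)
qed

lemma surface_div_formula:
  assumes b: "\<Phi> b = 0" and s: "transpose (A b) = A b"
    and F: "\<And>x. \<Phi> x = 0 \<Longrightarrow> F x = - (g x /\<^sub>R norm (g x))"
  shows "surface_div {x. \<Phi> x = 0} (F b) F b = - (tr_perp (A b) (g b /\<^sub>R norm (g b)) / norm (g b))"
proof -
  have gb: "g b \<noteq> 0" using regular[OF b] .
  have p: "norm (g b) > 0" using gb by simp
  let ?n = "g b /\<^sub>R norm (g b)"
  have n1: "norm ?n = 1" using gb by simp
  have nn: "?n \<bullet> ?n = 1" using n1 by (simp only: norm_eq_1)
  define J where "J = (1 / norm (g b)) *\<^sub>R A b + outer (g b) (- ((1 / norm (g b) ^ 3) *\<^sub>R (A b *v g b)))"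
  have j: "has_jac (\<lambda>x. - ((1 / norm (g x)) *\<^sub>R g x)) (- J) b"
    unfolding J_def by (rule has_jac_minus[OF jac_unit_normal[OF gb s]])
  have d: "(F has_derivative (\<lambda>h. (- J) *v h)) (at b within {x. \<Phi> x = 0})"
  proof (rule has_derivative_transform)
    show "((\<lambda>x. - ((1 / norm (g x)) *\<^sub>R g x)) has_derivative (*v) (- J)) (at b within {x. \<Phi> x = 0})"
      using j unfolding has_jac_def by (rule has_derivative_at_withinI)
    show "F x = - ((1 / norm (g x)) *\<^sub>R g x)" if "x \<in> {x. \<Phi> x = 0}" for x
      using F[of x] that by (simp add: inverse_eq_divide)
  qed (use b in simp)
  have d': "(F has_derivative frechet_derivative F (at b within {x. \<Phi> x = 0})) (at b within {x. \<Phi> x = 0})"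
    using d frechet_derivative_works differentiableI by blast
  have Fb: "F b = - ?n" by (rule F[OF b])
  have "frechet_derivative F (at b within {x. \<Phi> x = 0}) (\<beta> - (\<beta> \<bullet> F b) *\<^sub>R F b) = (- J) *v (\<beta> - (\<beta> \<bullet> ?n) *\<^sub>R ?n)" for \<beta>
  proof -
    have e: "\<beta> - (\<beta> \<bullet> F b) *\<^sub>R F b = \<beta> - (\<beta> \<bullet> ?n) *\<^sub>R ?n" by (simp add: Fb)
    have "?n \<bullet> (\<beta> - (\<beta> \<bullet> ?n) *\<^sub>R ?n) = 0"
      using nn by (simp only: inner_diff_right inner_scaleR_right inner_commute[of ?n \<beta>])
    then have "g b \<bullet> (\<beta> - (\<beta> \<bullet> ?n) *\<^sub>R ?n) = 0" using gb by simp
    from tangential_derivative_unique[OF b d' d this] show ?thesis unfolding e .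
  qed
  then have "surface_div {x. \<Phi> x = 0} (F b) F b = tr_perp (- J) ?n"
    unfolding surface_div_def using sum_tangential_basis[OF n1, of "- J"] by simp
  also have "\<dots> = - tr_perp J ?n" by (simp add: tr_perp_def trace_minus uminus_matrix_vector)
  also have "tr_perp J ?n = tr_perp (A b) ?n / norm (g b)"
  proof -
    have gg: "g b \<bullet> g b = norm (g b) * norm (g b)" by (simp flip: power2_norm_eq_inner power2_eq_square)
    have "trace (outer (g b) (- ((1 / norm (g b) ^ 3) *\<^sub>R (A b *v g b)))) = ?n \<bullet> (outer (g b) (- ((1 / norm (g b) ^ 3) *\<^sub>R (A b *v g b))) *v ?n)"
      unfolding trace_outer outer_mult_vec using p
      by (simp add: gg inner_commute field_simps power3_eq_cube)
    then show ?thesis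
      unfolding J_def tr_perp_def trace_add trace_scaleR matrix_vector_mult_add_rdistrib inner_add_right scaleR_matrix_vector
      by (simp add: diff_divide_distrib)
  qed
  finally show ?thesis .
qed

end

lemma domain_of_spherical_frontier:
  fixes \<Omega> :: "R3 set"
  assumes o: "open \<Omega>" and bd: "bounded \<Omega>" and ne: "\<Omega> \<noteq> {}" and R: "R > 0" and fr: "frontier \<Omega> \<subseteq> sphere c R"
  shows "\<Omega> = ball c R"
proof -
  have out: "\<Omega> \<subseteq> cball c R"
  proof (rule ccontr)
    assume "\<not> \<Omega> \<subseteq> cball c R"
    then have i: "- cball c R \<inter> \<Omega> \<noteq> {}" by blast
    have con: "connected (- cball c R)"
      by (rule connected_complement_bounded_convex) auto
    have "- cball c R \<inter> frontier \<Omega> = {}" using fr by auto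
    then have "- cball c R - \<Omega> = {}" using connected_Int_frontier[OF con i] by blast
    then have "bounded (- cball c R)" using bd bounded_subset by blast
    then show False using bounded_cball[of c R] not_bounded_UNIV
      by (metis bounded_Un Compl_partition)
  qed
  then have "\<Omega> \<subseteq> interior (cball c R)" using o by (rule interior_maximal)
  then have sub: "\<Omega> \<subseteq> ball c R" by simp
  then have i: "ball c R \<inter> \<Omega> \<noteq> {}" using ne by blast
  have "ball c R \<inter> frontier \<Omega> = {}" using fr by auto
  then have "ball c R - \<Omega> = {}" using connected_Int_frontier[OF connected_ball i] by blast
  then show ?thesis using sub by blast
qed

lemma C2_functionI:
  assumes "is_C2 UNIV \<Phi> g A" "\<And>x. \<Phi> x = 0 \<Longrightarrow> g x \<noteq> 0"
  shows "C2_function \<Phi> g A"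
  using assms by (auto simp: C2_function_def is_C2_def)

lemma is_C2_symmetric: "is_C2 UNIV \<Phi> g A \<Longrightarrow> transpose (A x) = A x"
  by (rule hessian_symmetric[OF open_UNIV UNIV_I]) (auto simp: is_C2_def)

theorem alexandrov:
  assumes dom: "C2_domain \<Omega>" and bd: "bounded \<Omega>" and ne: "\<Omega> \<noteq> {}" and con: "connected (frontier \<Omega>)"
    and H: "\<And>x. x \<in> frontier \<Omega> \<Longrightarrow> surface_div (frontier \<Omega>) (outer_normal \<Omega> x) (outer_normal \<Omega>) x = H"
  shows "\<exists>c. \<exists>R>0. \<Omega> = ball c R"
proof -
  obtain \<Phi> g A where C2: "is_C2 UNIV \<Phi> g A" and \<Omega>: "\<Omega> = {x. \<Phi> x > 0}" and fr: "frontier \<Omega> = {x. \<Phi> x = 0}"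
    and bd1: "bounded {x. \<Phi> x \<ge> - 1}" and reg: "\<And>x. \<Phi> x = 0 \<Longrightarrow> g x \<noteq> 0"
    and on: "\<And>x. \<Phi> x = 0 \<Longrightarrow> outer_normal \<Omega> x = - (g x /\<^sub>R norm (g x))"
    by (rule global_defining_function[OF dom bd], rule that)
  interpret C2_function \<Phi> g A by (rule C2_functionI[OF C2 reg])
  obtain a where a: "{x. \<Phi> x \<ge> - 1} \<subseteq> ball 0 a" using bounded_subset_ballD[OF bd1, of 0] by blast
  obtain d c where d: "d > 0" "c > 0" "\<And>x. x \<in> cball 0 a \<Longrightarrow> \<bar>\<Phi> x\<bar> \<le> d \<Longrightarrow> g x \<bullet> g x \<ge> c"
    by (rule positive_near_zero_set[of "cball 0 a" \<Phi> "\<lambda>x. g x \<bullet> g x"])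
      (auto intro!: continuous_intros cont_g cont_\<Phi> simp: reg)
  define \<delta> where "\<delta> = min d 1"
  interpret layered_domain \<Phi> g A \<delta>
  proof
    show "\<delta> > 0" using d by (simp add: \<delta>_def)
    show "g x \<noteq> 0" if "\<bar>\<Phi> x\<bar> \<le> \<delta>" for x
    proof -
      have "\<Phi> x \<ge> - 1" using that by (auto simp: \<delta>_def)
      then have "x \<in> cball 0 a" using a by (force simp: subset_iff)
      then have "g x \<bullet> g x \<ge> c" using d(3)[of x] that by (simp add: \<delta>_def)
      then show ?thesis using d(2) by auto
    qed
    show "bounded {x. 0 < \<Phi> x}" using bd \<Omega> by simp
    show "transpose (A x) = A x" for x by (rule is_C2_symmetric[OF C2])
  qed
  have r0: "r x = norm (g x)" if "\<Phi> x = 0" for x using r_layer(1)[of x] that \<delta>_pos by simp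
  have nn0: "nn x = g x /\<^sub>R norm (g x)" if "\<Phi> x = 0" for x using r0[OF that] by (simp add: nn_def inverse_eq_divide)
  have mean: "hh x = - H * norm (g x)" if x: "\<Phi> x = 0" for x
  proof -
    have "H = - (tr_perp (A x) (g x /\<^sub>R norm (g x)) / norm (g x))"
      using H[of x] surface_div_formula[OF x sym_A, of "outer_normal \<Omega>"] on x unfolding fr by simp
    then show ?thesis using reg[OF x] by (simp add: nn0[OF x] field_simps)
  qed
  have "frontier \<Omega> \<noteq> {}" using ne bd by (metis frontier_eq_empty not_bounded_UNIV)
  then obtain b where b: "\<Phi> b = 0" using fr by blast
  have Hpos: "H > 0" by (rule mean_curvature_pos[OF mean b])
  define w where "w x = nn x + (H / 2) *\<^sub>R x" for x
  have jw: "has_jac w (Jn x + (H / 2) *\<^sub>R mat 1) x" for x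
    unfolding w_def[abs_def] by (intro has_jac_add has_jac_cmul jac_nn has_jac_id)
  have tan: "(Jn x + (H / 2) *\<^sub>R mat 1) *v e = 0" if x: "\<Phi> x = 0" and e: "g x \<bullet> e = 0" for x e
  proof -
    have l: "\<bar>\<Phi> x\<bar> \<le> \<delta>" using x \<delta>_pos by simp
    have n1: "norm (nn x) = 1" using nn0[OF x] reg[OF x] by simp
    have ne: "nn x \<bullet> e = 0" using e by (simp add: nn_def)
    have "A x *v e = (hh x / 2) *\<^sub>R e + (nn x \<bullet> (A x *v e)) *\<^sub>R nn x"
      by (rule umbilic[OF sym_A n1 umbilic_boundary[OF mean x] ne])
    moreover have "gr x \<bullet> e = nn x \<bullet> (A x *v e)"
      unfolding gr_layer[OF l] by (simp add: A_inner nn_def)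
    moreover have "Jn x *v e = (1 / r x) *\<^sub>R (A x *v e) - ((gr x \<bullet> e) / (r x)\<^sup>2) *\<^sub>R g x"
      by (simp add: Jn_def matrix_vector_mult_add_rdistrib scaleR_matrix_vector outer_mult_vec)
    moreover have "((gr x \<bullet> e) / (r x)\<^sup>2) *\<^sub>R g x = ((gr x \<bullet> e) / r x) *\<^sub>R nn x"
      using r_nz[of x] by (simp add: nn_def power2_eq_square)
    ultimately have "Jn x *v e = (1 / r x) *\<^sub>R (hh x / 2) *\<^sub>R e"
      by (metis (no_types, lifting) add_diff_cancel_right' divide_inverse_commute inverse_eq_divide scaleR_add_right scaleR_scaleR)
    then have "Jn x *v e = - (H / 2) *\<^sub>R e"
      using mean[OF x] r0[OF x] reg[OF x] by simp
    then show ?thesis by (simp add: matrix_vector_mult_add_rdistrib scaleR_matrix_vector)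
  qed
  have con': "connected {x. \<Phi> x = 0}" using con fr by simp
  have const: "w x = w b" if "\<Phi> x = 0" for x
    by (rule tangentially_constant[OF con' jw tan that b])
  have "frontier \<Omega> \<subseteq> sphere ((2 / H) *\<^sub>R w b) (2 / H)"
  proof
    fix x assume "x \<in> frontier \<Omega>"
    then have x: "\<Phi> x = 0" using fr by blast
    have "(2 / H) *\<^sub>R w b = (2 / H) *\<^sub>R nn x + x"       unfolding const[OF x, symmetric] using Hpos by (simp add: w_def scaleR_add_right)
    moreover have "norm (nn x) = 1" using nn0[OF x] reg[OF x] by simp
    ultimately show "x \<in> sphere ((2 / H) *\<^sub>R w b) (2 / H)" using Hpos by (simp add: dist_norm)
  qed
  moreover have "open \<Omega>" using dom by (simp add: C2_domain_def)
  moreover have "2 / H > 0" using Hpos by simp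
  ultimately show ?thesis using domain_of_spherical_frontier bd ne by blast
qed

section \<open>Viscous flow in an exterior domain\<close>

lemma has_grad_sum:
  assumes "finite I" "\<And>i. i \<in> I \<Longrightarrow> has_grad (f i) (g i) x"
  shows "has_grad (\<lambda>x. \<Sum>i\<in>I. f i x) (\<Sum>i\<in>I. g i) x"
  using assms by (induction I) (auto intro: has_grad_add has_grad_const)

lemma has_jac_components:
  assumes "\<And>i. has_grad (\<lambda>x. F x $ i) (G i) x"
  shows "has_jac F (\<chi> i. G i) x"
  unfolding has_jac_def
proof (rule has_derivative_componentwise_within[THEN iffD2], rule ballI)
  fix b :: R3 assume "b \<in> Basis"
  then obtain i where b: "b = axis i 1" by (auto simp: Basis_vec_def)
  have "(\<lambda>h. ((\<chi> i. G i) *v h) \<bullet> b) = (\<lambda>h. G i \<bullet> h)"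
    by (simp add: b inner_axis matrix_vector_mul_component)
  then show "((\<lambda>x. F x \<bullet> b) has_derivative (\<lambda>h. ((\<chi> i. G i) *v h) \<bullet> b)) (at x)"
    using assms[of i] by (simp add: b inner_axis has_grad_def)
qed

lemma norm_matrix_vector_le: "norm ((A::real^3^3) *v x) \<le> norm A * norm x"
proof -
  have "norm (A *v x) = L2_set (\<lambda>i. \<bar>A $ i \<bullet> x\<bar>) UNIV"
    by (simp add: norm_vec_def matrix_vector_mul_component)
  also have "\<dots> \<le> L2_set (\<lambda>i. norm (A $ i) * norm x) UNIV"
    by (rule L2_set_mono) (auto simp: Cauchy_Schwarz_ineq2)
  also have "\<dots> = norm A * norm x" by (simp add: norm_vec_def[of A] L2_set_left_distrib)
  finally show ?thesis .
qed

definition symj :: "real^3^3 \<Rightarrow> real^3^3" where "symj J = J + transpose J"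

locale exterior_flow = C2_function +
  fixes v :: "R3 \<Rightarrow> R3" and J :: "R3 \<Rightarrow> real^3^3" and Hs :: "3 \<Rightarrow> R3 \<Rightarrow> real^3^3" and \<pi> :: "R3 \<Rightarrow> real" and g\<pi> :: "R3 \<Rightarrow> R3"
    and \<nu> \<rho> K R1 :: real
  assumes jac_v: "x \<in> E \<Longrightarrow> has_jac v (J x) x" and cont_v: "continuous_on {x. \<Phi> x \<ge> 0} v"
    and jac_J: "x \<in> E \<Longrightarrow> has_jac (\<lambda>x. J x $ i) (Hs i x) x" and cont_J: "continuous_on {x. \<Phi> x \<ge> 0} J"
    and cont_Hs: "continuous_on E (Hs i)"
    and grad_\<pi>: "x \<in> E \<Longrightarrow> has_grad \<pi> (g\<pi> x) x" and cont_\<pi>: "continuous_on {x. \<Phi> x \<ge> 0} \<pi>" and cont_g\<pi>: "continuous_on E g\<pi>"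
    and divergence_free: "x \<in> E \<Longrightarrow> trace (J x) = 0"
    and momentum: "x \<in> E \<Longrightarrow> \<nu> * trace (Hs i x) = (J x *v v x) $ i + g\<pi> x $ i / \<rho>"
    and pos: "\<nu> > 0" and dens_pos: "\<rho> > 0"
    and no_flux: "\<Phi> x = 0 \<Longrightarrow> v x \<bullet> g x = 0" and no_work: "\<Phi> x = 0 \<Longrightarrow> (symj (J x) *v v x) \<bullet> g x = 0"
    and decay_v: "norm x \<ge> R1 \<Longrightarrow> norm (v x) \<le> K / (norm x)\<^sup>2"
    and lim_J: "(J \<longlongrightarrow> 0) at_infinity" and lim_\<pi>: "(\<pi> \<longlongrightarrow> 0) at_infinity"
    and exterior: "norm x \<ge> R1 \<Longrightarrow> \<Phi> x > 0" and R1: "R1 > 0"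
begin

lemma Hs_sym: "x \<in> E \<Longrightarrow> transpose (Hs i x) = Hs i x"
  by (rule hessian_symmetric[OF open_E, of x "\<lambda>x. v x $ i" "\<lambda>x. J x $ i"]) (auto intro: has_grad_component jac_v jac_J)

lemma Hs_swap: "x \<in> E \<Longrightarrow> Hs i x $ j $ k = Hs i x $ k $ j"
  by (rule symmetric_entries[OF Hs_sym])

lemma grad_div: assumes "x \<in> E" shows "(\<Sum>i\<in>UNIV. Hs i x $ i $ k) = 0"
proof -
  have "has_grad (\<lambda>x. \<Sum>i\<in>UNIV. J x $ i $ i) (\<Sum>i\<in>UNIV. Hs i x $ i) x"
    by (intro has_grad_sum has_grad_component jac_J assms) simp
  moreover have "has_grad (\<lambda>x. \<Sum>i\<in>UNIV. J x $ i $ i) 0 x"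
    by (rule has_grad_cong_open[OF has_grad_const open_E assms, of 0])
      (use divergence_free in \<open>simp add: trace_def\<close>)
  ultimately have "(\<Sum>i\<in>UNIV. Hs i x $ i) = 0" by (rule has_grad_unique)
  from arg_cong[OF this, of "\<lambda>u. u $ k"] show ?thesis by simp
qed

definition flux :: "R3 \<Rightarrow> R3" where
  "flux x = \<nu> *\<^sub>R (symj (J x) *v v x) - (\<pi> x / \<rho> + (v x \<bullet> v x) / 2) *\<^sub>R v x"

definition Jstress :: "R3 \<Rightarrow> real^3^3" where
  "Jstress x = (\<chi> i. (transpose (Hs i x) *v v x + transpose (J x) *v (J x $ i))
     + (\<Sum>k\<in>UNIV. v x $ k *\<^sub>R Hs k x $ i + J x $ k $ i *\<^sub>R J x $ k))"

definition Jflux :: "R3 \<Rightarrow> real^3^3" where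
  "Jflux x = \<nu> *\<^sub>R Jstress x - ((\<pi> x / \<rho> + (v x \<bullet> v x) / 2) *\<^sub>R J x
     + outer (v x) ((1 / \<rho>) *\<^sub>R g\<pi> x + transpose (J x) *v v x))"

lemma jac_stress: assumes x: "x \<in> E" shows "has_jac (\<lambda>x. symj (J x) *v v x) (Jstress x) x"
  unfolding Jstress_def
proof (rule has_jac_components)
  fix i
  have "has_grad (\<lambda>x. J x $ i \<bullet> v x) (transpose (Hs i x) *v v x + transpose (J x) *v (J x $ i)) x"
    by (rule has_grad_inner[OF jac_J[OF x] jac_v[OF x]])
  moreover have "has_grad (\<lambda>x. \<Sum>k\<in>UNIV. J x $ k $ i * v x $ k) (\<Sum>k\<in>UNIV. v x $ k *\<^sub>R Hs k x $ i + J x $ k $ i *\<^sub>R J x $ k) x"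
    by (intro has_grad_sum has_grad_mult has_grad_component jac_J jac_v x) simp
  ultimately have "has_grad (\<lambda>x. J x $ i \<bullet> v x + (\<Sum>k\<in>UNIV. J x $ k $ i * v x $ k))
     ((transpose (Hs i x) *v v x + transpose (J x) *v (J x $ i))
     + (\<Sum>k\<in>UNIV. v x $ k *\<^sub>R Hs k x $ i + J x $ k $ i *\<^sub>R J x $ k)) x" by (rule has_grad_add)
  moreover have "(symj (J x) *v v x) $ i = J x $ i \<bullet> v x + (\<Sum>k\<in>UNIV. J x $ k $ i * v x $ k)" for x
    by (simp add: symj_def matrix_vector_mult_def inner_vec_def transpose_def distrib_right sum.distrib)
  ultimately show "has_grad (\<lambda>x. (symj (J x) *v v x) $ i)
     ((transpose (Hs i x) *v v x + transpose (J x) *v (J x $ i))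
     + (\<Sum>k\<in>UNIV. v x $ k *\<^sub>R Hs k x $ i + J x $ k $ i *\<^sub>R J x $ k)) x" by simp
qed

lemma jac_flux: assumes x: "x \<in> E" shows "has_jac flux (Jflux x) x"
proof -
  have 1: "has_grad (\<lambda>x. (1 / 2) * (v x \<bullet> v x)) (transpose (J x) *v v x) x"
    using has_grad_mult[OF has_grad_const[of "1/2"] has_grad_inner[OF jac_v[OF x] jac_v[OF x]]]
    by (simp flip: scaleR_2)
  have 2: "has_grad (\<lambda>x. (1 / \<rho>) * \<pi> x) ((1 / \<rho>) *\<^sub>R g\<pi> x) x"
    using has_grad_mult[OF has_grad_const[of "1/\<rho>"] grad_\<pi>[OF x]] by simp
  have "has_jac (\<lambda>x. ((1 / \<rho>) * \<pi> x + (1 / 2) * (v x \<bullet> v x)) *\<^sub>R v x)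
     (((1 / \<rho>) * \<pi> x + (1 / 2) * (v x \<bullet> v x)) *\<^sub>R J x + outer (v x) ((1 / \<rho>) *\<^sub>R g\<pi> x + transpose (J x) *v v x)) x"
    by (rule has_jac_scaleR[OF has_grad_add[OF 2 1] jac_v[OF x]])
  from has_jac_diff[OF has_jac_cmul[OF jac_stress[OF x]] this]
  show ?thesis by (simp add: flux_def[abs_def] Jflux_def)
qed

lemma trace_stress:
  assumes x: "x \<in> E"
  shows "trace (Jstress x) = (\<Sum>i\<in>UNIV. v x $ i * trace (Hs i x)) + (symj (J x) \<bullet> symj (J x)) / 2"
proof -
  have g: "Hs 1 x $ 1 $ k + Hs 2 x $ 2 $ k + Hs 3 x $ 3 $ k = 0" for k using grad_div[OF x, of k] by (simp add: sum_3)
  have s: "Hs i x $ k $ i = Hs i x $ i $ k" for i k by (rule Hs_swap[OF x])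
  have "(\<Sum>i\<in>UNIV. (transpose (Hs i x) *v v x) $ i) = (\<Sum>k\<in>UNIV. v x $ k * (\<Sum>i\<in>UNIV. Hs i x $ i $ k))"
    unfolding matrix_vector_mult_def transpose_def by (simp add: s sum_3 algebra_simps)
  also have "\<dots> = 0" using grad_div[OF x] by simp
  finally have 1: "(\<Sum>i\<in>UNIV. (transpose (Hs i x) *v v x) $ i) = 0" .
  have 2: "(\<Sum>i\<in>UNIV. (\<Sum>k\<in>UNIV. v x $ k *\<^sub>R Hs k x $ i) $ i) = (\<Sum>i\<in>UNIV. v x $ i * trace (Hs i x))"
    by (simp add: sum_3 trace_def algebra_simps)
  have 3: "(\<Sum>i\<in>UNIV. (transpose (J x) *v (J x $ i)) $ i) + (\<Sum>i\<in>UNIV. (\<Sum>k\<in>UNIV. J x $ k $ i *\<^sub>R J x $ k) $ i)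
      = (symj (J x) \<bullet> symj (J x)) / 2"
    unfolding symj_def inner_vec_def matrix_vector_mult_def transpose_def
    by (simp add: sum_3) (simp add: field_simps)
  have "trace (Jstress x) = (\<Sum>i\<in>UNIV. (transpose (Hs i x) *v v x) $ i) + (\<Sum>i\<in>UNIV. (\<Sum>k\<in>UNIV. v x $ k *\<^sub>R Hs k x $ i) $ i)
     + ((\<Sum>i\<in>UNIV. (transpose (J x) *v (J x $ i)) $ i) + (\<Sum>i\<in>UNIV. (\<Sum>k\<in>UNIV. J x $ k $ i *\<^sub>R J x $ k) $ i))"
    unfolding trace_def Jstress_def by (simp add: sum.distrib)
  then show ?thesis unfolding 1 2 3 by simp
qed

lemma trace_flux: assumes x: "x \<in> E" shows "trace (Jflux x) = \<nu> / 2 * (symj (J x) \<bullet> symj (J x))"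
proof -
  have "\<nu> * (\<Sum>i\<in>UNIV. v x $ i * trace (Hs i x)) = (\<Sum>i\<in>UNIV. v x $ i * ((J x *v v x) $ i + g\<pi> x $ i / \<rho>))"
    unfolding sum_distrib_left by (rule sum.cong) (simp_all add: momentum[OF x, symmetric] mult_ac)
  also have "\<dots> = v x \<bullet> (J x *v v x) + (1 / \<rho>) * (v x \<bullet> g\<pi> x)"
    by (simp add: inner_vec_def sum.distrib distrib_left sum_distrib_left mult_ac divide_inverse)
  finally have m: "\<nu> * (\<Sum>i\<in>UNIV. v x $ i * trace (Hs i x)) = v x \<bullet> (J x *v v x) + (1 / \<rho>) * (v x \<bullet> g\<pi> x)" .
  have t: "v x \<bullet> (transpose (J x) *v v x) = v x \<bullet> (J x *v v x)" by (metis inner_commute inner_transpose)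
  have "trace (Jflux x) = \<nu> * trace (Jstress x) - ((1 / \<rho>) * (v x \<bullet> g\<pi> x) + v x \<bullet> (J x *v v x))"
    unfolding Jflux_def trace_sub trace_add trace_scaleR trace_outer divergence_free[OF x] inner_add_right t
    by simp
  then show ?thesis unfolding trace_stress[OF x] distrib_left m by simp
qed

lemma cont_symj: "continuous_on {x. \<Phi> x \<ge> 0} (\<lambda>x. symj (J x))"
  unfolding symj_def by (intro continuous_intros cont_J)

lemma cont_flux: "continuous_on {x. \<Phi> x \<ge> 0} flux"
  unfolding flux_def[abs_def] divide_inverse by (intro continuous_intros cont_symj cont_v cont_\<pi>)

lemma E_sub: "E \<subseteq> {x. \<Phi> x \<ge> 0}" by auto

lemma cont_Jflux: "continuous_on E Jflux"
proof -
  note c = continuous_on_subset[OF cont_J E_sub] continuous_on_subset[OF cont_v E_sub] continuous_on_subset[OF cont_\<pi> E_sub]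
  have cs: "continuous_on E Jstress"
    unfolding Jstress_def[abs_def] by (intro continuous_on_vec_lambda continuous_intros c cont_Hs)
  show ?thesis unfolding Jflux_def[abs_def] divide_inverse by (intro continuous_intros c cs cont_g\<pi>)
qed

lemma flux_no_boundary: "\<Phi> x = 0 \<Longrightarrow> flux x \<bullet> g x = 0"
  by (simp add: flux_def inner_diff_left no_flux no_work)

lemma flux_decay:
  assumes e: "e > 0"
  obtains R where "R \<ge> R1" "\<And>x. norm x \<ge> R \<Longrightarrow> norm (flux x) \<le> e / (norm x)\<^sup>2"
proof -
  have lim_v: "(v \<longlongrightarrow> 0) at_infinity"
  proof (rule Lim_null_comparison)
    show "\<forall>\<^sub>F x in at_infinity. norm (v x) \<le> K / (norm x)\<^sup>2"
      unfolding eventually_at_infinity using decay_v by blast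
    have n: "filterlim (\<lambda>x::R3. norm x) at_top at_infinity" by (rule filterlim_norm_at_top)
    have "((\<lambda>x::R3. K / (norm x)\<^sup>2) \<longlongrightarrow> 0) at_infinity"
      by (rule tendsto_divide_0[OF tendsto_const filterlim_at_top_imp_at_infinity])
        (rule filterlim_pow_at_top[OF _ n], simp)
    then show "((\<lambda>x::R3. K / (norm x)\<^sup>2) \<longlongrightarrow> 0) at_infinity" .
  qed
  have lt: "((\<lambda>x. transpose (J x)) \<longlongrightarrow> transpose 0) at_infinity"
    unfolding transpose_def by (intro tendsto_vec_lambda tendsto_vec_nth lim_J)
  have ls: "((\<lambda>x. symj (J x)) \<longlongrightarrow> 0) at_infinity"
  proof -
    have "transpose (0::real^3^3) = 0" by (simp add: transpose_def vec_eq_iff)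
    then show ?thesis using tendsto_add[OF lim_J lt] unfolding symj_def by simp
  qed
  define q where "q x = \<bar>\<nu>\<bar> * norm (symj (J x)) + \<bar>\<pi> x / \<rho> + (v x \<bullet> v x) / 2\<bar>" for x
  have "(q \<longlongrightarrow> \<bar>\<nu>\<bar> * norm (0::real^3^3) + \<bar>0 * inverse \<rho> + (0 \<bullet> (0::R3)) * inverse 2\<bar>) at_infinity"
    unfolding q_def divide_inverse by (intro tendsto_intros ls lim_\<pi> lim_v)
  then have lq: "(q \<longlongrightarrow> 0) at_infinity" by simp
  have K0: "K \<ge> 0"
  proof -
    define y :: R3 where "y = R1 *\<^sub>R axis 1 1"
    have "norm y = R1" using R1 by (simp add: y_def norm_axis_1)
    then have "0 \<le> K / (norm y)\<^sup>2" using decay_v[of y] norm_ge_zero[of "v y"] by linarith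
    then show ?thesis using R1 \<open>norm y = R1\<close> by (simp add: zero_le_divide_iff)
  qed
  have e': "e / (K + 1) > 0" using e K0 by simp
  from tendstoD[OF lq e'] obtain b where b: "\<And>x. norm x \<ge> b \<Longrightarrow> \<bar>q x\<bar> < e / (K + 1)"
    unfolding eventually_at_infinity by auto
  show ?thesis
  proof (rule that[of "max b R1"])
    fix x :: R3 assume x: "norm x \<ge> max b R1"
    have "norm x > 0" using x R1 by linarith
    then have n2: "(norm x)\<^sup>2 > 0" by simp
    have "norm (flux x) \<le> \<bar>\<nu>\<bar> * norm (symj (J x) *v v x) + \<bar>\<pi> x / \<rho> + (v x \<bullet> v x) / 2\<bar> * norm (v x)"
      unfolding flux_def using norm_triangle_ineq4[of "\<nu> *\<^sub>R (symj (J x) *v v x)" "(\<pi> x / \<rho> + (v x \<bullet> v x) / 2) *\<^sub>R v x"]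
      by simp
    also have "norm (symj (J x) *v v x) \<le> norm (symj (J x)) * norm (v x)" by (rule norm_matrix_vector_le)
    finally have "norm (flux x) \<le> q x * norm (v x)"
      by (simp add: q_def distrib_right mult.assoc mult_left_mono)
    also have "\<dots> \<le> (e / (K + 1)) * (K / (norm x)\<^sup>2)"
      using b[of x] decay_v[of x] x e' by (intro mult_mono) auto
    also have "\<dots> \<le> e / (norm x)\<^sup>2"
    proof -
      have "e / (K + 1) * K \<le> e" using e K0 by (simp add: field_simps)
      from divide_right_mono[OF this less_imp_le[OF n2]] show ?thesis by simp
    qed
    finally show "norm (flux x) \<le> e / (norm x)\<^sup>2" .
  qed simp
qed

end

definition far_cut :: "real \<Rightarrow> R3 \<Rightarrow> real" where "far_cut R x = 1 - step ((x \<bullet> x) / (2 * R\<^sup>2))"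
definition grad_far_cut :: "real \<Rightarrow> R3 \<Rightarrow> R3" where
  "grad_far_cut R x = - ((step' ((x \<bullet> x) / (2 * R\<^sup>2)) / R\<^sup>2) *\<^sub>R x)"

lemma has_grad_far_cut: "R > 0 \<Longrightarrow> has_grad (far_cut R) (grad_far_cut R x) x"
proof -
  assume R: "R > 0"
  have "has_grad (\<lambda>x. (1 / (2 * R\<^sup>2)) * (x \<bullet> x)) ((1 / (2 * R\<^sup>2)) *\<^sub>R (2 *\<^sub>R x)) x"
    using has_grad_mult[OF has_grad_const[of "1 / (2 * R\<^sup>2)"] has_grad_inner[OF has_jac_id has_jac_id]]
    by (simp add: transpose_mat flip: scaleR_2)
  then have "has_grad (\<lambda>x. (x \<bullet> x) / (2 * R\<^sup>2)) ((1 / R\<^sup>2) *\<^sub>R x) x" by simp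
  from has_grad_diff[OF has_grad_const[of 1] has_grad_chain[OF has_real_derivative_step this]]
  show ?thesis by (simp add: far_cut_def[abs_def] grad_far_cut_def)
qed

lemma far_cut_bounds: "0 \<le> far_cut R x" "far_cut R x \<le> 1"
  using step_simps(6,7) by (simp_all add: far_cut_def)

lemma far_cut_one: "R > 0 \<Longrightarrow> norm x \<le> R \<Longrightarrow> far_cut R x = 1"
proof -
  assume R: "R > 0" "norm x \<le> R"
  then have "(norm x)\<^sup>2 \<le> R\<^sup>2" by (intro power_mono) auto
  then show ?thesis using R by (simp add: far_cut_def power2_norm_eq_inner step_simps(1))
qed

lemma far_cut_zero: "R > 0 \<Longrightarrow> norm x \<ge> 2 * R \<Longrightarrow> far_cut R x = 0" "R > 0 \<Longrightarrow> norm x \<ge> 2 * R \<Longrightarrow> grad_far_cut R x = 0"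
proof -
  assume R: "R > 0" "norm x \<ge> 2 * R"
  then have "(2 * R)\<^sup>2 \<le> (norm x)\<^sup>2" by (intro power_mono) auto
  then have "4 * R\<^sup>2 \<le> x \<bullet> x" by (simp add: power2_norm_eq_inner power_mult_distrib)
  moreover have "R\<^sup>2 > 0" using R by simp
  ultimately have "1 * (2 * R\<^sup>2) \<le> x \<bullet> x" by linarith
  then have "1 \<le> (x \<bullet> x) / (2 * R\<^sup>2)" using \<open>R\<^sup>2 > 0\<close> by (subst pos_le_divide_eq) auto
  then show "far_cut R x = 0" "grad_far_cut R x = 0" by (simp_all add: far_cut_def grad_far_cut_def step_simps)
qed

lemma grad_far_cut_inner_zero: "R > 0 \<Longrightarrow> norm x \<le> R \<Longrightarrow> grad_far_cut R x = 0"
proof -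
  assume R: "R > 0" "norm x \<le> R"
  then have "(norm x)\<^sup>2 \<le> R\<^sup>2" by (intro power_mono) auto
  then have "(x \<bullet> x) / (2 * R\<^sup>2) \<le> 1 / 2" using R by (simp add: power2_norm_eq_inner)
  then show ?thesis by (simp add: grad_far_cut_def step_simps(4))
qed

lemma step'_bounded: obtains C where "C > 0" "\<And>t. step' t \<le> C"
proof -
  have "bounded (step' ` {0..1})"
    by (intro compact_imp_bounded compact_continuous_image continuous_on_step' continuous_on_id) auto
  then obtain C where C: "\<forall>t\<in>{0..1}. \<bar>step' t\<bar> \<le> C" by (auto simp: bounded_iff)
  have "step' t \<le> \<bar>C\<bar> + 1" for t
  proof (cases "t \<in> {0..1}")
    case True then show ?thesis using C by force
  next
    case False then have "step' t = 0" using step_simps(4,5)[of t] by (auto simp: not_le)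
    then show ?thesis by simp
  qed
  then show ?thesis using that[of "\<bar>C\<bar> + 1"] by (simp add: add_nonneg_pos)
qed

lemma grad_far_cut_bound:
  assumes C: "\<And>t. step' t \<le> C" and R: "R > 0" shows "norm (grad_far_cut R x) \<le> 2 * C / R"
proof (cases "norm x \<ge> 2 * R")
  case True
  have "0 \<le> C" using C[of 0] step_simps(3)[of 0] by linarith
  then show ?thesis using far_cut_zero(2)[OF R True] R by simp
next
  case False
  have s: "0 \<le> step' t" for t by (rule step_simps(3))
  have "norm (grad_far_cut R x) = step' ((x \<bullet> x) / (2 * R\<^sup>2)) / R\<^sup>2 * norm x"
    using s by (simp add: grad_far_cut_def)
  also have "\<dots> \<le> C / R\<^sup>2 * (2 * R)"
    using False C s order_trans[OF s C] by (intro mult_mono divide_right_mono) auto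
  also have "\<dots> = 2 * C / R" using R by (simp add: power2_eq_square)
  finally show ?thesis .
qed

lemma continuous_on_far_cut: "continuous_on S (far_cut R)" "R > 0 \<Longrightarrow> continuous_on S (grad_far_cut R)"
  unfolding far_cut_def[abs_def] grad_far_cut_def[abs_def] divide_inverse by (intro continuous_intros)+

context exterior_flow
begin

abbreviation diss :: "R3 \<Rightarrow> real" where "diss x \<equiv> \<nu> / 2 * (symj (J x) \<bullet> symj (J x))"

lemma diss_nonneg: "diss x \<ge> 0" using pos by simp

lemma energy_identity:
  assumes R: "R > 0"
  shows "set_integrable lborel E (\<lambda>x. far_cut R x * diss x)"
    "set_integrable lborel E (\<lambda>x. flux x \<bullet> grad_far_cut R x)"
    "(LINT x:E|lborel. far_cut R x * diss x) = - (LINT x:E|lborel. flux x \<bullet> grad_far_cut R x)"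
proof -
  let ?J = "\<lambda>x. far_cut R x *\<^sub>R Jflux x + outer (flux x) (grad_far_cut R x)"
  have tr: "trace (?J x) = far_cut R x * diss x + flux x \<bullet> grad_far_cut R x" if "x \<in> E" for x
    unfolding trace_add trace_scaleR trace_outer trace_flux[OF that] ..
  have cl: "compact ({x. \<Phi> x \<ge> 0} \<inter> cball 0 (2 * R))" using closed_E by (simp add: closed_Int_compact)
  have c1: "continuous_on {x. \<Phi> x \<ge> 0} (\<lambda>x. far_cut R x * diss x)"
    by (intro continuous_intros cont_symj continuous_on_far_cut)
  have c2: "continuous_on {x. \<Phi> x \<ge> 0} (\<lambda>x. flux x \<bullet> grad_far_cut R x)"
    by (intro continuous_intros cont_flux continuous_on_far_cut R)
  obtain B1 where B1: "\<forall>x\<in>{x. \<Phi> x \<ge> 0} \<inter> cball 0 (2 * R). \<bar>far_cut R x * diss x\<bar> \<le> B1"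
    using compact_imp_bounded[OF compact_continuous_image[OF continuous_on_subset[OF c1] cl]] by (auto simp: bounded_iff)
  obtain B2 where B2: "\<forall>x\<in>{x. \<Phi> x \<ge> 0} \<inter> cball 0 (2 * R). \<bar>flux x \<bullet> grad_far_cut R x\<bar> \<le> B2"
    using compact_imp_bounded[OF compact_continuous_image[OF continuous_on_subset[OF c2] cl]] by (auto simp: bounded_iff)
  have z: "far_cut R x = 0" "grad_far_cut R x = 0" if "x \<notin> cball 0 (2 * R)" for x
    using far_cut_zero[OF R, of x] that by auto
  have b1: "\<bar>far_cut R x * diss x\<bar> \<le> \<bar>B1\<bar>" if "x \<in> E" for x
  proof (cases "x \<in> cball 0 (2 * R)")
    case True
    then have "\<bar>far_cut R x * diss x\<bar> \<le> B1" using B1 that by simp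
    then show ?thesis by linarith
  next
    case False then show ?thesis using z(1)[OF False] by simp
  qed
  have b2: "\<bar>flux x \<bullet> grad_far_cut R x\<bar> \<le> \<bar>B2\<bar>" if "x \<in> E" for x
  proof (cases "x \<in> cball 0 (2 * R)")
    case True
    then have "\<bar>flux x \<bullet> grad_far_cut R x\<bar> \<le> B2" using B2 that by simp
    then show ?thesis by linarith
  next
    case False then show ?thesis using z(2)[OF False] by simp
  qed
  have eb: "E \<in> sets borel" using open_E by simp
  show i1: "set_integrable lborel E (\<lambda>x. far_cut R x * diss x)"
    by (rule set_integrable_bounded_continuous[OF eb bounded_cball[of 0 "2 * R"] continuous_on_subset[OF c1 E_sub] b1])
      (use z in simp_all)
  show i2: "set_integrable lborel E (\<lambda>x. flux x \<bullet> grad_far_cut R x)"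
    by (rule set_integrable_bounded_continuous[OF eb bounded_cball[of 0 "2 * R"] continuous_on_subset[OF c2 E_sub] b2])
      (use z in simp_all)
  have "(LINT x:E|lborel. trace (?J x)) = 0"
  proof (rule integral_div_zero)
    show "has_jac (\<lambda>x. far_cut R x *\<^sub>R flux x) (?J x) x" if "0 < \<Phi> x" for x
      by (rule has_jac_scaleR[OF has_grad_far_cut[OF R] jac_flux]) (use that in simp)
    show "continuous_on E ?J"
      by (intro continuous_intros continuous_on_far_cut R cont_Jflux continuous_on_subset[OF cont_flux E_sub])
    show "continuous_on {x. 0 \<le> \<Phi> x} (\<lambda>x. far_cut R x *\<^sub>R flux x)"
      by (intro continuous_intros continuous_on_far_cut cont_flux)
    show "0 \<le> 2 * R" using R by simp
    show "far_cut R x *\<^sub>R flux x = 0" if "0 < \<Phi> x" "2 * R < norm x" for x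
      using far_cut_zero(1)[OF R, of x] that by simp
    show "\<bar>trace (?J x)\<bar> \<le> \<bar>B1\<bar> + \<bar>B2\<bar>" if "0 < \<Phi> x" for x
    proof -
      have "x \<in> E" using that by simp
      from tr[OF this] b1[OF this] b2[OF this] show ?thesis by linarith
    qed
    show "far_cut R x *\<^sub>R flux x \<bullet> g x = 0" if "\<Phi> x = 0" for x
      using flux_no_boundary[OF that] by simp
  qed
  moreover have "(LINT x:E|lborel. trace (?J x)) = (LINT x:E|lborel. far_cut R x * diss x + flux x \<bullet> grad_far_cut R x)"
    by (rule set_lebesgue_integral_cong) (use eb tr in simp_all)
  ultimately show "(LINT x:E|lborel. far_cut R x * diss x) = - (LINT x:E|lborel. flux x \<bullet> grad_far_cut R x)"
    unfolding set_integral_add(2)[OF i1 i2] by linarith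
qed

lemma dissipation_vanishes_limit:
  assumes e: "e > 0"
  obtains R0 where "R0 > 0" "\<And>R. R \<ge> R0 \<Longrightarrow> (LINT x:E|lborel. far_cut R x * diss x) \<le> e"
proof -
  obtain C where C: "C > 0" "\<And>t. step' t \<le> C" by (rule step'_bounded, rule that)
  define b where "b = measure lborel (cball (0::R3) 1)"
  have b: "b \<ge> 0" by (simp add: b_def)
  define e' where "e' = e / (16 * C * b + 1)"
  have d: "16 * C * b + 1 > 0" using C b by (simp add: add_nonneg_pos)
  have e': "e' > 0" using e d by (simp add: e'_def)
  obtain R0 where R0: "R0 \<ge> R1" "\<And>x. norm x \<ge> R0 \<Longrightarrow> norm (flux x) \<le> e' / (norm x)\<^sup>2"
    by (rule flux_decay[OF e'], rule that)
  show ?thesis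
  proof (rule that[of R0])
    show "R0 > 0" using R0(1) R1 by simp
    fix R assume "R \<ge> R0"
    then have R: "R > 0" "R \<ge> R0" using R0(1) R1 by auto
    have pt: "- (flux x \<bullet> grad_far_cut R x) \<le> (2 * C * e' / R^3) * indicat_real (cball 0 (2 * R)) x" for x
    proof -
      consider "norm x \<le> R" | "norm x \<ge> 2 * R" | "R \<le> norm x" "norm x \<le> 2 * R" by linarith
      then show ?thesis
      proof cases
        case 1 then show ?thesis using grad_far_cut_inner_zero[OF R(1) 1] C e' R by simp
      next
        case 2 then show ?thesis using far_cut_zero(2)[OF R(1) 2] C e' R by simp
      next
        case 3
        have "- (flux x \<bullet> grad_far_cut R x) \<le> norm (flux x) * norm (grad_far_cut R x)"
          using Cauchy_Schwarz_ineq2[of "flux x" "grad_far_cut R x"] by linarith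
        also have "\<dots> \<le> (e' / R\<^sup>2) * (2 * C / R)"
        proof (intro mult_mono grad_far_cut_bound C R)
          have "norm (flux x) \<le> e' / (norm x)\<^sup>2" using R0(2)[of x] 3 R by simp
          also have "\<dots> \<le> e' / R\<^sup>2" using 3 R e' by (intro divide_left_mono power_mono mult_pos_pos) auto
          finally show "norm (flux x) \<le> e' / R\<^sup>2" .
        qed (use e' in auto)
        also have "\<dots> = (2 * C * e' / R^3) * indicat_real (cball 0 (2 * R)) x"
          using 3 by (simp add: power2_eq_square power3_eq_cube)
        finally show ?thesis .
      qed
    qed
    have ii: "integrable lborel (\<lambda>x. (2 * C * e' / R^3) * indicat_real (cball (0::R3) (2 * R)) x)"
      by (intro integrable_mult_right integrable_real_indicator emeasure_bounded_finite) auto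
    have "(LINT x:E|lborel. far_cut R x * diss x) = (LINT x:E|lborel. - (flux x \<bullet> grad_far_cut R x))"
    proof -
      have "(LINT x:E|lborel. - (flux x \<bullet> grad_far_cut R x)) = - (LINT x:E|lborel. flux x \<bullet> grad_far_cut R x)"
        unfolding set_lebesgue_integral_def by (simp only: scaleR_minus_right integral_minus)
      then show ?thesis using energy_identity(3)[OF R(1)] by (rule trans[OF _ sym, rotated])
    qed
    also have "\<dots> \<le> (LINT x|lborel. (2 * C * e' / R^3) * indicat_real (cball (0::R3) (2 * R)) x)"
      unfolding set_lebesgue_integral_def
    proof (rule integral_mono[OF _ ii])
      show "integrable lborel (\<lambda>x. indicat_real E x *\<^sub>R - (flux x \<bullet> grad_far_cut R x))"
        using energy_identity(2)[OF R(1)] unfolding set_integrable_def by (simp only: scaleR_minus_right integrable_minus)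
      show "indicat_real E x *\<^sub>R - (flux x \<bullet> grad_far_cut R x) \<le> (2 * C * e' / R^3) * indicat_real (cball 0 (2 * R)) x" for x
      proof (cases "x \<in> E")
        case True then show ?thesis using pt[of x] by simp
      next
        case False
        have "0 \<le> (2 * C * e' / R^3) * indicat_real (cball 0 (2 * R)) x" using C e' R by simp
        then show ?thesis using False by simp
      qed
    qed
    also have "\<dots> = (2 * C * e' / R^3) * measure lborel (cball (0::R3) (2 * R))" by simp
    also have "measure lborel (cball (0::R3) (2 * R)) = (2 * R)^3 * b"
      unfolding b_def using R content_cball[of "2 * R" "0::R3"] content_cball[of 1 "0::R3"] by simp
    also have "(2 * C * e' / R^3) * ((2 * R)^3 * b) = 16 * C * b * e'" using R by (simp add: power_mult_distrib)
    also have "\<dots> \<le> (16 * C * b + 1) * e'" using e' by (simp add: distrib_right)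
    also have "\<dots> = e" using d by (simp add: e'_def)
    finally show "(LINT x:E|lborel. far_cut R x * diss x) \<le> e" .
  qed
qed

lemma strain_zero:
  assumes x: "x \<in> E" shows "symj (J x) = 0"
proof (rule ccontr)
  assume ne: "symj (J x) \<noteq> 0"
  define q where "q = diss x / 2"
  have q: "q > 0" using pos ne by (simp add: q_def)
  have "continuous_on E diss" by (intro continuous_intros continuous_on_subset[OF cont_symj E_sub])
  then have "open {y\<in>E. diss y > q}"
    using continuous_open_preimage[OF _ open_E, of diss "{q<..}"] by (simp add: vimage_def Int_def)
  moreover have "x \<in> {y\<in>E. diss y > q}" using x q by (simp add: q_def)
  ultimately obtain d where d: "d > 0" "ball x d \<subseteq> {y\<in>E. diss y > q}" by (rule openE)
  define m where "m = measure lborel (ball x d)"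
  have m: "m > 0" using d(1) by (simp add: m_def content_ball_pos)
  have qm: "q * m / 2 > 0" using q m by simp
  obtain R0 where R0: "R0 > 0" "\<And>R. R \<ge> R0 \<Longrightarrow> (LINT x:E|lborel. far_cut R x * diss x) \<le> q * m / 2"
    by (rule dissipation_vanishes_limit[OF qm], rule that)
  define R where "R = max R0 (norm x + d)"
  have R: "R > 0" "R \<ge> R0" "R \<ge> norm x + d" using R0(1) by (auto simp: R_def)
  have "(LINT y|lborel. q * indicat_real (ball x d) y) \<le> (LINT y:E|lborel. far_cut R y * diss y)"
    unfolding set_lebesgue_integral_def
  proof (rule integral_mono)
    show "integrable lborel (\<lambda>y. q * indicat_real (ball x d) y)"
      by (intro integrable_mult_right integrable_real_indicator emeasure_bounded_finite) auto
    show "integrable lborel (\<lambda>y. indicat_real E y *\<^sub>R (far_cut R y * diss y))"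
      using energy_identity(1)[OF R(1)] unfolding set_integrable_def .
    show "q * indicat_real (ball x d) y \<le> indicat_real E y *\<^sub>R (far_cut R y * diss y)" for y
    proof (cases "y \<in> ball x d")
      case True
      then have y: "y \<in> E" "diss y > q" using d(2) by blast+
      have "norm y \<le> norm x + norm (y - x)" using norm_triangle_ineq[of x "y - x"] by simp
      then have "norm y \<le> R" using R(3) True by (simp add: dist_norm norm_minus_commute)
      then show ?thesis using far_cut_one[OF R(1)] True y by simp
    next
      case False
      have "0 \<le> far_cut R y * diss y" using far_cut_bounds(1) diss_nonneg by (rule mult_nonneg_nonneg)
      then show ?thesis using False by (simp add: indicator_def)
    qed
  qed
  then have "q * m \<le> q * m / 2" using R0(2)[OF R(2)] by (simp add: m_def)
  then show False using qm by linarith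
qed

lemma unbounded_E: "\<exists>x\<in>E. norm x \<ge> b"
proof -
  define y :: R3 where "y = (max b R1) *\<^sub>R axis 1 1"
  have "norm y = max b R1" using R1 by (simp add: y_def norm_axis_1)
  then show ?thesis using exterior[of y] by (intro bexI[of _ y]) auto
qed

lemma constant_zero:
  fixes f :: "R3 \<Rightarrow> 'b::real_normed_vector"
  assumes con: "connected E" and f: "\<And>x. x \<in> E \<Longrightarrow> (f has_derivative (\<lambda>h. 0)) (at x)"
    and lim: "(f \<longlongrightarrow> 0) at_infinity" and x: "x \<in> E"
  shows "f x = 0"
proof (rule ccontr)
  assume ne: "f x \<noteq> 0"
  then have "norm (f x) > 0" by simp
  from tendstoD[OF lim this] obtain b where b: "\<And>y. norm y \<ge> b \<Longrightarrow> norm (f y) < norm (f x)"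
    unfolding eventually_at_infinity by auto
  obtain y where y: "y \<in> E" "norm y \<ge> b" using unbounded_E by blast
  have "f y = f x" by (rule has_derivative_zero_unique_connected[OF open_E con f y(1) x])
  then show False using b[OF y(2)] by simp
qed

lemma at_rest:
  assumes con: "connected E" and x: "x \<in> E"
  shows "v x = 0" "\<pi> x = 0"
proof -
  \<comment> \<open>A Hessian family antisymmetric in i, j and symmetric in j, k vanishes.\<close>
  have anti: "Hs i y $ j $ k + Hs j y $ i $ k = 0" if y: "y \<in> E" for y i j k
  proof -
    have "has_grad (\<lambda>x. J x $ i $ j + J x $ j $ i) (Hs i y $ j + Hs j y $ i) y"
      by (intro has_grad_add has_grad_component jac_J y)
    moreover have "has_grad (\<lambda>x. J x $ i $ j + J x $ j $ i) 0 y"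
    proof (rule has_grad_cong_open[OF has_grad_const open_E y, of 0])
      fix z assume "z \<in> E"
      from arg_cong[OF strain_zero[OF this], of "\<lambda>M. M $ i $ j"]
      show "0 = J z $ i $ j + J z $ j $ i" by (simp add: symj_def transpose_def)
    qed
    ultimately have "Hs i y $ j + Hs j y $ i = 0" by (rule has_grad_unique)
    from arg_cong[OF this, of "\<lambda>u. u $ k"] show ?thesis by simp
  qed
  have H0: "Hs i y = 0" if y: "y \<in> E" for i y
  proof -
    have "Hs i y $ j $ k = 0" for j k
      using anti[OF y, of i j k] anti[OF y, of j k i] anti[OF y, of k i j]
        Hs_swap[OF y, of i j k] Hs_swap[OF y, of j i k] Hs_swap[OF y, of k i j] by linarith
    then show ?thesis by (simp add: vec_eq_iff)
  qed
  have J0: "J y = 0" if y: "y \<in> E" for y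
  proof -
    have "J y $ i = 0" for i
    proof (rule constant_zero[OF con _ _ y])
      show "((\<lambda>x. J x $ i) has_derivative (\<lambda>h. 0)) (at x)" if "x \<in> E" for x
        using jac_J[OF that, of i] H0[OF that, of i] by (simp add: has_jac_def)
      show "((\<lambda>x. J x $ i) \<longlongrightarrow> 0) at_infinity" using tendsto_vec_nth[OF lim_J, of i] by simp
    qed
    then show ?thesis by (simp add: vec_eq_iff)
  qed
  have lim_v: "(v \<longlongrightarrow> 0) at_infinity"
  proof (rule Lim_null_comparison)
    show "\<forall>\<^sub>F x in at_infinity. norm (v x) \<le> K / (norm x)\<^sup>2"
      unfolding eventually_at_infinity using decay_v by blast
    have n: "filterlim (\<lambda>x::R3. norm x) at_top at_infinity" by (rule filterlim_norm_at_top)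
    show "((\<lambda>x::R3. K / (norm x)\<^sup>2) \<longlongrightarrow> 0) at_infinity"
      by (rule tendsto_divide_0[OF tendsto_const filterlim_at_top_imp_at_infinity])
        (rule filterlim_pow_at_top[OF _ n], simp)
  qed
  show v0: "v x = 0"
    by (rule constant_zero[OF con _ lim_v x]) (use jac_v J0 in \<open>fastforce simp: has_jac_def\<close>)
  show "\<pi> x = 0"
  proof (rule constant_zero[OF con _ lim_\<pi> x])
    fix y assume y: "y \<in> E"
    have "g\<pi> y $ i = 0" for i using momentum[OF y, of i] dens_pos by (simp add: H0[OF y] J0[OF y] trace_def)
    then have "g\<pi> y = 0" by (simp add: vec_eq_iff)
    then show "(\<pi> has_derivative (\<lambda>h. 0)) (at y)" using grad_\<pi>[OF y] by (simp add: has_grad_def)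
  qed
qed

end

section \<open>Steady states: the liquid and the shape\<close>

lemma has_jac_imp_jac:
  assumes "has_jac F J x" "x \<in> interior S" shows "jac S F x = J"
  unfolding jac_def at_within_interior[OF assms(2)]
  using frechet_derivative_at[OF assms(1)[unfolded has_jac_def]] by (metis matrix_of_matrix_vector_mul)

lemma has_grad_imp_grad_interior:
  assumes "has_grad f g x" "x \<in> interior S" shows "grad S f x = g"
  using has_grad_imp_grad[OF assms(1) open_interior assms(2)]
  unfolding grad_def at_within_interior[OF assms(2)] at_within_open[OF assms(2) open_interior] .

lemma C2_on_subset: "C2_on S f \<Longrightarrow> T \<subseteq> S \<Longrightarrow> C2_on T f"
  unfolding C2_on_def by (meson continuous_on_subset has_derivative_subset subsetD)

lemma C2_on_continuous: assumes "C2_on S f" shows "continuous_on S f"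
  using assms unfolding C2_on_def continuous_on_eq_continuous_within by (blast intro: has_derivative_continuous)

lemma C2_on_linear:
  fixes L :: "'b::real_normed_vector \<Rightarrow>\<^sub>L 'c::real_normed_vector"
  assumes "C2_on S f" shows "C2_on S (\<lambda>x. blinfun_apply L (f x))"
proof -
  obtain f' :: "R3 \<Rightarrow> R3 \<Rightarrow>\<^sub>L 'b" and f'' :: "R3 \<Rightarrow> R3 \<Rightarrow>\<^sub>L R3 \<Rightarrow>\<^sub>L 'b" where
    f': "\<forall>x\<in>S. (f has_derivative blinfun_apply (f' x)) (at x within S)" and
    f'': "\<forall>x\<in>S. (f' has_derivative blinfun_apply (f'' x)) (at x within S)" and c: "continuous_on S f''"
    using assms unfolding C2_on_def by blast
  have bl: "bounded_linear (\<lambda>M :: R3 \<Rightarrow>\<^sub>L 'b. L o\<^sub>L M)"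
    by (rule bounded_bilinear.bounded_linear_right[OF bounded_bilinear_blinfun_compose])
  define LL where "LL = Blinfun (\<lambda>M :: R3 \<Rightarrow>\<^sub>L 'b. L o\<^sub>L M)"
  have LL: "blinfun_apply LL M = L o\<^sub>L M" for M by (simp add: LL_def bounded_linear_Blinfun_apply[OF bl])
  show ?thesis unfolding C2_on_def
  proof (intro exI conjI ballI)
    fix x assume x: "x \<in> S"
    have e: "blinfun_apply (L o\<^sub>L f' x) = (\<lambda>h. blinfun_apply L (blinfun_apply (f' x) h))" by auto
    show "((\<lambda>x. blinfun_apply L (f x)) has_derivative blinfun_apply (L o\<^sub>L f' x)) (at x within S)"
      unfolding e by (rule bounded_linear.has_derivative[OF blinfun.bounded_linear_right f'[rule_format, OF x]])
    have e2: "blinfun_apply (LL o\<^sub>L f'' x) = (\<lambda>h. L o\<^sub>L blinfun_apply (f'' x) h)" by (auto simp: LL)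
    show "((\<lambda>x. L o\<^sub>L f' x) has_derivative blinfun_apply (LL o\<^sub>L f'' x)) (at x within S)"
      unfolding e2 by (rule bounded_linear.has_derivative[OF bl f''[rule_format, OF x]])
  next
    show "continuous_on S (\<lambda>x. LL o\<^sub>L f'' x)"
      by (rule bounded_bilinear.continuous_on[OF bounded_bilinear_blinfun_compose continuous_on_const c])
  qed
qed

lemma C2_on_component:
  fixes v :: "R3 \<Rightarrow> R3" assumes "C2_on S v" shows "C2_on S (\<lambda>x. v x $ i)"
  using C2_on_linear[OF assms, of "Blinfun (\<lambda>u. u $ i)"]
  by (simp add: bounded_linear_Blinfun_apply[OF bounded_linear_vec_nth])

lemma C2_on_interior_scalar:
  fixes f :: "R3 \<Rightarrow> real"
  assumes "C2_on S f"
  obtains A where "is_C2 (interior S) f (grad S f) A" "\<And>x. x \<in> interior S \<Longrightarrow> laplacian S f x = trace (A x)"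
proof -
  obtain A where A: "is_C2 (interior S) f (grad (interior S) f) A"
    by (rule C2_on_open_imp_is_C2[OF open_interior C2_on_subset[OF assms interior_subset]], rule that)
  have gr: "grad (interior S) f x = grad S f x" if "x \<in> interior S" for x
    using A that has_grad_imp_grad_interior[of f _ x S] by (auto simp: is_C2_def)
  have j: "has_jac (grad S f) (A x) x" if "x \<in> interior S" for x
    by (rule has_jac_cong_open[OF _ open_interior that gr]) (use A that in \<open>auto simp: is_C2_def\<close>)
  have "is_C2 (interior S) f (grad S f) A" using A gr j by (auto simp: is_C2_def)
  moreover have "laplacian S f x = trace (A x)" if "x \<in> interior S" for x
    using has_jac_imp_jac[OF j[OF that] that] by (simp add: laplacian_def divergence_def)
  ultimately show ?thesis by (rule that)
qed

lemma C2_on_interior_jac: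
  fixes v :: "R3 \<Rightarrow> R3"
  assumes "C2_on S v" "x \<in> interior S"
  shows "has_jac v (jac S v x) x"
proof -
  obtain f' :: "R3 \<Rightarrow> R3 \<Rightarrow>\<^sub>L R3" where f': "\<forall>x\<in>S. (v has_derivative blinfun_apply (f' x)) (at x within S)"
    using assms(1) unfolding C2_on_def by blast
  then have d: "(v has_derivative blinfun_apply (f' x)) (at x)"
    using assms(2) interior_subset by (metis at_within_interior subsetD)
  have "has_jac v (matrix (blinfun_apply (f' x))) x"
    using d by (simp add: has_jac_def matrix_works bounded_linear.linear blinfun.bounded_linear_right)
  with has_jac_imp_jac[OF this assms(2)] show ?thesis by simp
qed

lemma C2_on_interior_vec:
  fixes v :: "R3 \<Rightarrow> R3"
  assumes "C2_on S v"
  obtains Hs where "\<And>i x. x \<in> interior S \<Longrightarrow> has_jac (\<lambda>x. jac S v x $ i) (Hs i x) x"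
    "\<And>i. continuous_on (interior S) (Hs i)" "\<And>i x. x \<in> interior S \<Longrightarrow> vec_laplacian S v x $ i = trace (Hs i x)"
proof -
  have "\<exists>A. is_C2 (interior S) (\<lambda>x. v x $ i) (grad S (\<lambda>x. v x $ i)) A \<and>
      (\<forall>x\<in>interior S. laplacian S (\<lambda>x. v x $ i) x = trace (A x))" for i
    by (rule C2_on_interior_scalar[OF C2_on_component[OF assms, of i]]) blast
  then obtain Hs where Hs: "\<And>i. is_C2 (interior S) (\<lambda>x. v x $ i) (grad S (\<lambda>x. v x $ i)) (Hs i)"
    "\<And>i x. x \<in> interior S \<Longrightarrow> laplacian S (\<lambda>x. v x $ i) x = trace (Hs i x)" by metis
  have row: "grad S (\<lambda>x. v x $ i) x = jac S v x $ i" if "x \<in> interior S" for i x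
    by (rule has_grad_imp_grad_interior[OF has_grad_component[OF C2_on_interior_jac[OF assms that]] that])
  show ?thesis
  proof (rule that[of Hs])
    show "has_jac (\<lambda>x. jac S v x $ i) (Hs i x) x" if "x \<in> interior S" for i x
      by (rule has_jac_cong_open[OF _ open_interior that row]) (use Hs(1) that in \<open>auto simp: is_C2_def\<close>)
    show "continuous_on (interior S) (Hs i)" for i using Hs(1) by (simp add: is_C2_def)
    show "vec_laplacian S v x $ i = trace (Hs i x)" if "x \<in> interior S" for i x
      using Hs(2)[OF that] by (simp add: vec_laplacian_def)
  qed
qed

context C2_function
begin

lemma interior_closed_side: "interior {x. \<Phi> x \<ge> 0} = E"
proof
  show "E \<subseteq> interior {x. \<Phi> x \<ge> 0}" by (rule interior_maximal[OF _ open_E]) auto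
  show "interior {x. \<Phi> x \<ge> 0} \<subseteq> E"
  proof
    fix x assume x: "x \<in> interior {x. \<Phi> x \<ge> 0}"
    then have p: "\<Phi> x \<ge> 0" using interior_subset by auto
    moreover have False if z: "\<Phi> x = 0"
    proof -
      from x obtain e where e: "e > 0" "ball x e \<subseteq> {x. \<Phi> x \<ge> 0}" unfolding mem_interior by blast
      have "\<Phi> x \<le> \<Phi> y" if "y \<in> ball x e" for y using e(2) that z by auto
      then have "g x = 0" using second_order_min(1)[of "ball x e" x \<Phi> g "A x"] e(1) grad_\<Phi> jac_g by simp
      then show False using regular[OF z] by simp
    qed
    ultimately show "x \<in> E" by fastforce
  qed
qed

lemma derivative_unique_closed_side:
  fixes f :: "R3 \<Rightarrow> 'b::real_normed_vector"
  assumes x: "\<Phi> x \<ge> 0" and L1: "(f has_derivative L1) (at x within {x. \<Phi> x \<ge> 0})"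
    and L2: "(f has_derivative L2) (at x within {x. \<Phi> x \<ge> 0})"
  shows "L1 = L2"
proof (cases "\<Phi> x = 0")
  case False
  then have i: "x \<in> interior {x. \<Phi> x \<ge> 0}" using x by (simp add: interior_closed_side)
  show ?thesis using has_derivative_unique L1 L2 unfolding at_within_interior[OF i] by blast
next
  case True
  have lin: "linear L1" "linear L2" using L1 L2 by (auto dest: has_derivative_linear)
  have inward: "L1 e = L2 e" if e: "g x \<bullet> e > 0" for e
  proof -
    obtain d where d: "d > 0" "\<And>t. 0 < t \<Longrightarrow> t < d \<Longrightarrow> \<Phi> (x + t *\<^sub>R e) > \<Phi> x"
      by (rule increasing_direction[OF grad_\<Phi> e], rule that)
    have img: "(\<lambda>t. x + t *\<^sub>R e) ` {0..d/2} \<subseteq> {x. \<Phi> x \<ge> 0}"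
    proof clarify
      fix t assume "t \<in> {0..d/2}"
      then show "\<Phi> (x + t *\<^sub>R e) \<ge> 0" using d(2)[of t] True d(1) by (cases "t = 0") force+
    qed
    have v: "((\<lambda>t. f (x + t *\<^sub>R e)) has_vector_derivative L e) (at 0 within {0..d/2})"
      if L: "(f has_derivative L) (at x within {x. \<Phi> x \<ge> 0})" for L
    proof -
      have p: "((\<lambda>t. x + t *\<^sub>R e) has_derivative (\<lambda>h. h *\<^sub>R e)) (at 0 within {0..d/2})" by (auto intro!: derivative_eq_intros)
      have "((\<lambda>t. f (x + t *\<^sub>R e)) has_derivative (\<lambda>h. L (h *\<^sub>R e))) (at 0 within {0..d/2})"
        using has_derivative_in_compose[OF p, of f L] has_derivative_subset[OF L img] by simp
      then show ?thesis using has_derivative_linear[OF L]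
        by (simp add: has_vector_derivative_def linear_scale)
    qed
    show ?thesis using vector_derivative_unique_within[OF _ v[OF L1] v[OF L2]] d(1)
      by (simp add: trivial_limit_within islimpt_Icc)
  qed
  have gp: "g x \<bullet> g x > 0" using regular[OF True] by simp
  show ?thesis
  proof
    fix h
    define k where "k = (\<bar>g x \<bullet> h\<bar> + 1) / (g x \<bullet> g x)"
    have "g x \<bullet> (h + k *\<^sub>R g x) = g x \<bullet> h + (\<bar>g x \<bullet> h\<bar> + 1)" using gp by (simp add: k_def inner_add_right)
    then have "L1 (h + k *\<^sub>R g x) = L2 (h + k *\<^sub>R g x)" by (intro inward) linarith
    then show "L1 h = L2 h" using inward[OF gp] by (simp add: linear_add[OF lin(1)] linear_add[OF lin(2)] linear_scale[OF lin(1)] linear_scale[OF lin(2)])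
  qed
qed

lemma jac_closed_side:
  assumes x: "\<Phi> x \<ge> 0" and d: "(v has_derivative L) (at x within {x. \<Phi> x \<ge> 0})"
  shows "jac {x. \<Phi> x \<ge> 0} v x = matrix L"
proof -
  have "(v has_derivative frechet_derivative v (at x within {x. \<Phi> x \<ge> 0})) (at x within {x. \<Phi> x \<ge> 0})"
    using d frechet_derivative_works differentiable_def by blast
  from derivative_unique_closed_side[OF x this d] show ?thesis by (simp add: jac_def)
qed

lemma continuous_on_jac_closed_side:
  assumes "C2_on {x. \<Phi> x \<ge> 0} v"
  shows "continuous_on {x. \<Phi> x \<ge> 0} (jac {x. \<Phi> x \<ge> 0} v)"
proof -
  let ?S = "{x. \<Phi> x \<ge> 0}"
  obtain f' :: "R3 \<Rightarrow> R3 \<Rightarrow>\<^sub>L R3" and f'' :: "R3 \<Rightarrow> R3 \<Rightarrow>\<^sub>L R3 \<Rightarrow>\<^sub>L R3" where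
    f': "\<forall>x\<in>?S. (v has_derivative blinfun_apply (f' x)) (at x within ?S)" and
    f'': "\<forall>x\<in>?S. (f' has_derivative blinfun_apply (f'' x)) (at x within ?S)"
    using assms unfolding C2_on_def by blast
  have c: "continuous_on ?S f'" unfolding continuous_on_eq_continuous_within
    using f'' by (blast intro: has_derivative_continuous)
  have "continuous_on ?S (\<lambda>x. matrix (blinfun_apply (f' x)))"
    unfolding matrix_def by (intro continuous_on_vec_lambda continuous_intros c)
  then show ?thesis
    by (rule continuous_on_eq) (use f' jac_closed_side in auto)
qed

end

lemma norm_decay_bound:
  fixes v :: "R3 \<Rightarrow> R3"
  assumes "(\<lambda>x. norm (v x)) \<in> O[at_infinity](\<lambda>x. 1 / norm x ^ 2)"
  obtains K b where "\<And>x. norm x \<ge> b \<Longrightarrow> norm (v x) \<le> K / (norm x)\<^sup>2"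
proof -
  obtain c where "\<forall>\<^sub>F x in at_infinity. norm (norm (v x)) \<le> c * norm (1 / norm x ^ 2)"
    using assms by (auto elim!: landau_o.bigE)
  then obtain b where "\<And>x. norm x \<ge> b \<Longrightarrow> norm (v x) \<le> c / (norm x)\<^sup>2"
    unfolding eventually_at_infinity by auto
  then show ?thesis by (rule that)
qed

locale equilibrium =
  fixes P :: bubble_params and p_inf :: real and st :: bubble_state
  assumes adm: "admissible P" and p_inf_pos: "p_inf > 0" and steady: "steady_state P p_inf st"
begin

abbreviation "\<Omega> \<equiv> region st"
abbreviation "normal \<equiv> outer_normal \<Omega>"

lemma params: "rho_liq P > 0" "mu_liq P \<ge> 0" "kappa_gas P > 0" "R_gas P > 0" "cv_gas P > 0" "sigma_st P > 0" "T_inf P > 0"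
  using adm by (auto simp: admissible_def)

lemma eqs: "bubble_geometry st" "C2_state st" "liquid_eqs P (\<lambda>_. st) 1" "gas_eqs P (\<lambda>_. st) 1"
    "boundary_eqs P (\<lambda>_. st) 1" "far_field P p_inf st"
  using steady unfolding steady_state_def AS_solution_def by (auto dest: spec[of _ 1])

lemma domain: "C2_domain \<Omega>" "open \<Omega>" "bounded \<Omega>" "\<Omega> \<noteq> {}"
  using eqs(1,2) by (auto simp: C2_state_def C2_domain_def bubble_geometry_def)

lemma parametrized: "surf st ` sphere 0 1 = frontier \<Omega>"
  using eqs(1) by (auto simp: bubble_geometry_def homeomorphism_def)

lemma connected_frontier: "connected (frontier \<Omega>)"
proof -
  obtain g where "homeomorphism (sphere 0 1) (frontier \<Omega>) (surf st) g" using eqs(1) by (auto simp: bubble_geometry_def)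
  then have "continuous_on (sphere 0 1) (surf st)" by (simp add: homeomorphism_def)
  moreover have "connected (sphere (0::R3) 1)" by (rule connected_sphere) simp
  ultimately show ?thesis unfolding parametrized[symmetric] by (rule connected_continuous_image)
qed

lemma C2_fields: "C2_on (- \<Omega>) (vel_l st)" "C2_on (- \<Omega>) (pres_l st)" "C2_on (closure \<Omega>) (dens_g st)"
    "C2_on (closure \<Omega>) (vel_g st)" "C2_on (closure \<Omega>) (temp_g st)" "C2_on (closure \<Omega>) (entr_g st)"
  using eqs(2) by (auto simp: C2_state_def)

lemma liquid:
  assumes "x \<notin> closure \<Omega>"
  shows "divergence (- \<Omega>) (vel_l st) x = 0"
    "nu_liq P * vec_laplacian (- \<Omega>) (vel_l st) x $ i =
      (jac (- \<Omega>) (vel_l st) x *v vel_l st x) $ i + grad (- \<Omega>) (pres_l st) x $ i / rho_liq P"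
proof -
  have e: "0 = nu_liq P *\<^sub>R vec_laplacian (- \<Omega>) (vel_l st) x - jac (- \<Omega>) (vel_l st) x *v vel_l st x
      - (1 / rho_liq P) *\<^sub>R grad (- \<Omega>) (pres_l st) x" "divergence (- \<Omega>) (vel_l st) x = 0"
    using eqs(3) assms by (auto simp: liquid_eqs_def Let_def)
  show "divergence (- \<Omega>) (vel_l st) x = 0" by (rule e)
  from arg_cong[OF e(1), of "\<lambda>u. u $ i"]
  show "nu_liq P * vec_laplacian (- \<Omega>) (vel_l st) x $ i =
      (jac (- \<Omega>) (vel_l st) x *v vel_l st x) $ i + grad (- \<Omega>) (pres_l st) x $ i / rho_liq P" by simp
qed

lemma liquid_temperature: "x \<notin> \<Omega> \<Longrightarrow> temp_l st x = T_inf P"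
  using eqs(3) by (auto simp: liquid_eqs_def Let_def)

lemma gas_pos: "pres_g st > 0" "x \<in> \<Omega> \<Longrightarrow> dens_g st x > 0"
  using eqs(4) by (auto simp: gas_eqs_def Let_def)

lemma gas:
  assumes "x \<in> \<Omega>"
  shows "divergence \<Omega> (\<lambda>y. dens_g st y *\<^sub>R vel_g st y) x = 0"
    "dens_g st x * temp_g st x * (vel_g st x \<bullet> grad \<Omega> (entr_g st) x) = divergence \<Omega> (\<lambda>y. kappa_gas P *\<^sub>R grad \<Omega> (temp_g st) y) x"
    "pres_g st = R_gas P * temp_g st x * dens_g st x"
    "entr_g st x = cv_gas P * ln (pres_g st / dens_g st x powr gamma_gas P)"
  using eqs(4) assms by (auto simp: gas_eqs_def Let_def)

lemma tangential: assumes "x \<in> frontier \<Omega>" shows "vel_l st x \<bullet> normal x = 0" "vel_g st x \<bullet> normal x = 0"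
proof -
  obtain y where y: "y \<in> sphere 0 1" "x = surf st y" using assms parametrized by blast
  have "vel_l st x \<bullet> normal x = vel_g st x \<bullet> normal x" "vel_g st x \<bullet> normal x = 0"
    using eqs(5) y by (auto simp: boundary_eqs_def Let_def)
  then show "vel_l st x \<bullet> normal x = 0" "vel_g st x \<bullet> normal x = 0" by auto
qed

lemma traction:
  assumes "x \<in> frontier \<Omega>"
  shows "pres_g st *\<^sub>R normal x - pres_l st x *\<^sub>R normal x + (2 * mu_liq P) *\<^sub>R (normal x v* sym_grad (- \<Omega>) (vel_l st) x)
    = (sigma_st P * surface_div (frontier \<Omega>) (normal x) normal x) *\<^sub>R normal x" "temp_g st x = T_inf P"
  using eqs(5) assms by (auto simp: boundary_eqs_def Let_def)

lemma traction_at_rest: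
  assumes x: "x \<in> frontier \<Omega>" and J: "jac (- \<Omega>) (vel_l st) x = 0" and n: "normal x \<noteq> 0"
  shows "pres_g st - pres_l st x = sigma_st P * surface_div (frontier \<Omega>) (normal x) normal x"
proof -
  have "transpose (0::real^3^3) = 0" by (simp add: transpose_def vec_eq_iff)
  then have "(pres_g st - pres_l st x) *\<^sub>R normal x = (sigma_st P * surface_div (frontier \<Omega>) (normal x) normal x) *\<^sub>R normal x"
    using traction(1)[OF x] by (simp add: sym_grad_def J scaleR_diff_left)
  then show ?thesis using n by simp
qed

lemma exterior_geometry:
  obtains \<Phi> g A where "C2_function \<Phi> g A" "- \<Omega> = {x. \<Phi> x \<ge> 0}" "- closure \<Omega> = {x. \<Phi> x > 0}" "frontier \<Omega> = {x. \<Phi> x = 0}"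
    "bounded {x. \<Phi> x \<le> 1}" "\<And>x. \<Phi> x = 0 \<Longrightarrow> normal x = g x /\<^sub>R norm (g x)" "connected {x. \<Phi> x > 0}"
proof -
  obtain \<Phi> g A where C2: "is_C2 UNIV \<Phi> g A" and \<Omega>: "\<Omega> = {x. \<Phi> x > 0}" and fr: "frontier \<Omega> = {x. \<Phi> x = 0}"
    and bd1: "bounded {x. \<Phi> x \<ge> - 1}" and reg: "\<And>x. \<Phi> x = 0 \<Longrightarrow> g x \<noteq> 0"
    and on: "\<And>x. \<Phi> x = 0 \<Longrightarrow> normal x = - (g x /\<^sub>R norm (g x))"
    by (rule global_defining_function[OF domain(1,3)], rule that)
  have C2': "is_C2 UNIV (\<lambda>x. - \<Phi> x) (\<lambda>x. - g x) (\<lambda>x. - A x)" using is_C2_cmul[OF C2, of "-1"] by simp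
  interpret C2_function "\<lambda>x. - \<Phi> x" "\<lambda>x. - g x" "\<lambda>x. - A x"
    by (rule C2_functionI[OF C2']) (use reg in simp)
  show ?thesis
  proof (rule that[of "\<lambda>x. - \<Phi> x" "\<lambda>x. - g x" "\<lambda>x. - A x"])
    show "C2_function (\<lambda>x. - \<Phi> x) (\<lambda>x. - g x) (\<lambda>x. - A x)" ..
    show "- \<Omega> = {x. - \<Phi> x \<ge> 0}" using \<Omega> by auto
    have cl: "x \<in> closure \<Omega> \<longleftrightarrow> x \<in> \<Omega> \<or> x \<in> frontier \<Omega>" for x
      unfolding frontier_def interior_open[OF domain(2)] using closure_subset[of \<Omega>] by blast
    have m: "x \<in> \<Omega> \<longleftrightarrow> \<Phi> x > 0" "x \<in> frontier \<Omega> \<longleftrightarrow> \<Phi> x = 0" for x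
      using arg_cong[OF \<Omega>, of "\<lambda>S. x \<in> S"] arg_cong[OF fr, of "\<lambda>S. x \<in> S"] by (simp_all only: mem_Collect_eq)
    show "- closure \<Omega> = {x. - \<Phi> x > 0}"
      by (rule set_eqI) (simp only: Compl_iff mem_Collect_eq cl m, linarith)
    show "frontier \<Omega> = {x. - \<Phi> x = 0}" using fr by simp
    show "bounded {x. - \<Phi> x \<le> 1}" using bd1 by (rule bounded_subset) auto
    show "normal x = - g x /\<^sub>R norm (- g x)" if "- \<Phi> x = 0" for x using on that by simp
    show "connected {x. - \<Phi> x > 0}" by (rule connected_side) (use connected_frontier fr in simp)
  qed
qed

lemma normal_nonzero: "x \<in> frontier \<Omega> \<Longrightarrow> normal x \<noteq> 0"
  by (rule exterior_geometry) (auto simp: C2_function_def)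

lemma liquid_at_rest:
  assumes \<mu>: "mu_liq P \<noteq> 0" and v: "(\<lambda>x. norm (vel_l st x)) \<in> O[at_infinity](\<lambda>x. 1 / norm x ^ 2)"
    and J: "(jac (- \<Omega>) (vel_l st) \<longlongrightarrow> 0) at_infinity" and x: "x \<notin> \<Omega>"
  shows "vel_l st x = 0" "pres_l st x = p_inf"
proof -
  obtain \<Phi> g A where C2: "C2_function \<Phi> g A" and S: "- \<Omega> = {x. \<Phi> x \<ge> 0}" and E: "- closure \<Omega> = {x. \<Phi> x > 0}"
    and fr: "frontier \<Omega> = {x. \<Phi> x = 0}" and bd: "bounded {x. \<Phi> x \<le> 1}"
    and n: "\<And>x. \<Phi> x = 0 \<Longrightarrow> normal x = g x /\<^sub>R norm (g x)" and con: "connected {x. \<Phi> x > 0}"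
    by (rule exterior_geometry, rule that)
  interpret C2_function \<Phi> g A by (rule C2)
  have int: "interior (- \<Omega>) = E" unfolding S by (rule interior_closed_side)
  have ne: "y \<notin> closure \<Omega>" if "\<Phi> y > 0" for y using that E by blast
  obtain K b where K: "\<And>x. norm x \<ge> b \<Longrightarrow> norm (vel_l st x) \<le> K / (norm x)\<^sup>2" by (rule norm_decay_bound[OF v], rule that)
  obtain b' where b': "\<And>x. \<Phi> x \<le> 1 \<Longrightarrow> norm x \<le> b'" using bd by (auto simp: bounded_iff)
  obtain Hs where Hs: "\<And>i x. x \<in> E \<Longrightarrow> has_jac (\<lambda>x. jac (- \<Omega>) (vel_l st) x $ i) (Hs i x) x"
    "\<And>i. continuous_on E (Hs i)" "\<And>i x. x \<in> E \<Longrightarrow> vec_laplacian (- \<Omega>) (vel_l st) x $ i = trace (Hs i x)"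
    by (rule C2_on_interior_vec[OF C2_fields(1), unfolded int], rule that)
  obtain B where B: "is_C2 E (pres_l st) (grad (- \<Omega>) (pres_l st)) B"
    by (rule C2_on_interior_scalar[OF C2_fields(2), unfolded int], rule that)
  interpret exterior_flow \<Phi> g A "vel_l st" "jac (- \<Omega>) (vel_l st)" Hs "\<lambda>x. pres_l st x - p_inf" "grad (- \<Omega>) (pres_l st)"
    "nu_liq P" "rho_liq P" K "max (max b (b' + 1)) 1"
  proof
    show "has_jac (vel_l st) (jac (- \<Omega>) (vel_l st) x) x" if "x \<in> E" for x
      by (rule C2_on_interior_jac[OF C2_fields(1)]) (use that int in simp)
    show "continuous_on {x. 0 \<le> \<Phi> x} (vel_l st)" using C2_on_continuous[OF C2_fields(1)] S by simp
    show "has_jac (\<lambda>x. jac (- \<Omega>) (vel_l st) x $ i) (Hs i x) x" if "x \<in> E" for x i using Hs(1) that by simp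
    show "continuous_on {x. 0 \<le> \<Phi> x} (jac (- \<Omega>) (vel_l st))"
      using continuous_on_jac_closed_side[of "vel_l st"] C2_fields(1) unfolding S by blast
    show "continuous_on E (Hs i)" for i by (rule Hs(2))
    have p: "has_grad (pres_l st) (grad (- \<Omega>) (pres_l st) x) x" if "x \<in> E" for x using B that by (simp add: is_C2_def)
    show "has_grad (\<lambda>x. pres_l st x - p_inf) (grad (- \<Omega>) (pres_l st) x) x" if "x \<in> E" for x
      using has_grad_diff[OF p[OF that] has_grad_const[of p_inf]] by simp
    show "continuous_on {x. 0 \<le> \<Phi> x} (\<lambda>x. pres_l st x - p_inf)"
      using C2_on_continuous[OF C2_fields(2)] unfolding S by (intro continuous_intros)
    show "continuous_on E (grad (- \<Omega>) (pres_l st))" by (rule is_C2_continuous(2)[OF B])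
    show "trace (jac (- \<Omega>) (vel_l st) x) = 0" if "x \<in> E" for x
      using liquid(1)[OF ne, of x] that by (simp add: divergence_def)
    show "nu_liq P * trace (Hs i x) = (jac (- \<Omega>) (vel_l st) x *v vel_l st x) $ i + grad (- \<Omega>) (pres_l st) x $ i / rho_liq P"
      if "x \<in> E" for x i
      using liquid(2)[OF ne, of x i] Hs(3)[of x i] that by simp
    show "nu_liq P > 0" "rho_liq P > 0" using params \<mu> by (auto simp: nu_liq_def)
    show nf: "vel_l st x \<bullet> g x = 0" if z: "\<Phi> x = 0" for x
      using tangential(1)[of x] regular[OF z] by (simp add: fr z n)
    show "(symj (jac (- \<Omega>) (vel_l st) x) *v vel_l st x) \<bullet> g x = 0" if z: "\<Phi> x = 0" for x
    proof -
      let ?J = "jac (- \<Omega>) (vel_l st) x"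
      have xf: "x \<in> frontier \<Omega>" using z fr by simp
      have vn: "normal x \<bullet> vel_l st x = 0" using tangential(1)[OF xf] by (simp add: inner_commute)
      have "(2 * mu_liq P) * ((normal x v* sym_grad (- \<Omega>) (vel_l st) x) \<bullet> vel_l st x) = 0"
        using arg_cong[OF traction(1)[OF xf], of "\<lambda>u. u \<bullet> vel_l st x"] by (simp add: inner_add_left inner_diff_left vn)
      then have "normal x \<bullet> (sym_grad (- \<Omega>) (vel_l st) x *v vel_l st x) = 0" using \<mu> by (simp add: dot_lmul_matrix)
      then have "normal x \<bullet> (symj ?J *v vel_l st x) = 0" by (simp add: sym_grad_def symj_def scaleR_matrix_vector)
      then show ?thesis using regular[OF z] by (simp add: n[OF z] inner_commute)
    qed
    show "norm (vel_l st x) \<le> K / (norm x)\<^sup>2" if "max (max b (b' + 1)) 1 \<le> norm x" for x using K that by simp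
    show "(jac (- \<Omega>) (vel_l st) \<longlongrightarrow> 0) at_infinity" by (rule J)
    have "(pres_l st \<longlongrightarrow> p_inf) at_infinity" using eqs(6) by (simp add: far_field_def)
    then show "((\<lambda>x. pres_l st x - p_inf) \<longlongrightarrow> 0) at_infinity" by (simp add: LIM_zero_iff)
    show "\<Phi> x > 0" if "max (max b (b' + 1)) 1 \<le> norm x" for x
    proof (rule ccontr)
      assume "\<not> \<Phi> x > 0"
      then have "norm x \<le> b'" using b'[of x] by simp
      then show False using that by simp
    qed
    show "max (max b (b' + 1)) 1 > 0" by simp
  qed
  have cl: "x \<in> closure E"
  proof (cases "\<Phi> x = 0")
    case True
    show ?thesis unfolding closure_iff_nhds_not_empty using zero_set_approachable[OF True] by blast
  next
    case False
    then have "x \<in> E" using x S by (metis Compl_iff mem_Collect_eq less_le)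
    then show ?thesis using closure_subset by (rule subsetD[rotated])
  qed
  have sub: "closure E \<subseteq> {x. 0 \<le> \<Phi> x}" by (rule closure_minimal[OF _ closed_E]) auto
  show "vel_l st x = 0"
    by (rule continuous_constant_on_closure[OF continuous_on_subset[OF cont_v sub] _ cl]) (use at_rest(1)[OF con] in simp)
  have "pres_l st x - p_inf = 0"
    by (rule continuous_constant_on_closure[OF continuous_on_subset[OF cont_\<pi> sub] _ cl]) (use at_rest(2)[OF con] in simp)
  then show "pres_l st x = p_inf" by simp
qed

lemma jac_at_rest:
  assumes rest: "\<And>x. x \<notin> \<Omega> \<Longrightarrow> vel_l st x = 0" and x: "x \<in> frontier \<Omega>"
  shows "jac (- \<Omega>) (vel_l st) x = 0"
proof -
  obtain \<Phi> g A where C2: "C2_function \<Phi> g A" and S: "- \<Omega> = {x. \<Phi> x \<ge> 0}" and fr: "frontier \<Omega> = {x. \<Phi> x = 0}"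
    by (rule exterior_geometry, rule that)
  interpret C2_function \<Phi> g A by (rule C2)
  have z: "\<Phi> x \<ge> 0" using x fr by auto
  have "jac (- \<Omega>) (vel_l st) x = matrix (\<lambda>h. 0)"
    unfolding S
  proof (rule jac_closed_side[OF z])
    show "(vel_l st has_derivative (\<lambda>h. 0)) (at x within {x. 0 \<le> \<Phi> x})"
      by (rule has_derivative_transform[OF _ _ has_derivative_const[of 0]]) (use z rest S in auto)
  qed
  then show ?thesis by (simp add: matrix_def vec_eq_iff)
qed

lemma spherical:
  assumes rest: "\<And>x. x \<notin> \<Omega> \<Longrightarrow> vel_l st x = 0 \<and> pres_l st x = p_inf"
  shows "\<exists>c. \<exists>R>0. \<Omega> = ball c R"
proof (rule alexandrov[OF domain(1,3,4) connected_frontier])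
  fix x assume x: "x \<in> frontier \<Omega>"
  then have "x \<notin> \<Omega>" using domain(2) by (simp add: frontier_def interior_open)
  then show "surface_div (frontier \<Omega>) (normal x) normal x = (pres_g st - p_inf) / sigma_st P"
    using traction_at_rest[OF x jac_at_rest[OF _ x] normal_nonzero[OF x]] rest params by (simp add: field_simps)
qed

end

section \<open>Balls and the equilibrium radius\<close>

abbreviation "sphere_fun R x \<equiv> R\<^sup>2 - (x::R3) \<bullet> x"

lemma sphere_fun_iff:
  assumes "R > 0"
  shows "sphere_fun R x = 0 \<longleftrightarrow> norm x = R" "sphere_fun R x > 0 \<longleftrightarrow> norm x < R"
  using assms power2_eq_iff_nonneg[of R "norm x"] power_mono_iff[of R "norm x" 2]
  by (auto simp: power2_norm_eq_inner[symmetric] not_le[symmetric])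

lemma C2_sphere_fun: "is_C2 S (sphere_fun R) (\<lambda>x. - (2 *\<^sub>R x)) (\<lambda>x. - (2 *\<^sub>R mat 1))"
  using is_C2_quadratic[of S "R\<^sup>2" 1 0] by simp

lemma C2_function_sphere: "R > 0 \<Longrightarrow> C2_function (sphere_fun R) (\<lambda>x. - (2 *\<^sub>R x)) (\<lambda>x. - (2 *\<^sub>R mat 1))"
  by (rule C2_functionI[OF C2_sphere_fun]) auto

lemma is_C2_imp_C2_on:
  assumes U: "open U" and f: "is_C2 U f g A" shows "C2_on U f"
proof -
  let ?f' = "\<lambda>x. blinfun_inner_left (g x)"
  have bl: "bounded_linear (blinfun_inner_left :: R3 \<Rightarrow> R3 \<Rightarrow>\<^sub>L real)"
    by (rule bounded_linear_blinfun_inner_left)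
  have blv: "bounded_linear (\<lambda>h. A x *v h)" for x by (rule matrix_vector_mul_bounded_linear)
  define f'' where "f'' x = Blinfun (\<lambda>h. blinfun_inner_left (A x *v h))" for x
  have f'': "blinfun_apply (f'' x) = (\<lambda>h. blinfun_inner_left (A x *v h))" for x
    unfolding f''_def by (rule bounded_linear_Blinfun_apply[OF bounded_linear_compose[OF bl blv]])
  show ?thesis unfolding C2_on_def
  proof (intro exI conjI ballI)
    fix x assume x: "x \<in> U"
    have e: "blinfun_apply (?f' x) = (\<lambda>h. g x \<bullet> h)" by (auto simp: inner_commute)
    show "(f has_derivative blinfun_apply (?f' x)) (at x within U)"
      unfolding e using f x by (auto simp: is_C2_def has_grad_def intro: has_derivative_at_withinI)
    have "(g has_derivative (\<lambda>h. A x *v h)) (at x within U)"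
      using f x by (auto simp: is_C2_def has_jac_def intro: has_derivative_at_withinI)
    then show "(?f' has_derivative blinfun_apply (f'' x)) (at x within U)"
      unfolding f'' by (rule bounded_linear.has_derivative[OF bl])
  next
    have cA: "continuous_on U A" using f by (simp add: is_C2_def)
    show "continuous_on U f''"
      by (rule continuous_on_blinfun_componentwise) (simp only: f'', intro bounded_linear.continuous_on[OF bl] continuous_intros cA)
  qed
qed

lemma C2_on_const: "C2_on S (\<lambda>x. c)"
  unfolding C2_on_def
  by (rule exI[of _ "\<lambda>x. 0"], rule exI[of _ "\<lambda>x. 0"]) (auto simp: zero_blinfun.rep_eq)

lemma C2_defining_ball:
  assumes R: "R > 0" and x: "norm x = R"
  shows "C2_defining (ball 0 R) x (- {0}) (\<lambda>x. - sphere_fun R x)" "grad (- {0}) (\<lambda>x. - sphere_fun R x) x = 2 *\<^sub>R x"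
proof -
  have C2: "is_C2 (- {0}) (\<lambda>x. - sphere_fun R x) (\<lambda>x. 2 *\<^sub>R x) (\<lambda>x. 2 *\<^sub>R mat 1)"
    using is_C2_cmul[OF C2_sphere_fun, of _ "-1" R] by simp
  have gr: "grad (- {0}) (\<lambda>x. - sphere_fun R x) y = 2 *\<^sub>R y" if "y \<noteq> 0" for y
    by (rule has_grad_imp_grad) (use C2 that in \<open>auto simp: is_C2_def\<close>)
  have x0: "x \<noteq> 0" using R x by auto
  show "grad (- {0}) (\<lambda>x. - sphere_fun R x) x = 2 *\<^sub>R x" by (rule gr[OF x0])
  show "C2_defining (ball 0 R) x (- {0}) (\<lambda>x. - sphere_fun R x)"
    unfolding C2_defining_def
  proof (intro conjI ballI)
    show "C2_on (- {0}) (\<lambda>x. - sphere_fun R x)" by (rule is_C2_imp_C2_on[OF _ C2]) auto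
    show "ball 0 R \<inter> - {0} = {y \<in> - {0}. - sphere_fun R y < 0}"
      by (rule set_eqI) (simp only: Int_iff mem_Collect_eq mem_ball dist_0_norm neg_less_0_iff_less sphere_fun_iff(2)[OF R], rule conj_commute)
    show "frontier (ball 0 R) \<inter> - {0} = {y \<in> - {0}. - sphere_fun R y = 0}"
      by (rule set_eqI) (simp only: frontier_ball[OF R] Int_iff mem_Collect_eq mem_sphere dist_0_norm neg_equal_0_iff_equal sphere_fun_iff(1)[OF R], rule conj_commute)
  qed (use gr x0 in auto)
qed

lemma C2_domain_ball: "R > 0 \<Longrightarrow> C2_domain (ball 0 R)"
  unfolding C2_domain_def by (auto simp only: open_ball frontier_ball mem_sphere dist_0_norm intro!: exI C2_defining_ball(1))

lemma outer_normal_ball: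
  assumes R: "R > 0" and x: "norm x = R" shows "outer_normal (ball 0 R) x = x /\<^sub>R R"
proof -
  have "outer_normal (ball 0 R) x = (2 *\<^sub>R x) /\<^sub>R norm (2 *\<^sub>R x)"
    using outer_normal_eq[OF C2_defining_ball(1)[OF R x]] C2_defining_ball(2)[OF R x] x R by (simp add: frontier_ball)
  then show ?thesis using x R by simp
qed

lemma surface_div_sphere:
  assumes R: "R > 0" and x: "norm x = R"
  shows "surface_div (frontier (ball 0 R)) (outer_normal (ball 0 R) x) (outer_normal (ball 0 R)) x = 2 / R"
proof -
  interpret C2_function "sphere_fun R" "\<lambda>x. - (2 *\<^sub>R x)" "\<lambda>x. - (2 *\<^sub>R mat 1)" by (rule C2_function_sphere[OF R])
  have fr: "frontier (ball 0 R) = {x. sphere_fun R x = 0}" unfolding sphere_fun_iff(1)[OF R] using R by (auto simp: frontier_ball)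
  have s: "transpose (- (2 *\<^sub>R mat 1)) = (- (2 *\<^sub>R mat 1) :: real^3^3)" by (simp add: transpose_def mat_def vec_eq_iff)
  have "surface_div {x. sphere_fun R x = 0} (outer_normal (ball 0 R) x) (outer_normal (ball 0 R)) x
      = - (tr_perp (- (2 *\<^sub>R mat 1)) (- (2 *\<^sub>R x) /\<^sub>R norm (- (2 *\<^sub>R x))) / norm (- (2 *\<^sub>R x)))"
  proof (rule surface_div_formula[OF _ s])
    show "sphere_fun R x = 0" by (simp only: sphere_fun_iff(1)[OF R] x)
    show "outer_normal (ball 0 R) y = - (- (2 *\<^sub>R y) /\<^sub>R norm (- (2 *\<^sub>R y)))" if "sphere_fun R y = 0" for y
      using outer_normal_ball[OF R] that R unfolding sphere_fun_iff(1)[OF R] by simp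
  qed
  also have "tr_perp (- (2 *\<^sub>R mat 1)) (- (2 *\<^sub>R x) /\<^sub>R norm (- (2 *\<^sub>R x))) = -4"
  proof -
    have "trace (mat 1 :: real^3^3) = 3" by (simp add: trace_def mat_def)
    moreover have "x \<bullet> x = R\<^sup>2" using x by (simp add: power2_norm_eq_inner[symmetric])
    ultimately show ?thesis using R x
      by (simp add: tr_perp_def trace_minus trace_scaleR uminus_matrix_vector scaleR_matrix_vector power2_eq_square field_simps)
  qed
  finally show ?thesis using R x unfolding fr by simp
qed

abbreviation "bubble_cubic P p_inf M R \<equiv> p_inf * R ^ 3 + 2 * sigma_st P * R ^ 2 - 3 * R_gas P * T_inf P * M / (4 * pi)"

lemma bubble_cubic_strict_mono:
  assumes "admissible P" "p_inf > 0" "0 \<le> r" "r < s"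
  shows "bubble_cubic P p_inf M r < bubble_cubic P p_inf M s"
proof -
  have "p_inf * r ^ 3 < p_inf * s ^ 3" "2 * sigma_st P * r ^ 2 < 2 * sigma_st P * s ^ 2"
    using assms by (auto simp: admissible_def intro!: mult_strict_left_mono power_strict_mono)
  then show ?thesis by linarith
qed

lemma R_star_eqI:
  assumes "admissible P" "p_inf > 0" "R > 0" "bubble_cubic P p_inf M R = 0"
  shows "R_star P p_inf M = R"
  unfolding R_star_def
proof (rule the_equality)
  show "R > 0 \<and> bubble_cubic P p_inf M R = 0" using assms by simp
  fix r assume r: "r > 0 \<and> bubble_cubic P p_inf M r = 0"
  then show "r = R"
    using bubble_cubic_strict_mono[OF assms(1,2), of r R M] bubble_cubic_strict_mono[OF assms(1,2), of R r M] assms(3,4)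
    by (cases r R rule: linorder_cases) auto
qed

lemma R_star:
  assumes "admissible P" "p_inf > 0" "M > 0"
  shows "R_star P p_inf M > 0" "bubble_cubic P p_inf M (R_star P p_inf M) = 0"
proof -
  let ?k = "3 * R_gas P * T_inf P * M / (4 * pi)"
  define b where "b = ?k / p_inf + 1"
  have k: "?k > 0" using assms by (auto simp: admissible_def)
  have b1: "b \<ge> 1" using divide_nonneg_pos[OF less_imp_le[OF k] assms(2)] unfolding b_def by linarith
  have "p_inf * b \<le> p_inf * b ^ 3" using b1 assms(2) self_le_power[OF b1, of 3] by simp
  moreover have "p_inf * b = ?k + p_inf" using assms(2) by (simp add: b_def field_simps)
  moreover have "2 * sigma_st P * b ^ 2 \<ge> 0" using assms(1) by (simp add: admissible_def)
  ultimately have up: "bubble_cubic P p_inf M b \<ge> 0" using assms(2) by linarith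
  have "bubble_cubic P p_inf M 0 \<le> 0" using k by simp
  with up obtain R where R: "0 \<le> R" "R \<le> b" "bubble_cubic P p_inf M R = 0"
  proof -
    have "continuous_on {0..b} (bubble_cubic P p_inf M)" by (intro continuous_intros)
    moreover have "0 \<le> b" using b1 by simp
    ultimately have "\<exists>x\<ge>0. x \<le> b \<and> bubble_cubic P p_inf M x = 0"
      by (intro IVT'[of "bubble_cubic P p_inf M", OF \<open>bubble_cubic P p_inf M 0 \<le> 0\<close> up])
    then show thesis by (elim exE conjE) (rule that)
  qed
  have "R \<noteq> 0" using R(3) k by auto
  then have "R > 0" using R(1) by simp
  with R_star_eqI[OF assms(1,2) this R(3)] R(3)
  show "R_star P p_inf M > 0" "bubble_cubic P p_inf M (R_star P p_inf M) = 0" by simp_all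
qed

section \<open>The gas temperature\<close>

text \<open>Adding a small multiple of exp (a . x) with |a| > K rules out an interior maximum.\<close>

lemma maximum_principle:
  fixes u :: "R3 \<Rightarrow> real"
  assumes \<Omega>: "open \<Omega>" "bounded \<Omega>" and c: "continuous_on (closure \<Omega>) u" and u: "is_C2 \<Omega> u g A"
    and eq: "\<And>x. x \<in> \<Omega> \<Longrightarrow> trace (A x) = b x \<bullet> g x" and K: "\<And>x. x \<in> \<Omega> \<Longrightarrow> norm (b x) \<le> K"
    and bd: "\<And>x. x \<in> frontier \<Omega> \<Longrightarrow> u x \<le> m" and x0: "x0 \<in> \<Omega>"
  shows "u x0 \<le> m"
proof (rule ccontr)
  assume "\<not> u x0 \<le> m"
  then have d: "u x0 - m > 0" by simp
  define a :: R3 where "a = (\<bar>K\<bar> + 1) *\<^sub>R axis 1 1"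
  have na: "norm a = \<bar>K\<bar> + 1" by (simp add: a_def norm_axis_1)
  let ?E = "\<lambda>x. exp (a \<bullet> x)"
  have k: "compact (closure \<Omega>)" using \<Omega>(2) by (simp add: compact_closure)
  have cE: "continuous_on S ?E" for S by (intro continuous_intros)
  obtain B where B: "\<And>x. x \<in> closure \<Omega> \<Longrightarrow> ?E x \<le> B"
    using compact_imp_bounded[OF compact_continuous_image[OF cE k]] by (auto simp: bounded_iff)
  have x0c: "x0 \<in> closure \<Omega>" using x0 closure_subset by blast
  have Bp: "B > 0" using B[OF x0c] exp_gt_zero[of "a \<bullet> x0"] by linarith
  define e where "e = (u x0 - m) / (2 * B)"
  have e: "e > 0" "e * B < u x0 - m" using d Bp by (auto simp: e_def)
  define w where "w x = u x + e * ?E x" for x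
  have cw: "continuous_on (closure \<Omega>) w" unfolding w_def by (intro continuous_intros c)
  have "closure \<Omega> \<noteq> {}" using x0c by (metis empty_iff)
  from continuous_attains_sup[OF k this cw]
  obtain z where z: "z \<in> closure \<Omega>" "\<And>y. y \<in> closure \<Omega> \<Longrightarrow> w y \<le> w z" by (elim bexE) auto
  have z\<Omega>: "z \<in> \<Omega>"
  proof (rule ccontr)
    assume "z \<notin> \<Omega>"
    then have "z \<in> frontier \<Omega>" using z(1) interior_subset by (auto simp: frontier_def)
    then have "w z \<le> m + e * B" unfolding w_def using bd B[OF z(1)] e(1) by (intro add_mono mult_left_mono) auto
    moreover have "w x0 > u x0" using e(1) by (simp add: w_def)
    ultimately show False using z(2)[OF x0c] e(2) by linarith
  qed
  have gE: "has_grad ?E (?E x *\<^sub>R a) x" for x by (rule has_grad_chain[OF DERIV_exp has_grad_inner_const])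
  have jE: "has_jac (\<lambda>x. ?E x *\<^sub>R a) (outer a (?E x *\<^sub>R a)) x" for x
    using has_jac_scaleR[OF gE has_jac_const[of a]] by simp
  have "is_C2 \<Omega> ?E (\<lambda>x. ?E x *\<^sub>R a) (\<lambda>x. outer a (?E x *\<^sub>R a))"
    unfolding is_C2_def by (intro conjI ballI gE jE continuous_intros)
  from is_C2_cmul[OF is_C2_add[OF u is_C2_cmul[OF this, of e]], of "-1"]
  have C2: "is_C2 \<Omega> (\<lambda>x. - w x) (\<lambda>x. - (g x + e *\<^sub>R ?E x *\<^sub>R a)) (\<lambda>x. - (A x + e *\<^sub>R outer a (?E x *\<^sub>R a)))"
    by (simp add: w_def)
  let ?H = "- (A z + e *\<^sub>R outer a (?E z *\<^sub>R a))"
  have G: "has_grad (\<lambda>x. - w x) (- (g x + e *\<^sub>R ?E x *\<^sub>R a)) x" if "x \<in> \<Omega>" for x using C2 that unfolding is_C2_def by blast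
  have J: "has_jac (\<lambda>x. - (g x + e *\<^sub>R ?E x *\<^sub>R a)) ?H z" using C2 z\<Omega> unfolding is_C2_def by blast
  have le: "- w z \<le> - w y" if "y \<in> \<Omega>" for y using z(2)[OF subsetD[OF closure_subset that]] by simp
  have min: "- (g z + e *\<^sub>R ?E z *\<^sub>R a) = 0" by (rule second_order_min(1)[OF \<Omega>(1) z\<Omega> G J le])
  have min2: "v \<bullet> (?H *v v) \<ge> 0" for v by (rule second_order_min(2)[OF \<Omega>(1) z\<Omega> G J le])
  have "trace ?H = (\<Sum>i\<in>UNIV. axis i 1 \<bullet> (?H *v axis i 1))"
    by (simp add: trace_def inner_axis' matrix_vector_mul_component inner_axis)
  also have "\<dots> \<ge> 0" by (rule sum_nonneg) (rule min2)
  finally have t: "trace (A z) + e * (?E z * (a \<bullet> a)) \<le> 0"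
    unfolding trace_minus trace_add trace_scaleR trace_outer inner_scaleR_right by linarith
  have gz: "g z = - (e * ?E z) *\<^sub>R a" using arg_cong[OF min, of uminus] by (simp add: eq_neg_iff_add_eq_0 add.commute)
  have "\<bar>b z \<bullet> a\<bar> \<le> \<bar>K\<bar> * norm a"
    using Cauchy_Schwarz_ineq2[of "b z" a] mult_right_mono[OF K[OF z\<Omega>] norm_ge_zero[of a]] mult_right_mono[OF abs_ge_self norm_ge_zero, of K a] by linarith
  also have "\<dots> < a \<bullet> a" unfolding power2_norm_eq_inner[symmetric] power2_eq_square na by (intro mult_strict_right_mono) auto
  finally have "b z \<bullet> a < a \<bullet> a" by linarith
  then have "0 < (e * ?E z) * (a \<bullet> a - b z \<bullet> a)" using e(1) by simp
  also have "\<dots> = trace (A z) + e * (?E z * (a \<bullet> a))" unfolding eq[OF z\<Omega>] gz by (simp add: algebra_simps)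
  finally show False using t by linarith
qed

lemma constant_by_maximum_principle:
  fixes u :: "R3 \<Rightarrow> real"
  assumes \<Omega>: "open \<Omega>" "bounded \<Omega>" and c: "continuous_on (closure \<Omega>) u" and u: "is_C2 \<Omega> u g A"
    and eq: "\<And>x. x \<in> \<Omega> \<Longrightarrow> trace (A x) = b x \<bullet> g x" and K: "\<And>x. x \<in> \<Omega> \<Longrightarrow> norm (b x) \<le> K"
    and bd: "\<And>x. x \<in> frontier \<Omega> \<Longrightarrow> u x = m" and x: "x \<in> \<Omega>"
  shows "u x = m"
proof (rule antisym)
  show "u x \<le> m" by (rule maximum_principle[OF \<Omega> c u eq K _ x]) (use bd in auto)
  have u': "is_C2 \<Omega> (\<lambda>x. - u x) (\<lambda>x. - g x) (\<lambda>x. - A x)" using is_C2_cmul[OF u, of "-1"] by simp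
  have "- u x \<le> - m"
    by (rule maximum_principle[OF \<Omega> continuous_on_minus[OF c] u' _ K _ x]) (use eq bd in \<open>auto simp: trace_minus\<close>)
  then show "m \<le> u x" by simp
qed

context equilibrium
begin

definition dens_eq :: real where "dens_eq = pres_g st / (R_gas P * T_inf P)"

lemma gas_temperature:
  assumes x: "x \<in> \<Omega>" shows "temp_g st x = T_inf P"
proof -
  have int: "interior \<Omega> = \<Omega>" by (rule interior_open[OF domain(2)])
  obtain A where A: "is_C2 \<Omega> (temp_g st) (grad \<Omega> (temp_g st)) A"
    by (rule C2_on_interior_scalar[OF C2_on_subset[OF C2_fields(5) closure_subset], unfolded int], rule that)
  define b where "b x = (dens_g st x * (cv_gas P * gamma_gas P) / kappa_gas P) *\<^sub>R vel_g st x" for x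
  have gamma: "gamma_gas P > 1" using params by (simp add: gamma_gas_def)
  have Tpos: "temp_g st x > 0" if "x \<in> \<Omega>" for x
  proof -
    have "R_gas P * dens_g st x * temp_g st x > 0" using gas(3)[OF that] gas_pos(1) by (simp add: mult_ac)
    moreover have "R_gas P * dens_g st x > 0" using gas_pos(2)[OF that] params by simp
    ultimately show ?thesis by (simp add: zero_less_mult_iff)
  qed
  define C where "C = cv_gas P * (ln (pres_g st) - gamma_gas P * (ln (pres_g st) - ln (R_gas P)))"
  have entropy: "entr_g st x = C + (cv_gas P * gamma_gas P) * ln (temp_g st x)" if "x \<in> \<Omega>" for x
  proof -
    have "ln (pres_g st) = ln (R_gas P) + ln (temp_g st x) + ln (dens_g st x)"
      unfolding gas(3)[OF that] using params Tpos[OF that] gas_pos(2)[OF that] by (simp add: ln_mult)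
    moreover have "entr_g st x = cv_gas P * (ln (pres_g st) - gamma_gas P * ln (dens_g st x))"
      unfolding gas(4)[OF that] using gas_pos(1) gas_pos(2)[OF that] by (simp add: ln_div ln_powr)
    ultimately show ?thesis by (simp add: C_def algebra_simps)
  qed
  have eq: "trace (A x) = b x \<bullet> grad \<Omega> (temp_g st) x" if "x \<in> \<Omega>" for x
  proof -
    let ?g = "grad \<Omega> (temp_g st)"
    have gT: "has_grad (temp_g st) (?g x) x" and jT: "has_jac ?g (A x) x" using A that by (auto simp: is_C2_def)
    have "has_grad (\<lambda>x. ln (temp_g st x)) ((1 / temp_g st x) *\<^sub>R ?g x) x"
      by (rule has_grad_chain[OF DERIV_ln_divide[OF Tpos[OF that]] gT])
    from has_grad_add[OF has_grad_const[of C] has_grad_mult[OF has_grad_const[of "cv_gas P * gamma_gas P"] this]]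
    have "has_grad (\<lambda>x. C + (cv_gas P * gamma_gas P) * ln (temp_g st x)) ((cv_gas P * gamma_gas P / temp_g st x) *\<^sub>R ?g x) x"
      by simp
    then have "has_grad (entr_g st) ((cv_gas P * gamma_gas P / temp_g st x) *\<^sub>R ?g x) x"
      by (rule has_grad_cong_open[OF _ domain(2) that]) (simp add: entropy)
    then have gs: "grad \<Omega> (entr_g st) x = (cv_gas P * gamma_gas P / temp_g st x) *\<^sub>R ?g x"
      by (rule has_grad_imp_grad[OF _ domain(2) that])
    have "divergence \<Omega> (\<lambda>y. kappa_gas P *\<^sub>R ?g y) x = kappa_gas P * trace (A x)"
      unfolding divergence_def
      by (subst has_jac_imp_jac[OF has_jac_cmul[OF jT]]) (simp_all add: int that trace_scaleR)
    with gas(2)[OF that] have "kappa_gas P * trace (A x) = dens_g st x * (cv_gas P * gamma_gas P) * (vel_g st x \<bullet> ?g x)"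
      using Tpos[OF that] by (simp add: gs)
    then show ?thesis using params by (simp add: b_def field_simps)
  qed
  have "continuous_on (closure \<Omega>) b"
    unfolding b_def divide_inverse by (intro continuous_intros C2_on_continuous C2_fields)
  then have "bounded (b ` closure \<Omega>)"
    using domain(3) by (intro compact_imp_bounded compact_continuous_image) (simp_all add: compact_closure)
  then obtain K where K: "\<And>x. x \<in> closure \<Omega> \<Longrightarrow> norm (b x) \<le> K" by (auto simp: bounded_iff)
  show ?thesis
    by (rule constant_by_maximum_principle[OF domain(2,3) C2_on_continuous[OF C2_fields(5)] A eq _ _ x])
      (use K closure_subset traction(2) in auto)
qed

lemma constant_on_closure:
  assumes "C2_on (closure \<Omega>) f" "\<And>x. x \<in> \<Omega> \<Longrightarrow> f x = (c::real)" "x \<in> closure \<Omega>"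
  shows "f x = c"
  by (rule continuous_constant_on_closure[OF C2_on_continuous[OF assms(1)] assms(2,3)])

lemma density_interior: assumes "x \<in> \<Omega>" shows "dens_g st x = dens_eq"
  using gas(3)[OF assms] gas_temperature[OF assms] params by (simp add: dens_eq_def field_simps)

lemma density: "x \<in> closure \<Omega> \<Longrightarrow> dens_g st x = dens_eq"
  by (rule constant_on_closure[OF C2_fields(3) density_interior])

lemma dens_eq_pos: "dens_eq > 0"
  using params gas_pos(1) by (simp add: dens_eq_def)

lemma gas_jac: "x \<in> \<Omega> \<Longrightarrow> has_jac (vel_g st) (jac \<Omega> (vel_g st) x) x"
  by (rule C2_on_interior_jac[OF C2_on_subset[OF C2_fields(4) closure_subset]]) (simp add: interior_open[OF domain(2)])

lemma gas_divergence: assumes x: "x \<in> \<Omega>" shows "divergence \<Omega> (vel_g st) x = 0"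
proof -
  have "has_jac (\<lambda>y. dens_g st y *\<^sub>R vel_g st y) (dens_eq *\<^sub>R jac \<Omega> (vel_g st) x) x"
    by (rule has_jac_cong_open[OF has_jac_cmul[OF gas_jac[OF x]] domain(2) x]) (simp add: density_interior)
  from has_jac_imp_jac[OF this, of \<Omega>] gas(1)[OF x] x dens_eq_pos
  show ?thesis by (simp add: divergence_def trace_scaleR interior_open[OF domain(2)])
qed

end

section \<open>Spherically symmetric equilibria\<close>

abbreviation "pole \<equiv> axis 1 1 :: R3"

lemma DERIV_along_pole:
  assumes "has_grad f u (r *\<^sub>R pole)" shows "((\<lambda>r. f (r *\<^sub>R pole)) has_real_derivative u $ 1) (at r)"
proof -
  have "((\<lambda>r. r *\<^sub>R pole) has_derivative (\<lambda>h. h *\<^sub>R pole)) (at r)" by (auto intro!: derivative_eq_intros)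
  from has_derivative_compose[OF this assms[unfolded has_grad_def]]
  show ?thesis by (simp add: has_field_derivative_def inner_axis mult_commute_abs)
qed

text \<open>
  Differentiating the parallelism of v x and x across the axis gives r J22 = r J33 = v1, so the
  divergence equation is the equation (r^2 v1)' = 0.
\<close>

lemma radial_flux_constant:
  assumes a: "a < b" and c: "continuous_on {a..b} (\<lambda>r. v (r *\<^sub>R pole))"
    and U: "open U" "\<And>r. a < r \<Longrightarrow> r < b \<Longrightarrow> r *\<^sub>R pole \<in> U"
    and J: "\<And>x. x \<in> U \<Longrightarrow> has_jac v (J x) x" and div: "\<And>x. x \<in> U \<Longrightarrow> trace (J x) = 0"
    and radial: "\<And>x i j. x \<in> U \<Longrightarrow> x $ i * v x $ j = x $ j * v x $ i"
  shows "b\<^sup>2 * v (b *\<^sub>R pole) $ 1 = a\<^sup>2 * v (a *\<^sub>R pole) $ 1"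
proof (rule DERIV_isconst_end[OF a])
  show "continuous_on {a..b} (\<lambda>r. r\<^sup>2 * v (r *\<^sub>R pole) $ 1)" by (intro continuous_intros c)
  fix r assume r: "a < r" "r < b"
  let ?x = "r *\<^sub>R pole"
  have x: "?x \<in> U" by (rule U(2)[OF r])
  have diag: "r * J ?x $ i $ i = v ?x $ 1" if i: "i \<noteq> 1" for i
  proof -
    have "has_grad (\<lambda>y. y $ 1 * v y $ i - y $ i * v y $ 1)
      ((v ?x $ i *\<^sub>R mat 1 $ 1 + ?x $ 1 *\<^sub>R J ?x $ i) - (v ?x $ 1 *\<^sub>R mat 1 $ i + ?x $ i *\<^sub>R J ?x $ 1)) ?x"
      by (intro has_grad_diff has_grad_mult has_grad_component has_jac_id J x)
    moreover have "has_grad (\<lambda>y. y $ 1 * v y $ i - y $ i * v y $ 1) 0 ?x"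
      by (rule has_grad_cong_open[OF has_grad_const[of 0] U(1) x]) (use radial in simp)
    ultimately have "(v ?x $ i *\<^sub>R mat 1 $ 1 + ?x $ 1 *\<^sub>R J ?x $ i) - (v ?x $ 1 *\<^sub>R mat 1 $ i + ?x $ i *\<^sub>R J ?x $ 1) = 0"
      by (rule has_grad_unique)
    from arg_cong[OF this, of "\<lambda>u. u $ i"] i show ?thesis by (simp add: mat_def axis_def)
  qed
  have "r * J ?x $ 1 $ 1 + r * J ?x $ 2 $ 2 + r * J ?x $ 3 $ 3 = 0"
    using div[OF x] by (simp add: trace_def sum_3 flip: distrib_left)
  then have "2 * v ?x $ 1 + r * J ?x $ 1 $ 1 = 0" using diag[of 2] diag[of 3] by simp
  then have "r * (2 * v ?x $ 1 + r * J ?x $ 1 $ 1) = 0" by simp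
  moreover have "((\<lambda>r. r\<^sup>2 * v (r *\<^sub>R pole) $ 1) has_real_derivative (2 * r) * v ?x $ 1 + r\<^sup>2 * J ?x $ 1 $ 1) (at r)"
    using DERIV_along_pole[OF has_grad_component[OF J[OF x], of 1]]
    by (auto intro!: derivative_eq_intros)
  ultimately show "((\<lambda>r. r\<^sup>2 * v (r *\<^sub>R pole) $ 1) has_real_derivative 0) (at r)"
    by (simp add: power2_eq_square algebra_simps)
qed

lemma radial_vector_parallel: "radial_vector_on S u \<Longrightarrow> x \<in> S \<Longrightarrow> x $ i * u x $ j = x $ j * u x $ i"
  by (auto simp: radial_vector_on_def)

lemma radial_vector_zero:
  assumes "radial_vector_on S u" "x \<in> S" "norm x *\<^sub>R pole \<in> S" "u (norm x *\<^sub>R pole) $ 1 = 0"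
  shows "u x = 0"
proof -
  obtain h where h: "\<And>x. x \<in> S \<Longrightarrow> u x = h (norm x) *\<^sub>R (x /\<^sub>R norm x)" using assms(1) by (auto simp: radial_vector_on_def)
  show ?thesis
  proof (cases "x = 0")
    case True then show ?thesis using h[OF assms(2)] by simp
  next
    case False
    then have "h (norm x) = 0" using assms(4) unfolding h[OF assms(3)] by (simp add: norm_axis_1)
    then show ?thesis using h[OF assms(2)] by simp
  qed
qed

lemma entropy_argument:
  fixes p k c :: real
  assumes "p > 0" "k > 0" shows "p / (p / k) powr c = k powr c * p powr (1 - c)"
  using assms by (simp add: powr_divide powr_diff)

context equilibrium
begin

lemma symmetric_liquid_at_rest:
  assumes R: "R > 0" and ball: "\<Omega> = ball 0 R" and rad: "radial_vector_on (- \<Omega>) (vel_l st)" and x: "x \<notin> \<Omega>"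
  shows "vel_l st x = 0"
proof (rule radial_vector_zero[OF rad])
  have nx: "norm x \<ge> R" using x ball by simp
  show "x \<in> - \<Omega>" "norm x *\<^sub>R pole \<in> - \<Omega>" using x ball by (simp_all add: norm_axis_1)
  have fr: "norm (R *\<^sub>R pole) = R" using R by (simp add: norm_axis_1)
  have "vel_l st (R *\<^sub>R pole) \<bullet> normal (R *\<^sub>R pole) = 0" by (rule tangential(1)) (use R in \<open>simp add: ball frontier_ball norm_axis_1\<close>)
  then have e: "vel_l st (R *\<^sub>R pole) $ 1 = 0"
    using R by (simp add: ball outer_normal_ball[OF R fr] inner_axis)
  show "vel_l st (norm x *\<^sub>R pole) $ 1 = 0"
  proof (cases "norm x = R")
    case True then show ?thesis using e by simp
  next
    case False
    then have less: "R < norm x" using nx by simp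
    have int: "interior (- \<Omega>) = - cball 0 R" using R by (simp add: ball interior_complement)
    have "(norm x)\<^sup>2 * vel_l st (norm x *\<^sub>R pole) $ 1 = R\<^sup>2 * vel_l st (R *\<^sub>R pole) $ 1"
    proof (rule radial_flux_constant[OF less])
      show "continuous_on {R..norm x} (\<lambda>r. vel_l st (r *\<^sub>R pole))"
        by (rule continuous_on_compose2[OF C2_on_continuous[OF C2_fields(1)]])
          (use R in \<open>auto simp: ball norm_axis_1 intro!: continuous_intros\<close>)
      show "open (- cball (0::R3) R)" by auto
      show "r *\<^sub>R pole \<in> - cball 0 R" if "R < r" "r < norm x" for r using that R by (simp add: norm_axis_1)
      show "has_jac (vel_l st) (jac (- \<Omega>) (vel_l st) y) y" if "y \<in> - cball 0 R" for y
        by (rule C2_on_interior_jac[OF C2_fields(1)]) (use that int in simp)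
      show "trace (jac (- \<Omega>) (vel_l st) y) = 0" if "y \<in> - cball 0 R" for y
        using liquid(1)[of y] that R by (simp add: ball divergence_def)
      show "y $ i * vel_l st y $ j = y $ j * vel_l st y $ i" if "y \<in> - cball 0 R" for y i j
        by (rule radial_vector_parallel[OF rad]) (use that in \<open>simp add: ball\<close>)
    qed
    moreover have "(norm x)\<^sup>2 \<noteq> 0" using less R by auto
    ultimately show ?thesis using e by simp
  qed
qed

lemma symmetric_gas_at_rest:
  assumes R: "R > 0" and ball: "\<Omega> = ball 0 R" and rad: "radial_vector_on (closure \<Omega>) (vel_g st)" and x: "x \<in> closure \<Omega>"
  shows "vel_g st x = 0"
proof (cases "x = 0")
  case True
  then show ?thesis using rad x by (auto simp: radial_vector_on_def)
next
  case False
  have cl: "closure \<Omega> = cball 0 R" using R by (simp add: ball)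
  show ?thesis
  proof (rule radial_vector_zero[OF rad x])
    have nx: "norm x \<le> R" "0 < norm x" using x False cl by simp_all
    show "norm x *\<^sub>R pole \<in> closure \<Omega>" using nx cl by (simp add: norm_axis_1)
    have "(norm x)\<^sup>2 * vel_g st (norm x *\<^sub>R pole) $ 1 = 0\<^sup>2 * vel_g st (0 *\<^sub>R pole) $ 1"
    proof (rule radial_flux_constant[OF nx(2)])
      show "continuous_on {0..norm x} (\<lambda>r. vel_g st (r *\<^sub>R pole))"
        by (rule continuous_on_compose2[OF C2_on_continuous[OF C2_fields(4)]])
          (use nx in \<open>auto simp: cl norm_axis_1 intro!: continuous_intros\<close>)
      show "open (ball (0::R3) R)" by auto
      show "r *\<^sub>R pole \<in> ball 0 R" if "0 < r" "r < norm x" for r using that nx by (simp add: norm_axis_1)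
      show "has_jac (vel_g st) (jac \<Omega> (vel_g st) y) y" if "y \<in> ball 0 R" for y using gas_jac that ball by simp
      show "trace (jac \<Omega> (vel_g st) y) = 0" if "y \<in> ball 0 R" for y
        using gas_divergence[of y] that by (simp add: ball divergence_def)
      show "y $ i * vel_g st y $ j = y $ j * vel_g st y $ i" if "y \<in> ball 0 R" for y i j
        by (rule radial_vector_parallel[OF rad]) (use that in \<open>simp add: cl\<close>)
    qed
    then show "vel_g st (norm x *\<^sub>R pole) $ 1 = 0" using nx by simp
  qed
qed

lemma liquid_pressure_at_rest:
  assumes R: "R > 0" and ball: "\<Omega> = ball 0 R" and rest: "\<And>x. x \<notin> \<Omega> \<Longrightarrow> vel_l st x = 0"
    and rad: "radial_scalar_on (- \<Omega>) (pres_l st)" and x: "x \<notin> \<Omega>"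
  shows "pres_l st x = p_inf"
proof -
  have int: "interior (- \<Omega>) = - cball 0 R" using R by (simp add: ball interior_complement)
  obtain B where B: "is_C2 (- cball 0 R) (pres_l st) (grad (- \<Omega>) (pres_l st)) B"
    by (rule C2_on_interior_scalar[OF C2_fields(2), unfolded int], rule that)
  obtain Hs where Hs: "\<And>i x. x \<in> - cball 0 R \<Longrightarrow> has_jac (\<lambda>x. jac (- \<Omega>) (vel_l st) x $ i) (Hs i x) x"
    "\<And>i x. x \<in> - cball 0 R \<Longrightarrow> vec_laplacian (- \<Omega>) (vel_l st) x $ i = trace (Hs i x)"
    by (rule C2_on_interior_vec[OF C2_fields(1), unfolded int], rule that)
  have J0: "jac (- \<Omega>) (vel_l st) y = 0" if "y \<in> - cball 0 R" for y
  proof (rule has_jac_imp_jac)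
    show "has_jac (vel_l st) 0 y"
      by (rule has_jac_cong_open[OF has_jac_const[of 0] _ that]) (use rest ball in auto)
  qed (use that int in simp)
  have g0: "grad (- \<Omega>) (pres_l st) y = 0" if y: "y \<in> - cball 0 R" for y
  proof -
    have "Hs i y = 0" for i
    proof (rule has_jac_unique[OF Hs(1)[OF y]])
      show "has_jac (\<lambda>x. jac (- \<Omega>) (vel_l st) x $ i) 0 y"
        by (rule has_jac_cong_open[OF has_jac_const[of 0] _ y]) (use J0 in auto)
    qed
    then have "grad (- \<Omega>) (pres_l st) y $ i = 0" for i
      using liquid(2)[of y i] y params R J0[OF y] Hs(2)[OF y, of i] by (simp add: ball trace_def)
    then show ?thesis by (simp add: vec_eq_iff)
  qed
  have ray: "pres_l st (r *\<^sub>R pole) = pres_l st (R *\<^sub>R pole)" if r: "r > R" for r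
  proof (rule DERIV_isconst_end[OF r])
    show "continuous_on {R..r} (\<lambda>r. pres_l st (r *\<^sub>R pole))"
      by (rule continuous_on_compose2[OF C2_on_continuous[OF C2_fields(2)]])
        (use R in \<open>auto simp: ball norm_axis_1 intro!: continuous_intros\<close>)
    fix t assume t: "R < t" "t < r"
    then have "t *\<^sub>R pole \<in> - cball 0 R" using R by (simp add: norm_axis_1)
    then have "has_grad (pres_l st) 0 (t *\<^sub>R pole)" using B g0 by (force simp: is_C2_def)
    from DERIV_along_pole[OF this] show "((\<lambda>r. pres_l st (r *\<^sub>R pole)) has_real_derivative 0) (at t)" by simp
  qed
  have "filterlim (\<lambda>r. r *\<^sub>R pole) at_infinity at_top"
    unfolding filterlim_at_infinity[OF order_refl]
  proof (intro allI impI)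
    fix s :: real
    show "\<forall>\<^sub>F r in at_top. s \<le> norm (r *\<^sub>R pole)"
      using eventually_ge_at_top[of s] by eventually_elim (simp add: norm_axis_1)
  qed
  moreover have "(pres_l st \<longlongrightarrow> p_inf) at_infinity" using eqs(6) by (simp add: far_field_def)
  ultimately have "((\<lambda>r. pres_l st (r *\<^sub>R pole)) \<longlongrightarrow> p_inf) at_top" by (rule filterlim_compose[rotated])
  moreover have "((\<lambda>r. pres_l st (r *\<^sub>R pole)) \<longlongrightarrow> pres_l st (R *\<^sub>R pole)) at_top"
  proof (rule tendsto_eventually)
    show "\<forall>\<^sub>F r in at_top. pres_l st (r *\<^sub>R pole) = pres_l st (R *\<^sub>R pole)"
      using eventually_gt_at_top[of R] by (rule eventually_mono) (rule ray)
  qed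
  ultimately have e: "pres_l st (R *\<^sub>R pole) = p_inf" by (intro tendsto_unique[OF trivial_limit_at_top_linorder])
  obtain h where h: "\<And>x. x \<in> - \<Omega> \<Longrightarrow> pres_l st x = h (norm x)" using rad by (auto simp: radial_scalar_on_def)
  have "pres_l st x = pres_l st (norm x *\<^sub>R pole)" using h[of x] h[of "norm x *\<^sub>R pole"] x by (simp add: ball norm_axis_1)
  also have "\<dots> = p_inf" using ray[of "norm x"] e x by (cases "norm x = R") (simp_all add: ball)
  finally show ?thesis .
qed

lemma gas_mass_ball:
  assumes R: "R > 0" and ball: "\<Omega> = ball 0 R" shows "gas_mass st = dens_eq * (4 / 3 * pi * R ^ 3)"
proof -
  have "gas_mass st = integral (ball (0::R3) R) (\<lambda>x. dens_eq * 1)"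
    unfolding gas_mass_def ball by (rule Henstock_Kurzweil_Integration.integral_cong) (simp add: density_interior ball)
  also have "\<dots> = dens_eq * measure lebesgue (ball (0::R3) R)"
    by (simp only: integral_mult_right lmeasure_integral[OF lmeasurable_ball])
  also have "measure lebesgue (ball (0::R3) R) = 4 / 3 * pi * R ^ 3"
    using content_ball[of R "0::R3"] R by (simp add: unit_ball_vol_3)
  finally show ?thesis .
qed

theorem symmetric_unique:
  assumes sym: "spherically_symmetric st"
  shows "gas_mass st > 0" "same_state st (spherical_equilibrium P p_inf (gas_mass st))"
proof -
  obtain R where R: "R > 0" "\<Omega> = ball 0 R" using sym by (auto simp: spherically_symmetric_def)
  have rad: "radial_vector_on (- \<Omega>) (vel_l st)" "radial_scalar_on (- \<Omega>) (pres_l st)" "radial_vector_on (closure \<Omega>) (vel_g st)"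
    using sym by (auto simp: spherically_symmetric_def)
  have vl: "vel_l st x = 0" if "x \<notin> \<Omega>" for x by (rule symmetric_liquid_at_rest[OF R rad(1) that])
  have pl: "pres_l st x = p_inf" if "x \<notin> \<Omega>" for x by (rule liquid_pressure_at_rest[OF R vl rad(2) that])
  have vg: "vel_g st x = 0" if "x \<in> closure \<Omega>" for x by (rule symmetric_gas_at_rest[OF R rad(3) that])
  let ?M = "gas_mass st"
  have M: "?M = dens_eq * (4 / 3 * pi * R ^ 3)" by (rule gas_mass_ball[OF R])
  show "?M > 0" unfolding M using dens_eq_pos R by simp
  have nb: "norm (R *\<^sub>R pole) = R" using R by (simp add: norm_axis_1)
  have x: "R *\<^sub>R pole \<in> frontier \<Omega>" using R(1) by (simp add: R(2) frontier_ball norm_axis_1)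
  have xo: "R *\<^sub>R pole \<notin> \<Omega>" using R nb by simp
  have pg: "pres_g st = p_inf + 2 * sigma_st P / R"
    using traction_at_rest[OF x jac_at_rest[OF vl x] normal_nonzero[OF x]] surface_div_sphere[OF R(1) nb] pl[OF xo]
    by (simp add: R(2) algebra_simps)
  have cubic: "bubble_cubic P p_inf ?M R = 0"
    unfolding M dens_eq_def pg using params R(1) by (simp add: field_simps power2_eq_square power3_eq_cube)
  have Rs: "R_star P p_inf ?M = R" by (rule R_star_eqI[OF adm p_inf_pos R(1) cubic])
  have ps: "p_star P p_inf ?M = pres_g st" by (simp add: p_star_def Rs pg)
  have rs: "rho_star P p_inf ?M = dens_eq" by (simp add: rho_star_def Rs pg dens_eq_def)
  have T: "temp_g st x = T_inf P" if "x \<in> closure \<Omega>" for x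
    by (rule constant_on_closure[OF C2_fields(5) gas_temperature that])
  have RT: "R_gas P * T_inf P > 0" using params by simp
  have s: "entr_g st x = cv_gas P * ln ((R_gas P * T_inf P) powr gamma_gas P * pres_g st powr (1 - gamma_gas P))"
    if "x \<in> closure \<Omega>" for x
  proof (rule constant_on_closure[OF C2_fields(6) _ that])
    fix y assume y: "y \<in> \<Omega>"
    show "entr_g st y = cv_gas P * ln ((R_gas P * T_inf P) powr gamma_gas P * pres_g st powr (1 - gamma_gas P))"
      unfolding gas(4)[OF y] density_interior[OF y] dens_eq_def entropy_argument[OF gas_pos(1) RT] ..
  qed
  show "same_state st (spherical_equilibrium P p_inf ?M)"
    unfolding same_state_def spherical_equilibrium_def
    using vl pl vg T s density liquid_temperature by (simp add: Rs ps rs R(2))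
qed

end

lemma jac_const: "x \<in> interior S \<Longrightarrow> jac S (\<lambda>y. c) x = 0"
  by (rule has_jac_imp_jac[OF has_jac_const])

lemma grad_const: "x \<in> interior S \<Longrightarrow> grad S (\<lambda>y. c) x = 0"
  by (rule has_grad_imp_grad_interior[OF has_grad_const])

lemma divergence_cmul_grad_const:
  assumes "x \<in> interior S" shows "divergence S (\<lambda>y. k *\<^sub>R grad S (\<lambda>y. c) y) x = 0"
proof -
  have "has_jac (\<lambda>y. k *\<^sub>R grad S (\<lambda>y. c) y) 0 x"
    by (rule has_jac_cong_open[OF has_jac_const[of 0] open_interior assms]) (simp add: grad_const)
  from has_jac_imp_jac[OF this assms] show ?thesis by (simp add: divergence_def trace_def)
qed

lemma vec_laplacian_const: "x \<in> interior S \<Longrightarrow> vec_laplacian S (\<lambda>y. c) x = 0"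
  using divergence_cmul_grad_const[of x S 1] by (simp add: vec_laplacian_def laplacian_def vec_eq_iff)

lemma jac_const_outside_ball:
  assumes R: "R > 0" and x: "norm x \<ge> R" shows "jac (- ball 0 R) (\<lambda>y. c) x = 0"
proof -
  have C2: "is_C2 UNIV (\<lambda>x. - sphere_fun R x) (\<lambda>x. 2 *\<^sub>R x) (\<lambda>x. 2 *\<^sub>R mat 1)"
    using is_C2_cmul[OF C2_sphere_fun, of _ "-1" R] by simp
  interpret C2_function "\<lambda>x. - sphere_fun R x" "\<lambda>x. 2 *\<^sub>R x" "\<lambda>x. 2 *\<^sub>R mat 1"
    by (rule C2_functionI[OF C2]) (use R in auto)
  have S: "- ball 0 R = {x. - sphere_fun R x \<ge> 0}"
    by (rule set_eqI) (simp only: Compl_iff mem_Collect_eq mem_ball dist_0_norm neg_0_le_iff_le sphere_fun_iff(2)[OF R, symmetric] not_less)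
  have "x \<in> - ball 0 R" using x by simp
  then have "- sphere_fun R x \<ge> 0" unfolding S by (simp only: mem_Collect_eq)
  from jac_closed_side[OF this has_derivative_const[of c]] show ?thesis
    unfolding S by (simp add: matrix_def vec_eq_iff)
qed

lemma spherical_equilibrium_steady:
  assumes adm: "admissible P" and p: "p_inf > 0" and M: "M > 0"
  shows "steady_state P p_inf (spherical_equilibrium P p_inf M)"
proof -
  let ?st = "spherical_equilibrium P p_inf M"
  define R where "R = R_star P p_inf M"
  have R: "R > 0" unfolding R_def by (rule R_star(1)[OF assms])
  have par: "R_gas P * T_inf P > 0" "kappa_gas P > 0" "R_gas P > 0" "T_inf P > 0" "sigma_st P > 0" using adm by (auto simp: admissible_def)
  have pp: "p_star P p_inf M = p_inf + 2 * sigma_st P / R" "p_star P p_inf M > 0"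
    using R par p by (auto simp: p_star_def R_def intro!: add_pos_pos)
  have rr: "rho_star P p_inf M = p_star P p_inf M / (R_gas P * T_inf P)" by (simp add: rho_star_def p_star_def)
  have reg: "region ?st = ball 0 R" by (simp add: spherical_equilibrium_def R_def)
  have fr: "frontier (ball 0 R) = sphere (0::R3) R" using R by (simp add: frontier_ball)
  have int: "interior (- ball 0 R) = - cball (0::R3) R" using R by (simp add: interior_complement)
  have 1: "bubble_geometry ?st"
    unfolding bubble_geometry_def reg fr
  proof (intro conjI exI)
    show "homeomorphism (sphere 0 1) (sphere 0 R) (surf ?st) (\<lambda>x. x /\<^sub>R R)"
    proof (rule homeomorphismI)
      show "continuous_on (sphere 0 1) (surf ?st)" unfolding spherical_equilibrium_def by (auto intro!: continuous_intros)
      show "continuous_on (sphere (0::R3) R) (\<lambda>x. x /\<^sub>R R)" by (rule continuous_on_scaleR[OF continuous_on_const continuous_on_id])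
    qed (use R in \<open>auto simp: spherical_equilibrium_def R_def[symmetric]\<close>)
    show "simply_connected (ball (0::R3) R)" by (rule convex_imp_simply_connected) simp
  qed (use R in auto)
  have 2: "C2_state ?st"
    unfolding C2_state_def reg using C2_domain_ball[OF R] by (simp add: spherical_equilibrium_def C2_on_const)
  have 3: "time_regular (\<lambda>_. ?st) t" for t by (simp add: time_regular_def)
  have 4: "liquid_eqs P (\<lambda>_. ?st) t" for t
    unfolding liquid_eqs_def Let_def reg
  proof (intro conjI ballI)
    fix x assume "x \<in> - closure (ball (0::R3) R)"
    then have x: "x \<in> interior (- ball (0::R3) R)" unfolding int using R by simp
    show "vector_derivative (\<lambda>\<tau>. vel_l ?st x) (at t) = nu_liq P *\<^sub>R vec_laplacian (- ball 0 R) (vel_l ?st) x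
        - jac (- ball 0 R) (vel_l ?st) x *v vel_l ?st x - (1 / rho_liq P) *\<^sub>R grad (- ball 0 R) (pres_l ?st) x"
      by (simp add: spherical_equilibrium_def vec_laplacian_const[OF x] grad_const[OF x])
    show "divergence (- ball 0 R) (vel_l ?st) x = 0"
      by (simp add: spherical_equilibrium_def divergence_def jac_const[OF x] trace_def)
  qed (simp add: spherical_equilibrium_def)
  have 5: "gas_eqs P (\<lambda>_. ?st) t" for t
    unfolding gas_eqs_def Let_def reg
  proof (intro conjI ballI)
    fix x assume "x \<in> ball (0::R3) R"
    then have x: "x \<in> interior (ball (0::R3) R)" by (simp add: interior_open)
    show "dens_g ?st x > 0" using pp(2) par by (simp add: spherical_equilibrium_def rr)
    show "vector_derivative (\<lambda>\<tau>. dens_g ?st x) (at t) + divergence (ball 0 R) (\<lambda>y. dens_g ?st y *\<^sub>R vel_g ?st y) x = 0"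
      by (simp add: spherical_equilibrium_def divergence_def jac_const[OF x] trace_def)
    show "dens_g ?st x * temp_g ?st x * (vector_derivative (\<lambda>\<tau>. entr_g ?st x) (at t) + vel_g ?st x \<bullet> grad (ball 0 R) (entr_g ?st) x)
        = divergence (ball 0 R) (\<lambda>y. kappa_gas P *\<^sub>R grad (ball 0 R) (temp_g ?st) y) x"
      by (simp add: spherical_equilibrium_def divergence_cmul_grad_const[OF x])
    show "pres_g ?st = R_gas P * temp_g ?st x * dens_g ?st x" using par by (simp add: spherical_equilibrium_def rr)
    show "entr_g ?st x = cv_gas P * ln (pres_g ?st / dens_g ?st x powr gamma_gas P)"
      by (simp add: spherical_equilibrium_def rr entropy_argument[OF pp(2) par(1)])
  qed (simp add: spherical_equilibrium_def pp(2))
  have 6: "boundary_eqs P (\<lambda>_. ?st) t" for t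
    unfolding boundary_eqs_def Let_def reg
  proof (intro conjI ballI)
    fix x assume "x \<in> frontier (ball (0::R3) R)"
    then have x: "norm x = R" by (simp add: fr)
    let ?n = "outer_normal (ball 0 R)"
    have "sym_grad (- ball 0 R) (\<lambda>x. 0) x = 0"
      using jac_const_outside_ball[OF R] x by (simp add: sym_grad_def transpose_def vec_eq_iff)
    moreover have "(p_inf + 2 * sigma_st P / R) *\<^sub>R ?n x - p_inf *\<^sub>R ?n x = (sigma_st P * (2 / R)) *\<^sub>R ?n x"
      by (simp add: scaleR_add_left)
    ultimately show "pres_g ?st *\<^sub>R ?n x - pres_l ?st x *\<^sub>R ?n x + (2 * mu_liq P) *\<^sub>R (?n x v* sym_grad (- ball 0 R) (vel_l ?st) x)
        = (sigma_st P * surface_div (frontier (ball 0 R)) (?n x) ?n x) *\<^sub>R ?n x"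
      unfolding surface_div_sphere[OF R x] by (simp add: spherical_equilibrium_def pp(1))
  qed (simp_all add: spherical_equilibrium_def)
  have 7: "far_field P p_inf ?st" by (simp add: far_field_def spherical_equilibrium_def)
  show ?thesis unfolding steady_state_def AS_solution_def using 1 2 3 4 5 6 7 by simp
qed

lemma spherical_equilibrium_symmetric:
  assumes adm: "admissible P" and p: "p_inf > 0" and M: "M > 0"
  shows "spherically_symmetric (spherical_equilibrium P p_inf M)"
  using R_star(1)[OF assms] by (auto simp: spherically_symmetric_def spherical_equilibrium_def radial_scalar_on_def radial_vector_on_def
      intro: exI[of _ "\<lambda>_. 0"])

lemma spherical_equilibrium_mass:
  assumes adm: "admissible P" and p: "p_inf > 0" and M: "M > 0"
  shows "gas_mass (spherical_equilibrium P p_inf M) = M"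
proof -
  let ?st = "spherical_equilibrium P p_inf M"
  interpret equilibrium P p_inf ?st by unfold_locales (use assms spherical_equilibrium_steady in auto)
  define R where "R = R_star P p_inf M"
  have R: "R > 0" "bubble_cubic P p_inf M R = 0" unfolding R_def by (rule R_star[OF assms])+
  have reg: "region ?st = ball 0 R" by (simp add: spherical_equilibrium_def R_def)
  have d: "dens_eq = (p_inf + 2 * sigma_st P / R) / (R_gas P * T_inf P)"
    unfolding dens_eq_def by (simp add: spherical_equilibrium_def p_star_def R_def)
  have "gas_mass ?st = (p_inf * R ^ 3 + 2 * sigma_st P * R ^ 2) * (4 * pi) / (3 * (R_gas P * T_inf P))"
    unfolding gas_mass_ball[OF R(1) reg] d using R(1) params by (simp add: field_simps power2_eq_square power3_eq_cube)
  also have "p_inf * R ^ 3 + 2 * sigma_st P * R ^ 2 = 3 * R_gas P * T_inf P * M / (4 * pi)" using R(2) by simp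
  also have "3 * R_gas P * T_inf P * M / (4 * pi) * (4 * pi) / (3 * (R_gas P * T_inf P)) = M" using params by simp
  finally show ?thesis .
qed

lemma DERIV_R_star:
  assumes adm: "admissible P" and p: "p_inf > 0" and M: "M > 0"
  shows "(R_star P p_inf has_real_derivative
    (3 * R_gas P * T_inf P / (4 * pi)) / (3 * p_inf * (R_star P p_inf M)\<^sup>2 + 4 * sigma_st P * R_star P p_inf M)) (at M)"
proof -
  define k where "k = 3 * R_gas P * T_inf P / (4 * pi)"
  have k: "k > 0" using adm by (simp add: k_def admissible_def)
  define F where "F r = (p_inf * r ^ 3 + 2 * sigma_st P * r ^ 2) / k" for r
  let ?R = "R_star P p_inf"
  have cub: "bubble_cubic P p_inf m r = 0 \<longleftrightarrow> F r = m" for m r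
    using k by (simp add: F_def field_simps) (simp add: k_def field_simps)
  have FR: "F (?R m) = m" if "m > 0" for m using R_star(2)[OF adm p that] unfolding cub .
  have RF: "?R (F r) = r" if "r > 0" for r by (rule R_star_eqI[OF adm p that]) (simp only: cub)
  have R: "?R M > 0" by (rule R_star(1)[OF assms])
  have dF: "(F has_real_derivative (3 * p_inf * r\<^sup>2 + 4 * sigma_st P * r) / k) (at r)" for r
    unfolding F_def using k by (auto intro!: derivative_eq_intros simp: field_simps)
  have "isCont ?R (F (?R M))"
  proof (rule isCont_inverse_function[where f = F and x = "?R M" and d = "?R M / 2"])
    show "?R (F z) = z" if "\<bar>z - ?R M\<bar> \<le> ?R M / 2" for z by (rule RF) (use that R in linarith)
    show "isCont F z" for z using dF by (rule DERIV_isCont)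
  qed (use R in simp)
  then have c: "isCont ?R M" using FR[OF M] by simp
  have D: "3 * p_inf * (?R M)\<^sup>2 + 4 * sigma_st P * ?R M > 0" using R p adm by (simp add: admissible_def add_pos_pos)
  have "(?R has_real_derivative inverse ((3 * p_inf * (?R M)\<^sup>2 + 4 * sigma_st P * ?R M) / k)) (at M)"
    by (rule DERIV_inverse_function[OF dF _ _ _ _ c, of 0 "M + 1"]) (use D k M FR in auto)
  then show ?thesis by (simp add: k_def mult.commute)
qed

text \<open>Derivatives of rational functions of the radius are again rational functions of the radius.\<close>

lemma rational_in_R_star_smooth:
  assumes adm: "admissible P" and p: "p_inf > 0"
    and f: "\<And>M. M > 0 \<Longrightarrow> f M = poly q (R_star P p_inf M) / poly e (R_star P p_inf M)" and e: "\<And>r. r > 0 \<Longrightarrow> poly e r \<noteq> 0"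
  shows "smooth_on_reals {0<..} f"
proof -
  let ?R = "R_star P p_inf"
  define k where "k = 3 * R_gas P * T_inf P / (4 * pi)"
  define d where "d = [:0, 4 * sigma_st P, 3 * p_inf:]"
  have d: "poly d r = 3 * p_inf * r\<^sup>2 + 4 * sigma_st P * r" for r by (simp add: d_def power2_eq_square algebra_simps)
  have dp: "poly d r \<noteq> 0" if "r > 0" for r
    unfolding d using that p adm by (intro less_imp_neq[THEN not_sym]) (simp add: admissible_def add_pos_pos)
  have step: "(h has_real_derivative poly (smult k (pderiv q * e - q * pderiv e)) (?R M) / poly (e * e * d) (?R M)) (at M)"
    if M: "M > 0" and h: "\<And>M. M > 0 \<Longrightarrow> h M = poly q (?R M) / poly e (?R M)" and e: "\<And>r. r > 0 \<Longrightarrow> poly e r \<noteq> 0" for h q e M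
  proof -
    have R: "?R M > 0" by (rule R_star(1)[OF adm p M])
    have RD: "(?R has_real_derivative k / poly d (?R M)) (at M)" using DERIV_R_star[OF adm p M] by (simp add: d k_def)
    have "((\<lambda>M. poly q (?R M) / poly e (?R M)) has_real_derivative
        poly (smult k (pderiv q * e - q * pderiv e)) (?R M) / poly (e * e * d) (?R M)) (at M)"
      by (rule DERIV_cong[OF DERIV_divide[OF DERIV_chain2[OF poly_DERIV RD] DERIV_chain2[OF poly_DERIV RD] e[OF R]]])
        (use e[OF R] dp[OF R] in \<open>simp add: field_simps\<close>)
    then show ?thesis
      by (rule has_field_derivative_transform_within_open[of _ _ _ "{0<..}"]) (use M h in auto)
  qed
  have "\<exists>q e. (\<forall>M>0. (deriv ^^ n) f M = poly q (?R M) / poly e (?R M)) \<and> (\<forall>r>0. poly e r \<noteq> 0)" for n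
  proof (induction n)
    case 0 then show ?case using f e by auto
  next
    case (Suc n)
    then obtain q e where q: "\<And>M. M > 0 \<Longrightarrow> (deriv ^^ n) f M = poly q (?R M) / poly e (?R M)" and e: "\<And>r. r > 0 \<Longrightarrow> poly e r \<noteq> 0" by blast
    show ?case
    proof (intro exI conjI allI impI)
      show "(deriv ^^ Suc n) f M = poly (smult k (pderiv q * e - q * pderiv e)) (?R M) / poly (e * e * d) (?R M)" if "M > 0" for M
        using DERIV_imp_deriv[OF step[OF that q e]] by simp
      show "poly (e * e * d) r \<noteq> 0" if "r > 0" for r using e[OF that] dp[OF that] by simp
    qed
  qed
  then show ?thesis unfolding smooth_on_reals_def field_differentiable_def using step by (metis greaterThan_iff)
qed

lemma smooth_on_reals_continuous: "smooth_on_reals S f \<Longrightarrow> continuous_on S f"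
  unfolding smooth_on_reals_def
  by (rule continuous_at_imp_continuous_on) (metis field_differentiable_imp_continuous_at funpow_0)

theorem proposition4p3:
  fixes P :: bubble_params and p_inf :: real
  assumes "admissible P" and "p_inf > 0"
  shows
    "(\<forall>st. mu_liq P \<noteq> 0 \<and> sigma_st P \<noteq> 0 \<and> steady_state P p_inf st \<and>
        (\<lambda>x. norm (vel_l st x)) \<in> O[at_infinity](\<lambda>x. 1 / norm x ^ 2) \<and>
        (jac (- region st) (vel_l st) \<longlongrightarrow> 0) at_infinity \<longrightarrow>
          (\<forall>x \<in> - region st. vel_l st x = 0 \<and> pres_l st x = p_inf) \<and>
          (\<exists>c. \<exists>R>0. region st = ball c R) \<and>
          (\<exists>\<rho>. \<forall>x \<in> closure (region st). dens_g st x = \<rho>) \<and>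
          (\<forall>x \<in> region st. divergence (region st) (vel_g st) x = 0)) \<and>
     (\<forall>M>0. steady_state P p_inf (spherical_equilibrium P p_inf M) \<and>
        spherically_symmetric (spherical_equilibrium P p_inf M) \<and>
        gas_mass (spherical_equilibrium P p_inf M) = M) \<and>
     (\<forall>st. steady_state P p_inf st \<and> spherically_symmetric st \<longrightarrow>
        gas_mass st > 0 \<and>
        same_state st (spherical_equilibrium P p_inf (gas_mass st))) \<and>
     continuous_on {0<..} (R_star P p_inf) \<and> smooth_on_reals {0<..} (R_star P p_inf) \<and>
     continuous_on {0<..} (rho_star P p_inf) \<and> smooth_on_reals {0<..} (rho_star P p_inf)"
proof -
  have eq: "equilibrium P p_inf st" if "steady_state P p_inf st" for st
    using assms that by (simp add: equilibrium_def)
  have R: "smooth_on_reals {0<..} (R_star P p_inf)"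
    by (rule rational_in_R_star_smooth[OF assms, of _ "[:0, 1:]" "[:1:]"]) simp_all
  have \<rho>: "smooth_on_reals {0<..} (rho_star P p_inf)"
  proof (rule rational_in_R_star_smooth[OF assms])
    let ?k = "1 / (R_gas P * T_inf P)"
    show "rho_star P p_inf M = poly [:?k * (2 * sigma_st P), ?k * p_inf:] (R_star P p_inf M) / poly [:0, 1:] (R_star P p_inf M)"
      if "M > 0" for M using R_star(1)[OF assms that] assms(1) by (simp add: rho_star_def admissible_def field_simps)
  qed simp
  show ?thesis
  proof (intro conjI allI impI)
    fix st
    assume a: "mu_liq P \<noteq> 0 \<and> sigma_st P \<noteq> 0 \<and> steady_state P p_inf st \<and>
        (\<lambda>x. norm (vel_l st x)) \<in> O[at_infinity](\<lambda>x. 1 / norm x ^ 2) \<and>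
        (jac (- region st) (vel_l st) \<longlongrightarrow> 0) at_infinity"
    then interpret equilibrium P p_inf st using eq by blast
    have rest: "vel_l st x = 0" "pres_l st x = p_inf" if "x \<notin> region st" for x
      using liquid_at_rest[of x] a that by blast+
    show "\<forall>x \<in> - region st. vel_l st x = 0 \<and> pres_l st x = p_inf" using rest by simp
    show "\<exists>c. \<exists>R>0. region st = ball c R" by (rule spherical) (use rest in simp)
    show "\<exists>\<rho>. \<forall>x \<in> closure (region st). dens_g st x = \<rho>" using density by blast
    show "\<forall>x \<in> region st. divergence (region st) (vel_g st) x = 0" using gas_divergence by blast
  next
    fix st assume a: "steady_state P p_inf st \<and> spherically_symmetric st"
    then interpret equilibrium P p_inf st using eq by blast
    show "gas_mass st > 0" "same_state st (spherical_equilibrium P p_inf (gas_mass st))"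
      using symmetric_unique a by blast+
  qed (use assms spherical_equilibrium_steady spherical_equilibrium_symmetric spherical_equilibrium_mass
      R \<rho> smooth_on_reals_continuous in blast)+
qed

end
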